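(* Let $R$ be a ring, let $(\mathfrak m_\alpha)_{\alpha\in E}$ be a family of pairwise coprime supramaximal ideals of $R$, and let $E=E'\sqcup E''$ be a partition of $E$. Let $n\in\mathbf N^{(E)}$, and let $n'$ and $n''$ be its restrictions to $E'$ and $E''$. Then for any $R$-algebra $A$, the canonical maps $$W_{R,E}(A)\longrightarrow W_{R,E''}\big(W_{R,E'}(A)\big),\qquad W_{R,E,n}(A)\longrightarrow W_{R,E'',n''}\big(W_{R,E',n'}(A)\big)$$ are isomorphisms.
   Context: All rings are commutative with 1; $\mathbf N=\{0,1,2,\dots\}$, $\mathbf N^{(E)}=\bigoplus_E\mathbf N$. An ideal $\mathfrak m$ of a ring $R$ is supramaximal if either (i) $R/\mathfrak m$ is a finite field, $R_{\mathfrak m}$ is a discrete valuation ring and $\mathfrak m$ is finitely presented as an $R$-module, or (ii) $\mathfrak m=R$. Given a family $(\mathfrak m_\alpha)_{\alpha\in E}$ of pairwise coprime supramaximal ideals of $R$ (the unit ideal may be repeated), put $q_\alpha=|R/\mathfrak m_\alpha|$; let $R[1/E]\supseteq R$ be the universal $R$-algebra in which every $\mathfrak m_\alpha$ becomes the unit ideal, and $\mathfrak m_\alpha^{-1}=\{x\in R[1/E]:x\mathfrak m_\alpha\subseteq R\}$. For $n\in\mathbf N^{(E)}$ put $[0,n]=\{i\in\mathbf N^{(E)}: i_\alpha\le n_\alpha\ \forall\alpha\}$; $b_\alpha$ is the $\alpha$-th standard basis vector. Witt vectors. Let $\Psi_{R,E}=R[\psi_i\mid i\in\mathbf N^{(E)}]$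 (polynomial ring); $\mathbf N^{(E)}$ acts on $R[1/E]\otimes_R\Psi_{R,E}$ by $R[1/E]$-algebra endomorphisms, $m$ acting by $\psi_i\mapsto\psi_{i+m}$; the action of $m$ is also denoted $\psi_m$, and $\psi_\alpha=\psi_{b_\alpha}$. Put $\Lambda^0=\Psi_{R,E}$, and let $\Lambda^{k+1}$ be the sub-$\Lambda^k$-algebra of $R[1/E]\otimes_R\Psi_{R,E}$ generated by all $\pi^*(\psi_\alpha(g)-g^{q_\alpha})$ with $\alpha\in E$, $\pi^*\in\mathfrak m_\alpha^{-1}$, $g\in\Lambda^k$. Put $\Lambda_{R,E}=\bigcup_k\Lambda^k$ and $\Lambda_{R,E,n}=\Lambda_{R,E}\cap R[1/E][\psi_i\mid i\in[0,n]]$. For an $R$-algebra $A$, $W_{R,E}(A)=\mathrm{Hom}_{R\text{-alg}}(\Lambda_{R,E},A)$ and $W_{R,E,n}(A)=\mathrm{Hom}_{R\text{-alg}}(\Lambda_{R,E,n},A)$, with the unique $R$-algebra structures, functorial in $A$, such that for all $A$ the ghost maps $W_{R,E}(A)\to A^{\mathbf N^{(E)}}$ and $W_{R,E,n}(A)\to A^{[0,n]}$, $a\mapsto(a(\psi_i))_i$, are $R$-algebra homomorphisms. The same definitions apply to the subfamilies indexed by $E'$ and $E''$, and $\mathbf N^{(E')},\mathbf N^{(E'')}\subseteq\mathbf N^{(E)}$ via extension by zero, so that $\Lambda_{R,E'},\Lambda_{R,E''}\subseteq\Lambda_{R,E}$. Composition. For $f,g\in R[1/E]\otimes_R\Psi_{R,E}$,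 $f\circ g$ is the image of $f$ under the $R[1/E]$-algebra map sending each generator $\psi_i$ to $\psi_i(g)$. One has $\Lambda_{R,E}\circ\Lambda_{R,E}\subseteq\Lambda_{R,E}$ and $\Lambda_{R,E',n'}\circ\Lambda_{R,E'',n''}\subseteq\Lambda_{R,E,n}$. Canonical maps. $W_{R,E}(A)\to W_{R,E''}(W_{R,E'}(A))$ sends $a\colon\Lambda_{R,E}\to A$ to $\gamma\mapsto[\beta\mapsto a(\beta\circ\gamma)]$ for $\gamma\in\Lambda_{R,E''}$, $\beta\in\Lambda_{R,E'}$. The truncated map is given by the same formula with $\gamma\in\Lambda_{R,E'',n''}$, $\beta\in\Lambda_{R,E',n'}$. *)

theory Defs
  imports "HOL-Algebra.Algebra" "HOL-Library.Poly_Mapping"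
begin

section \<open>Algebras over a ring\<close>

text \<open>Commutative algebras are modules-with-multiplication, i.e. records of type
  \<open>('a, 'b) module\<close> satisfying the locale predicate \<open>algebra\<close>. The zero ring is allowed.\<close>

definition alg_hom ::
  "'a ring \<Rightarrow> ('a, 'b) module \<Rightarrow> ('a, 'c) module \<Rightarrow> ('b \<Rightarrow> 'c) set" where
  "alg_hom R B C = {h \<in> ring_hom B C.
     \<forall>r\<in>carrier R. \<forall>x\<in>carrier B. h (r \<odot>\<^bsub>B\<^esub> x) = r \<odot>\<^bsub>C\<^esub> h x}"

definition alg_iso ::
  "'a ring \<Rightarrow> ('a, 'b) module \<Rightarrow> ('a, 'c) module \<Rightarrow> ('b \<Rightarrow> 'c) set" where
  "alg_iso R B C = {h \<in> alg_hom R B C. bij_betw h (carrier B) (carrier C)}"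

text \<open>Homomorphisms as elements of a set: two of them are equal iff they agree on the carrier.\<close>

definition Hom_alg ::
  "'a ring \<Rightarrow> ('a, 'b) module \<Rightarrow> ('a, 'c) module \<Rightarrow> ('b \<Rightarrow> 'c) set" where
  "Hom_alg R B C = alg_hom R B C \<inter> extensional (carrier B)"

definition struct_map :: "('a, 'b) module \<Rightarrow> 'a \<Rightarrow> 'b" where
  "struct_map B r = r \<odot>\<^bsub>B\<^esub> \<one>\<^bsub>B\<^esub>"


section \<open>Supramaximal ideals\<close>

text \<open>A presentation with generators \<open>g 0, \<dots>, g (k - 1)\<close> and with syzygies generated by
  the rows \<open>c 0, \<dots>, c (l - 1)\<close>.\<close>

definition finitely_presented :: "'a ring \<Rightarrow> ('a, 'b) module \<Rightarrow> bool" where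
  "finitely_presented R M \<longleftrightarrow> module R M \<and>
     (\<exists>(k::nat) g. g \<in> {..<k} \<rightarrow> carrier M \<and>
        (\<forall>x\<in>carrier M. \<exists>a \<in> {..<k} \<rightarrow> carrier R.
            x = (\<Oplus>\<^bsub>M\<^esub> i\<in>{..<k}. a i \<odot>\<^bsub>M\<^esub> g i)) \<and>
        (\<exists>(l::nat) c. (\<forall>j<l. c j \<in> {..<k} \<rightarrow> carrier R \<and>
              (\<Oplus>\<^bsub>M\<^esub> i\<in>{..<k}. c j i \<odot>\<^bsub>M\<^esub> g i) = \<zero>\<^bsub>M\<^esub>) \<and>
           (\<forall>a \<in> {..<k} \<rightarrow> carrier R.
              (\<Oplus>\<^bsub>M\<^esub> i\<in>{..<k}. a i \<odot>\<^bsub>M\<^esub> g i) = \<zero>\<^bsub>M\<^esub> \<longrightarrow>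
              (\<exists>d \<in> {..<l} \<rightarrow> carrier R. \<forall>i<k. a i = (\<Oplus>\<^bsub>R\<^esub> j\<in>{..<l}. d j \<otimes>\<^bsub>R\<^esub> c j i)))))"

text \<open>The fields \<open>mult\<close> and \<open>one\<close> of the record play no role for a module.\<close>

definition ideal_module :: "'a ring \<Rightarrow> 'a set \<Rightarrow> ('a, 'a) module" where
  "ideal_module R I = \<lparr>carrier = I, monoid.mult = monoid.mult R, monoid.one = \<one>\<^bsub>R\<^esub>,
     ring.zero = \<zero>\<^bsub>R\<^esub>, ring.add = ring.add R, smult = monoid.mult R\<rparr>"

definition loc_rel :: "'a ring \<Rightarrow> 'a set \<Rightarrow> (('a \<times> 'a) \<times> ('a \<times> 'a)) set" where
  "loc_rel R p = {((a, s), (b, t)).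
     a \<in> carrier R \<and> s \<in> carrier R - p \<and> b \<in> carrier R \<and> t \<in> carrier R - p \<and>
     (\<exists>u \<in> carrier R - p. u \<otimes>\<^bsub>R\<^esub> (a \<otimes>\<^bsub>R\<^esub> t \<ominus>\<^bsub>R\<^esub> b \<otimes>\<^bsub>R\<^esub> s) = \<zero>\<^bsub>R\<^esub>)}"

text \<open>The localisation at a prime ideal \<open>p\<close>; the class of \<open>(a, s)\<close> is the fraction \<open>a / s\<close>.\<close>

definition localisation :: "'a ring \<Rightarrow> 'a set \<Rightarrow> ('a \<times> 'a) set ring" where
  "localisation R p =
     \<lparr>carrier = (carrier R \<times> (carrier R - p)) // loc_rel R p,
      monoid.mult = (\<lambda>P Q. \<Union>(a, s)\<in>P. \<Union>(b, t)\<in>Q. loc_rel R p `` {(a \<otimes>\<^bsub>R\<^esub> b, s \<otimes>\<^bsub>R\<^esub> t)}),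
      monoid.one = loc_rel R p `` {(\<one>\<^bsub>R\<^esub>, \<one>\<^bsub>R\<^esub>)},
      ring.zero = loc_rel R p `` {(\<zero>\<^bsub>R\<^esub>, \<one>\<^bsub>R\<^esub>)},
      ring.add = (\<lambda>P Q. \<Union>(a, s)\<in>P. \<Union>(b, t)\<in>Q.
               loc_rel R p `` {(a \<otimes>\<^bsub>R\<^esub> t \<oplus>\<^bsub>R\<^esub> b \<otimes>\<^bsub>R\<^esub> s, s \<otimes>\<^bsub>R\<^esub> t)})\<rparr>"

definition discrete_valuation_ring :: "'b ring \<Rightarrow> bool" where
  "discrete_valuation_ring V \<longleftrightarrow>
     principal_domain V \<and> (\<exists>!p. primeideal p V \<and> p \<noteq> {\<zero>\<^bsub>V\<^esub>})"

definition supramaximal :: "'a ring \<Rightarrow> 'a set \<Rightarrow> bool" where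
  "supramaximal R I \<longleftrightarrow> ideal I R \<and>
     ((field (R Quot I) \<and> finite (carrier (R Quot I)) \<and>
       discrete_valuation_ring (localisation R I) \<and>
       finitely_presented R (ideal_module R I)) \<or>
      I = carrier R)"

definition coprime_supramaximal_family :: "'a ring \<Rightarrow> 'e set \<Rightarrow> ('e \<Rightarrow> 'a set) \<Rightarrow> bool" where
  "coprime_supramaximal_family R E \<mm> \<longleftrightarrow>
     (\<forall>\<alpha>\<in>E. supramaximal R (\<mm> \<alpha>)) \<and>
     (\<forall>\<alpha>\<in>E. \<forall>\<beta>\<in>E. \<alpha> \<noteq> \<beta> \<longrightarrow> \<mm> \<alpha> <+>\<^bsub>R\<^esub> \<mm> \<beta> = carrier R)"


section \<open>The algebra obtained by inverting the ideals of the family\<close>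

definition becomes_unit :: "'a set \<Rightarrow> ('a, 'b) module \<Rightarrow> bool" where
  "becomes_unit I B \<longleftrightarrow> Idl\<^bsub>B\<^esub> (struct_map B ` I) = carrier B"

text \<open>\<open>is_inverting_algebra R E \<mm> S\<close>: the \<open>R\<close>-algebra \<open>S\<close> contains \<open>R\<close> and is the universal
  (initial) \<open>R\<close>-algebra in which all \<open>\<mm> \<alpha>\<close>, \<open>\<alpha> \<in> E\<close>, become the unit ideal. HOL cannot
  quantify over the carrier types of the test algebras \<open>T\<close>; they are taken over the type
  of \<open>S\<close>. For supramaximal ideals this loses nothing: as \<open>S\<close> contains \<open>R\<close>, its type has
  room for an isomorphic copy of the actual universal algebra (which is \<open>R\<close> itself if \<open>R\<close> is
  finite, and has the cardinality of \<open>R\<close> otherwise), so \<open>S\<close> is isomorphic to it.\<close>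

definition is_inverting_algebra ::
  "'a ring \<Rightarrow> 'e set \<Rightarrow> ('e \<Rightarrow> 'a set) \<Rightarrow> ('a, 's) module \<Rightarrow> bool" where
  "is_inverting_algebra R E \<mm> S \<longleftrightarrow>
     algebra R S \<and> inj_on (struct_map S) (carrier R) \<and>
     (\<forall>\<alpha>\<in>E. becomes_unit (\<mm> \<alpha>) S) \<and>
     (\<forall>T :: ('a, 's) module. algebra R T \<and> (\<forall>\<alpha>\<in>E. becomes_unit (\<mm> \<alpha>) T) \<longrightarrow>
        (\<exists>!h. h \<in> Hom_alg R S T))"

definition ideal_inverse :: "'a ring \<Rightarrow> ('a, 's) module \<Rightarrow> 'a set \<Rightarrow> 's set" where
  "ideal_inverse R S I =
     {x \<in> carrier S. \<forall>a\<in>I. x \<otimes>\<^bsub>S\<^esub> struct_map S a \<in> struct_map S ` carrier R}"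


section \<open>Polynomial algebras\<close>

text \<open>Polynomials over \<open>S\<close> in variables indexed by \<open>I\<close>, represented as in
  \<open>HOL-Algebra.Indexed_Polynomials\<close> by their coefficient functions on monomials, a monomial
  being a multiset of indices. A polynomial over a subring, or in fewer variables, is thus
  literally a polynomial over \<open>S\<close>.\<close>

definition mpoly_alg :: "('a, 's) module \<Rightarrow> 'i set \<Rightarrow> ('a, 'i multiset \<Rightarrow> 's) module" where
  "mpoly_alg S I =
     \<lparr>carrier = ring.indexed_pset S I (carrier S),
      monoid.mult = (\<lambda>f g w. \<Oplus>\<^bsub>S\<^esub> u\<in>{u. u \<subseteq># w}. f u \<otimes>\<^bsub>S\<^esub> g (w - u)),
      monoid.one = ring.indexed_const S \<one>\<^bsub>S\<^esub>,
      ring.zero = ring.indexed_const S \<zero>\<^bsub>S\<^esub>,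
      ring.add = ring.indexed_padd S,
      smult = (\<lambda>r f w. r \<odot>\<^bsub>S\<^esub> f w)\<rparr>"

text \<open>The value at \<open>f\<close> of the \<open>S\<close>-algebra endomorphism of \<open>S[X\<^sub>i | i \<in> I]\<close> sending each
  variable \<open>X\<^sub>i\<close> to \<open>x i\<close>.\<close>

definition poly_subst ::
  "('a, 's) module \<Rightarrow> 'i set \<Rightarrow> ('i \<Rightarrow> 'i multiset \<Rightarrow> 's) \<Rightarrow> ('i multiset \<Rightarrow> 's) \<Rightarrow> ('i multiset \<Rightarrow> 's)"
  where
  "poly_subst S I x f =
     (\<Oplus>\<^bsub>mpoly_alg S I\<^esub> w\<in>{w. f w \<noteq> \<zero>\<^bsub>S\<^esub>}.
        ring.indexed_const S (f w) \<otimes>\<^bsub>mpoly_alg S I\<^esub>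
        finprod (mpoly_alg S I) (\<lambda>i. x i [^]\<^bsub>mpoly_alg S I\<^esub> count w i) (set_mset w))"


section \<open>The rings of operators on Witt vectors\<close>

text \<open>\<open>\<nat>\<^sup>(\<^sup>E\<^sup>)\<close>, with \<open>E\<close> a subset of the type \<open>'e\<close>; extension by zero is then an inclusion.
  The order on exponents is the pointwise one, not the lexicographic order of
  \<open>Poly_Mapping\<close>.\<close>

definition exponents :: "'e set \<Rightarrow> ('e \<Rightarrow>\<^sub>0 nat) set" where
  "exponents E = {i. Poly_Mapping.keys i \<subseteq> E}"

definition box :: "('e \<Rightarrow>\<^sub>0 nat) \<Rightarrow> ('e \<Rightarrow>\<^sub>0 nat) set" where
  "box n = {i. \<forall>\<alpha>. Poly_Mapping.lookup i \<alpha> \<le> Poly_Mapping.lookup n \<alpha>}"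

definition exp_restrict :: "'e set \<Rightarrow> ('e \<Rightarrow>\<^sub>0 nat) \<Rightarrow> ('e \<Rightarrow>\<^sub>0 nat)" where
  "exp_restrict F n = Abs_poly_mapping (\<lambda>\<alpha>. if \<alpha> \<in> F then Poly_Mapping.lookup n \<alpha> else 0)"

text \<open>In what follows \<open>S\<close> stands for \<open>R[1/E]\<close>, and \<open>S[\<psi>\<^sub>i | i \<in> \<nat>\<^sup>(\<^sup>E\<^sup>)]\<close> for
  the tensor product of \<open>R[1/E]\<close> with \<open>R[\<psi>\<^sub>i | i \<in> \<nat>\<^sup>(\<^sup>E\<^sup>)]\<close> over \<open>R\<close>.\<close>

abbreviation psi_ring ::
  "('a, 's) module \<Rightarrow> 'e set \<Rightarrow> ('a, ('e \<Rightarrow>\<^sub>0 nat) multiset \<Rightarrow> 's) module" where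
  "psi_ring S E \<equiv> mpoly_alg S (exponents E)"

abbreviation psi_var ::
  "('a, 's) module \<Rightarrow> ('e \<Rightarrow>\<^sub>0 nat) \<Rightarrow> (('e \<Rightarrow>\<^sub>0 nat) multiset \<Rightarrow> 's)" where
  "psi_var S i \<equiv> ring.indexed_var S i"

definition psi_act ::
  "('a, 's) module \<Rightarrow> 'e set \<Rightarrow> ('e \<Rightarrow>\<^sub>0 nat) \<Rightarrow>
   (('e \<Rightarrow>\<^sub>0 nat) multiset \<Rightarrow> 's) \<Rightarrow> (('e \<Rightarrow>\<^sub>0 nat) multiset \<Rightarrow> 's)" where
  "psi_act S E k f = poly_subst S (exponents E) (\<lambda>i. psi_var S (i + k)) f"

definition psi_comp ::
  "('a, 's) module \<Rightarrow> 'e set \<Rightarrow> (('e \<Rightarrow>\<^sub>0 nat) multiset \<Rightarrow> 's) \<Rightarrow>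
   (('e \<Rightarrow>\<^sub>0 nat) multiset \<Rightarrow> 's) \<Rightarrow> (('e \<Rightarrow>\<^sub>0 nat) multiset \<Rightarrow> 's)" where
  "psi_comp S E f g = poly_subst S (exponents E) (\<lambda>i. psi_act S E i g) f"

text \<open>The sub-\<open>\<Lambda>\<^sup>k\<close>-algebra generated by a set is the subring generated by that set
  and \<open>\<Lambda>\<^sup>k\<close>.\<close>

primrec Lambda_step ::
  "'a ring \<Rightarrow> ('e \<Rightarrow> 'a set) \<Rightarrow> ('a, 's) module \<Rightarrow> 'e set \<Rightarrow> nat \<Rightarrow>
   (('e \<Rightarrow>\<^sub>0 nat) multiset \<Rightarrow> 's) set" where
  "Lambda_step R \<mm> S E 0 = ring.indexed_pset S (exponents E) (struct_map S ` carrier R)"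
| "Lambda_step R \<mm> S E (Suc k) =
     generate_ring (psi_ring S E)
       (Lambda_step R \<mm> S E k \<union>
        {ring.indexed_const S x \<otimes>\<^bsub>psi_ring S E\<^esub>
           (psi_act S E (Poly_Mapping.single \<alpha> 1) g \<ominus>\<^bsub>psi_ring S E\<^esub>
            g [^]\<^bsub>psi_ring S E\<^esub> order (R Quot \<mm> \<alpha>))
         | \<alpha> x g. \<alpha> \<in> E \<and> x \<in> ideal_inverse R S (\<mm> \<alpha>) \<and> g \<in> Lambda_step R \<mm> S E k})"

definition Lambda ::
  "'a ring \<Rightarrow> ('e \<Rightarrow> 'a set) \<Rightarrow> ('a, 's) module \<Rightarrow> 'e set \<Rightarrow>
   (('e \<Rightarrow>\<^sub>0 nat) multiset \<Rightarrow> 's) set" where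
  "Lambda R \<mm> S E = (\<Union>k. Lambda_step R \<mm> S E k)"

definition Lambda_tr ::
  "'a ring \<Rightarrow> ('e \<Rightarrow> 'a set) \<Rightarrow> ('a, 's) module \<Rightarrow> 'e set \<Rightarrow> ('e \<Rightarrow>\<^sub>0 nat) \<Rightarrow>
   (('e \<Rightarrow>\<^sub>0 nat) multiset \<Rightarrow> 's) set" where
  "Lambda_tr R \<mm> S E n = Lambda R \<mm> S E \<inter> ring.indexed_pset S (box n) (carrier S)"

definition Lambda_alg ::
  "'a ring \<Rightarrow> ('e \<Rightarrow> 'a set) \<Rightarrow> ('a, 's) module \<Rightarrow> 'e set \<Rightarrow>
   ('a, ('e \<Rightarrow>\<^sub>0 nat) multiset \<Rightarrow> 's) module" where
  "Lambda_alg R \<mm> S E = (psi_ring S E)\<lparr>carrier := Lambda R \<mm> S E\<rparr>"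

definition Lambda_tr_alg ::
  "'a ring \<Rightarrow> ('e \<Rightarrow> 'a set) \<Rightarrow> ('a, 's) module \<Rightarrow> 'e set \<Rightarrow> ('e \<Rightarrow>\<^sub>0 nat) \<Rightarrow>
   ('a, ('e \<Rightarrow>\<^sub>0 nat) multiset \<Rightarrow> 's) module" where
  "Lambda_tr_alg R \<mm> S E n = (psi_ring S E)\<lparr>carrier := Lambda_tr R \<mm> S E n\<rparr>"


section \<open>Witt vectors\<close>

text \<open>\<open>M\<close> is an \<open>R\<close>-algebra structure on \<open>Hom(L, A)\<close> making the ghost map
  \<open>a \<mapsto> (a (v i))\<^sub>i\<^sub>\<in>\<^sub>I\<close> into the product algebra \<open>A\<^sup>I\<close>, i.e. each of its components, a
  homomorphism of \<open>R\<close>-algebras.\<close>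

definition is_ghost_structure ::
  "'a ring \<Rightarrow> ('a, 'l) module \<Rightarrow> 'i set \<Rightarrow> ('i \<Rightarrow> 'l) \<Rightarrow> ('a, 'c) module \<Rightarrow>
   ('a, 'l \<Rightarrow> 'c) module \<Rightarrow> bool" where
  "is_ghost_structure R L I v A M \<longleftrightarrow>
     algebra R M \<and> carrier M = Hom_alg R L A \<and>
     (\<forall>i\<in>I. (\<lambda>a. a (v i)) \<in> alg_hom R M A)"

definition is_functorial_ghost_structure ::
  "'a ring \<Rightarrow> ('a, 'l) module \<Rightarrow> 'i set \<Rightarrow> ('i \<Rightarrow> 'l) \<Rightarrow>
   (('a, 'l) module \<Rightarrow> ('a, 'l \<Rightarrow> 'l) module) \<Rightarrow> bool" where
  "is_functorial_ghost_structure R L I v V \<longleftrightarrow>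
     (\<forall>B. algebra R B \<longrightarrow> is_ghost_structure R L I v B (V B)) \<and>
     (\<forall>B C. algebra R B \<longrightarrow> algebra R C \<longrightarrow> (\<forall>h \<in> alg_hom R B C.
        compose (carrier L) h \<in> alg_hom R (V B) (V C)))"

text \<open>\<open>Hom(L, A)\<close> with the unique functorial algebra structures that make the ghost maps
  homomorphisms. A structure on \<open>Hom(L, A)\<close> alone is not determined by the ghost map if
  \<open>A\<close> has torsion, so functoriality is essential; it is required with respect to all
  \<open>R\<close>-algebras \<open>B\<close> over the type of \<open>L\<close> and all homomorphisms \<open>B \<rightarrow> A\<close>. For
  \<open>L = \<Lambda>\<close> this pins the structure down: every pair of elements of \<open>Hom(L, A)\<close> is the image
  of the universal pair in \<open>Hom(L, L \<otimes>\<^sub>R L)\<close>, where the ghost map is injective, and the type of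
  \<open>L\<close> has room for a copy of \<open>L \<otimes>\<^sub>R L\<close>. The choice operator only selects the irrelevant
  values of the operations outside the carrier.\<close>

definition ghost_algebra ::
  "'a ring \<Rightarrow> ('a, 'l) module \<Rightarrow> 'i set \<Rightarrow> ('i \<Rightarrow> 'l) \<Rightarrow> ('a, 'c) module \<Rightarrow>
   ('a, 'l \<Rightarrow> 'c) module" where
  "ghost_algebra R L I v A =
     (SOME M. is_ghost_structure R L I v A M \<and>
        (\<exists>V. is_functorial_ghost_structure R L I v V \<and>
           (\<forall>B. algebra R B \<longrightarrow> (\<forall>h \<in> alg_hom R B A.
              compose (carrier L) h \<in> alg_hom R (V B) M))))"

definition Witt ::
  "'a ring \<Rightarrow> ('e \<Rightarrow> 'a set) \<Rightarrow> ('a, 's) module \<Rightarrow> 'e set \<Rightarrow> ('a, 'c) module \<Rightarrow>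
   ('a, (('e \<Rightarrow>\<^sub>0 nat) multiset \<Rightarrow> 's) \<Rightarrow> 'c) module" where
  "Witt R \<mm> S E A =
     ghost_algebra R (Lambda_alg R \<mm> S E) (exponents E) (psi_var S) A"

definition Witt_tr ::
  "'a ring \<Rightarrow> ('e \<Rightarrow> 'a set) \<Rightarrow> ('a, 's) module \<Rightarrow> 'e set \<Rightarrow> ('e \<Rightarrow>\<^sub>0 nat) \<Rightarrow>
   ('a, 'c) module \<Rightarrow> ('a, (('e \<Rightarrow>\<^sub>0 nat) multiset \<Rightarrow> 's) \<Rightarrow> 'c) module" where
  "Witt_tr R \<mm> S E n A =
     ghost_algebra R (Lambda_tr_alg R \<mm> S E n) (box n) (psi_var S) A"

text \<open>The map \<open>a \<mapsto> (\<gamma> \<mapsto> (\<beta> \<mapsto> a (\<beta> \<circ> \<gamma>)))\<close> for \<open>\<beta> \<in> L'\<close> and \<open>\<gamma> \<in> L''\<close>.\<close>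

definition canonical_map ::
  "('a, 's) module \<Rightarrow> 'e set \<Rightarrow> (('e \<Rightarrow>\<^sub>0 nat) multiset \<Rightarrow> 's) set \<Rightarrow>
   (('e \<Rightarrow>\<^sub>0 nat) multiset \<Rightarrow> 's) set \<Rightarrow> ((('e \<Rightarrow>\<^sub>0 nat) multiset \<Rightarrow> 's) \<Rightarrow> 'c) \<Rightarrow>
   (('e \<Rightarrow>\<^sub>0 nat) multiset \<Rightarrow> 's) \<Rightarrow> (('e \<Rightarrow>\<^sub>0 nat) multiset \<Rightarrow> 's) \<Rightarrow> 'c" where
  "canonical_map S E L' L'' a = (\<lambda>\<gamma>\<in>L''. \<lambda>\<beta>\<in>L'. a (psi_comp S E \<beta> \<gamma>))"

end

theory Submission
  imports Defs
begin

text \<open>Fix a family \<open>s\<close> indexed by exponents, with values in a ring \<open>T\<close> over \<open>R[1/E]\<close>, and a subring \<open>Q\<close>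
  of \<open>T\<close>. Call \<open>s\<close> integral up to \<open>n\<close> if \<open>s 0 \<in> Q\<close> and, whenever \<open>n = k + b\<^sub>\<alpha>\<close> and \<open>x\<close> lies in the inverse
  of \<open>\<mm>\<^sub>\<alpha>\<close>, the family \<open>i \<mapsto> x (s (i + b\<^sub>\<alpha>) - s i ^ q\<^sub>\<alpha>)\<close> is integral up to \<open>k\<close>. These families form a ring,
  and \<open>\<Lambda>\<^sub>n\<close> is the least subring for which the universal family \<open>(\<psi>\<^sub>i)\<close> is integral up to \<open>n\<close>.
  As the ideals are coprime, for \<open>n'\<close> and \<open>n''\<close> of disjoint support integrality up to \<open>n' + n''\<close> means
  integrality up to \<open>n''\<close> of the family of the rows, relative to the ring of families that are integral
  up to \<open>n'\<close>; this is the corollary for subrings \<open>A\<close> of some \<open>T\<close>. As the ideals are invertible, integral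
  families lift along surjections. So every homomorphism \<open>\<Lambda>\<^sub>n \<rightarrow> A\<close> is induced by an integral family
  over a polynomial ring that maps onto \<open>A\<close>, and the general case follows.\<close>


section \<open>Rings of functions, products and binomial expansions\<close>

text \<open>The obstacle is torsion. A homomorphism from \<open>L n\<close> to \<open>A\<close> is
  in general not determined by its ghost components, so identities between ghost components prove
  nothing in \<open>A\<close>. Computations therefore take place in a subring \<open>Q\<close> of a
  ring \<open>T\<close> under \<open>R[1/E]\<close>; there the ideals are invertible and ghost
  components suffice. For a general \<open>A\<close> this is the polynomial ring over
  \<open>R\<close> with one variable for each element of \<open>A\<close>. Descending to
  \<open>A\<close> is legitimate because the outcome does not depend on the lift: two lifts of one
  homomorphism are together integral over the fibre product \<open>fib\<close> of the two covers,
  and there integral families form a ring. Truncated and full rings are treated at once, as unions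
  over a directed set \<open>D\<close> of exponents. Lifts are chosen at one exponent at a time and
  are not coherent; only the homomorphisms that they induce are. The algebra structure on
  homomorphisms is given through functoriality only. It is constructed from lifts
  (\<open>WA\<close>) and then recognised as the chosen one (\<open>Wt\<close>) on a pair of
  homomorphisms of which every other pair is an image.\<close>

definition fun_ring :: "('t, 'm) ring_scheme \<Rightarrow> ('i \<Rightarrow> 't) ring" where
  "fun_ring T = \<lparr>carrier = {f. \<forall>i. f i \<in> carrier T},
     monoid.mult = (\<lambda>f g i. f i \<otimes>\<^bsub>T\<^esub> g i), monoid.one = (\<lambda>i. \<one>\<^bsub>T\<^esub>),
     ring.zero = (\<lambda>i. \<zero>\<^bsub>T\<^esub>), ring.add = (\<lambda>f g i. f i \<oplus>\<^bsub>T\<^esub> g i)\<rparr>"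

lemma fun_ring_simps [simp]:
  "f \<in> carrier (fun_ring T) \<longleftrightarrow> (\<forall>i. f i \<in> carrier T)"
  "f \<otimes>\<^bsub>fun_ring T\<^esub> g = (\<lambda>i. f i \<otimes>\<^bsub>T\<^esub> g i)"
  "\<one>\<^bsub>fun_ring T\<^esub> = (\<lambda>i. \<one>\<^bsub>T\<^esub>)"
  "f \<oplus>\<^bsub>fun_ring T\<^esub> g = (\<lambda>i. f i \<oplus>\<^bsub>T\<^esub> g i)"
  "\<zero>\<^bsub>fun_ring T\<^esub> = (\<lambda>i. \<zero>\<^bsub>T\<^esub>)"
  by (auto simp: fun_ring_def)

lemma cring_fun_ring:
  assumes "cring T"
  shows "cring (fun_ring T)"
proof -
  interpret T: cring T by fact
  show ?thesis
  proof (rule cringI)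
    show "abelian_group (fun_ring T)"
    proof (rule abelian_groupI)
      fix x assume x: "x \<in> carrier (fun_ring T)"
      show "\<exists>y\<in>carrier (fun_ring T). y \<oplus>\<^bsub>fun_ring T\<^esub> x = \<zero>\<^bsub>fun_ring T\<^esub>"
        using x by (intro bexI[of _ "\<lambda>i. \<ominus>\<^bsub>T\<^esub> x i"]) (auto simp: T.l_neg)
    qed (auto simp: T.a_ac)
    show "comm_monoid (fun_ring T)"
      by (rule comm_monoidI) (auto simp: T.m_ac)
  qed (auto simp: T.l_distr)
qed

lemma fun_ring_a_inv [simp]:
  assumes "cring T" "\<And>i. f i \<in> carrier T"
  shows "\<ominus>\<^bsub>fun_ring T\<^esub> f = (\<lambda>i. \<ominus>\<^bsub>T\<^esub> f i)"
proof -
  interpret T: cring T by fact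
  interpret F: cring "fun_ring T" by (rule cring_fun_ring) fact
  show ?thesis
    by (rule F.minus_equality) (auto simp: assms T.l_neg)
qed

lemma fun_ring_minus [simp]:
  assumes "cring T" "\<And>i. g i \<in> carrier T"
  shows "f \<ominus>\<^bsub>fun_ring T\<^esub> g = (\<lambda>i. f i \<ominus>\<^bsub>T\<^esub> g i)"
  using assms by (simp add: a_minus_def)

lemma fun_ring_pow [simp]: "f [^]\<^bsub>fun_ring T\<^esub> (k::nat) = (\<lambda>i. f i [^]\<^bsub>T\<^esub> k)"
  by (induct k) auto

lemma RDirProd_simps [simp]:
  "carrier (RDirProd T U) = carrier T \<times> carrier U"
  "p \<otimes>\<^bsub>RDirProd T U\<^esub> p' = (fst p \<otimes>\<^bsub>T\<^esub> fst p', snd p \<otimes>\<^bsub>U\<^esub> snd p')"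
  "p \<oplus>\<^bsub>RDirProd T U\<^esub> p' = (fst p \<oplus>\<^bsub>T\<^esub> fst p', snd p \<oplus>\<^bsub>U\<^esub> snd p')"
  "\<one>\<^bsub>RDirProd T U\<^esub> = (\<one>\<^bsub>T\<^esub>, \<one>\<^bsub>U\<^esub>)"
  "\<zero>\<^bsub>RDirProd T U\<^esub> = (\<zero>\<^bsub>T\<^esub>, \<zero>\<^bsub>U\<^esub>)"
  by (auto simp: RDirProd_def DirProd_def monoid.defs split: prod.splits)

lemma cring_RDirProd:
  assumes "cring T" "cring U"
  shows "cring (RDirProd T U)"
proof -
  interpret T: cring T by fact
  interpret U: cring U by fact
  interpret D: ring "RDirProd T U" by (rule RDirProd_ring) (rule T.ring_axioms U.ring_axioms)+
  show ?thesis
    by unfold_locales (auto simp: T.m_comm U.m_comm)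
qed

lemma RDirProd_a_inv [simp]:
  assumes "cring T" "cring U" "x \<in> carrier T" "y \<in> carrier U"
  shows "\<ominus>\<^bsub>RDirProd T U\<^esub> (x, y) = (\<ominus>\<^bsub>T\<^esub> x, \<ominus>\<^bsub>U\<^esub> y)"
proof -
  interpret T: cring T by fact
  interpret U: cring U by fact
  interpret F: cring "RDirProd T U" by (rule cring_RDirProd) fact+
  show ?thesis
    by (rule F.minus_equality) (auto simp: assms T.l_neg U.l_neg)
qed

lemma ring_hom_minus:
  assumes "cring T" "cring U" "h \<in> ring_hom T U" "x \<in> carrier T" "y \<in> carrier T"
  shows "h (x \<ominus>\<^bsub>T\<^esub> y) = h x \<ominus>\<^bsub>U\<^esub> h y" "h (\<ominus>\<^bsub>T\<^esub> y) = \<ominus>\<^bsub>U\<^esub> h y" 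
    "h (x [^]\<^bsub>T\<^esub> (k::nat)) = h x [^]\<^bsub>U\<^esub> k"
proof -
  interpret h: ring_hom_cring T U h
    by (intro ring_hom_cring.intro assms ring_hom_cring_axioms.intro)
  show "h (x \<ominus>\<^bsub>T\<^esub> y) = h x \<ominus>\<^bsub>U\<^esub> h y" "h (\<ominus>\<^bsub>T\<^esub> y) = \<ominus>\<^bsub>U\<^esub> h y"
    using assms by (auto simp: a_minus_def)
  show "h (x [^]\<^bsub>T\<^esub> k) = h x [^]\<^bsub>U\<^esub> k"
    using assms by (induct k) auto
qed

lemma ring_hom_fst: "fst \<in> ring_hom (RDirProd T U) T"
  and ring_hom_snd: "snd \<in> ring_hom (RDirProd T U) U"
  by (auto intro!: ring_hom_memI)

lemma ring_hom_apply: "(\<lambda>f. f i) \<in> ring_hom (fun_ring T) T"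
  by (auto intro!: ring_hom_memI)

lemma ring_hom_compose_fun:
  "h \<in> ring_hom T U \<Longrightarrow> (\<lambda>f i. h (f i)) \<in> ring_hom (fun_ring T) (fun_ring U)"
  by (auto intro!: ring_hom_memI simp: ring_hom_memE)

lemma ring_hom_reindex: "(\<lambda>f i. f (r i)) \<in> ring_hom (fun_ring T) (fun_ring T)"
  by (auto intro!: ring_hom_memI)

lemma subringE_more:
  assumes "subring H T" "x \<in> H" "cring T"
  shows "\<And>y. y \<in> H \<Longrightarrow> a_minus T x y \<in> H"
    and "x [^]\<^bsub>T\<^esub> (k::nat) \<in> H"
proof -
  interpret T: cring T by fact
  show "\<And>y. y \<in> H \<Longrightarrow> a_minus T x y \<in> H"
    using subringE[OF assms(1)] assms(2) by (simp add: a_minus_def)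
  show "x [^]\<^bsub>T\<^esub> (k::nat) \<in> H"
    using subringE[OF assms(1)] assms(2) by (induct k) auto
qed

section \<open>Binomial expansions and the integrality of their middle terms\<close>

context cring
begin

lemma binomial_expansion:
  assumes x: "x \<in> carrier R" and y: "y \<in> carrier R"
  shows "(x \<oplus> y) [^] n = (\<Oplus>k\<in>{..n}. add_pow R (n choose k) (x [^] k \<otimes> y [^] (n - k)))"
proof (induct n)
  case 0
  show ?case by simp
next
  case (Suc n)
  let ?t = "\<lambda>m k. x [^] k \<otimes> y [^] (m - k)"
  have "(x \<oplus> y) [^] Suc n = (\<Oplus>k\<in>{..n}. add_pow R (n choose k) (?t n k)) \<otimes> (x \<oplus> y)"
    using Suc by simp
  also have "\<dots> = (\<Oplus>k\<in>{..n}. add_pow R (n choose k) (?t n k)) \<otimes> x \<oplus> (\<Oplus>k\<in>{..n}. add_pow R (n choose k) (?t n k)) \<otimes> y"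
    using x y by (simp add: r_distr)
  also have "(\<Oplus>k\<in>{..n}. add_pow R (n choose k) (?t n k)) \<otimes> x = (\<Oplus>k\<in>{..n}. add_pow R (n choose k) (?t (Suc n) (Suc k)))"
    using x y by (subst finsum_ldistr) (auto intro!: finsum_cong' simp: add_pow_ldistr add_pow_rdistr m_ac)
  also have "(\<Oplus>k\<in>{..n}. add_pow R (n choose k) (?t n k)) \<otimes> y = (\<Oplus>k\<in>{..n}. add_pow R (n choose k) (?t (Suc n) k))"
    using x y by (subst finsum_ldistr) (auto intro!: finsum_cong' simp: add_pow_ldistr m_assoc Suc_diff_le)
  \<comment> \<open>The upper limit is raised to \<open>Suc n\<close>, where the coefficient
    \<open>n choose Suc n\<close> vanishes, and the term at 0 is split off. Both halves then run
    over \<open>Suc k\<close> and Pascal's rule applies termwise.\<close>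
  also have "(\<Oplus>k\<in>{..n}. add_pow R (n choose k) (?t (Suc n) k)) = 
      (\<Oplus>k\<in>{..n}. add_pow R (n choose Suc k) (?t (Suc n) (Suc k))) \<oplus> ?t (Suc n) 0"
  proof -
    have "(\<Oplus>k\<in>{..Suc n}. add_pow R (n choose k) (?t (Suc n) k)) = (\<Oplus>k\<in>{..n}. add_pow R (n choose k) (?t (Suc n) k))"
      using x y by (simp add: finsum_Suc binomial_eq_0)
    moreover have "(\<Oplus>k\<in>{..Suc n}. add_pow R (n choose k) (?t (Suc n) k)) = 
      (\<Oplus>k\<in>{..n}. add_pow R (n choose Suc k) (?t (Suc n) (Suc k))) \<oplus> ?t (Suc n) 0"
      using x y by (subst finsum_Suc2) auto
    ultimately show ?thesis by simp
  qed
  also have "(\<Oplus>k\<in>{..n}. add_pow R (n choose k) (?t (Suc n) (Suc k))) \<oplus>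
      ((\<Oplus>k\<in>{..n}. add_pow R (n choose Suc k) (?t (Suc n) (Suc k))) \<oplus> ?t (Suc n) 0) =
      (\<Oplus>k\<in>{..n}. add_pow R (Suc n choose Suc k) (?t (Suc n) (Suc k))) \<oplus> ?t (Suc n) 0"
  proof -
    have "(\<Oplus>k\<in>{..n}. add_pow R (Suc n choose Suc k) (?t (Suc n) (Suc k))) =
      (\<Oplus>k\<in>{..n}. add_pow R (n choose k) (?t (Suc n) (Suc k)) \<oplus> add_pow R (n choose Suc k) (?t (Suc n) (Suc k)))"
      using x y by (intro finsum_cong') (auto simp: add.nat_pow_mult)
    also have "\<dots> = (\<Oplus>k\<in>{..n}. add_pow R (n choose k) (?t (Suc n) (Suc k))) \<oplus>
      (\<Oplus>k\<in>{..n}. add_pow R (n choose Suc k) (?t (Suc n) (Suc k)))"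
      using x y by (intro finsum_addf) auto
    finally show ?thesis using x y by (simp add: a_assoc)
  qed
  also have "\<dots> = (\<Oplus>k\<in>{..Suc n}. add_pow R (Suc n choose k) (?t (Suc n) k))"
    using x y by (subst finsum_Suc2) auto
  finally show ?case .
qed

lemma subring_finsum_closed:
  assumes "subring H R" "\<And>i. i \<in> A \<Longrightarrow> f i \<in> H"
  shows "(\<Oplus>i\<in>A. f i) \<in> H"
  using assms(2)
proof (induct A rule: infinite_finite_induct)
  case (insert a A)
  then show ?case
    using subringE[OF assms(1)] by (subst finsum_insert) (auto simp: Pi_def subset_iff)
qed (use subringE[OF assms(1)] in auto)

text \<open>The end terms of the expansion cancel, and each middle term carries a binomial
  coefficient that \<open>c\<close> takes into \<open>H\<close>. With \<open>c\<close> from the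
  inverse of an ideal this controls how far \<open>c (s(i+b) - s(i)^q)\<close> is from being
  additive in \<open>s\<close>.\<close>

lemma binomial_mem:
  assumes H: "subring H R" and u: "u \<in> H" and v: "v \<in> H" and c: "c \<in> carrier R"
    and q: "q > 0" and b: "\<And>j. 0 < j \<Longrightarrow> j < q \<Longrightarrow> c \<otimes> add_pow R (q choose j) \<one> \<in> H"
  shows "c \<otimes> ((u \<oplus> v) [^] (q::nat) \<ominus> (u [^] q \<oplus> v [^] q)) \<in> H"
proof -
  have uv: "u \<in> carrier R" "v \<in> carrier R" using subringE(1)[OF H] u v by auto
  obtain q' where q': "q = Suc q'" using q by (cases q) auto
  let ?t = "\<lambda>k. add_pow R (q choose k) (u [^] k \<otimes> v [^] (q - k))"
  define m where "m = (\<Oplus>k\<in>{0<..<q}. ?t k)"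
  have tc: "?t k \<in> carrier R" for k using uv by simp
  have mc: "m \<in> carrier R" unfolding m_def using tc by (intro finsum_closed) (auto simp: Pi_def)
  \<comment> \<open>As \<open>q > 0\<close>, the terms at 0 and at \<open>q\<close> are two
    different ones.\<close>
  have "{..q} = insert 0 (insert q {0<..<q})" using q by auto
  then have "(u \<oplus> v) [^] q = (\<Oplus>k\<in>insert 0 (insert q {0<..<q}). ?t k)"
    using binomial_expansion[OF uv, of q] by simp
  also have "\<dots> = ?t 0 \<oplus> (?t q \<oplus> m)"
  proof -
    have "(\<Oplus>k\<in>insert 0 (insert q {0<..<q}). ?t k) = ?t 0 \<oplus> (\<Oplus>k\<in>insert q {0<..<q}. ?t k)"
      by (rule finsum_insert) (use q uv in auto)
    moreover have "(\<Oplus>k\<in>insert q {0<..<q}. ?t k) = ?t q \<oplus> m"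
      unfolding m_def by (rule finsum_insert) (use q uv in auto)
    ultimately show ?thesis by simp
  qed
  also have "\<dots> = v [^] q \<oplus> (u [^] q \<oplus> m)" using uv by simp
  finally have "(u \<oplus> v) [^] q \<ominus> (u [^] q \<oplus> v [^] q) = m" using uv mc
    by (smt (verit, ccfv_threshold) a_ac(2) a_assoc a_closed a_inv_closed a_minus_def minus_add nat_pow_closed r_neg1 add.m_lcomm)
  moreover have "c \<otimes> m = (\<Oplus>k\<in>{0<..<q}. (c \<otimes> add_pow R (q choose k) \<one>) \<otimes> (u [^] k \<otimes> v [^] (q - k)))"
    unfolding m_def using uv c 
    by (subst finsum_rdistr) (auto intro!: finsum_cong' simp: add_pow_ldistr add_pow_rdistr)
  moreover have "(\<Oplus>k\<in>{0<..<q}. (c \<otimes> add_pow R (q choose k) \<one>) \<otimes> (u [^] k \<otimes> v [^] (q - k))) \<in> H"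
    using subringE_more[OF H _ cring_axioms] subringE[OF H] b u v 
    by (intro subring_finsum_closed[OF H]) auto
  ultimately show ?thesis by simp
qed

end


section \<open>Polynomial algebras\<close>

text \<open>The convolution product sums over this set, and a \<open>finsum\<close> over an infinite
  set is zero by convention. A submultiset is recovered from its multiplicities, which are bounded
  on the support of \<open>w\<close> and zero off it.\<close>

lemma finite_submultisets: "finite {u. u \<subseteq># w}"
proof -
  have "{u. u \<subseteq># w} \<subseteq> (\<lambda>f. Abs_multiset f) ` {f. \<forall>x. f x \<in> (if x \<in> set_mset w then {..count w x} else {0})}"
  proof
    fix u assume "u \<in> {u. u \<subseteq># w}"
    then have "count u x \<le> count w x" for x by (simp add: mset_subset_eq_count)
    then have "\<forall>x. count u x \<in> (if x \<in> set_mset w then {..count w x} else {0})"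
      by (metis atMost_iff count_eq_zero_iff insertI1 le_zero_eq)
    then show "u \<in> (\<lambda>f. Abs_multiset f) ` {f. \<forall>x. f x \<in> (if x \<in> set_mset w then {..count w x} else {0})}"
      by (intro image_eqI[of _ _ "count u"]) (auto simp: count_inverse)
  qed
  moreover have "finite {f. \<forall>x. f x \<in> (if x \<in> set_mset w then {..count w x} else {0::nat})}"
  proof -
    have "{f. \<forall>x. f x \<in> (if x \<in> set_mset w then {..count w x} else {0::nat})} \<subseteq> 
      {f. \<forall>x. (x \<in> set_mset w \<longrightarrow> f x \<in> {..size w}) \<and> (x \<notin> set_mset w \<longrightarrow> f x = 0)}"
      using count_le_size order_trans by (fastforce split: if_splits)
    then show ?thesis
      by (rule finite_subset) (rule finite_set_of_finite_funs, auto)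
  qed
  ultimately show ?thesis by (meson finite_imageI finite_subset)
qed

lemma (in ring) finsum_subring:
  assumes "subring K R" "\<And>i. i \<in> A \<Longrightarrow> f i \<in> K"
  shows "finsum (R\<lparr>carrier := K\<rparr>) f A = finsum R f A"
proof -
  interpret K: ring "R\<lparr>carrier := K\<rparr>" by (rule subring_is_ring) fact
  show ?thesis using assms(2)
  proof (induct A rule: infinite_finite_induct)
    case (insert a A)
    then have "f \<in> A \<rightarrow> carrier R" "f a \<in> carrier R"
      using subringE(1)[OF assms(1)] by auto
    with insert show ?case by (subst finsum_insert) (auto simp: Pi_def K.finsum_insert)
  qed simp_all
qed

text \<open>The sum in \<open>poly_subst\<close> with its target set free: the coefficients go to an
  arbitrary ring \<open>T\<close> along \<open>\<phi>\<close>. Integral families take their values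
  in such rings.\<close>

definition mpoly_eval :: "('a, 's) module \<Rightarrow> ('t, 'm) ring_scheme \<Rightarrow> ('s \<Rightarrow> 't) \<Rightarrow> ('i \<Rightarrow> 't) \<Rightarrow>
    ('i multiset \<Rightarrow> 's) \<Rightarrow> 't" where
  "mpoly_eval S T \<phi> x f =
     (\<Oplus>\<^bsub>T\<^esub> w\<in>{w. f w \<noteq> \<zero>\<^bsub>S\<^esub>}. \<phi> (f w) \<otimes>\<^bsub>T\<^esub> finprod T (\<lambda>i. x i [^]\<^bsub>T\<^esub> count w i) (set_mset w))"

lemma poly_subst_eq_eval: "poly_subst S I x f = mpoly_eval S (mpoly_alg S I) (ring.indexed_const S) x f"
  by (simp add: poly_subst_def mpoly_eval_def)

lemma mpoly_alg_simps:
  "carrier (mpoly_alg S I) = ring.indexed_pset S I (carrier S)"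
  "\<one>\<^bsub>mpoly_alg S I\<^esub> = ring.indexed_const S \<one>\<^bsub>S\<^esub>"
  "\<zero>\<^bsub>mpoly_alg S I\<^esub> = ring.indexed_const S \<zero>\<^bsub>S\<^esub>"
  "f \<oplus>\<^bsub>mpoly_alg S I\<^esub> g = ring.indexed_padd S f g"
  "r \<odot>\<^bsub>mpoly_alg S I\<^esub> f = (\<lambda>w. r \<odot>\<^bsub>S\<^esub> f w)"
  by (simp_all add: mpoly_alg_def)

locale mpoly = cring S for S :: "('a, 's) module" (structure)
begin

abbreviation cst :: "'s \<Rightarrow> 'i multiset \<Rightarrow> 's" where "cst \<equiv> indexed_const"
abbreviation vr :: "'i \<Rightarrow> 'i multiset \<Rightarrow> 's" where "vr \<equiv> indexed_var"
abbreviation pset :: "'i set \<Rightarrow> 's set \<Rightarrow> ('i multiset \<Rightarrow> 's) set" where "pset \<equiv> indexed_pset"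

text \<open>The product of \<open>mpoly_alg S I\<close> does not depend on \<open>I\<close>. Stated
  for bare coefficient functions, it is shared by all sets of variables.\<close>

definition conv :: "('i multiset \<Rightarrow> 's) \<Rightarrow> ('i multiset \<Rightarrow> 's) \<Rightarrow> ('i multiset \<Rightarrow> 's)" where
  "conv f g = (\<lambda>w. \<Oplus>u\<in>{u. u \<subseteq># w}. f u \<otimes> g (w - u))"

lemma mpoly_mult: "f \<otimes>\<^bsub>mpoly_alg S I\<^esub> g = conv f g"
  by (simp add: mpoly_alg_def conv_def)

lemma pset_coeff: "f \<in> pset I (carrier S) \<Longrightarrow> f w \<in> carrier S"
  using indexed_pset_in_carrier[of "carrier S"] carrier_coeffE by blast

lemma pset_mono: "f \<in> pset J K \<Longrightarrow> J \<subseteq> I \<Longrightarrow> K \<subseteq> L \<Longrightarrow> f \<in> pset I L"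
  by (induct rule: indexed_pset.induct) (auto intro: indexed_pset.intros)

lemma finite_supp: "f \<in> pset I K \<Longrightarrow> finite {w. f w \<noteq> \<zero>}"
proof (induct rule: indexed_pset.induct)
  case (indexed_const k)
  show ?case by (rule finite_subset[of _ "{{#}}"]) (auto simp: indexed_const_def)
next
  case (indexed_padd P Q)
  then have "finite ({w. P w \<noteq> \<zero>} \<union> {w. Q w \<noteq> \<zero>})" by simp
  then show ?case
    by (rule finite_subset[rotated]) (auto simp: indexed_padd_def)
next
  case (indexed_pmult P i)
  then have "finite (add_mset i ` {w. P w \<noteq> \<zero>})" by simp
  moreover have "{w. indexed_pmult P i w \<noteq> \<zero>} \<subseteq> add_mset i ` {w. P w \<noteq> \<zero>}"
  proof
      fix w assume "w \<in> {w. indexed_pmult P i w \<noteq> \<zero>}"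
      then have "w = add_mset i (w - {#i#})" "P (w - {#i#}) \<noteq> \<zero>"
        by (auto simp: indexed_pmult_def split: if_splits)
      then show "w \<in> add_mset i ` {w. P w \<noteq> \<zero>}" by blast
    qed
  ultimately show ?case by (rule finite_subset[rotated])
qed

lemma supp_index: "f \<in> pset I K \<Longrightarrow> f w \<noteq> \<zero> \<Longrightarrow> set_mset w \<subseteq> I"
proof (induct arbitrary: w rule: indexed_pset.induct)
  case (indexed_const k)
  then show ?case by (auto simp: indexed_const_def split: if_splits)
next
  case (indexed_padd P Q)
  then have "P w \<noteq> \<zero> \<or> Q w \<noteq> \<zero>" by (auto simp: indexed_padd_def)
  then show ?case using indexed_padd by blast
next
  case (indexed_pmult P i)
  then have "i \<in># w" "P (w - {#i#}) \<noteq> \<zero>" by (auto simp: indexed_pmult_def split: if_splits)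
  then have "set_mset (w - {#i#}) \<subseteq> I" using indexed_pmult by blast
  then show ?case using \<open>i \<in># w\<close> \<open>i \<in> I\<close>
    by (metis insert_DiffM insert_subset set_mset_add_mset_insert)
qed

lemma supp_coeff: "f \<in> pset I K \<Longrightarrow> subring K S \<Longrightarrow> f w \<in> K"
  by (induct arbitrary: w rule: indexed_pset.induct)
     (auto simp: indexed_const_def indexed_padd_def indexed_pmult_def subringE)

lemma monomial_in_pset:
  assumes "set_mset u \<subseteq> I" "k \<in> K"
  shows "(\<lambda>w. if w = u then k else \<zero>) \<in> pset I K"
  using assms(1)
proof (induct u)
  case empty
  have "(\<lambda>w. if w = {#} then k else \<zero>) = cst k" by (simp add: indexed_const_def)
  then show ?case using assms(2) by (metis indexed_pset.indexed_const)
next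
  case (add i u)
  have "(\<lambda>w. if w = add_mset i u then k else \<zero>) = indexed_pmult (\<lambda>w. if w = u then k else \<zero>) i"
    by (auto simp: indexed_pmult_def fun_eq_iff)
  then show ?case using add by (simp add: indexed_pset.indexed_pmult)
qed

text \<open>The converse of \<open>finite_supp\<close>, \<open>supp_index\<close> and
  \<open>supp_coeff\<close>. Together they replace the inductive description of \<open>pset\<close>
  by one through coefficients, where conditions on the variables and on the coefficients can be
  combined freely.\<close>

lemma psetI:
  assumes K: "subring K S" and "finite {w. f w \<noteq> \<zero>}"
    and "\<And>w. f w \<in> K" and "\<And>w. f w \<noteq> \<zero> \<Longrightarrow> set_mset w \<subseteq> I"
  shows "f \<in> pset I K"
proof -
  \<comment> \<open>The induction runs over a finite set \<open>W\<close> that contains the support.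
    A monomial \<open>u\<close> is removed by setting its coefficient to zero.\<close>
  have "f \<in> pset I K" if "finite W" "\<And>w. f w \<in> K" "\<And>w. f w \<noteq> \<zero> \<Longrightarrow> w \<in> W \<and> set_mset w \<subseteq> I" for W f
    using that
  proof (induct W arbitrary: f)
    case empty
    then have "f = cst \<zero>" by (auto simp: indexed_const_def)
    then show ?case using subringE(2)[OF K] by (auto intro: indexed_pset.intros)
  next
    case (insert u W)
    let ?f = "f(u := \<zero>)"
    have "?f \<in> pset I K"
      by (rule insert) (use insert subringE(2)[OF K] in \<open>auto split: if_splits\<close>)
    moreover have "(\<lambda>w. if w = u then f u else \<zero>) \<in> pset I K"
    proof (cases "f u = \<zero>")
      case True
      then have "(\<lambda>w. if w = u then f u else \<zero>) = cst \<zero>" by (auto simp: indexed_const_def)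
      then show ?thesis using subringE(2)[OF K] by (auto intro: indexed_pset.intros)
    next
      case False
      then show ?thesis using insert.prems monomial_in_pset[of u I "f u" K] by blast
    qed
    ultimately have "indexed_padd ?f (\<lambda>w. if w = u then f u else \<zero>) \<in> pset I K"
      by (rule indexed_pset.intros)
    moreover have "indexed_padd ?f (\<lambda>w. if w = u then f u else \<zero>) = f"
      using subringE(1)[OF K] insert.prems(1) by (auto simp: indexed_padd_def fun_eq_iff subset_iff)
    ultimately show ?case by simp
  qed
  then show ?thesis using assms by blast
qed

section \<open>The convolution product\<close>

lemma conv_closed:
  assumes "\<And>w. f w \<in> carrier S" "\<And>w. g w \<in> carrier S"
  shows "conv f g w \<in> carrier S"
  unfolding conv_def using assms by (auto intro!: finsum_closed)

lemma conv_const: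
  assumes "k \<in> carrier S" "\<And>w. g w \<in> carrier S"
  shows "conv (cst k) g = (\<lambda>w. k \<otimes> g w)"
proof
  fix w
  have "conv (cst k) g w = (\<Oplus>u\<in>{u. u \<subseteq># w}. if {#} = u then k \<otimes> g (w - u) else \<zero>)"
    unfolding conv_def using assms by (intro finsum_cong') (auto simp: indexed_const_def)
  also have "\<dots> = k \<otimes> g (w - {#})"
    by (rule finsum_singleton) (use assms finite_submultisets in auto)
  finally show "conv (cst k) g w = k \<otimes> g w" by simp
qed

lemma conv_padd:
  assumes "\<And>w. f w \<in> carrier S" "\<And>w. f' w \<in> carrier S" "\<And>w. g w \<in> carrier S"
  shows "conv (indexed_padd f f') g = indexed_padd (conv f g) (conv f' g)"
proof
  fix w
  have "conv (indexed_padd f f') g w = (\<Oplus>u\<in>{u. u \<subseteq># w}. f u \<otimes> g (w - u) \<oplus> f' u \<otimes> g (w - u))"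
    unfolding conv_def using assms by (intro finsum_cong') (auto simp: indexed_padd_def l_distr)
  also have "\<dots> = indexed_padd (conv f g) (conv f' g) w"
    unfolding conv_def indexed_padd_def using assms by (intro finsum_addf) auto
  finally show "conv (indexed_padd f f') g w = indexed_padd (conv f g) (conv f' g) w" .
qed

lemma conv_pmult:
  assumes "\<And>w. f w \<in> carrier S" "\<And>w. g w \<in> carrier S"
  shows "conv (indexed_pmult f i) g = indexed_pmult (conv f g) i"
proof
  fix w
  show "conv (indexed_pmult f i) g w = indexed_pmult (conv f g) i w"
  proof (cases "i \<in># w")
    case False
    then have "conv (indexed_pmult f i) g w = (\<Oplus>u\<in>{u. u \<subseteq># w}. \<zero>)"
      unfolding conv_def using assms
      by (intro finsum_cong') (auto simp: indexed_pmult_def dest: mset_subset_eqD)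
    then show ?thesis using False by (simp add: indexed_pmult_def)
  next
    case True
    let ?t = "\<lambda>u. indexed_pmult f i u \<otimes> g (w - u)"
    have tc: "?t u \<in> carrier S" for u using assms by (auto simp: indexed_pmult_def)
    have sub: "add_mset i ` {u. u \<subseteq># w - {#i#}} \<subseteq> {u. u \<subseteq># w}"
      using True by (auto simp: insert_subset_eq_iff)
    \<comment> \<open>Submultisets without \<open>i\<close> contribute nothing, and those with
      \<open>i\<close> are the \<open>add_mset i u\<close> for \<open>u\<close> below
      \<open>w - {#i#}\<close>.\<close>
    have "(\<Oplus>u\<in>{u. u \<subseteq># w}. ?t u) = (\<Oplus>u\<in>add_mset i ` {u. u \<subseteq># w - {#i#}}. ?t u)"
    proof (rule add.finprod_mono_neutral_cong_left[symmetric])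
      show "finite {u. u \<subseteq># w}" by (rule finite_submultisets)
      show "add_mset i ` {u. u \<subseteq># w - {#i#}} \<subseteq> {u. u \<subseteq># w}" by (rule sub)
      fix u assume u: "u \<in> {u. u \<subseteq># w} - add_mset i ` {u. u \<subseteq># w - {#i#}}"
      have "i \<notin># u"
      proof
        assume "i \<in># u"
        then have "u = add_mset i (u - {#i#})" "u - {#i#} \<subseteq># w - {#i#}"
          using u by (auto simp: subseteq_mset_def diff_le_mono)
        then show False using u by blast
      qed
      then show "?t u = \<zero>" using assms by (simp add: indexed_pmult_def)
    qed (use tc in auto)
    also have "\<dots> = (\<Oplus>u\<in>{u. u \<subseteq># w - {#i#}}. ?t (add_mset i u))"
      by (rule finsum_reindex) (use tc in \<open>auto simp: inj_on_def\<close>)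
    also have "\<dots> = (\<Oplus>u\<in>{u. u \<subseteq># w - {#i#}}. f u \<otimes> g (w - {#i#} - u))"
      using assms by (intro finsum_cong') (auto simp: indexed_pmult_def)
    finally show ?thesis using True by (simp add: conv_def indexed_pmult_def)
  qed
qed

lemma conv_commute:
  fixes f g :: "'i multiset \<Rightarrow> 's"
  assumes "\<And>w. f w \<in> carrier S" "\<And>w. g w \<in> carrier S"
  shows "conv f g = conv g f"
proof
  fix w :: "'i multiset"
  have dd: "\<And>u :: 'i multiset. u \<subseteq># w \<Longrightarrow> w - (w - u) = u"
    by (metis add_diff_cancel_left' subset_mset.diff_add)
  have "bij_betw (\<lambda>u. w - u) {u. u \<subseteq># w} {u. u \<subseteq># w}"
    by (rule bij_betw_byWitness[of _ "\<lambda>u. w - u"]) (auto simp: dd)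
  then have "conv f g w = (\<Oplus>u\<in>(\<lambda>u. w - u) ` {u. u \<subseteq># w}. f u \<otimes> g (w - u))"
    by (simp add: conv_def bij_betw_def)
  also have "\<dots> = (\<Oplus>u\<in>{u. u \<subseteq># w}. f (w - u) \<otimes> g (w - (w - u)))"
    by (rule finsum_reindex) (use assms \<open>bij_betw _ _ _\<close> in \<open>auto simp: bij_betw_def\<close>)
  also have "\<dots> = conv g f w"
    unfolding conv_def using assms 
    by (intro finsum_cong') (auto simp: m_comm dd)
  finally show "conv f g w = conv g f w" .
qed

lemma conv_pset:
  assumes "subring K S" "f \<in> pset I K" "g \<in> pset I K"
  shows "conv f g \<in> pset I K"
  using assms(2)
proof (induct rule: indexed_pset.induct)
  have gc: "g w \<in> carrier S" "g w \<in> K" for w using supp_coeff[OF assms(3,1)] subringE(1)[OF assms(1)] by auto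
  have Kc: "K \<subseteq> carrier S" by (rule subringE(1)[OF assms(1)])
  {
    case (indexed_const k)
    then have "conv (cst k) g = (\<lambda>w. k \<otimes> g w)" using gc Kc by (auto intro!: conv_const)
    also have "\<dots> \<in> pset I K"
    proof (rule psetI[OF assms(1)])
      show "finite {w. k \<otimes> g w \<noteq> \<zero>}"
        by (rule finite_subset[OF _ finite_supp[OF assms(3)]]) (use indexed_const Kc in auto)
      show "set_mset w \<subseteq> I" if "k \<otimes> g w \<noteq> \<zero>" for w
        by (rule supp_index[OF assms(3)]) (use indexed_const Kc that in auto)
    qed (use subringE[OF assms(1)] indexed_const gc in auto)
    finally show ?case .
  next
    case (indexed_padd P Q)
    then have "P w \<in> carrier S" "Q w \<in> carrier S" for w 
      using supp_coeff[OF _ assms(1)] Kc by auto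
    with indexed_padd show ?case using gc by (subst conv_padd) (auto intro: indexed_pset.intros)
  next
    case (indexed_pmult P i)
    then have "P w \<in> carrier S" for w 
      using supp_coeff[OF _ assms(1)] Kc by auto
    with indexed_pmult show ?case using gc by (subst conv_pmult) (auto intro: indexed_pset.intros)
  }
qed

text \<open>Induction on the construction of \<open>f\<close> avoids the reindexing of a double sum,
  since \<open>conv\<close> is compatible with constants, sums and multiplication by a variable in
  its first argument.\<close>

lemma conv_assoc:
  assumes "f \<in> pset I (carrier S)" "\<And>w. g w \<in> carrier S" "\<And>w. h w \<in> carrier S"
  shows "conv (conv f g) h = conv f (conv g h)"
  using assms(1)
proof (induct rule: indexed_pset.induct)
  have gh: "conv g h w \<in> carrier S" for w using assms by (intro conv_closed)
  note cl = assms(2,3) gh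
  {
    case (indexed_const k)
    have "conv (\<lambda>w. k \<otimes> g w) h = (\<lambda>w. k \<otimes> conv g h w)"
      unfolding conv_def using indexed_const cl(1,2)
      by (subst finsum_rdistr) (auto intro!: finsum_cong' ext finite_submultisets simp: m_assoc)
    then show ?case using indexed_const cl by (simp add: conv_const)
  next
    case (indexed_padd P Q)
    then have "P w \<in> carrier S" "Q w \<in> carrier S" for w using pset_coeff by auto
    with indexed_padd show ?case using cl by (simp add: conv_padd conv_closed)
  next
    case (indexed_pmult P i)
    then have "P w \<in> carrier S" for w using pset_coeff by auto
    with indexed_pmult show ?case using cl by (simp add: conv_pmult conv_closed)
  }
qed

lemma cring_mpoly: "cring (mpoly_alg S I)"
proof (rule cringI, goal_cases)
  case 1
  have cl: "f w \<in> carrier S" if "f \<in> pset I (carrier S)" for f w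
    using that by (rule pset_coeff)
  show ?case
  proof (rule abelian_groupI; unfold mpoly_alg_simps)
    fix f assume f: "f \<in> pset I (carrier S)"
    show "\<exists>g\<in>pset I (carrier S). indexed_padd g f = cst \<zero>"
    proof (intro bexI[of _ "\<lambda>w. \<ominus> f w"])
      show "indexed_padd (\<lambda>w. \<ominus> f w) f = cst \<zero>"
        using cl[OF f] by (auto simp: indexed_padd_def indexed_const_def l_neg)
      show "(\<lambda>w. \<ominus> f w) \<in> pset I (carrier S)"
      proof (rule psetI[OF carrier_is_subring])
        show "finite {w. \<ominus> f w \<noteq> \<zero>}"
          by (rule finite_subset[OF _ finite_supp[OF f]]) auto
        show "set_mset w \<subseteq> I" if "\<ominus> f w \<noteq> \<zero>" for w
          by (rule supp_index[OF f]) (use that in auto)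
      qed (simp add: cl[OF f])
    qed
  next
    fix f g assume "f \<in> pset I (carrier S)" "g \<in> pset I (carrier S)"
    then show "indexed_padd f g \<in> pset I (carrier S)" by (rule indexed_pset.intros)
  next
    show "cst \<zero> \<in> pset I (carrier S)" by (simp add: indexed_pset.intros)
  next
    fix f g h assume "f \<in> pset I (carrier S)" "g \<in> pset I (carrier S)" "h \<in> pset I (carrier S)"
    then have "\<And>w. f w \<in> carrier S" "\<And>w. g w \<in> carrier S" "\<And>w. h w \<in> carrier S"
      using cl by auto
    then show "indexed_padd (indexed_padd f g) h = indexed_padd f (indexed_padd g h)"
      by (simp add: indexed_padd_def a_assoc)
  next
    fix f g assume "f \<in> pset I (carrier S)" "g \<in> pset I (carrier S)"
    then have "\<And>w. f w \<in> carrier S" "\<And>w. g w \<in> carrier S"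
      using cl by auto
    then show "indexed_padd f g = indexed_padd g f"
      by (simp add: indexed_padd_def a_comm)
  next
    fix f assume "f \<in> pset I (carrier S)"
    then have "\<And>w. f w \<in> carrier S" using cl by auto
    then show "indexed_padd (cst \<zero>) f = f"
      by (auto simp: indexed_padd_def indexed_const_def)
  qed
next
  case 2
  have cl: "f w \<in> carrier S" if "f \<in> pset I (carrier S)" for f w
    using that by (rule pset_coeff)
  show ?case
  proof (rule comm_monoidI; unfold mpoly_alg_simps mpoly_mult)
    fix f g assume fg: "f \<in> pset I (carrier S)" "g \<in> pset I (carrier S)"
    show "conv f g \<in> pset I (carrier S)" by (rule conv_pset[OF carrier_is_subring fg])
    show "conv f g = conv g f" by (rule conv_commute) (rule cl, rule fg)+
  next
    fix f g h assume f: "f \<in> pset I (carrier S)" and "g \<in> pset I (carrier S)" "h \<in> pset I (carrier S)"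
    then show "conv (conv f g) h = conv f (conv g h)"
      by (intro conv_assoc[OF f] cl)
  next
    fix f assume f: "f \<in> pset I (carrier S)"
    show "conv (cst \<one>) f = f"
      using cl[OF f] by (simp add: conv_const)
  next
    show "cst \<one> \<in> pset I (carrier S)" by (simp add: indexed_pset.intros)
  qed
next
  case (3 f g h)
  then have "f \<in> pset I (carrier S)" "g \<in> pset I (carrier S)" "h \<in> pset I (carrier S)"
    by (simp_all only: mpoly_alg_simps)
  then have c: "f w \<in> carrier S" "g w \<in> carrier S" "h w \<in> carrier S" for w
    by (simp_all add: pset_coeff)
  have "conv (indexed_padd f g) h = indexed_padd (conv f h) (conv g h)"
    by (rule conv_padd) (simp_all only: c)
  then show ?case
    unfolding mpoly_alg_simps(4) mpoly_mult by assumption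
qed

end

context mpoly
begin

lemma cst_closed: "k \<in> carrier S \<Longrightarrow> cst k \<in> carrier (mpoly_alg S I)"
  by (simp add: mpoly_alg_simps indexed_pset.intros)

lemma vr_closed: "i \<in> I \<Longrightarrow> vr i \<in> carrier (mpoly_alg S I)"
  by (simp add: mpoly_alg_simps indexed_var_def indexed_pset.intros)

lemma cst_hom: "cst \<in> ring_hom S (mpoly_alg S I)"
proof (rule ring_hom_memI)
  fix x y assume "x \<in> carrier S" "y \<in> carrier S"
  then show "cst (x \<otimes> y) = cst x \<otimes>\<^bsub>mpoly_alg S I\<^esub> cst y"
    by (subst mpoly_mult, subst conv_const) (auto simp: indexed_const_def)
qed (auto simp: cst_closed mpoly_alg_simps(2,4) indexed_padd_const)

lemma pmult_eq:
  assumes "\<And>w. f w \<in> carrier S"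
  shows "indexed_pmult f i = vr i \<otimes>\<^bsub>mpoly_alg S I\<^esub> f"
  using assms by (simp add: mpoly_mult indexed_var_def conv_pmult conv_const indexed_const_in_carrier[OF subset_refl])

text \<open>The induction rule of \<open>indexed_pset\<close>, rewritten in the ring operations of
  \<open>mpoly_alg S I\<close>. Coefficients and variables may be restricted to \<open>K\<close> and
  \<open>J\<close> while the operations remain those of the large algebra.\<close>

lemma mpoly_induct [consumes 2, case_names const add var]:
  assumes "subring K S" "f \<in> pset J K"
    and "\<And>k. k \<in> K \<Longrightarrow> P (cst k)"
    and "\<And>f g. f \<in> pset J K \<Longrightarrow> g \<in> pset J K \<Longrightarrow> P f \<Longrightarrow> P g \<Longrightarrow> P (f \<oplus>\<^bsub>mpoly_alg S I\<^esub> g)"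
    and "\<And>f i. f \<in> pset J K \<Longrightarrow> i \<in> J \<Longrightarrow> P f \<Longrightarrow> P (vr i \<otimes>\<^bsub>mpoly_alg S I\<^esub> f)"
  shows "P f"
  using assms(2)
proof (induct rule: indexed_pset.induct)
  case (indexed_pmult f i)
  have "f w \<in> carrier S" for w 
    using indexed_pmult(1) assms(1) subringE(1)[OF assms(1)] supp_coeff by blast
  then show ?case using indexed_pmult assms by (simp add: pmult_eq[of _ _ I])
qed (use assms in \<open>auto simp: mpoly_alg_simps\<close>)

lemma pset_subring:
  assumes "subring K S" "J \<subseteq> I"
  shows "subring (pset J K) (mpoly_alg S I)"
proof -
  interpret P: cring "mpoly_alg S I" by (rule cring_mpoly)
  have K: "K \<subseteq> carrier S" "\<one> \<in> K" "\<And>k. k \<in> K \<Longrightarrow> \<ominus> k \<in> K" using subringE[OF assms(1)] by auto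
  show ?thesis
  proof (rule P.subringI)
    show sub: "pset J K \<subseteq> carrier (mpoly_alg S I)" 
      using K assms(2) by (auto simp: mpoly_alg_simps intro: pset_mono)
    show "\<one>\<^bsub>mpoly_alg S I\<^esub> \<in> pset J K"
      using K by (simp add: mpoly_alg_simps indexed_pset.intros)
    fix f assume f: "f \<in> pset J K"
    \<comment> \<open>Negation is multiplication by the constant \<open>\<ominus> \<one>\<close>,
      for which closure is already known.\<close>
    have m1: "\<ominus> \<one> \<in> K" using K by simp
    have "conv (cst (\<ominus> \<one>)) f \<in> pset J K"
      by (rule conv_pset[OF assms(1)]) (use f m1 in \<open>auto intro: indexed_pset.intros\<close>)
    moreover have "conv (cst (\<ominus> \<one>)) f = \<ominus>\<^bsub>mpoly_alg S I\<^esub> f"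
    proof -
      have "cst (\<ominus> \<one>) = \<ominus>\<^bsub>mpoly_alg S I\<^esub> (cst \<one>)"
        using ring_hom_minus(2)[OF is_cring cring_mpoly cst_hom, of \<one> \<one>] by simp
      then show ?thesis using f sub P.l_minus[of "\<one>\<^bsub>mpoly_alg S I\<^esub>" f]
        by (auto simp: mpoly_mult[symmetric, of _ _ I] mpoly_alg_simps(2)[symmetric, of S I])
    qed
    ultimately show "\<ominus>\<^bsub>mpoly_alg S I\<^esub> f \<in> pset J K" by simp
    fix g assume g: "g \<in> pset J K"
    show "f \<otimes>\<^bsub>mpoly_alg S I\<^esub> g \<in> pset J K"
      by (simp add: mpoly_mult conv_pset[OF assms(1) f g])
    show "f \<oplus>\<^bsub>mpoly_alg S I\<^esub> g \<in> pset J K"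
      using f g by (simp only: mpoly_alg_simps indexed_pset.intros)
  qed
qed

lemma mpoly_hom_ext:
  assumes "subring K S" "f \<in> pset J K" "J \<subseteq> I"
    and "h \<in> ring_hom (mpoly_alg S I) T" "h' \<in> ring_hom (mpoly_alg S I) T"
    and "\<And>k. k \<in> K \<Longrightarrow> h (cst k) = h' (cst k)" "\<And>i. i \<in> J \<Longrightarrow> h (vr i) = h' (vr i)"
  shows "h f = h' f"
proof -
  have sub: "pset J K \<subseteq> carrier (mpoly_alg S I)"
    using pset_subring[OF assms(1,3)] by (rule subringE)
  show ?thesis
    using assms(1,2)
  proof (induct f rule: mpoly_induct[where I = I])
    case (add f g)
    then have "f \<in> carrier (mpoly_alg S I)" "g \<in> carrier (mpoly_alg S I)" using sub by auto
    with add show ?case by (simp add: ring_hom_add[OF assms(4)] ring_hom_add[OF assms(5)])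
  next
    case (var f i)
    then have "f \<in> carrier (mpoly_alg S I)" "vr i \<in> carrier (mpoly_alg S I)"
      using sub assms(3) vr_closed[of i I] by auto
    with var show ?case by (simp add: ring_hom_mult[OF assms(4)] ring_hom_mult[OF assms(5)] assms)
  qed (use assms in auto)
qed

end

section \<open>Evaluation homomorphisms\<close>

locale mpoly_hom = mpoly S + T: cring T for S :: "('a, 's) module" (structure) and T :: "('t, 'm) ring_scheme" +
  fixes \<phi> :: "'s \<Rightarrow> 't" and x :: "'i \<Rightarrow> 't" and I :: "'i set"
  assumes phi: "\<phi> \<in> ring_hom S T" and x: "\<And>i. i \<in> I \<Longrightarrow> x i \<in> carrier T"
begin

abbreviation "ev \<equiv> mpoly_eval S T \<phi> x"

definition mon :: "'i multiset \<Rightarrow> 't" where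
  "mon w = finprod T (\<lambda>i. x i [^]\<^bsub>T\<^esub> count w i) (set_mset w)"

lemma phi_zero: "\<phi> \<zero> = \<zero>\<^bsub>T\<^esub>"
  by (rule ring_hom_zero[OF phi ring_axioms T.ring_axioms])

lemma phi_closed: "k \<in> carrier S \<Longrightarrow> \<phi> k \<in> carrier T"
  by (rule ring_hom_closed[OF phi])

lemma mon_closed: "set_mset w \<subseteq> I \<Longrightarrow> mon w \<in> carrier T"
  unfolding mon_def by (intro T.finprod_closed) (use x in auto)

lemma mon_superset:
  assumes "set_mset w \<subseteq> A" "A \<subseteq> I" "finite A"
  shows "mon w = finprod T (\<lambda>i. x i [^]\<^bsub>T\<^esub> count w i) A"
  unfolding mon_def
  by (rule T.finprod_mono_neutral_cong_left) (use assms x in \<open>auto simp: not_in_iff\<close>)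

lemma mon_empty: "mon {#} = \<one>\<^bsub>T\<^esub>"
  by (simp add: mon_def)

lemma mon_add:
  assumes "i \<in> I" "set_mset w \<subseteq> I"
  shows "mon (add_mset i w) = x i \<otimes>\<^bsub>T\<^esub> mon w"
proof -
  let ?A = "insert i (set_mset w)"
  have xc: "x j \<in> carrier T" if "j \<in> ?A" for j using that assms x by auto
  have "mon (add_mset i w) = finprod T (\<lambda>j. x j [^]\<^bsub>T\<^esub> count (add_mset i w) j) ?A"
    by (rule mon_superset) (use assms in auto)
  also have "\<dots> = finprod T (\<lambda>j. (if i = j then x j else \<one>\<^bsub>T\<^esub>) \<otimes>\<^bsub>T\<^esub> x j [^]\<^bsub>T\<^esub> count w j) ?A"
    using xc by (intro T.finprod_cong') (auto simp: T.m_comm)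
  also have "\<dots> = finprod T (\<lambda>j. if i = j then x j else \<one>\<^bsub>T\<^esub>) ?A \<otimes>\<^bsub>T\<^esub> finprod T (\<lambda>j. x j [^]\<^bsub>T\<^esub> count w j) ?A"
    using xc by (intro T.finprod_multf) auto
  also have "finprod T (\<lambda>j. if i = j then x j else \<one>\<^bsub>T\<^esub>) ?A = x i"
    by (rule T.finprod_singleton) (use xc in auto)
  also have "finprod T (\<lambda>j. x j [^]\<^bsub>T\<^esub> count w j) ?A = mon w"
    by (rule mon_superset[symmetric]) (use assms in auto)
  finally show ?thesis .
qed

lemma ev_def: "ev f = (\<Oplus>\<^bsub>T\<^esub>w\<in>{w. f w \<noteq> \<zero>}. \<phi> (f w) \<otimes>\<^bsub>T\<^esub> mon w)"
  by (simp add: mpoly_eval_def mon_def)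

text \<open>The sum in \<open>ev\<close> runs over the support of \<open>f\<close>. Extending it to
  a common finite set \<open>W\<close> by zero terms allows different polynomials to be compared
  term by term.\<close>

lemma ev_superset:
  assumes "{w. f w \<noteq> \<zero>} \<subseteq> W" "finite W" "\<And>w. w \<in> W \<Longrightarrow> set_mset w \<subseteq> I" "\<And>w. f w \<in> carrier S"
  shows "ev f = (\<Oplus>\<^bsub>T\<^esub>w\<in>W. \<phi> (f w) \<otimes>\<^bsub>T\<^esub> mon w)"
  unfolding ev_def
  by (rule T.add.finprod_mono_neutral_cong_left) 
     (use assms in \<open>auto simp: phi_zero mon_closed phi_closed\<close>)

lemma ev_const: "k \<in> carrier S \<Longrightarrow> ev (cst k) = \<phi> k"
proof -
  assume k: "k \<in> carrier S"
  have "ev (cst k) = (\<Oplus>\<^bsub>T\<^esub>w\<in>{{#}}. \<phi> (cst k w) \<otimes>\<^bsub>T\<^esub> mon w)"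
    by (rule ev_superset) (use k in \<open>auto simp: indexed_const_def\<close>)
  then show ?thesis using k by (simp add: mon_empty indexed_const_def phi_closed)
qed

lemma ev_padd:
  assumes "f \<in> pset I (carrier S)" "g \<in> pset I (carrier S)"
  shows "ev (indexed_padd f g) = ev f \<oplus>\<^bsub>T\<^esub> ev g"
proof -
  let ?W = "{w. f w \<noteq> \<zero>} \<union> {w. g w \<noteq> \<zero>}"
  note c = pset_coeff[OF assms(1)] pset_coeff[OF assms(2)]
  have fin: "finite ?W" using assms finite_supp by auto
  have W: "set_mset w \<subseteq> I" if "w \<in> ?W" for w using assms supp_index that by blast
  have e: "ev h = (\<Oplus>\<^bsub>T\<^esub>w\<in>?W. \<phi> (h w) \<otimes>\<^bsub>T\<^esub> mon w)" 
    if "{w. h w \<noteq> \<zero>} \<subseteq> ?W" "\<And>w. h w \<in> carrier S" for h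
    using that W fin by (intro ev_superset) auto
  have "ev (indexed_padd f g) = (\<Oplus>\<^bsub>T\<^esub>w\<in>?W. \<phi> (indexed_padd f g w) \<otimes>\<^bsub>T\<^esub> mon w)"
    using c by (intro e) (auto simp: indexed_padd_def)
  also have "\<dots> = (\<Oplus>\<^bsub>T\<^esub>w\<in>?W. \<phi> (f w) \<otimes>\<^bsub>T\<^esub> mon w \<oplus>\<^bsub>T\<^esub> \<phi> (g w) \<otimes>\<^bsub>T\<^esub> mon w)"
    using c W by (intro T.finsum_cong') 
      (auto simp: indexed_padd_def ring_hom_add[OF phi] T.l_distr phi_closed mon_closed)
  also have "\<dots> = ev f \<oplus>\<^bsub>T\<^esub> ev g"
    using c W e[of f] e[of g] by (subst T.finsum_addf) (auto simp: phi_closed mon_closed)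
  finally show ?thesis .
qed

lemma ev_pmult:
  assumes "f \<in> pset I (carrier S)" "i \<in> I"
  shows "ev (indexed_pmult f i) = x i \<otimes>\<^bsub>T\<^esub> ev f"
proof -
  note c = pset_coeff[OF assms(1)]
  let ?W = "{w. f w \<noteq> \<zero>}"
  have W: "set_mset w \<subseteq> I" if "w \<in> ?W" for w using assms supp_index that by blast
  have fin: "finite ?W" using assms finite_supp by auto
  have "ev (indexed_pmult f i) = (\<Oplus>\<^bsub>T\<^esub>w\<in>add_mset i ` ?W. \<phi> (indexed_pmult f i w) \<otimes>\<^bsub>T\<^esub> mon w)"
  proof (rule ev_superset)
    show "{w. indexed_pmult f i w \<noteq> \<zero>} \<subseteq> add_mset i ` ?W"
    proof
      fix w assume "w \<in> {w. indexed_pmult f i w \<noteq> \<zero>}"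
      then have "w = add_mset i (w - {#i#})" "f (w - {#i#}) \<noteq> \<zero>"
        by (auto simp: indexed_pmult_def split: if_splits)
      then show "w \<in> add_mset i ` ?W" by blast
    qed
  next
    show "set_mset w \<subseteq> I" if w: "w \<in> add_mset i ` ?W" for w
    proof -
      obtain v where "w = add_mset i v" "v \<in> ?W" using w by auto
      with W[of v] assms(2) show ?thesis by simp
    qed
  qed (use fin c in \<open>auto simp: indexed_pmult_def\<close>)
  also have "\<dots> = (\<Oplus>\<^bsub>T\<^esub>w\<in>?W. \<phi> (indexed_pmult f i (add_mset i w)) \<otimes>\<^bsub>T\<^esub> mon (add_mset i w))"
    using W c assms(2) by (intro T.finsum_reindex) (auto simp: inj_on_def indexed_pmult_def phi_closed mon_closed)
  also have "\<dots> = (\<Oplus>\<^bsub>T\<^esub>w\<in>?W. x i \<otimes>\<^bsub>T\<^esub> (\<phi> (f w) \<otimes>\<^bsub>T\<^esub> mon w))"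
    using W c assms(2) x by (intro T.finsum_cong') 
     (auto simp: indexed_pmult_def mon_add phi_closed mon_closed T.m_lcomm)
  also have "\<dots> = x i \<otimes>\<^bsub>T\<^esub> ev f"
    unfolding ev_def using fin W c x assms(2) 
    by (subst T.finsum_rdistr) (auto simp: phi_closed mon_closed)
  finally show ?thesis .
qed

lemma ev_closed: "f \<in> pset I (carrier S) \<Longrightarrow> ev f \<in> carrier T"
  unfolding ev_def using pset_coeff[of f I] supp_index[of f I "carrier S"]
  by (intro T.finsum_closed) (simp add: phi_closed mon_closed Pi_def)

lemma ev_hom: "ev \<in> ring_hom (mpoly_alg S I) T"
proof (rule ring_hom_memI)
  fix f g assume fg: "f \<in> carrier (mpoly_alg S I)" "g \<in> carrier (mpoly_alg S I)"
  then have g: "g \<in> pset I (carrier S)" by (simp add: mpoly_alg_simps)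
  note gc = pset_coeff[OF g]
  have f: "f \<in> pset I (carrier S)" using fg by (simp add: mpoly_alg_simps)
  show "ev (f \<oplus>\<^bsub>mpoly_alg S I\<^esub> g) = ev f \<oplus>\<^bsub>T\<^esub> ev g"
    using f g by (simp add: mpoly_alg_simps ev_padd)
  \<comment> \<open>With \<open>g\<close> fixed, induction on \<open>f\<close> reduces
    multiplicativity to the rules for \<open>conv\<close> in its first argument.\<close>
  have "ev (conv f g) = ev f \<otimes>\<^bsub>T\<^esub> ev g"
    using f
  proof (induct rule: indexed_pset.induct)
    case (indexed_const k)
    have supp: "{w. k \<otimes> g w \<noteq> \<zero>} \<subseteq> {w. g w \<noteq> \<zero>}" using indexed_const by auto
    have W: "set_mset w \<subseteq> I" if "w \<in> {w. g w \<noteq> \<zero>}" for w using g supp_index that by blast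
    have "ev (conv (cst k) g) = (\<Oplus>\<^bsub>T\<^esub>w\<in>{w. g w \<noteq> \<zero>}. \<phi> (k \<otimes> g w) \<otimes>\<^bsub>T\<^esub> mon w)"
      using indexed_const gc supp W finite_supp[OF g] 
      by (subst conv_const) (auto intro!: ev_superset)
    also have "\<dots> = (\<Oplus>\<^bsub>T\<^esub>w\<in>{w. g w \<noteq> \<zero>}. \<phi> k \<otimes>\<^bsub>T\<^esub> (\<phi> (g w) \<otimes>\<^bsub>T\<^esub> mon w))"
      using indexed_const gc W
      by (intro T.finsum_cong') (auto simp: ring_hom_mult[OF phi] T.m_assoc phi_closed mon_closed)
    also have "\<dots> = \<phi> k \<otimes>\<^bsub>T\<^esub> ev g"
      unfolding ev_def using indexed_const gc W finite_supp[OF g] 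
      by (subst T.finsum_rdistr) (auto simp: phi_closed mon_closed)
    finally show ?case using indexed_const by (simp add: ev_const)
  next
    case (indexed_padd P Q)
    then have PQ: "P w \<in> carrier S" "Q w \<in> carrier S" for w using pset_coeff by auto
    have "conv P g \<in> pset I (carrier S)" "conv Q g \<in> pset I (carrier S)"
      using conv_pset[OF carrier_is_subring] indexed_padd g by auto
    then have "ev (conv (indexed_padd P Q) g) = ev (conv P g) \<oplus>\<^bsub>T\<^esub> ev (conv Q g)"
      using PQ gc by (simp add: conv_padd ev_padd)
    then show ?case using indexed_padd g by (simp add: ev_padd T.l_distr ev_closed)
  next
    case (indexed_pmult P i)
    then have PQ: "P w \<in> carrier S" for w using pset_coeff by auto
    have "conv P g \<in> pset I (carrier S)"
      using conv_pset[OF carrier_is_subring] indexed_pmult g by auto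
    then have "ev (conv (indexed_pmult P i) g) = x i \<otimes>\<^bsub>T\<^esub> ev (conv P g)"
      using PQ gc indexed_pmult by (simp add: conv_pmult ev_pmult)
    then show ?case using indexed_pmult g x by (simp add: ev_pmult T.m_assoc ev_closed)
  qed
  then show "ev (f \<otimes>\<^bsub>mpoly_alg S I\<^esub> g) = ev f \<otimes>\<^bsub>T\<^esub> ev g" by (simp add: mpoly_mult)
qed (auto simp: mpoly_alg_simps ev_closed ev_const ring_hom_one[OF phi])

lemma ev_var: "i \<in> I \<Longrightarrow> ev (vr i) = x i"
  using x unfolding indexed_var_def 
  by (subst ev_pmult) (auto simp: indexed_pset.intros ev_const ring_hom_one[OF phi])

lemma ev_mem_subring:
  assumes "subring K S" "f \<in> pset J K" "J \<subseteq> I" "subring Q T" "\<phi> ` K \<subseteq> Q" "\<And>i. i \<in> J \<Longrightarrow> x i \<in> Q"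
  shows "ev f \<in> Q"
proof -
  have Kc: "K \<subseteq> carrier S" using subringE assms by auto
  have sub: "pset J K \<subseteq> carrier (mpoly_alg S I)"
    using pset_subring[OF assms(1,3)] by (rule subringE)
  show ?thesis
    using assms(1,2)
  proof (induct f rule: mpoly_induct[where I = I])
    case (const k)
    then have "k \<in> carrier S" "\<phi> k \<in> Q" using assms(5) Kc by auto
    then show ?case by (simp add: ev_const)
  next
    case (add f g)
    then have "f \<in> carrier (mpoly_alg S I)" "g \<in> carrier (mpoly_alg S I)" using sub by auto
    with add show ?case by (simp add: ring_hom_add[OF ev_hom] subringE[OF assms(4)])
  next
    case (var f i)
    then have "f \<in> carrier (mpoly_alg S I)" "vr i \<in> carrier (mpoly_alg S I)" "i \<in> I"
      using sub assms(3) vr_closed[of i I] by auto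
    with var show ?case using assms
      by (simp add: ring_hom_mult[OF ev_hom] subringE[OF assms(4)] ev_var)
  qed
qed

lemma ev_unique:
  assumes "subring K S" "f \<in> pset J K" "J \<subseteq> I" "h \<in> ring_hom (mpoly_alg S I) T"
    and "\<And>k. k \<in> K \<Longrightarrow> h (cst k) = \<phi> k" "\<And>i. i \<in> J \<Longrightarrow> h (vr i) = x i"
  shows "h f = ev f"
  by (rule mpoly_hom_ext[OF assms(1-4) ev_hom]) 
     (use assms subringE(1)[OF assms(1)] in \<open>auto simp: ev_const ev_var\<close>)

end


section \<open>Integral ghost vectors\<close>

definition bexp :: "'e \<Rightarrow> 'e \<Rightarrow>\<^sub>0 nat" where
  "bexp \<alpha> = Poly_Mapping.single \<alpha> 1"

lemma lookup_bexp [simp]: "Poly_Mapping.lookup (bexp \<alpha>) \<beta> = (if \<alpha> = \<beta> then 1 else 0)"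
  by (simp add: bexp_def lookup_single when_def)

text \<open>Induction on the total degree. The hypothesis covers the removal of one basis vector in
  every direction, as the recursion of \<open>wit\<close> requires.\<close>

lemma exp_induct [case_names step]:
  assumes "\<And>n. (\<And>k \<alpha>. n = k + bexp \<alpha> \<Longrightarrow> Pr k) \<Longrightarrow> Pr n"
  shows "Pr (n :: 'e \<Rightarrow>\<^sub>0 nat)"
proof -
  define deg where "deg n = sum (Poly_Mapping.lookup n) (Poly_Mapping.keys n)" for n :: "'e \<Rightarrow>\<^sub>0 nat"
  have deg: "deg k < deg (k + bexp \<alpha>)" for k \<alpha>
  proof -
    let ?A = "insert \<alpha> (Poly_Mapping.keys k)"
    have "deg k = sum (Poly_Mapping.lookup k) ?A"
      unfolding deg_def by (rule sum.mono_neutral_left) (auto simp: in_keys_iff)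
    moreover have "deg (k + bexp \<alpha>) = sum (Poly_Mapping.lookup (k + bexp \<alpha>)) ?A"
      unfolding deg_def by (rule sum.mono_neutral_left) (auto simp: in_keys_iff lookup_add split: if_splits)
    moreover have "sum (Poly_Mapping.lookup k) ?A < sum (Poly_Mapping.lookup (k + bexp \<alpha>)) ?A"
      by (rule sum_strict_mono_ex1) (auto simp: lookup_add)
    ultimately show ?thesis by simp
  qed
  show ?thesis
  proof (induct n rule: measure_induct_rule[where f = deg])
    case (less n)
    show ?case by (rule assms) (use less deg in simp)
  qed
qed

lemma keys_decomp: "\<alpha> \<in> Poly_Mapping.keys n \<Longrightarrow> \<exists>k. n = k + bexp \<alpha>" for n :: "'e \<Rightarrow>\<^sub>0 nat"
  by (rule exI[of _ "n - bexp \<alpha>"], rule poly_mapping_eqI)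
     (auto simp: lookup_add lookup_minus in_keys_iff)

lemma keys_plus_bexp: "Poly_Mapping.keys (k + bexp \<alpha>) = insert \<alpha> (Poly_Mapping.keys k)"
  by (auto simp: in_keys_iff lookup_add split: if_splits)

lemma keys_plus_nat: "Poly_Mapping.keys (k + l) = Poly_Mapping.keys k \<union> Poly_Mapping.keys l"
  for k l :: "'e \<Rightarrow>\<^sub>0 nat"
  by (auto simp: in_keys_iff lookup_add)

lemma zero_ne_plus_bexp: "k + bexp \<alpha> \<noteq> 0"
  by (metis keys_plus_bexp keys_zero insert_not_empty)

text \<open>Two different last steps towards the same exponent can be interchanged. The recursion
  over all directions leads to such pairs of steps.\<close>

lemma plus_bexp_eqD:
  assumes "k + bexp \<alpha> = l + bexp \<beta>" "\<alpha> \<noteq> \<beta>"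
  shows "\<exists>j. k = j + bexp \<beta> \<and> l = j + bexp \<alpha>"
proof -
  have "\<beta> \<in> Poly_Mapping.keys (k + bexp \<alpha>)" using assms by (simp add: keys_plus_bexp)
  then have "\<beta> \<in> Poly_Mapping.keys k" using assms(2) by (simp add: keys_plus_bexp)
  from keys_decomp[OF this] obtain j where j: "k = j + bexp \<beta>" ..
  then have "l + bexp \<beta> = (j + bexp \<alpha>) + bexp \<beta>" using assms(1) by (simp add: ac_simps)
  then have "l = j + bexp \<alpha>" by (rule add_right_imp_eq)
  with j show ?thesis by blast
qed

text \<open>The product of two fractional ideals, as sums of products. Invertibility of
  \<open>M \<alpha>\<close> is expressed by \<open>\<one>\<close> lying in its product with
  \<open>P \<alpha>\<close>.\<close>

inductive_set prod_span :: "('s, 'm) ring_scheme \<Rightarrow> 's set \<Rightarrow> 's set \<Rightarrow> 's set" for S M P where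
  "a \<in> M \<Longrightarrow> x \<in> P \<Longrightarrow> a \<otimes>\<^bsub>S\<^esub> x \<in> prod_span S M P"
| "u \<in> prod_span S M P \<Longrightarrow> v \<in> prod_span S M P \<Longrightarrow> u \<oplus>\<^bsub>S\<^esub> v \<in> prod_span S M P"

text \<open>\<open>R0\<close>, \<open>M \<alpha>\<close> and \<open>P \<alpha>\<close> are the images in \<open>S\<close> of \<open>R\<close>, \<open>\<mm>\<^sub>\<alpha>\<close> and the inverse of \<open>\<mm>\<^sub>\<alpha>\<close>. All elements of the
  type \<open>'e\<close> serve as indices; those outside of \<open>E\<close> will get the unit ideal.\<close>

locale witt_base = mpoly S for S :: "('a, 's) module" (structure) +
  fixes R0 :: "'s set" and M P :: "'e \<Rightarrow> 's set" and q :: "'e \<Rightarrow> nat"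
  assumes R0: "subring R0 S"
    and M_sub: "M \<alpha> \<subseteq> R0" and P_sub: "P \<alpha> \<subseteq> carrier S"
    and M_zero: "\<zero> \<in> M \<alpha>"
    and M_add: "a \<in> M \<alpha> \<Longrightarrow> b \<in> M \<alpha> \<Longrightarrow> a \<oplus> b \<in> M \<alpha>"
    and M_mult: "a \<in> M \<alpha> \<Longrightarrow> r \<in> R0 \<Longrightarrow> r \<otimes> a \<in> M \<alpha>"
    and P_add: "x \<in> P \<alpha> \<Longrightarrow> y \<in> P \<alpha> \<Longrightarrow> x \<oplus> y \<in> P \<alpha>"
    and P_mult: "x \<in> P \<alpha> \<Longrightarrow> r \<in> R0 \<Longrightarrow> r \<otimes> x \<in> P \<alpha>"
    and P_M: "x \<in> P \<alpha> \<Longrightarrow> a \<in> M \<alpha> \<Longrightarrow> x \<otimes> a \<in> R0"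
    and one_span: "\<one> \<in> prod_span S (M \<alpha>) (P \<alpha>)"
    and q_pos: "q \<alpha> > 0"
    and frob: "r \<in> R0 \<Longrightarrow> r \<ominus> r [^] q \<alpha> \<in> M \<alpha>"
    and binom: "0 < j \<Longrightarrow> j < q \<alpha> \<Longrightarrow> add_pow S (q \<alpha> choose j) \<one> \<in> M \<alpha>"
    and coprime: "\<alpha> \<noteq> \<beta> \<Longrightarrow> \<exists>a\<in>M \<alpha>. \<exists>b\<in>M \<beta>. a \<oplus> b = \<one>"
begin

lemma R0_carrier: "r \<in> R0 \<Longrightarrow> r \<in> carrier S" using subringE(1)[OF R0] by auto
lemma M_carrier: "a \<in> M \<alpha> \<Longrightarrow> a \<in> carrier S" using M_sub R0_carrier by blast
lemma P_carrier: "x \<in> P \<alpha> \<Longrightarrow> x \<in> carrier S" using P_sub by blast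
lemmas base_carrier = R0_carrier M_carrier P_carrier
lemmas R0_closed = subringE(2,3,5-7)[OF R0]

definition del :: "('t, 'm) ring_scheme \<Rightarrow> ('s \<Rightarrow> 't) \<Rightarrow> 'e \<Rightarrow> 's \<Rightarrow> (('e \<Rightarrow>\<^sub>0 nat) \<Rightarrow> 't) \<Rightarrow> ('e \<Rightarrow>\<^sub>0 nat) \<Rightarrow> 't" where
  "del T \<phi> \<alpha> x s = (\<lambda>i. \<phi> x \<otimes>\<^bsub>T\<^esub> (s (i + bexp \<alpha>) \<ominus>\<^bsub>T\<^esub> s i [^]\<^bsub>T\<^esub> q \<alpha>))"

text \<open>Only the value at 0 is tested; integrality of the other values in \<open>box n\<close>
  follows through \<open>del\<close> (\<open>wit_mem\<close>). As \<open>n\<close> has no preferred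
  predecessor, the recursion runs through all directions, whence an inductive predicate and not a
  function. The carrier condition concerns all indices, so that the families form a subring of
  \<open>fun_ring T\<close>.\<close>

inductive wit :: "('t, 'm) ring_scheme \<Rightarrow> ('s \<Rightarrow> 't) \<Rightarrow> 't set \<Rightarrow> ('e \<Rightarrow>\<^sub>0 nat) \<Rightarrow> (('e \<Rightarrow>\<^sub>0 nat) \<Rightarrow> 't) \<Rightarrow> bool"
  for T \<phi> Q where
  witI: "(\<And>i. s i \<in> carrier T) \<Longrightarrow> s 0 \<in> Q \<Longrightarrow>
    (\<And>\<alpha> k x. n = k + bexp \<alpha> \<Longrightarrow> x \<in> P \<alpha> \<Longrightarrow> wit T \<phi> Q k (del T \<phi> \<alpha> x s)) \<Longrightarrow> wit T \<phi> Q n s"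

lemma wit_closed: "wit T \<phi> Q n s \<Longrightarrow> s i \<in> carrier T"
  by (erule wit.cases) auto

lemma wit_zero: "wit T \<phi> Q n s \<Longrightarrow> s 0 \<in> Q"
  by (erule wit.cases) auto

lemma wit_del: "wit T \<phi> Q (k + bexp \<alpha>) s \<Longrightarrow> x \<in> P \<alpha> \<Longrightarrow> wit T \<phi> Q k (del T \<phi> \<alpha> x s)"
  by (erule wit.cases) auto

lemma wit_0_iff: "wit T \<phi> Q 0 s \<longleftrightarrow> (\<forall>i. s i \<in> carrier T) \<and> s 0 \<in> Q"
proof
  assume *: "(\<forall>i. s i \<in> carrier T) \<and> s 0 \<in> Q"
  show "wit T \<phi> Q 0 s"
  proof (rule witI)
    fix \<alpha> :: 'e and k x assume "0 = k + bexp \<alpha>"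
    then show "wit T \<phi> Q k (del T \<phi> \<alpha> x s)" using zero_ne_plus_bexp by metis
  qed (use * in auto)
qed (auto dest: wit_closed wit_zero)

lemma wit_mono: "wit T \<phi> Q (k + j) s \<Longrightarrow> wit T \<phi> Q k s"
proof (induct k arbitrary: s rule: exp_induct)
  case (step k)
  show ?case
  proof (rule witI)
    fix \<alpha> k' x assume k: "k = k' + bexp \<alpha>" "x \<in> P \<alpha>"
    then have "wit T \<phi> Q ((k' + j) + bexp \<alpha>) s" using step(2) by (simp add: ac_simps)
    then show "wit T \<phi> Q k' (del T \<phi> \<alpha> x s)"
      by (rule step(1)[OF k(1) wit_del]) fact
  qed (use wit_closed[OF step(2)] wit_zero[OF step(2)] in auto)
qed

lemma wit_Int:
  assumes "\<And>Q. Q \<in> \<Q> \<Longrightarrow> wit T \<phi> Q n s" "\<Q> \<noteq> {}"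
  shows "wit T \<phi> (\<Inter>\<Q>) n s"
  using assms(1)
proof (induct n arbitrary: s rule: exp_induct)
  case (step n)
  show ?case
  proof (rule witI)
    fix \<alpha> k x assume k: "n = k + bexp \<alpha>" "x \<in> P \<alpha>"
    show "wit T \<phi> (\<Inter>\<Q>) k (del T \<phi> \<alpha> x s)"
      by (rule step(1)[OF k(1)], rule wit_del) (use k step(2) in auto)
  next
    fix i
    show "s i \<in> carrier T" using step(2) wit_closed assms(2) by fast
  next
    show "s 0 \<in> \<Inter>\<Q>" using wit_zero[OF step(2)] by simp
  qed
qed

end

text \<open>The setting in which integrality makes sense: the inverse ideals act on
  \<open>T\<close>, and \<open>Q\<close> is a subring over \<open>R0\<close>. The locale is
  interpreted again with \<open>fun_ring T\<close> for \<open>T\<close> and a ring of integral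
  families for \<open>Q\<close>; this is how the construction is iterated.\<close>

locale wcover = witt_base S R0 M P q + T: cring T
  for S :: "('a, 's) module" (structure) and R0 and M P :: "'e \<Rightarrow> 's set" and q 
    and T :: "('t, 'm) ring_scheme" +
  fixes \<phi> :: "'s \<Rightarrow> 't" and Q :: "'t set"
  assumes phi: "\<phi> \<in> ring_hom S T" and Q: "subring Q T" and phi_R0: "r \<in> R0 \<Longrightarrow> \<phi> r \<in> Q"
begin

lemma phi_closed: "k \<in> carrier S \<Longrightarrow> \<phi> k \<in> carrier T"
  by (rule ring_hom_closed[OF phi])

lemma Q_carrier: "y \<in> Q \<Longrightarrow> y \<in> carrier T" using subringE(1)[OF Q] by auto

lemma del_closed: "(\<And>i. s i \<in> carrier T) \<Longrightarrow> x \<in> P \<alpha> \<Longrightarrow> del T \<phi> \<alpha> x s i \<in> carrier T"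
  by (simp add: del_def phi_closed P_carrier)

text \<open>The projectivity of an invertible ideal. Write \<open>\<one>\<close> as a sum of
  products \<open>a x'\<close> with \<open>a\<close> in \<open>M \<alpha>\<close> and
  \<open>x'\<close> in \<open>P \<alpha>\<close>, and pick a partner \<open>y\<close> of each
  \<open>x'\<close> under \<open>G\<close>. The sum of the \<open>\<phi> a y\<close> is the required
  \<open>z\<close>: for \<open>x\<close> in \<open>P \<alpha>\<close> the factors \<open>x a\<close>
  lie in \<open>R0\<close>, over which \<open>G\<close> is linear.\<close>

lemma span_solve:
  assumes ex: "\<And>x. x \<in> P \<alpha> \<Longrightarrow> \<exists>y. G x y"
    and cl: "\<And>x y. G x y \<Longrightarrow> y \<in> carrier T"
    and add: "\<And>x y x' y'. x \<in> P \<alpha> \<Longrightarrow> x' \<in> P \<alpha> \<Longrightarrow> G x y \<Longrightarrow> G x' y' \<Longrightarrow> G (x \<oplus> x') (y \<oplus>\<^bsub>T\<^esub> y')"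
    and mult: "\<And>x y r. x \<in> P \<alpha> \<Longrightarrow> r \<in> R0 \<Longrightarrow> G x y \<Longrightarrow> G (r \<otimes> x) (\<phi> r \<otimes>\<^bsub>T\<^esub> y)"
  shows "\<exists>z\<in>carrier T. \<forall>x\<in>P \<alpha>. G x (\<phi> x \<otimes>\<^bsub>T\<^esub> z)"
proof -
  \<comment> \<open>The claim for \<open>e = \<one>\<close> is generalised to all \<open>e\<close>
    in the span, with \<open>x e\<close> in place of \<open>x\<close>.\<close>
  have "e \<in> carrier S \<and> (\<exists>z\<in>carrier T. \<forall>x\<in>P \<alpha>. x \<otimes> e \<in> P \<alpha> \<and> G (x \<otimes> e) (\<phi> x \<otimes>\<^bsub>T\<^esub> z))"
    if "e \<in> prod_span S (M \<alpha>) (P \<alpha>)" for e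
    using that
  proof induct
    case (1 a y)
    obtain z where z: "G y z" using ex 1 by blast
    have "x \<otimes> (a \<otimes> y) \<in> P \<alpha> \<and> G (x \<otimes> (a \<otimes> y)) (\<phi> x \<otimes>\<^bsub>T\<^esub> (\<phi> a \<otimes>\<^bsub>T\<^esub> z))" if "x \<in> P \<alpha>" for x
      using mult[OF 1(2) P_M[OF that 1(1)] z] P_mult[OF 1(2) P_M[OF that 1(1)]] that 1 cl[OF z]
      by (simp add: base_carrier m_assoc T.m_assoc ring_hom_mult[OF phi] phi_closed)
    moreover have "\<phi> a \<otimes>\<^bsub>T\<^esub> z \<in> carrier T" "a \<otimes> y \<in> carrier S" using 1 cl[OF z] by (simp_all add: phi_closed base_carrier)
    ultimately show ?case by blast
  next
    case (2 e e')
    then obtain z z' where z: "z \<in> carrier T" "\<And>x. x \<in> P \<alpha> \<Longrightarrow> x \<otimes> e \<in> P \<alpha> \<and> G (x \<otimes> e) (\<phi> x \<otimes>\<^bsub>T\<^esub> z)"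
      and z': "z' \<in> carrier T" "\<And>x. x \<in> P \<alpha> \<Longrightarrow> x \<otimes> e' \<in> P \<alpha> \<and> G (x \<otimes> e') (\<phi> x \<otimes>\<^bsub>T\<^esub> z')" by blast
    have "x \<otimes> (e \<oplus> e') \<in> P \<alpha> \<and> G (x \<otimes> (e \<oplus> e')) (\<phi> x \<otimes>\<^bsub>T\<^esub> (z \<oplus>\<^bsub>T\<^esub> z'))" if "x \<in> P \<alpha>" for x
      using add[of "x \<otimes> e" "x \<otimes> e'"] P_add[of "x \<otimes> e" \<alpha> "x \<otimes> e'"] that z z' 2
      by (simp add: base_carrier r_distr T.r_distr phi_closed)
    moreover have "z \<oplus>\<^bsub>T\<^esub> z' \<in> carrier T" "e \<oplus> e' \<in> carrier S" using 2 z z' by simp_all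
    ultimately show ?case by blast
  qed
  from this[OF one_span] obtain z where "z \<in> carrier T" "\<forall>x\<in>P \<alpha>. x \<otimes> \<one> \<in> P \<alpha> \<and> G (x \<otimes> \<one>) (\<phi> x \<otimes>\<^bsub>T\<^esub> z)"
    by blast
  then show ?thesis by (auto simp: P_carrier)
qed

text \<open>\<open>u\<close> is the sum of its products with the terms \<open>a x\<close> of a
  representation of \<open>\<one>\<close>.\<close>

lemma span_mem:
  assumes "u \<in> carrier T" "\<And>a x. a \<in> M \<alpha> \<Longrightarrow> x \<in> P \<alpha> \<Longrightarrow> \<phi> a \<otimes>\<^bsub>T\<^esub> (\<phi> x \<otimes>\<^bsub>T\<^esub> u) \<in> H"
    and "\<And>u v. u \<in> H \<Longrightarrow> v \<in> H \<Longrightarrow> u \<oplus>\<^bsub>T\<^esub> v \<in> H"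
  shows "u \<in> H"
proof -
  have "e \<in> carrier S \<and> \<phi> e \<otimes>\<^bsub>T\<^esub> u \<in> H" if "e \<in> prod_span S (M \<alpha>) (P \<alpha>)" for e
    using that
  proof induct
    case (1 a x)
    then show ?case using assms(1) assms(2)[of a x]
      by (simp add: base_carrier ring_hom_mult[OF phi] T.m_assoc phi_closed)
  next
    case (2 e e')
    then show ?case using assms(1,3)
      by (simp add: ring_hom_add[OF phi] T.l_distr phi_closed)
  qed
  from this[OF one_span] show ?thesis using assms by (simp add: ring_hom_one[OF phi])
qed

lemma span_cancel:
  assumes "u \<in> carrier T" "v \<in> carrier T" "\<And>x. x \<in> P \<alpha> \<Longrightarrow> \<phi> x \<otimes>\<^bsub>T\<^esub> u = \<phi> x \<otimes>\<^bsub>T\<^esub> v"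
  shows "u = v"
proof -
  have "u \<ominus>\<^bsub>T\<^esub> v \<in> {\<zero>\<^bsub>T\<^esub>}"
  proof (rule span_mem[where \<alpha> = \<alpha>])
    fix a x assume ax: "a \<in> M \<alpha>" "x \<in> P \<alpha>"
    then have "\<phi> x \<otimes>\<^bsub>T\<^esub> (u \<ominus>\<^bsub>T\<^esub> v) = \<phi> x \<otimes>\<^bsub>T\<^esub> u \<ominus>\<^bsub>T\<^esub> \<phi> x \<otimes>\<^bsub>T\<^esub> v"
      using assms(1,2) phi_closed P_carrier by algebra
    moreover have "w \<ominus>\<^bsub>T\<^esub> w = \<zero>\<^bsub>T\<^esub>" if "w \<in> carrier T" for w using that by simp
    ultimately show "\<phi> a \<otimes>\<^bsub>T\<^esub> (\<phi> x \<otimes>\<^bsub>T\<^esub> (u \<ominus>\<^bsub>T\<^esub> v)) \<in> {\<zero>\<^bsub>T\<^esub>}"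
      using assms ax by (simp add: phi_closed base_carrier)
  qed (use assms in auto)
  then show ?thesis using assms by simp
qed

text \<open>No element of \<open>T\<close> other than zero is annihilated by all of
  \<open>M \<alpha>\<close>. This torsion-freeness is what lets ghost components determine a
  homomorphism into \<open>Q\<close> (\<open>hom_eq_ev\<close>).\<close>

lemma span_cancel':
  assumes "u \<in> carrier T" "v \<in> carrier T" "\<And>a. a \<in> M \<alpha> \<Longrightarrow> \<phi> a \<otimes>\<^bsub>T\<^esub> u = \<phi> a \<otimes>\<^bsub>T\<^esub> v"
  shows "u = v"
proof -
  have "u \<ominus>\<^bsub>T\<^esub> v \<in> {\<zero>\<^bsub>T\<^esub>}"
  proof (rule span_mem[where \<alpha> = \<alpha>])
    fix a x assume ax: "a \<in> M \<alpha>" "x \<in> P \<alpha>"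
    then have "\<phi> a \<otimes>\<^bsub>T\<^esub> (\<phi> x \<otimes>\<^bsub>T\<^esub> (u \<ominus>\<^bsub>T\<^esub> v)) = \<phi> x \<otimes>\<^bsub>T\<^esub> (\<phi> a \<otimes>\<^bsub>T\<^esub> u \<ominus>\<^bsub>T\<^esub> \<phi> a \<otimes>\<^bsub>T\<^esub> v)"
      using assms(1,2) phi_closed[OF P_carrier] phi_closed[OF M_carrier] by algebra
    moreover have "w \<ominus>\<^bsub>T\<^esub> w = \<zero>\<^bsub>T\<^esub>" if "w \<in> carrier T" for w using that by simp
    ultimately show "\<phi> a \<otimes>\<^bsub>T\<^esub> (\<phi> x \<otimes>\<^bsub>T\<^esub> (u \<ominus>\<^bsub>T\<^esub> v)) \<in> {\<zero>\<^bsub>T\<^esub>}"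
      using assms ax by (simp add: phi_closed base_carrier)
  qed (use assms in auto)
  then show ?thesis using assms by simp
qed

end

section \<open>The ring of integral families\<close>

context wcover
begin

text \<open>\<open>del\<close> sends the constant family of \<open>r\<close> to that of
  \<open>x (r - r^q)\<close>, and this element lies in \<open>R0\<close> again by
  \<open>frob\<close> and \<open>P_M\<close>.\<close>

lemma wit_const: "r \<in> R0 \<Longrightarrow> wit T \<phi> Q n (\<lambda>i. \<phi> r)"
proof (induct n arbitrary: r rule: exp_induct)
  case (step n)
  show ?case
  proof (rule witI)
    fix \<alpha> k x assume k: "n = k + bexp \<alpha>" "x \<in> P \<alpha>"
    have c: "x \<in> carrier S" "r \<in> carrier S" using k step base_carrier by auto
    have "x \<otimes> (r \<ominus> r [^] q \<alpha>) \<in> R0" using P_M[OF k(2) frob[OF step(2)]] .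
    moreover have "del T \<phi> \<alpha> x (\<lambda>i. \<phi> r) = (\<lambda>i. \<phi> (x \<otimes> (r \<ominus> r [^] q \<alpha>)))"
      using c by (simp add: del_def ring_hom_mult[OF phi] ring_hom_minus[OF is_cring T.is_cring phi])
    ultimately show "wit T \<phi> Q k (del T \<phi> \<alpha> x (\<lambda>i. \<phi> r))"
      using step(1)[OF k(1)] by simp
  qed (use step(2) phi_R0 phi_closed R0_carrier in auto)
qed

lemma const_hom: "(\<lambda>r i. \<phi> r) \<in> ring_hom S (fun_ring T)"
  by (rule ring_hom_memI) (auto simp: phi_closed ring_hom_mult[OF phi] ring_hom_add[OF phi] ring_hom_one[OF phi])

text \<open>The subring property is an assumption here, since the lemma serves inside the induction
  that proves this property.\<close>

lemma wcover_funI: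
  assumes "subring {s. wit T \<phi> Q n s} (fun_ring T)"
  shows "wcover S R0 M P q (fun_ring T) (\<lambda>r i. \<phi> r) {s. wit T \<phi> Q n s}"
proof (intro wcover.intro wcover_axioms.intro)
  show "witt_base S R0 M P q" by (rule witt_base_axioms)
  show "cring (fun_ring T)" by (rule cring_fun_ring) (rule T.is_cring)
  fix r assume "r \<in> R0"
  then show "(\<lambda>i. \<phi> r) \<in> {s. wit T \<phi> Q n s}" by (simp add: wit_const)
qed (rule const_hom assms)+

text \<open>The shifted family is \<open>u + s^q\<close>, where \<open>u\<close> is the difference
  that \<open>del\<close> multiplies by \<open>x\<close>. The multiples \<open>x u\<close> are
  integral by assumption, and \<open>span_mem\<close> recovers \<open>u\<close> itself from
  them.\<close>

lemma wit_shift_aux: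
  assumes sub: "subring {s. wit T \<phi> Q k s} (fun_ring T)" and s: "wit T \<phi> Q (k + bexp \<alpha>) s"
  shows "wit T \<phi> Q k (\<lambda>i. s (i + bexp \<alpha>))"
proof -
  interpret F: cring "fun_ring T :: (('e \<Rightarrow>\<^sub>0 nat) \<Rightarrow> 't) ring" by (rule cring_fun_ring) (rule T.is_cring)
  let ?H = "{s. wit T \<phi> Q k s}"
  interpret C: wcover S R0 M P q "fun_ring T :: (('e \<Rightarrow>\<^sub>0 nat) \<Rightarrow> 't) ring" "\<lambda>r i. \<phi> r" ?H
    by (rule wcover_funI[OF sub])
  have sc: "s i \<in> carrier T" for i using wit_closed[OF s] .
  have sk: "s \<in> ?H" using wit_mono[OF s] by simp
  define u where "u = (\<lambda>i. s (i + bexp \<alpha>) \<ominus>\<^bsub>T\<^esub> s i [^]\<^bsub>T\<^esub> q \<alpha>)"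
  have "u \<in> ?H"
  proof (rule C.span_mem[where \<alpha> = \<alpha>])
    fix a x assume ax: "a \<in> M \<alpha>" "x \<in> P \<alpha>"
    have "(\<lambda>i. \<phi> x) \<otimes>\<^bsub>fun_ring T\<^esub> u = del T \<phi> \<alpha> x s" by (simp add: u_def del_def)
    moreover have "del T \<phi> \<alpha> x s \<in> ?H" using s ax wit_del by auto
    moreover have "(\<lambda>i. \<phi> a) \<in> ?H" using ax M_sub wit_const by auto
    ultimately show "(\<lambda>i. \<phi> a) \<otimes>\<^bsub>fun_ring T\<^esub> ((\<lambda>i. \<phi> x) \<otimes>\<^bsub>fun_ring T\<^esub> u) \<in> ?H"
      using subringE(6)[OF sub] by metis
  qed (use sc subringE(7)[OF sub] in \<open>auto simp: u_def\<close>)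
  moreover have "s [^]\<^bsub>fun_ring T\<^esub> q \<alpha> \<in> ?H" using subringE_more(2)[OF sub sk F.is_cring] .
  ultimately have "u \<oplus>\<^bsub>fun_ring T\<^esub> s [^]\<^bsub>fun_ring T\<^esub> q \<alpha> \<in> ?H" using subringE(7)[OF sub] by metis
  moreover have "u \<oplus>\<^bsub>fun_ring T\<^esub> s [^]\<^bsub>fun_ring T\<^esub> q \<alpha> = (\<lambda>i. s (i + bexp \<alpha>))"
  proof -
    have "(a \<ominus>\<^bsub>T\<^esub> b) \<oplus>\<^bsub>T\<^esub> b = a" if "a \<in> carrier T" "b \<in> carrier T" for a b
      using that by algebra
    then show ?thesis using sc by (simp add: u_def)
  qed
  ultimately show ?thesis by simp
qed

text \<open>\<open>del\<close> of a sum is the sum of the two \<open>del\<close> minus a binomial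
  defect, and \<open>del (s t) = del s t' + s^q del t\<close> with \<open>t'\<close> the shift of
  \<open>t\<close>. All these terms lie in the ring of families that are integral up to
  \<open>k\<close>, which the induction provides.\<close>

lemma wit_subring_aux:
  assumes "\<And>k \<alpha>. n = k + bexp \<alpha> \<Longrightarrow> subring {s. wit T \<phi> Q k s} (fun_ring T)"
  shows "subring {s. wit T \<phi> Q n s} (fun_ring T)"
proof -
  interpret F: cring "fun_ring T :: (('e \<Rightarrow>\<^sub>0 nat) \<Rightarrow> 't) ring" by (rule cring_fun_ring) (rule T.is_cring)
  note Q' = subringE(2,3,5-7)[OF Q]
  have sh: "wit T \<phi> Q k (\<lambda>i. s (i + bexp \<alpha>))" if "wit T \<phi> Q n s" "n = k + bexp \<alpha>" for k s \<alpha>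
    using wit_shift_aux[OF assms[OF that(2)]] that by simp
  have add: "wit T \<phi> Q n (s \<oplus>\<^bsub>fun_ring T\<^esub> t)" if s: "wit T \<phi> Q n s" and t: "wit T \<phi> Q n t" for s t
  proof (rule witI)
    have c: "s i \<in> carrier T" "t i \<in> carrier T" for i using wit_closed[OF s] wit_closed[OF t] by auto
    then show "(s \<oplus>\<^bsub>fun_ring T\<^esub> t) i \<in> carrier T" for i by simp
    show "(s \<oplus>\<^bsub>fun_ring T\<^esub> t) 0 \<in> Q" using wit_zero[OF s] wit_zero[OF t] Q' by simp
    fix \<alpha> k x assume k: "n = k + bexp \<alpha>" and x: "x \<in> P \<alpha>"
    let ?H = "{s. wit T \<phi> Q k s}"
    let ?q = "q \<alpha>"
    note sub = assms[OF k]
    have st: "s \<in> ?H" "t \<in> ?H" using wit_mono s t k by auto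
    have "(\<lambda>i. \<phi> x) \<otimes>\<^bsub>fun_ring T\<^esub> ((s \<oplus>\<^bsub>fun_ring T\<^esub> t) [^]\<^bsub>fun_ring T\<^esub> ?q \<ominus>\<^bsub>fun_ring T\<^esub> (s [^]\<^bsub>fun_ring T\<^esub> ?q \<oplus>\<^bsub>fun_ring T\<^esub> t [^]\<^bsub>fun_ring T\<^esub> ?q)) \<in> ?H"
    proof (rule F.binomial_mem[OF sub st _ q_pos])
      fix j assume j: "0 < j" "j < q \<alpha>"
      \<comment> \<open>The middle binomial coefficients lie in the ideal, so \<open>x\<close> times
        such a coefficient is in \<open>R0\<close> and gives an integral constant family.\<close>
      have r0: "x \<otimes> add_pow S (q \<alpha> choose j) \<one> \<in> R0" using P_M[OF x binom[OF j]] .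
      have "(\<lambda>i. \<phi> (x \<otimes> add_pow S (q \<alpha> choose j) \<one>)) \<in> ?H" by (intro CollectI wit_const r0)
      moreover have apow: "(\<lambda>i::'e \<Rightarrow>\<^sub>0 nat. \<phi> (add_pow S (m::nat) \<one>)) = add_pow (fun_ring T) m \<one>\<^bsub>fun_ring T\<^esub>" for m
      proof (induct m)
        case 0
        show ?case by (simp add: ring_hom_zero[OF phi ring_axioms T.ring_axioms])
      next
        case (Suc m)
        then show ?case by (simp add: fun_eq_iff ring_hom_add[OF phi] ring_hom_one[OF phi])
      qed
      have "(\<lambda>i::'e \<Rightarrow>\<^sub>0 nat. \<phi> (x \<otimes> add_pow S (q \<alpha> choose j) \<one>)) =
         (\<lambda>i. \<phi> x) \<otimes>\<^bsub>fun_ring T\<^esub> add_pow (fun_ring T) (q \<alpha> choose j) \<one>\<^bsub>fun_ring T\<^esub>"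
        unfolding apow[symmetric] using x by (simp add: ring_hom_mult[OF phi] P_carrier)
      ultimately show "(\<lambda>i. \<phi> x) \<otimes>\<^bsub>fun_ring T\<^esub> add_pow (fun_ring T) (q \<alpha> choose j) \<one>\<^bsub>fun_ring T\<^esub> \<in> ?H" by simp
    qed (use x phi_closed P_carrier in auto)
    then have "(del T \<phi> \<alpha> x s \<oplus>\<^bsub>fun_ring T\<^esub> del T \<phi> \<alpha> x t) \<ominus>\<^bsub>fun_ring T\<^esub> ((\<lambda>i. \<phi> x) \<otimes>\<^bsub>fun_ring T\<^esub> ((s \<oplus>\<^bsub>fun_ring T\<^esub> t) [^]\<^bsub>fun_ring T\<^esub> ?q \<ominus>\<^bsub>fun_ring T\<^esub> (s [^]\<^bsub>fun_ring T\<^esub> ?q \<oplus>\<^bsub>fun_ring T\<^esub> t [^]\<^bsub>fun_ring T\<^esub> ?q))) \<in> ?H"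
      using s t k x wit_del subringE(7)[OF sub] by (intro subringE_more(1)[OF sub _ F.is_cring]) blast+
    moreover
    \<comment> \<open>Here \<open>a\<close> and \<open>b\<close> will be the shifted values,
      \<open>c\<close> and \<open>d\<close> the powers of \<open>s\<close> and \<open>t\<close>, and
      \<open>e\<close> the power of the sum.\<close>
    have "y \<otimes>\<^bsub>T\<^esub> ((a \<oplus>\<^bsub>T\<^esub> b) \<ominus>\<^bsub>T\<^esub> e) = (y \<otimes>\<^bsub>T\<^esub> (a \<ominus>\<^bsub>T\<^esub> c) \<oplus>\<^bsub>T\<^esub> y \<otimes>\<^bsub>T\<^esub> (b \<ominus>\<^bsub>T\<^esub> d)) \<ominus>\<^bsub>T\<^esub> y \<otimes>\<^bsub>T\<^esub> (e \<ominus>\<^bsub>T\<^esub> (c \<oplus>\<^bsub>T\<^esub> d))"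
      if "y \<in> carrier T" "a \<in> carrier T" "b \<in> carrier T" "c \<in> carrier T" "d \<in> carrier T" "e \<in> carrier T" for y a b c d e
      using that by algebra
    from this[OF phi_closed[OF P_carrier[OF x]] c(1) c(2) T.nat_pow_closed[OF c(1)] T.nat_pow_closed[OF c(2)] T.nat_pow_closed]
    have "del T \<phi> \<alpha> x (s \<oplus>\<^bsub>fun_ring T\<^esub> t) = (del T \<phi> \<alpha> x s \<oplus>\<^bsub>fun_ring T\<^esub> del T \<phi> \<alpha> x t) \<ominus>\<^bsub>fun_ring T\<^esub> ((\<lambda>i. \<phi> x) \<otimes>\<^bsub>fun_ring T\<^esub> ((s \<oplus>\<^bsub>fun_ring T\<^esub> t) [^]\<^bsub>fun_ring T\<^esub> ?q \<ominus>\<^bsub>fun_ring T\<^esub> (s [^]\<^bsub>fun_ring T\<^esub> ?q \<oplus>\<^bsub>fun_ring T\<^esub> t [^]\<^bsub>fun_ring T\<^esub> ?q)))"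
      using c x by (simp add: del_def T.is_cring phi_closed P_carrier)
    ultimately show "wit T \<phi> Q k (del T \<phi> \<alpha> x (s \<oplus>\<^bsub>fun_ring T\<^esub> t))" by simp
  qed
  have mult: "wit T \<phi> Q n (s \<otimes>\<^bsub>fun_ring T\<^esub> t)" if s: "wit T \<phi> Q n s" and t: "wit T \<phi> Q n t" for s t
  proof (rule witI)
    have c: "s i \<in> carrier T" "t i \<in> carrier T" for i using wit_closed[OF s] wit_closed[OF t] by auto
    then show "(s \<otimes>\<^bsub>fun_ring T\<^esub> t) i \<in> carrier T" for i by simp
    show "(s \<otimes>\<^bsub>fun_ring T\<^esub> t) 0 \<in> Q" using wit_zero[OF s] wit_zero[OF t] Q' by simp
    fix \<alpha> k x assume k: "n = k + bexp \<alpha>" and x: "x \<in> P \<alpha>"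
    let ?H = "{s. wit T \<phi> Q k s}"
    note sub = assms[OF k]
    have st: "s \<in> ?H" "t \<in> ?H" using wit_mono s t k by auto
    have "del T \<phi> \<alpha> x s \<in> ?H" "del T \<phi> \<alpha> x t \<in> ?H" "(\<lambda>i. t (i + bexp \<alpha>)) \<in> ?H" "s [^]\<^bsub>fun_ring T\<^esub> q \<alpha> \<in> ?H"
      using wit_del s t k x sh subringE_more(2)[OF sub st(1) F.is_cring] by blast+
    then have "(del T \<phi> \<alpha> x s \<otimes>\<^bsub>fun_ring T\<^esub> (\<lambda>i. t (i + bexp \<alpha>))) \<oplus>\<^bsub>fun_ring T\<^esub> (s [^]\<^bsub>fun_ring T\<^esub> q \<alpha> \<otimes>\<^bsub>fun_ring T\<^esub> del T \<phi> \<alpha> x t) \<in> ?H"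
      using subringE(6,7)[OF sub] by blast
    moreover
    \<comment> \<open>The product rule, with \<open>a\<close> and \<open>b\<close> the shifted
      values and \<open>c\<close> and \<open>d\<close> the powers of the unshifted ones.\<close>
    have "y \<otimes>\<^bsub>T\<^esub> ((a \<otimes>\<^bsub>T\<^esub> b) \<ominus>\<^bsub>T\<^esub> (c \<otimes>\<^bsub>T\<^esub> d)) = (y \<otimes>\<^bsub>T\<^esub> (a \<ominus>\<^bsub>T\<^esub> c) \<otimes>\<^bsub>T\<^esub> b) \<oplus>\<^bsub>T\<^esub> (c \<otimes>\<^bsub>T\<^esub> (y \<otimes>\<^bsub>T\<^esub> (b \<ominus>\<^bsub>T\<^esub> d)))"
      if "y \<in> carrier T" "a \<in> carrier T" "b \<in> carrier T" "c \<in> carrier T" "d \<in> carrier T" for y a b c d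
      using that by algebra
    from this[OF phi_closed[OF P_carrier[OF x]] c(1) c(2) T.nat_pow_closed[OF c(1)] T.nat_pow_closed[OF c(2)]]
    have "del T \<phi> \<alpha> x (s \<otimes>\<^bsub>fun_ring T\<^esub> t) = (del T \<phi> \<alpha> x s \<otimes>\<^bsub>fun_ring T\<^esub> (\<lambda>i. t (i + bexp \<alpha>))) \<oplus>\<^bsub>fun_ring T\<^esub> (s [^]\<^bsub>fun_ring T\<^esub> q \<alpha> \<otimes>\<^bsub>fun_ring T\<^esub> del T \<phi> \<alpha> x t)"
      using c x by (simp add: del_def T.is_cring phi_closed P_carrier T.nat_pow_distrib)
    ultimately show "wit T \<phi> Q k (del T \<phi> \<alpha> x (s \<otimes>\<^bsub>fun_ring T\<^esub> t))" by simp
  qed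
  show ?thesis
  proof (rule F.subringI)
    show "{s. wit T \<phi> Q n s} \<subseteq> carrier (fun_ring T)" using wit_closed by auto
    have "\<one>\<^bsub>fun_ring T\<^esub> = (\<lambda>i::'e \<Rightarrow>\<^sub>0 nat. \<phi> \<one>)" by (simp add: ring_hom_one[OF phi])
    then show "\<one>\<^bsub>fun_ring T\<^esub> \<in> {s. wit T \<phi> Q n s}" using wit_const[OF R0_closed(2)] by simp
    fix s assume s: "s \<in> {s. wit T \<phi> Q n s}"
    have "wit T \<phi> Q n ((\<lambda>i. \<phi> (\<ominus> \<one>)) \<otimes>\<^bsub>fun_ring T\<^esub> s)"
      using s wit_const R0_closed by (intro mult) auto
    moreover have "(\<lambda>i. \<phi> (\<ominus> \<one>)) \<otimes>\<^bsub>fun_ring T\<^esub> s = \<ominus>\<^bsub>fun_ring T\<^esub> s"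
    proof -
      have sc: "s i \<in> carrier T" for i using s wit_closed by auto
      have "\<phi> (\<ominus> \<one>) = \<ominus>\<^bsub>T\<^esub> \<one>\<^bsub>T\<^esub>"
        using ring_hom_minus(2)[OF is_cring T.is_cring phi one_closed one_closed] by (simp add: ring_hom_one[OF phi])
      then show ?thesis using sc by (simp add: T.is_cring T.l_minus)
    qed
    ultimately show "\<ominus>\<^bsub>fun_ring T\<^esub> s \<in> {s. wit T \<phi> Q n s}" by simp
  qed (use add mult in auto)
qed

lemma wit_subring: "subring {s. wit T \<phi> Q n s} (fun_ring T)"
  by (induct n rule: exp_induct) (rule wit_subring_aux)

lemmas wcover_fun = wcover_funI[OF wit_subring]

end

section \<open>Exponents, boxes and their decompositions\<close>

lemma exp_cases: "n = 0 \<or> (\<exists>k \<alpha>. n = k + bexp \<alpha>)" for n :: "'e \<Rightarrow>\<^sub>0 nat"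
proof (cases "Poly_Mapping.keys n = {}")
  case False
  then obtain \<alpha> where "\<alpha> \<in> Poly_Mapping.keys n" by blast
  from keys_decomp[OF this] show ?thesis by metis
qed simp

lemma box_iff: "i \<in> box n \<longleftrightarrow> (\<exists>j. n = i + j)"
proof
  assume "i \<in> box n"
  then have "n = i + (n - i)"
    by (intro poly_mapping_eqI) (auto simp: lookup_add lookup_minus box_def)
  then show "\<exists>j. n = i + j" ..
qed (auto simp: box_def lookup_add)

lemma zero_in_box [simp]: "0 \<in> box n"
  by (simp add: box_def)

lemma box_plus: "i \<in> box n \<Longrightarrow> j \<in> box m \<Longrightarrow> i + j \<in> box (n + m)"
  by (auto simp: box_def lookup_add add_mono)

lemma box_mono: "i \<in> box n \<Longrightarrow> i \<in> box (n + m)"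
  by (auto simp: box_def lookup_add intro: trans_le_add1)

lemma box_refl [simp]: "n \<in> box n"
  by (simp add: box_def)

lemma keys_box: "i \<in> box n \<Longrightarrow> Poly_Mapping.keys i \<subseteq> Poly_Mapping.keys n"
  by (auto simp: box_def in_keys_iff) (metis le_zero_eq not_gr_zero)

lemma single_Suc: "Poly_Mapping.single \<alpha> (Suc k) = Poly_Mapping.single \<alpha> k + bexp \<alpha>"
  by (simp add: bexp_def single_add[symmetric])

lemma box_single: "i \<in> box (Poly_Mapping.single \<alpha> k) \<longleftrightarrow> (\<exists>m\<le>k. i = Poly_Mapping.single \<alpha> m)"
proof
  assume i: "i \<in> box (Poly_Mapping.single \<alpha> k)"
  have "i = Poly_Mapping.single \<alpha> (Poly_Mapping.lookup i \<alpha>)"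
  proof (rule poly_mapping_eqI)
    fix \<beta> 
    have "Poly_Mapping.lookup i \<beta> \<le> Poly_Mapping.lookup (Poly_Mapping.single \<alpha> k) \<beta>" using i by (auto simp: box_def)
    then show "Poly_Mapping.lookup i \<beta> = Poly_Mapping.lookup (Poly_Mapping.single \<alpha> (Poly_Mapping.lookup i \<alpha>)) \<beta>"
      by (auto simp: lookup_single when_def split: if_splits)
  qed
  moreover have "Poly_Mapping.lookup i \<alpha> \<le> k" using i by (auto simp: box_def dest: spec[of _ \<alpha>])
  ultimately show "\<exists>m\<le>k. i = Poly_Mapping.single \<alpha> m" by blast
qed (auto simp: box_def lookup_single when_def)

lemma lookup_exp_restrict [simp]:
  "Poly_Mapping.lookup (exp_restrict F n) \<alpha> = (if \<alpha> \<in> F then Poly_Mapping.lookup n \<alpha> else 0)"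
proof -
  have "finite {\<alpha>. (if \<alpha> \<in> F then Poly_Mapping.lookup n \<alpha> else 0) \<noteq> 0}"
    by (rule finite_subset[of _ "Poly_Mapping.keys n"]) (auto simp: in_keys_iff)
  then show ?thesis by (simp add: exp_restrict_def lookup_Abs_poly_mapping)
qed

lemma exp_restrict_plus:
  assumes "Poly_Mapping.keys i \<subseteq> F" "Poly_Mapping.keys j \<inter> F = {}"
  shows "exp_restrict F (j + i) = i" "exp_restrict F (i + j) = i"
proof -
  have "Poly_Mapping.lookup j k = 0" if "k \<in> F" for k using assms(2) that by (meson disjoint_iff in_keys_iff)
  moreover have "Poly_Mapping.lookup i k = 0" if "k \<notin> F" for k using assms(1) that by (meson subsetD in_keys_iff)
  ultimately show "exp_restrict F (j + i) = i" "exp_restrict F (i + j) = i"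
    by (auto intro!: poly_mapping_eqI simp: lookup_add)
qed

lemma decompose_exp:
  "\<exists>n0 k. n = n0 + Poly_Mapping.single \<alpha> k \<and> \<alpha> \<notin> Poly_Mapping.keys n0" for n :: "'e \<Rightarrow>\<^sub>0 nat"
  by (rule exI[of _ "exp_restrict (- {\<alpha>}) n"], rule exI[of _ "Poly_Mapping.lookup n \<alpha>"])
     (auto intro!: poly_mapping_eqI simp: lookup_add lookup_single when_def in_keys_iff)

text \<open>A whole coordinate is added at once, so that the two summands have disjoint supports, as
  \<open>wit_unhat\<close> demands.\<close>

lemma exp_support_induct [case_names zero plus]:
  assumes "Pr 0" "\<And>n \<alpha> k. \<alpha> \<notin> Poly_Mapping.keys n \<Longrightarrow> Pr n \<Longrightarrow> Pr (n + Poly_Mapping.single \<alpha> k)"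
  shows "Pr (n :: 'e \<Rightarrow>\<^sub>0 nat)"
proof (induct n rule: update_induct)
  case const
  show ?case by (rule assms)
next
  case (update f a b)
  have "Poly_Mapping.update a b f = f + Poly_Mapping.single a b"
    using update(1) by (intro poly_mapping_eqI) (auto simp: lookup_add lookup_single when_def in_keys_iff lookup_update)
  then show ?case using assms(2)[OF update(1,3), of b] by simp
qed

section \<open>Products of powers of the ideals, and transport along homomorphisms\<close>

context witt_base
begin

text \<open>The product of the powers of the \<open>M \<alpha>\<close> with exponents
  \<open>n\<close>, seen from the other side: the elements that stay in \<open>R0\<close> under
  multiplication by as many factors from each \<open>P \<alpha>\<close> as \<open>n\<close> allows.
  This form follows the recursion of \<open>wit\<close>.\<close>

inductive mpow :: "('e \<Rightarrow>\<^sub>0 nat) \<Rightarrow> 's \<Rightarrow> bool" where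
  mpowI: "c \<in> R0 \<Longrightarrow> (\<And>\<alpha> k x. n = k + bexp \<alpha> \<Longrightarrow> x \<in> P \<alpha> \<Longrightarrow> mpow k (x \<otimes> c)) \<Longrightarrow> mpow n c"

lemma mpow_R0: "mpow n c \<Longrightarrow> c \<in> R0"
  by (erule mpow.cases) auto

lemma mpow_P: "mpow (k + bexp \<alpha>) c \<Longrightarrow> x \<in> P \<alpha> \<Longrightarrow> mpow k (x \<otimes> c)"
  by (erule mpow.cases) auto

lemma mpow_mult: "mpow n c \<Longrightarrow> r \<in> R0 \<Longrightarrow> mpow n (r \<otimes> c)"
proof (induct n arbitrary: c rule: exp_induct)
  case (step n)
  have c: "c \<in> R0" by (rule mpow_R0[OF step(2)])
  show ?case
  proof (rule mpowI)
    show "r \<otimes> c \<in> R0" using step c R0_closed by auto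
    fix \<alpha> k x assume k: "n = k + bexp \<alpha>" and x: "x \<in> P \<alpha>"
    have "mpow k (r \<otimes> (x \<otimes> c))"
      by (rule step(1)[OF k mpow_P step(3)]) (use step(2) k x in auto)
    moreover have "r \<otimes> (x \<otimes> c) = x \<otimes> (r \<otimes> c)"
      using c x step(3) base_carrier by (intro m_lcomm) auto
    ultimately show "mpow k (x \<otimes> (r \<otimes> c))" by simp
  qed
qed

lemma mpow_M: "mpow n c \<Longrightarrow> b \<in> M \<beta> \<Longrightarrow> mpow (n + bexp \<beta>) (b \<otimes> c)"
proof (induct n arbitrary: c rule: exp_induct)
  case (step n)
  have c: "c \<in> R0" by (rule mpow_R0[OF step(2)])
  show ?case
  proof (rule mpowI)
    show "b \<otimes> c \<in> R0" using step(3) M_sub c R0_closed by blast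
    fix \<gamma> k y assume k: "n + bexp \<beta> = k + bexp \<gamma>" and y: "y \<in> P \<gamma>"
    show "mpow k (y \<otimes> (b \<otimes> c))"
    \<comment> \<open>If the removed direction is that of \<open>b\<close>, the product
      \<open>y b\<close> lies in \<open>R0\<close>; otherwise the factor \<open>y\<close> is passed
      on to \<open>c\<close>.\<close>
    proof (cases "\<beta> = \<gamma>")
      case True
      then have "mpow k ((y \<otimes> b) \<otimes> c)"
        using k step(2,3) y P_M by (intro mpow_mult) auto
      then show ?thesis using y step(3) c base_carrier by (simp add: m_assoc)
    next
      case False
      from plus_bexp_eqD[OF k False] obtain j where j: "n = j + bexp \<gamma>" "k = j + bexp \<beta>" by blast
      have "mpow (j + bexp \<beta>) (b \<otimes> (y \<otimes> c))"
        by (rule step(1)[OF j(1) mpow_P step(3)]) (use step(2) j y in auto)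
      moreover have "b \<otimes> (y \<otimes> c) = y \<otimes> (b \<otimes> c)"
        using c y step(3) base_carrier by (intro m_lcomm) auto
      ultimately show ?thesis using j by simp
    qed
  qed
qed

lemma mpow_one: "mpow 0 \<one>"
proof (rule mpowI)
  fix \<alpha> :: 'e and k x assume "0 = k + bexp \<alpha>"
  then show "mpow k (x \<otimes> \<one>)" using zero_ne_plus_bexp by metis
qed (rule R0_closed)

text \<open>An ideal coprime to each factor is coprime to the product: \<open>a + c = 1\<close> and
  \<open>a' + b = 1\<close> give \<open>(a + c a') + b c = 1\<close>.\<close>

lemma mpow_coprime: "\<alpha> \<notin> Poly_Mapping.keys n \<Longrightarrow> \<exists>a\<in>M \<alpha>. \<exists>c. mpow n c \<and> a \<oplus> c = \<one>"
proof (induct n rule: exp_induct)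
  case (step n)
  consider "n = 0" | k \<beta> where "n = k + bexp \<beta>" using exp_cases by blast
  then show ?case
  proof cases
    case 1
    then show ?thesis using mpow_one M_zero by (intro bexI[of _ \<zero>] exI[of _ \<one>]) auto
  next
    case (2 k \<beta>)
    have "\<alpha> \<noteq> \<beta>" "\<alpha> \<notin> Poly_Mapping.keys k" using step(2) 2 by (auto simp: keys_plus_bexp)
    then obtain a c a' b where ac: "a \<in> M \<alpha>" "mpow k c" "a \<oplus> c = \<one>" and ab: "a' \<in> M \<alpha>" "b \<in> M \<beta>" "a' \<oplus> b = \<one>"
      using step(1)[OF 2] coprime[of \<alpha> \<beta>] by blast
    have c: "a \<in> carrier S" "c \<in> carrier S" "a' \<in> carrier S" "b \<in> carrier S" 
      using ac ab base_carrier mpow_R0 by auto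
    have "(a \<oplus> c \<otimes> a') \<oplus> b \<otimes> c = a \<oplus> c \<otimes> (a' \<oplus> b)" using c by algebra
    also have "\<dots> = \<one>" using ac ab c by simp
    finally have "(a \<oplus> c \<otimes> a') \<oplus> b \<otimes> c = \<one>" .
    moreover have "a \<oplus> c \<otimes> a' \<in> M \<alpha>" using ac ab M_add M_mult mpow_R0 by blast
    moreover have "mpow n (b \<otimes> c)" using mpow_M ac ab 2 by simp
    ultimately show ?thesis by blast
  qed
qed

lemma del_hom:
  assumes "cring T" "cring T2" "h \<in> ring_hom T T2" "\<phi> \<in> ring_hom S T" 
    "\<And>k. k \<in> carrier S \<Longrightarrow> \<phi>2 k = h (\<phi> k)" "\<And>i. s i \<in> carrier T" "x \<in> P \<alpha>"
  shows "del T2 \<phi>2 \<alpha> x (\<lambda>i. h (s i)) = (\<lambda>i. h (del T \<phi> \<alpha> x s i))"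
proof -
  interpret T: cring T by fact
  have "x \<in> carrier S" "\<phi> x \<in> carrier T" using assms(4,7) P_carrier ring_hom_closed by metis+
  then show ?thesis
    using assms(5,6) by (simp add: del_def ring_hom_mult[OF assms(3)] ring_hom_minus[OF assms(1-3)])
qed

lemma wit_hom:
  assumes "cring T" "cring T2" "h \<in> ring_hom T T2" "\<phi> \<in> ring_hom S T" 
    "\<And>k. k \<in> carrier S \<Longrightarrow> \<phi>2 k = h (\<phi> k)" "\<And>y. y \<in> Q \<Longrightarrow> h y \<in> Q2"
  shows "wit T \<phi> Q n s \<Longrightarrow> wit T2 \<phi>2 Q2 n (\<lambda>i. h (s i))"
proof (induct n arbitrary: s rule: exp_induct)
  case (step n)
  have sc: "s i \<in> carrier T" for i by (rule wit_closed[OF step(2)])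
  show ?case
  proof (rule witI)
    fix \<alpha> k x assume k: "n = k + bexp \<alpha>" and x: "x \<in> P \<alpha>"
    have "wit T2 \<phi>2 Q2 k (\<lambda>i. h (del T \<phi> \<alpha> x s i))"
      by (rule step(1)[OF k wit_del]) (use step(2) k x in auto)
    then show "wit T2 \<phi>2 Q2 k (del T2 \<phi>2 \<alpha> x (\<lambda>i. h (s i)))"
      by (simp only: del_hom[OF assms(1-5) sc x])
  qed (use sc ring_hom_closed[OF assms(3)] assms(6) wit_zero[OF step(2)] in auto)
qed

text \<open>Integrality tests elements built by \<open>del\<close> for membership in
  \<open>Q\<close>, and \<open>h\<close> commutes with \<open>del\<close>. So it may be read off
  after \<open>h\<close> if the preimage of \<open>Q2\<close> lies in \<open>Q\<close>. Taking this
  preimage for \<open>Q\<close> is how subrings are shown to be admissible for the universal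
  family.\<close>

lemma wit_hom_reflect:
  assumes "cring T" "cring T2" "h \<in> ring_hom T T2" "\<phi> \<in> ring_hom S T" 
    "\<And>k. k \<in> carrier S \<Longrightarrow> \<phi>2 k = h (\<phi> k)" "\<And>y. y \<in> carrier T \<Longrightarrow> h y \<in> Q2 \<Longrightarrow> y \<in> Q"
  shows "wit T2 \<phi>2 Q2 n (\<lambda>i. h (s i)) \<Longrightarrow> (\<And>i. s i \<in> carrier T) \<Longrightarrow> wit T \<phi> Q n s"
proof (induct n arbitrary: s rule: exp_induct)
  case (step n)
  interpret T: cring T by fact
  note sc = step(3)
  show ?case
  proof (rule witI)
    fix \<alpha> k x assume k: "n = k + bexp \<alpha>" and x: "x \<in> P \<alpha>"
    have c: "\<phi> x \<in> carrier T" using ring_hom_closed[OF assms(4)] x P_carrier by auto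
    show "wit T \<phi> Q k (del T \<phi> \<alpha> x s)"
    proof (rule step(1)[OF k])
      have "wit T2 \<phi>2 Q2 k (del T2 \<phi>2 \<alpha> x (\<lambda>i. h (s i)))"
        by (rule wit_del) (use step(2) k x in auto)
      then show "wit T2 \<phi>2 Q2 k (\<lambda>i. h (del T \<phi> \<alpha> x s i))"
        by (simp only: del_hom[OF assms(1-5) sc x])
    qed (use sc c in \<open>simp add: del_def\<close>)
  qed (use sc assms(6) wit_zero[OF step(2)] in auto)
qed

end

section \<open>Truncation and splitting of integrality\<close>

context wcover
begin

lemma wit_shift: "wit T \<phi> Q (k + i) s \<Longrightarrow> wit T \<phi> Q k (\<lambda>j. s (j + i))"
proof (induct i arbitrary: s rule: exp_induct)
  case (step i)
  consider "i = 0" | l \<beta> where "i = l + bexp \<beta>" using exp_cases by blast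
  then show ?case
  proof cases
    case (2 l \<beta>)
    have "wit T \<phi> Q (k + l) (\<lambda>j. s (j + bexp \<beta>))"
      by (rule wit_shift_aux[OF wit_subring]) (use step(2) 2 in \<open>simp add: ac_simps\<close>)
    then have "wit T \<phi> Q k (\<lambda>j. s (j + l + bexp \<beta>))" by (rule step(1)[OF 2])
    then show ?thesis using 2 by (simp add: ac_simps)
  qed (use step(2) in simp)
qed

text \<open>\<open>s i\<close> is the value at 0 of the family shifted by \<open>i\<close>.\<close>

lemma wit_mem: "wit T \<phi> Q n s \<Longrightarrow> i \<in> box n \<Longrightarrow> s i \<in> Q"
  using wit_zero[OF wit_shift[of _ i s]] by (auto simp: box_iff add.commute)

lemma wit_cong:
  "wit T \<phi> Q n s \<Longrightarrow> (\<And>i. t i \<in> carrier T) \<Longrightarrow> (\<And>i. i \<in> box n \<Longrightarrow> t i = s i) \<Longrightarrow> wit T \<phi> Q n t"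
proof (induct n arbitrary: s t rule: exp_induct)
  case (step n)
  show ?case
  proof (rule witI)
    show "t 0 \<in> Q" using step(4)[of 0] wit_zero[OF step(2)] by simp
    fix \<alpha> k x assume k: "n = k + bexp \<alpha>" and x: "x \<in> P \<alpha>"
    show "wit T \<phi> Q k (del T \<phi> \<alpha> x t)"
    proof (rule step(1)[OF k])
      show "wit T \<phi> Q k (del T \<phi> \<alpha> x s)" by (rule wit_del) (use step(2) k x in auto)
      show "del T \<phi> \<alpha> x t i = del T \<phi> \<alpha> x s i" if "i \<in> box k" for i
        using step(4)[of i] step(4)[of "i + bexp \<alpha>"] that k by (simp add: del_def box_plus box_mono)
    qed (use step(3) x in \<open>simp add: del_closed\<close>)
  qed (rule step(3))
qed

text \<open>Once \<open>Q\<close> contains the image of all of \<open>S\<close>, the denominators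
  \<open>x\<close> cost nothing. This provides large subrings for which the universal family is
  integral, and with them upper bounds for \<open>L n\<close>.\<close>

lemma wit_full:
  assumes "\<And>k. k \<in> carrier S \<Longrightarrow> \<phi> k \<in> Q"
  shows "(\<And>i. s i \<in> carrier T) \<Longrightarrow> (\<And>i. i \<in> box n \<Longrightarrow> s i \<in> Q) \<Longrightarrow> wit T \<phi> Q n s"
proof (induct n arbitrary: s rule: exp_induct)
  case (step n)
  show ?case
  proof (rule witI)
    show "s 0 \<in> Q" by (rule step) simp
    fix \<alpha> k x assume k: "n = k + bexp \<alpha>" and x: "x \<in> P \<alpha>"
    show "wit T \<phi> Q k (del T \<phi> \<alpha> x s)"
    proof (rule step(1)[OF k])
      show "del T \<phi> \<alpha> x s i \<in> Q" if "i \<in> box k" for i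
        using step(3)[of i] step(3)[of "i + bexp \<alpha>"] that k assms[OF P_carrier[OF x]] 
          subringE(6)[OF Q] subringE_more[OF Q _ T.is_cring]
        by (simp add: del_def box_plus box_mono)
    qed (use step(2) x in \<open>simp add: del_closed\<close>)
  qed (rule step(2))
qed

text \<open>\<open>\<phi> a\<close> times a value of \<open>del\<close> has the coefficient
  \<open>x a\<close>, which is in \<open>R0\<close>, so the product lies in \<open>Q1\<close>;
  saturation then removes \<open>\<phi> a\<close>.\<close>

lemma wit_saturated:
  assumes Q1: "subring Q1 T" "Q1 \<subseteq> Q" "\<And>r. r \<in> R0 \<Longrightarrow> \<phi> r \<in> Q1"
    and sat: "\<And>\<alpha> y. y \<in> Q \<Longrightarrow> (\<And>a. a \<in> M \<alpha> \<Longrightarrow> \<phi> a \<otimes>\<^bsub>T\<^esub> y \<in> Q1) \<Longrightarrow> y \<in> Q1"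
  shows "wit T \<phi> Q n v \<Longrightarrow> (\<And>i. i \<in> box n \<Longrightarrow> v i \<in> Q1) \<Longrightarrow> wit T \<phi> Q1 n v"
proof (induct n arbitrary: v rule: exp_induct)
  case (step n)
  show ?case
  proof (rule witI)
    show "v 0 \<in> Q1" by (rule step) simp
    fix \<alpha> k x assume k: "n = k + bexp \<alpha>" and x: "x \<in> P \<alpha>"
    have d: "wit T \<phi> Q k (del T \<phi> \<alpha> x v)" by (rule wit_del) (use step(2) k x in auto)
    show "wit T \<phi> Q1 k (del T \<phi> \<alpha> x v)"
    proof (rule step(1)[OF k d])
      fix i assume i: "i \<in> box k"
      show "del T \<phi> \<alpha> x v i \<in> Q1"
      proof (rule sat[of _ \<alpha>])
        show "del T \<phi> \<alpha> x v i \<in> Q" by (rule wit_mem[OF d i])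
        fix a assume a: "a \<in> M \<alpha>"
        have v: "v i \<in> Q1" "v (i + bexp \<alpha>) \<in> Q1" using step(3) i k by (auto simp: box_plus box_mono)
        then have vc: "v i \<in> carrier T" "v (i + bexp \<alpha>) \<in> carrier T" using Q1(2) Q_carrier by auto
        have "\<phi> (x \<otimes> a) \<otimes>\<^bsub>T\<^esub> (v (i + bexp \<alpha>) \<ominus>\<^bsub>T\<^esub> v i [^]\<^bsub>T\<^esub> q \<alpha>) \<in> Q1"
          using v Q1(3)[OF P_M[OF x a]] subringE(6)[OF Q1(1)] subringE_more[OF Q1(1) _ T.is_cring] by auto
        also have "\<phi> (x \<otimes> a) \<otimes>\<^bsub>T\<^esub> (v (i + bexp \<alpha>) \<ominus>\<^bsub>T\<^esub> v i [^]\<^bsub>T\<^esub> q \<alpha>) = \<phi> a \<otimes>\<^bsub>T\<^esub> del T \<phi> \<alpha> x v i"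
          using vc a x base_carrier by (simp add: del_def ring_hom_mult[OF phi] phi_closed T.m_assoc T.m_lcomm)
        finally show "\<phi> a \<otimes>\<^bsub>T\<^esub> del T \<phi> \<alpha> x v i \<in> Q1" .
      qed
    qed
  qed (rule wit_closed[OF step(2)])
qed

text \<open>\<open>del\<close> of \<open>c v\<close> is \<open>x c\<close> times the shift of
  \<open>v\<close> minus \<open>c^(q-1) v^q\<close>, and \<open>x c\<close> belongs to the product
  of powers for \<open>k\<close>. Thus multiplication by \<open>c\<close> makes any family with
  values in \<open>Q\<close> integral.\<close>

lemma mpow_wit:
  "mpow n c \<Longrightarrow> (\<And>i. v i \<in> carrier T) \<Longrightarrow> (\<And>i. i \<in> box n \<Longrightarrow> v i \<in> Q) \<Longrightarrow> wit T \<phi> Q n (\<lambda>i. \<phi> c \<otimes>\<^bsub>T\<^esub> v i)"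
proof (induct n arbitrary: c v rule: exp_induct)
  case (step n)
  have c: "c \<in> R0" by (rule mpow_R0[OF step(2)])
  have cc: "c \<in> carrier S" using c base_carrier by auto
  show ?case
  proof (rule witI)
    show "\<phi> c \<otimes>\<^bsub>T\<^esub> v i \<in> carrier T" for i using cc step(3) by (simp add: phi_closed)
    show "\<phi> c \<otimes>\<^bsub>T\<^esub> v 0 \<in> Q" using phi_R0[OF c] step(4)[of 0] subringE(6)[OF Q] by simp
    fix \<alpha> k x assume k: "n = k + bexp \<alpha>" and x: "x \<in> P \<alpha>"
    \<comment> \<open>Since \<open>q > 0\<close>, one factor \<open>c\<close> can be taken out of
      \<open>c^q\<close>.\<close>
    obtain q' where q': "q \<alpha> = Suc q'" using q_pos[of \<alpha>] by (cases "q \<alpha>") auto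
    define u where "u = (\<lambda>i. v (i + bexp \<alpha>) \<ominus>\<^bsub>T\<^esub> \<phi> c [^]\<^bsub>T\<^esub> q' \<otimes>\<^bsub>T\<^esub> v i [^]\<^bsub>T\<^esub> q \<alpha>)"
    have "wit T \<phi> Q k (\<lambda>i. \<phi> (x \<otimes> c) \<otimes>\<^bsub>T\<^esub> u i)"
    proof (rule step(1)[OF k mpow_P])
      show "mpow (k + bexp \<alpha>) c" using step(2) k by simp
      show "u i \<in> carrier T" for i using step(3) cc by (simp add: u_def phi_closed)
      show "u i \<in> Q" if "i \<in> box k" for i
        using step(4)[of i] step(4)[of "i + bexp \<alpha>"] that k phi_R0[OF c]
          subringE(6)[OF Q] subringE_more[OF Q _ T.is_cring]
        by (simp add: u_def box_plus box_mono)
    qed (rule x)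
    moreover have "(\<lambda>i. \<phi> (x \<otimes> c) \<otimes>\<^bsub>T\<^esub> u i) = del T \<phi> \<alpha> x (\<lambda>i. \<phi> c \<otimes>\<^bsub>T\<^esub> v i)"
    proof
      fix i
      have "(y \<otimes>\<^bsub>T\<^esub> d) \<otimes>\<^bsub>T\<^esub> (a \<ominus>\<^bsub>T\<^esub> e \<otimes>\<^bsub>T\<^esub> b) = y \<otimes>\<^bsub>T\<^esub> (d \<otimes>\<^bsub>T\<^esub> a \<ominus>\<^bsub>T\<^esub> (e \<otimes>\<^bsub>T\<^esub> d) \<otimes>\<^bsub>T\<^esub> b)"
        if "y \<in> carrier T" "d \<in> carrier T" "a \<in> carrier T" "b \<in> carrier T" "e \<in> carrier T" for y d a b e
        using that by algebra
      note id = this[OF phi_closed[OF P_carrier[OF x]] phi_closed[OF cc] step(3)[of "i + bexp \<alpha>"] T.nat_pow_closed[OF step(3)[of i], of "q \<alpha>"] T.nat_pow_closed[OF phi_closed[OF cc], of q']]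
      have "(\<phi> c \<otimes>\<^bsub>T\<^esub> v i) [^]\<^bsub>T\<^esub> q \<alpha> = \<phi> c [^]\<^bsub>T\<^esub> q \<alpha> \<otimes>\<^bsub>T\<^esub> v i [^]\<^bsub>T\<^esub> q \<alpha>"
        by (rule T.nat_pow_distrib) (use step(3) cc phi_closed in auto)
      also have "\<phi> c [^]\<^bsub>T\<^esub> q \<alpha> = \<phi> c [^]\<^bsub>T\<^esub> q' \<otimes>\<^bsub>T\<^esub> \<phi> c" by (simp add: q')
      finally have pw: "(\<phi> c \<otimes>\<^bsub>T\<^esub> v i) [^]\<^bsub>T\<^esub> q \<alpha> = \<phi> c [^]\<^bsub>T\<^esub> q' \<otimes>\<^bsub>T\<^esub> \<phi> c \<otimes>\<^bsub>T\<^esub> v i [^]\<^bsub>T\<^esub> q \<alpha>" .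
      show "\<phi> (x \<otimes> c) \<otimes>\<^bsub>T\<^esub> u i = del T \<phi> \<alpha> x (\<lambda>i. \<phi> c \<otimes>\<^bsub>T\<^esub> v i) i"
        unfolding del_def u_def pw ring_hom_mult[OF phi P_carrier[OF x] cc] by (rule id)
    qed
    ultimately show "wit T \<phi> Q k (del T \<phi> \<alpha> x (\<lambda>i. \<phi> c \<otimes>\<^bsub>T\<^esub> v i))" by simp
  qed
qed

lemma del_pointwise:
  assumes "\<And>i j. u i j \<in> carrier T"
  shows "del (fun_ring T) (\<lambda>r i. \<phi> r) \<alpha> x u = (\<lambda>i j. \<phi> x \<otimes>\<^bsub>T\<^esub> (u (i + bexp \<alpha>) j \<ominus>\<^bsub>T\<^esub> u i j [^]\<^bsub>T\<^esub> q \<alpha>))"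
  using assms by (simp add: del_def T.is_cring)

text \<open>In \<open>\<lambda>i j. s (j + i)\<close> the row of index \<open>i\<close> is
  \<open>s\<close> shifted by \<open>i\<close>. The operator acts on the outer index, and as
  exponents add commutatively the result is again the family of rows of a single family.\<close>

lemma hat_del:
  assumes "\<And>i. s i \<in> carrier T"
  shows "del (fun_ring T) (\<lambda>r i. \<phi> r) \<alpha> x (\<lambda>i j. s (j + i)) = (\<lambda>i j. del T \<phi> \<alpha> x s (j + i))"
  using assms by (simp add: del_pointwise) (simp add: del_def ac_simps)

text \<open>The directions of \<open>n''\<close> are unwound by \<open>hat_del\<close>; what is left
  of the exponent is \<open>n'\<close>, the integrality of each row. Coprimality enters only in the
  converse.\<close>

lemma wit_hat:
  "wit T \<phi> Q (n' + n'') s \<Longrightarrow> wit (fun_ring T) (\<lambda>r i. \<phi> r) {s. wit T \<phi> Q n' s} n'' (\<lambda>i j. s (j + i))"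
proof (induct n'' arbitrary: s rule: exp_induct)
  case (step n'')
  have sc: "s i \<in> carrier T" for i by (rule wit_closed[OF step(2)])
  show ?case
  proof (rule witI)
    show "(\<lambda>j. s (j + 0)) \<in> {s. wit T \<phi> Q n' s}" using wit_mono[OF step(2)] by simp
    fix \<alpha> k x assume k: "n'' = k + bexp \<alpha>" and x: "x \<in> P \<alpha>"
    have "wit (fun_ring T) (\<lambda>r i. \<phi> r) {s. wit T \<phi> Q n' s} k (\<lambda>i j. del T \<phi> \<alpha> x s (j + i))"
      by (rule step(1)[OF k], rule wit_del) (use step(2) k x in \<open>simp_all add: ac_simps\<close>)
    then show "wit (fun_ring T) (\<lambda>r i. \<phi> r) {s. wit T \<phi> Q n' s} k (del (fun_ring T) (\<lambda>r i. \<phi> r) \<alpha> x (\<lambda>i j. s (j + i)))"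
      by (subst hat_del) (rule sc)
  qed (use sc in auto)
qed

text \<open>Here coprimality is used. Inside the rows, \<open>del\<close> in direction
  \<open>\<alpha>\<close> divides by the ideal and is not additive, so it is not clear that it
  respects integrality along \<open>n\<close>. Write \<open>\<one> = a + c\<close> with
  \<open>a\<close> in \<open>M \<alpha>\<close> and \<open>c\<close> in the product of powers for
  \<open>n\<close>. Then \<open>a v\<close> is a polynomial expression in integral families with the
  coefficient \<open>x a\<close> from \<open>R0\<close>, while \<open>c v\<close> is integral by
  \<open>mpow_wit\<close>, because in the box every single row of \<open>v\<close> lies in the right
  ring.\<close>

lemma wit_coprime_del:
  assumes u: "wit (fun_ring T) (\<lambda>r i. \<phi> r) {s. wit T \<phi> Q (k + bexp \<alpha>) s} n u" 
    and \<alpha>: "\<alpha> \<notin> Poly_Mapping.keys n" and x: "x \<in> P \<alpha>"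
  shows "wit (fun_ring T) (\<lambda>r i. \<phi> r) {s. wit T \<phi> Q k s} n (\<lambda>i. del T \<phi> \<alpha> x (u i))"
proof -
  let ?F = "fun_ring T :: (('e \<Rightarrow>\<^sub>0 nat) \<Rightarrow> 't) ring" and ?\<phi> = "\<lambda>r (i :: 'e \<Rightarrow>\<^sub>0 nat). \<phi> r"
  let ?K = "{s. wit T \<phi> Q k s}" and ?K' = "{s. wit T \<phi> Q (k + bexp \<alpha>) s}"
  interpret F: wcover S R0 M P q ?F ?\<phi> ?K by (rule wcover_fun)
  interpret F': wcover S R0 M P q ?F ?\<phi> ?K' by (rule wcover_fun)
  let ?H = "{v. wit ?F ?\<phi> ?K n v}"
  have H: "subring ?H (fun_ring ?F)" by (rule F.wit_subring)
  have G: "cring (fun_ring ?F)" by (rule cring_fun_ring) (rule F.T.is_cring)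
  have uc: "u i j \<in> carrier T" for i j using wit_closed[OF u] by simp
  obtain a c where ac: "a \<in> M \<alpha>" "mpow n c" "a \<oplus> c = \<one>" using mpow_coprime[OF \<alpha>] by blast
  have c: "c \<in> R0" using ac mpow_R0 by auto
  have car: "a \<in> carrier S" "c \<in> carrier S" "x \<in> carrier S" using ac c x base_carrier by auto
  define v where "v = (\<lambda>i. del T \<phi> \<alpha> x (u i))"
  have vc: "v i j \<in> carrier T" for i j using uc x by (simp add: v_def del_closed)
  \<comment> \<open>\<open>u\<close>, and also its shift inside the rows, remains integral along
    \<open>n\<close> when the rows are only required to be integral up to \<open>k\<close>.\<close>
  have u1: "u \<in> ?H"
    using wit_hom[where h = id and ?T2.0 = ?F and ?\<phi>2.0 = ?\<phi> and ?Q2.0 = ?K, OF F.T.is_cring F.T.is_cring id_ring_hom F.phi _ _ u]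
    by (auto intro: wit_mono)
  have u2: "(\<lambda>i j. u i (j + bexp \<alpha>)) \<in> ?H"
    using wit_hom[where h = "\<lambda>f j. f (j + bexp \<alpha>)" and ?T2.0 = ?F and ?\<phi>2.0 = ?\<phi> and ?Q2.0 = ?K, OF F.T.is_cring F.T.is_cring ring_hom_reindex F.phi _ _ u]
    by (auto intro: wit_shift)
  have "?\<phi> (x \<otimes> a) \<in> ?K" using P_M[OF x ac(1)] wit_const by auto
  have "(\<lambda>i. ?\<phi> (x \<otimes> a)) \<in> ?H" using F.wit_const[OF P_M[OF x ac(1)]] by simp
  then have "(\<lambda>i. ?\<phi> (x \<otimes> a)) \<otimes>\<^bsub>fun_ring ?F\<^esub> ((\<lambda>i j. u i (j + bexp \<alpha>)) \<ominus>\<^bsub>fun_ring ?F\<^esub> u [^]\<^bsub>fun_ring ?F\<^esub> q \<alpha>) \<in> ?H"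
    using u1 u2 subringE(6)[OF H] subringE_more[OF H _ G] by blast
  moreover have "(\<lambda>i. ?\<phi> (x \<otimes> a)) \<otimes>\<^bsub>fun_ring ?F\<^esub> ((\<lambda>i j. u i (j + bexp \<alpha>)) \<ominus>\<^bsub>fun_ring ?F\<^esub> u [^]\<^bsub>fun_ring ?F\<^esub> q \<alpha>)
    = (\<lambda>i j. \<phi> a \<otimes>\<^bsub>T\<^esub> v i j)"
    using uc car F.T.is_cring T.is_cring 
    by (simp add: v_def del_def ring_hom_mult[OF phi] phi_closed T.m_assoc T.m_lcomm)
  ultimately have 1: "(\<lambda>i j. \<phi> a \<otimes>\<^bsub>T\<^esub> v i j) \<in> ?H" by simp
  have "wit ?F ?\<phi> ?K n (\<lambda>i. ?\<phi> c \<otimes>\<^bsub>?F\<^esub> v i)"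
  proof (rule F.mpow_wit[OF ac(2)])
    show "v i \<in> ?K" if "i \<in> box n" for i
      using F'.wit_mem[OF u that] x by (simp add: v_def wit_del)
  qed (use vc in auto)
  then have 2: "(\<lambda>i j. \<phi> c \<otimes>\<^bsub>T\<^esub> v i j) \<in> ?H" by simp
  have "\<phi> a \<otimes>\<^bsub>T\<^esub> v i j \<oplus>\<^bsub>T\<^esub> \<phi> c \<otimes>\<^bsub>T\<^esub> v i j = v i j" for i j
  proof -
    have "\<phi> a \<otimes>\<^bsub>T\<^esub> v i j \<oplus>\<^bsub>T\<^esub> \<phi> c \<otimes>\<^bsub>T\<^esub> v i j = \<phi> (a \<oplus> c) \<otimes>\<^bsub>T\<^esub> v i j"
      using car vc by (simp add: ring_hom_add[OF phi] T.l_distr phi_closed)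
    then show ?thesis using ac vc by (simp add: ring_hom_one[OF phi])
  qed
  then have "v = (\<lambda>i j. \<phi> a \<otimes>\<^bsub>T\<^esub> v i j) \<oplus>\<^bsub>fun_ring ?F\<^esub> (\<lambda>i j. \<phi> c \<otimes>\<^bsub>T\<^esub> v i j)" by simp
  also have "\<dots> \<in> ?H" by (rule subringE(7)[OF H 1 2])
  finally show ?thesis by (simp add: v_def)
qed

text \<open>A direction of \<open>n''\<close> moves the rows and is handled by
  \<open>hat_del\<close>. A direction of \<open>n'\<close> acts inside the rows; as it lies outside
  the support of \<open>n''\<close>, it is handled by \<open>wit_coprime_del\<close>.\<close>

lemma wit_unhat:
  "wit (fun_ring T) (\<lambda>r i. \<phi> r) {s. wit T \<phi> Q n' s} n'' (\<lambda>i j. s (j + i)) \<Longrightarrow>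
   Poly_Mapping.keys n' \<inter> Poly_Mapping.keys n'' = {} \<Longrightarrow> wit T \<phi> Q (n' + n'') s"
proof (induct "n' + n''" arbitrary: n' n'' s rule: exp_induct)
  case step
  have sc: "s i \<in> carrier T" for i using wit_closed[OF step(2), of 0] by (auto dest: spec[of _ i])
  show ?case
  proof (rule witI)
    show "s 0 \<in> Q" using wit_zero[OF step(2)] wit_zero by simp
    fix \<alpha> k x assume k: "n' + n'' = k + bexp \<alpha>" and x: "x \<in> P \<alpha>"
    have "\<alpha> \<in> Poly_Mapping.keys n' \<union> Poly_Mapping.keys n''"
      using k by (metis keys_plus_bexp keys_plus_nat insertI1)
    then show "wit T \<phi> Q k (del T \<phi> \<alpha> x s)"
    proof
      assume \<alpha>: "\<alpha> \<in> Poly_Mapping.keys n''"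
      from keys_decomp[OF this] obtain l where l: "n'' = l + bexp \<alpha>" ..
      then have "k + bexp \<alpha> = (n' + l) + bexp \<alpha>" using k by (simp add: ac_simps)
      then have kl: "k = n' + l" by (rule add_right_imp_eq)
      have "wit (fun_ring T) (\<lambda>r i. \<phi> r) {s. wit T \<phi> Q n' s} l (del (fun_ring T) (\<lambda>r i. \<phi> r) \<alpha> x (\<lambda>i j. s (j + i)))"
        by (rule wit_del) (use step(2) l x in auto)
      then have "wit (fun_ring T) (\<lambda>r i. \<phi> r) {s. wit T \<phi> Q n' s} l (\<lambda>i j. del T \<phi> \<alpha> x s (j + i))"
        by (subst (asm) hat_del) (rule sc)
      then have "wit T \<phi> Q (n' + l) (del T \<phi> \<alpha> x s)"
        by (rule step(1)[OF k[unfolded kl]]) (use step(3) l in \<open>auto simp: keys_plus_bexp\<close>)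
      then show ?thesis using kl by simp
    next
      assume \<alpha>: "\<alpha> \<in> Poly_Mapping.keys n'"
      then have \<alpha>'': "\<alpha> \<notin> Poly_Mapping.keys n''" using step(3) by auto
      from keys_decomp[OF \<alpha>] obtain l where l: "n' = l + bexp \<alpha>" ..
      then have "k + bexp \<alpha> = (l + n'') + bexp \<alpha>" using k by (simp add: ac_simps)
      then have kl: "k = l + n''" by (rule add_right_imp_eq)
      have "wit (fun_ring T) (\<lambda>r i. \<phi> r) {s. wit T \<phi> Q l s} n'' (\<lambda>i. del T \<phi> \<alpha> x (\<lambda>j. s (j + i)))"
        by (rule wit_coprime_del[OF _ \<alpha>'' x]) (use step(2) l in simp)
      moreover have "(\<lambda>i. del T \<phi> \<alpha> x (\<lambda>j. s (j + i))) = (\<lambda>i j. del T \<phi> \<alpha> x s (j + i))"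
        by (simp add: del_def ac_simps)
      ultimately have "wit (fun_ring T) (\<lambda>r i. \<phi> r) {s. wit T \<phi> Q l s} n'' (\<lambda>i j. del T \<phi> \<alpha> x s (j + i))" by simp
      then have "wit T \<phi> Q (l + n'') (del T \<phi> \<alpha> x s)"
        by (rule step(1)[OF k[unfolded kl]]) (use step(3) l in \<open>auto simp: keys_plus_bexp\<close>)
      then show ?thesis using kl by simp
    qed
  qed (rule sc)
qed

end


section \<open>Extending and lifting integral ghost vectors\<close>

lemma box_zero [simp]: "i \<in> box 0 \<longleftrightarrow> i = 0"
  using box_single[of i undefined 0] by simp

lemma single_in_box: "m \<le> k \<Longrightarrow> Poly_Mapping.single \<alpha> m \<in> box (Poly_Mapping.single \<alpha> k)"
  unfolding box_single by blast

context wcover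
begin

text \<open>\<open>span_solve\<close> for families: the integral families \<open>y\<close>, chosen
  for each \<open>x\<close> separately, are replaced by the multiples \<open>\<phi> x z\<close> of
  one family. With \<open>h = id\<close> this serves for extending, with a surjection
  \<open>h\<close> for lifting.\<close>

lemma span_solve_fun:
  assumes ex: "\<And>x. x \<in> P \<alpha> \<Longrightarrow> \<exists>y. wit T \<phi> Q n y \<and> (\<forall>m\<le>k. h (y (g m)) = v x m)"
    and T2: "cring T2" "h \<in> ring_hom T T2"
    and add: "\<And>x x' m. x \<in> P \<alpha> \<Longrightarrow> x' \<in> P \<alpha> \<Longrightarrow> m \<le> k \<Longrightarrow> v (x \<oplus> x') m = v x m \<oplus>\<^bsub>T2\<^esub> v x' m"
    and mult: "\<And>x r m. x \<in> P \<alpha> \<Longrightarrow> r \<in> R0 \<Longrightarrow> m \<le> k \<Longrightarrow> v (r \<otimes> x) m = h (\<phi> r) \<otimes>\<^bsub>T2\<^esub> v x m"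
  shows "\<exists>z. (\<forall>i. z i \<in> carrier T) \<and> (\<forall>x\<in>P \<alpha>. wit T \<phi> Q n (\<lambda>i. \<phi> x \<otimes>\<^bsub>T\<^esub> z i) \<and> (\<forall>m\<le>k. h (\<phi> x) \<otimes>\<^bsub>T2\<^esub> h (z (g m)) = v x m))"
proof -
  let ?F = "fun_ring T :: (('e \<Rightarrow>\<^sub>0 nat) \<Rightarrow> 't) ring" and ?\<phi> = "\<lambda>r (i :: 'e \<Rightarrow>\<^sub>0 nat). \<phi> r"
  interpret F: wcover S R0 M P q ?F ?\<phi> "{s. wit T \<phi> Q n s}" by (rule wcover_fun)
  let ?G = "\<lambda>x y. wit T \<phi> Q n y \<and> (\<forall>m\<le>k. h (y (g m)) = v x m)"
  have cl: "y i \<in> carrier T" if "?G x y" for x y i using that wit_closed by blast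
  have "\<exists>z\<in>carrier ?F. \<forall>x\<in>P \<alpha>. ?G x (?\<phi> x \<otimes>\<^bsub>?F\<^esub> z)"
  proof (rule F.span_solve[of \<alpha> ?G])
    fix x y x' y' assume a: "x \<in> P \<alpha>" "x' \<in> P \<alpha>" "?G x y" "?G x' y'"
    have "y \<oplus>\<^bsub>?F\<^esub> y' \<in> {s. wit T \<phi> Q n s}" by (rule subringE(7)[OF wit_subring]) (use a in auto)
    then show "?G (x \<oplus> x') (y \<oplus>\<^bsub>?F\<^esub> y')"
      using a add cl[OF a(3)] cl[OF a(4)] by (simp add: ring_hom_add[OF T2(2)])
  next
    fix x y r assume a: "x \<in> P \<alpha>" "r \<in> R0" "?G x y"
    have "?\<phi> r \<otimes>\<^bsub>?F\<^esub> y \<in> {s. wit T \<phi> Q n s}" 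
      by (rule subringE(6)[OF wit_subring]) (use a wit_const in auto)
    then show "?G (r \<otimes> x) (?\<phi> r \<otimes>\<^bsub>?F\<^esub> y)"
      using a mult cl[OF a(3)] by (simp add: ring_hom_mult[OF T2(2)] phi_closed R0_carrier)
  next
    fix x y assume g: "?G x y"
    show "y \<in> carrier ?F" using cl[OF g] by simp
  qed (rule ex)
  then obtain z where z0: "z \<in> carrier ?F" "\<forall>x\<in>P \<alpha>. ?G x (?\<phi> x \<otimes>\<^bsub>?F\<^esub> z)" by (rule bexE)
  have zc: "z i \<in> carrier T" for i using z0(1) fun_ring_simps(1) by metis
  show ?thesis
  proof (intro exI[of _ z] conjI allI ballI impI)
    fix x assume x: "x \<in> P \<alpha>"
    then have g: "?G x (?\<phi> x \<otimes>\<^bsub>?F\<^esub> z)" using z0(2) by (rule bspec[rotated])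
    then show "wit T \<phi> Q n (\<lambda>i. \<phi> x \<otimes>\<^bsub>T\<^esub> z i)" by simp
    fix m assume "m \<le> k"
    then have "h (\<phi> x \<otimes>\<^bsub>T\<^esub> z (g m)) = v x m" using g by simp
    then show "h (\<phi> x) \<otimes>\<^bsub>T2\<^esub> h (z (g m)) = v x m"
      using zc x by (simp add: ring_hom_mult[OF T2(2)] phi_closed P_carrier)
  qed (rule zc)
qed

text \<open>The solution of \<open>s(0) = y\<close>, \<open>s(m+1) = s(m)^q + z(m)\<close>. Its
  \<open>del\<close> in direction \<open>\<alpha>\<close> for \<open>x\<close> is
  \<open>\<phi> x z\<close> by construction.\<close>

fun tower :: "(('e \<Rightarrow>\<^sub>0 nat) \<Rightarrow> 't) \<Rightarrow> 't \<Rightarrow> 'e \<Rightarrow> nat \<Rightarrow> 't" where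
  "tower z y \<alpha> 0 = y"
| "tower z y \<alpha> (Suc m) = tower z y \<alpha> m [^]\<^bsub>T\<^esub> q \<alpha> \<oplus>\<^bsub>T\<^esub> z (Poly_Mapping.single \<alpha> m)"

lemma tower_closed: "(\<And>i. z i \<in> carrier T) \<Longrightarrow> y \<in> carrier T \<Longrightarrow> tower z y \<alpha> m \<in> carrier T"
  by (induct m) auto

lemma tower_wit:
  assumes z: "\<And>i. z i \<in> carrier T" and y: "y \<in> Q"
    and w: "\<And>x. x \<in> P \<alpha> \<Longrightarrow> wit T \<phi> Q (Poly_Mapping.single \<alpha> k) (\<lambda>i. \<phi> x \<otimes>\<^bsub>T\<^esub> z i)"
  shows "wit T \<phi> Q (Poly_Mapping.single \<alpha> (Suc k)) (\<lambda>i. tower z y \<alpha> (Poly_Mapping.lookup i \<alpha>))"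
proof (rule witI)
  have tc: "tower z y \<alpha> m \<in> carrier T" for m using tower_closed z y Q_carrier by auto
  then show "tower z y \<alpha> (Poly_Mapping.lookup i \<alpha>) \<in> carrier T" for i .
  fix \<beta> l x assume l: "Poly_Mapping.single \<alpha> (Suc k) = l + bexp \<beta>" and x: "x \<in> P \<beta>"
  \<comment> \<open>From a multiple of \<open>bexp \<alpha>\<close> no other direction can be
    removed.\<close>
  have "\<beta> \<in> Poly_Mapping.keys (Poly_Mapping.single \<alpha> (Suc k))" unfolding l by (simp add: keys_plus_bexp)
  then have \<beta>: "\<beta> = \<alpha>" by simp
  then have l': "l = Poly_Mapping.single \<alpha> k" using l unfolding single_Suc by (metis add_right_imp_eq)
  show "wit T \<phi> Q l (del T \<phi> \<beta> x (\<lambda>i. tower z y \<alpha> (Poly_Mapping.lookup i \<alpha>)))"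
    unfolding \<beta> l'
  proof (rule wit_cong[OF w])
    fix i assume "i \<in> box (Poly_Mapping.single \<alpha> k)"
    then obtain m where i: "i = Poly_Mapping.single \<alpha> m" by (auto simp: box_single)
    have "(a \<oplus>\<^bsub>T\<^esub> b) \<ominus>\<^bsub>T\<^esub> a = b" if "a \<in> carrier T" "b \<in> carrier T" for a b using that by algebra
    then show "del T \<phi> \<alpha> x (\<lambda>i. tower z y \<alpha> (Poly_Mapping.lookup i \<alpha>)) i = \<phi> x \<otimes>\<^bsub>T\<^esub> z i"
      using tc z by (simp add: i del_def lookup_add)
  qed (use tc x \<beta> in \<open>auto intro: del_closed\<close>)
qed (simp add: y)

text \<open>The families \<open>del T \<phi> \<alpha> x s\<close> are one step shorter and are
  extended by induction. Their extensions are unrelated for different \<open>x\<close>;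
  \<open>span_solve_fun\<close> makes them multiples of one \<open>z\<close>, which equals
  \<open>s(m+1) - s(m)^q\<close> where \<open>s\<close> is prescribed, and \<open>tower\<close>
  rebuilds \<open>s\<close> from it.\<close>

lemma extend_single:
  "wit T \<phi> Q (Poly_Mapping.single \<alpha> k) s \<Longrightarrow>
   \<exists>t. wit T \<phi> Q (Poly_Mapping.single \<alpha> (Suc k)) t \<and> (\<forall>m\<le>k. t (Poly_Mapping.single \<alpha> m) = s (Poly_Mapping.single \<alpha> m))"
proof (induct k arbitrary: s)
  case 0
  \<comment> \<open>With \<open>z = 0\<close> the family \<open>y, y^q, y^(q^2), ...\<close> arises,
    whose \<open>del\<close> in direction \<open>\<alpha>\<close> vanish.\<close>
  have "wit T \<phi> Q (Poly_Mapping.single \<alpha> (Suc 0)) (\<lambda>i. tower (\<lambda>_. \<zero>\<^bsub>T\<^esub>) (s 0) \<alpha> (Poly_Mapping.lookup i \<alpha>))"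
    by (rule tower_wit) (use wit_zero[OF 0] subringE(2)[OF Q] in \<open>auto simp: wit_0_iff phi_closed P_carrier\<close>)
  then show ?case by (intro exI[of _ "\<lambda>i. tower (\<lambda>_. \<zero>\<^bsub>T\<^esub>) (s 0) \<alpha> (Poly_Mapping.lookup i \<alpha>)"] conjI) auto
next
  case (Suc k)
  let ?s = "\<lambda>m. s (Poly_Mapping.single \<alpha> m)"
  have sc: "s i \<in> carrier T" for i by (rule wit_closed[OF Suc(2)])
  have ds: "del T \<phi> \<alpha> x s (Poly_Mapping.single \<alpha> m) = \<phi> x \<otimes>\<^bsub>T\<^esub> (?s (Suc m) \<ominus>\<^bsub>T\<^esub> ?s m [^]\<^bsub>T\<^esub> q \<alpha>)" for x m
    by (simp add: del_def single_Suc)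
  have "\<exists>z. (\<forall>i. z i \<in> carrier T) \<and> (\<forall>x\<in>P \<alpha>. wit T \<phi> Q (Poly_Mapping.single \<alpha> (Suc k)) (\<lambda>i. \<phi> x \<otimes>\<^bsub>T\<^esub> z i) \<and> 
     (\<forall>m\<le>k. id (\<phi> x) \<otimes>\<^bsub>T\<^esub> id (z (Poly_Mapping.single \<alpha> m)) = \<phi> x \<otimes>\<^bsub>T\<^esub> (?s (Suc m) \<ominus>\<^bsub>T\<^esub> ?s m [^]\<^bsub>T\<^esub> q \<alpha>)))"
  proof (rule span_solve_fun)
    fix x assume x: "x \<in> P \<alpha>"
    have "wit T \<phi> Q (Poly_Mapping.single \<alpha> k) (del T \<phi> \<alpha> x s)"
      by (rule wit_del[OF _ x]) (use Suc(2) in \<open>simp add: single_Suc\<close>)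
    from Suc(1)[OF this] show "\<exists>y. wit T \<phi> Q (Poly_Mapping.single \<alpha> (Suc k)) y \<and> (\<forall>m\<le>k. id (y (Poly_Mapping.single \<alpha> m)) = \<phi> x \<otimes>\<^bsub>T\<^esub> (?s (Suc m) \<ominus>\<^bsub>T\<^esub> ?s m [^]\<^bsub>T\<^esub> q \<alpha>))"
      by (simp add: ds)
  next
    show "id \<in> ring_hom T T" by (rule id_ring_hom)
  qed (use sc in \<open>auto simp: T.is_cring ring_hom_add[OF phi] ring_hom_mult[OF phi] P_carrier R0_carrier phi_closed T.l_distr T.m_assoc\<close>)
  then obtain z where z: "\<And>i. z i \<in> carrier T" 
    "\<And>x. x \<in> P \<alpha> \<Longrightarrow> wit T \<phi> Q (Poly_Mapping.single \<alpha> (Suc k)) (\<lambda>i. \<phi> x \<otimes>\<^bsub>T\<^esub> z i)"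
    "\<And>x m. x \<in> P \<alpha> \<Longrightarrow> m \<le> k \<Longrightarrow> \<phi> x \<otimes>\<^bsub>T\<^esub> z (Poly_Mapping.single \<alpha> m) = \<phi> x \<otimes>\<^bsub>T\<^esub> (?s (Suc m) \<ominus>\<^bsub>T\<^esub> ?s m [^]\<^bsub>T\<^esub> q \<alpha>)"
    by auto
  have zm: "z (Poly_Mapping.single \<alpha> m) = ?s (Suc m) \<ominus>\<^bsub>T\<^esub> ?s m [^]\<^bsub>T\<^esub> q \<alpha>" if "m \<le> k" for m
    by (rule span_cancel[where \<alpha> = \<alpha>]) (use z that sc in auto)
  have t: "tower z (s 0) \<alpha> m = ?s m" if "m \<le> Suc k" for m
    using that
  proof (induct m)
    case (Suc m)
    have "a \<oplus>\<^bsub>T\<^esub> (b \<ominus>\<^bsub>T\<^esub> a) = b" if "a \<in> carrier T" "b \<in> carrier T" for a b using that by algebra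
    then show ?case using Suc zm sc by simp
  qed simp
  have "wit T \<phi> Q (Poly_Mapping.single \<alpha> (Suc (Suc k))) (\<lambda>i. tower z (s 0) \<alpha> (Poly_Mapping.lookup i \<alpha>))"
    by (rule tower_wit) (use z wit_zero[OF Suc(2)] in auto)
  then show ?case using t by (intro exI[of _ "\<lambda>i. tower z (s 0) \<alpha> (Poly_Mapping.lookup i \<alpha>)"] conjI) auto
qed

text \<open>\<open>u\<close> need not consist of the shifts of a single family. As the supports are
  disjoint, an index of the large box splits uniquely into its two parts, and on the boxes
  \<open>u\<close> can be read as \<open>s (j + i) = u i j\<close>.\<close>

lemma unhat_exists:
  assumes u: "wit (fun_ring T) (\<lambda>r i. \<phi> r) {s. wit T \<phi> Q n' s} n'' u"
    and disj: "Poly_Mapping.keys n' \<inter> Poly_Mapping.keys n'' = {}"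
  shows "\<exists>s. wit T \<phi> Q (n' + n'') s \<and> (\<forall>i\<in>box n''. \<forall>j\<in>box n'. s (j + i) = u i j)"
proof -
  let ?F = "fun_ring T :: (('e \<Rightarrow>\<^sub>0 nat) \<Rightarrow> 't) ring" and ?\<phi> = "\<lambda>r (i :: 'e \<Rightarrow>\<^sub>0 nat). \<phi> r"
  let ?K = "{s. wit T \<phi> Q n' s}"
  interpret F: wcover S R0 M P q ?F ?\<phi> ?K by (rule wcover_fun)
  define s where "s l = u (exp_restrict (Poly_Mapping.keys n'') l) (exp_restrict (Poly_Mapping.keys n') l)" for l
  have su: "s (j + i) = u i j" if "i \<in> box n''" "j \<in> box n'" for i j
  proof -
    have "Poly_Mapping.keys i \<subseteq> Poly_Mapping.keys n''" "Poly_Mapping.keys j \<subseteq> Poly_Mapping.keys n'" using that keys_box by auto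
    then have "exp_restrict (Poly_Mapping.keys n'') (j + i) = i" "exp_restrict (Poly_Mapping.keys n') (j + i) = j"
      using disj by (auto intro!: exp_restrict_plus)
    then show ?thesis by (simp add: s_def)
  qed
  have uc: "u i j \<in> carrier T" for i j using wit_closed[OF u] by simp
  have sc: "s i \<in> carrier T" for i by (simp add: s_def uc)
  \<comment> \<open>\<open>s (j + i) = u i j\<close> holds only for \<open>j\<close> in
    \<open>box n'\<close>, whereas \<open>wit_cong\<close> for the outer family compares whole rows.
    Precomposition with \<open>r\<close>, which fixes the box and sends all else to 0, makes the
    rows equal and does not affect membership in \<open>?K\<close>.\<close>
  define r where "r j = (if j \<in> box n' then j else 0)" for j
  have rb: "r j \<in> box n'" "j \<in> box n' \<Longrightarrow> r j = j" for j by (auto simp: r_def)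
  have rK: "f \<in> ?K" if "f \<in> carrier ?F" "(\<lambda>j. f (r j)) \<in> ?K" for f
  proof (rule CollectI, rule wit_cong)
    show "wit T \<phi> Q n' (\<lambda>j. f (r j))" using that(2) by simp
  qed (use that(1) rb(2) in auto)
  have Kr: "(\<lambda>j. f (r j)) \<in> ?K" if "f \<in> ?K" for f
  proof (rule CollectI, rule wit_cong)
    show "wit T \<phi> Q n' f" using that by simp
    show "f (r i) \<in> carrier T" for i using wit_closed that by auto
    show "f (r i) = f i" if "i \<in> box n'" for i using rb(2)[OF that] by simp
  qed
  have "wit ?F ?\<phi> ?K n'' (\<lambda>i j. u i (r j))"
    by (rule wit_hom[where h = "\<lambda>f j. f (r j)" and \<phi> = ?\<phi> and Q = ?K, OF F.T.is_cring F.T.is_cring ring_hom_reindex F.phi _ Kr u]) simp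
  then have w: "wit ?F ?\<phi> ?K n'' (\<lambda>i j. s (r j + i))"
    by (rule F.wit_cong) (use su rb sc in auto)
  have "wit ?F ?\<phi> ?K n'' (\<lambda>i j. s (j + i))"
    by (rule wit_hom_reflect[where h = "\<lambda>f j. f (r j)" and T = ?F and \<phi> = ?\<phi> and Q = ?K and s = "\<lambda>i j. s (j + i)", OF F.T.is_cring F.T.is_cring ring_hom_reindex F.phi _ rK w])
      (use sc in auto)
  from wit_unhat[OF this disj] su show ?thesis by blast
qed

text \<open>The coordinate \<open>\<alpha>\<close> is split off entirely, the family of rows is
  extended in this one direction, and the result is reassembled. This is what identifies the
  truncated operator rings (\<open>L_int\<close>).\<close>

lemma extend:
  assumes s: "wit T \<phi> Q n s"
  shows "\<exists>t. wit T \<phi> Q (n + bexp \<alpha>) t \<and> (\<forall>i\<in>box n. t i = s i)"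
proof -
  obtain n0 k where n: "n = n0 + Poly_Mapping.single \<alpha> k" and \<alpha>: "\<alpha> \<notin> Poly_Mapping.keys n0" 
    using decompose_exp[of n \<alpha>] by metis
  let ?F = "fun_ring T :: (('e \<Rightarrow>\<^sub>0 nat) \<Rightarrow> 't) ring" and ?\<phi> = "\<lambda>r (i :: 'e \<Rightarrow>\<^sub>0 nat). \<phi> r"
  interpret F: wcover S R0 M P q ?F ?\<phi> "{s. wit T \<phi> Q n0 s}" by (rule wcover_fun)
  from F.extend_single[OF wit_hat[OF s[unfolded n]]] obtain u where
    u: "wit ?F ?\<phi> {s. wit T \<phi> Q n0 s} (Poly_Mapping.single \<alpha> (Suc k)) u"
      "\<And>m. m \<le> k \<Longrightarrow> u (Poly_Mapping.single \<alpha> m) = (\<lambda>j. s (j + Poly_Mapping.single \<alpha> m))" by blast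
  have "Poly_Mapping.keys n0 \<inter> Poly_Mapping.keys (Poly_Mapping.single \<alpha> (Suc k)) = {}" using \<alpha> by simp
  from unhat_exists[OF u(1) this] obtain t where 
    t: "wit T \<phi> Q (n0 + Poly_Mapping.single \<alpha> (Suc k)) t"
      "\<And>i j. i \<in> box (Poly_Mapping.single \<alpha> (Suc k)) \<Longrightarrow> j \<in> box n0 \<Longrightarrow> t (j + i) = u i j" by auto
  have "t i = s i" if i: "i \<in> box n" for i
  proof -
    obtain i0 m where im: "i = i0 + Poly_Mapping.single \<alpha> m" "\<alpha> \<notin> Poly_Mapping.keys i0"
      using decompose_exp[of i \<alpha>] by metis
    have le: "Poly_Mapping.lookup i \<beta> \<le> Poly_Mapping.lookup n \<beta>" for \<beta> using i by (simp add: box_def)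
    have "m \<le> k" using le[of \<alpha>] im \<alpha> by (simp add: n lookup_add in_keys_iff)
    moreover have "i0 \<in> box n0"
      unfolding box_def
    proof (rule CollectI, rule allI)
      fix \<beta> show "Poly_Mapping.lookup i0 \<beta> \<le> Poly_Mapping.lookup n0 \<beta>"
        using le[of \<beta>] im(2) by (cases "\<beta> = \<alpha>") (auto simp: im(1) n lookup_add lookup_single when_def in_keys_iff)
    qed
    moreover have "Poly_Mapping.single \<alpha> m \<in> box (Poly_Mapping.single \<alpha> (Suc k))" 
      using \<open>m \<le> k\<close> by (simp add: single_in_box)
    ultimately show ?thesis using t(2)[of "Poly_Mapping.single \<alpha> m" i0] u(2)[of m] im by simp
  qed
  moreover have "n + bexp \<alpha> = n0 + Poly_Mapping.single \<alpha> (Suc k)" by (simp add: n single_Suc ac_simps)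
  ultimately show ?thesis using t(1) by auto
qed

end

section \<open>Lifting along surjections\<close>

locale wcover_surj = T: wcover S R0 M P q T \<phi> Q + T2: wcover S R0 M P q T2 \<phi>2 Q2
  for S :: "('a, 's) module" (structure) and R0 and M P :: "'e \<Rightarrow> 's set" and q 
    and T :: "('t, 'm) ring_scheme" and \<phi> Q and T2 :: "('t2, 'm2) ring_scheme" and \<phi>2 Q2 +
  fixes h :: "'t \<Rightarrow> 't2"
  assumes h: "h \<in> ring_hom T T2" and h_phi: "k \<in> carrier S \<Longrightarrow> \<phi>2 k = h (\<phi> k)"
    and h_surj: "y \<in> carrier T2 \<Longrightarrow> \<exists>x\<in>carrier T. h x = y" and h_Q: "h ` Q = Q2"
begin

text \<open>Values outside \<open>box n\<close> do not affect integrality, so there any preimages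
  under \<open>h\<close> may be substituted.\<close>

lemma lift_adjust:
  assumes "T.wit T \<phi> Q n s" "\<And>i. i \<in> box n \<Longrightarrow> h (s i) = v i" "\<And>i. v i \<in> carrier T2"
  shows "\<exists>s. T.wit T \<phi> Q n s \<and> (\<forall>i. h (s i) = v i)"
proof -
  have "\<exists>y. y \<in> carrier T \<and> h y = v i \<and> (i \<in> box n \<longrightarrow> y = s i)" for i
    using assms h_surj[OF assms(3)[of i]] T.wit_closed[OF assms(1)] by metis
  then obtain s' where "\<And>i. s' i \<in> carrier T \<and> h (s' i) = v i \<and> (i \<in> box n \<longrightarrow> s' i = s i)" by metis
  then show ?thesis using T.wit_cong[OF assms(1), of s'] by blast
qed

text \<open>As in \<open>extend_single\<close>, but the families \<open>del\<close> of
  \<open>v\<close> are lifted instead of extended: \<open>span_solve_fun\<close> yields one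
  \<open>z\<close> over \<open>T\<close>, and the \<open>tower\<close> over a preimage of
  \<open>v 0\<close> in \<open>Q\<close> lifts \<open>v\<close>.\<close>

lemma lift_single:
  "T.wit T2 \<phi>2 Q2 (Poly_Mapping.single \<alpha> k) v \<Longrightarrow>
   \<exists>s. T.wit T \<phi> Q (Poly_Mapping.single \<alpha> k) s \<and> (\<forall>i. h (s i) = v i)"
proof (induct k arbitrary: v)
  case 0
  have vc: "v i \<in> carrier T2" for i by (rule T.wit_closed[OF 0])
  have "v 0 \<in> h ` Q" using T.wit_zero[OF 0] h_Q by simp
  then obtain y where y: "y \<in> Q" "h y = v 0" by auto
  show ?case
    by (rule lift_adjust[of _ "\<lambda>_. y"]) (use y vc T.Q_carrier in \<open>auto simp: T.wit_0_iff box_single\<close>)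
next
  case (Suc k)
  let ?v = "\<lambda>m. v (Poly_Mapping.single \<alpha> m)"
  have vc: "v i \<in> carrier T2" for i by (rule T.wit_closed[OF Suc(2)])
  have dv: "T.del T2 \<phi>2 \<alpha> x v (Poly_Mapping.single \<alpha> m) = \<phi>2 x \<otimes>\<^bsub>T2\<^esub> (?v (Suc m) \<ominus>\<^bsub>T2\<^esub> ?v m [^]\<^bsub>T2\<^esub> q \<alpha>)" for x m
    by (simp add: T.del_def single_Suc)
  have "\<exists>z. (\<forall>i. z i \<in> carrier T) \<and> (\<forall>x\<in>P \<alpha>. T.wit T \<phi> Q (Poly_Mapping.single \<alpha> k) (\<lambda>i. \<phi> x \<otimes>\<^bsub>T\<^esub> z i) \<and> 
     (\<forall>m\<le>k. h (\<phi> x) \<otimes>\<^bsub>T2\<^esub> h (z (Poly_Mapping.single \<alpha> m)) = \<phi>2 x \<otimes>\<^bsub>T2\<^esub> (?v (Suc m) \<ominus>\<^bsub>T2\<^esub> ?v m [^]\<^bsub>T2\<^esub> q \<alpha>)))"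
  proof (rule T.span_solve_fun)
    fix x assume x: "x \<in> P \<alpha>"
    have "T.wit T2 \<phi>2 Q2 (Poly_Mapping.single \<alpha> k) (T.del T2 \<phi>2 \<alpha> x v)"
      by (rule T.wit_del[OF _ x]) (use Suc(2) in \<open>simp add: single_Suc\<close>)
    from Suc(1)[OF this] show "\<exists>y. T.wit T \<phi> Q (Poly_Mapping.single \<alpha> k) y \<and> (\<forall>m\<le>k. h (y (Poly_Mapping.single \<alpha> m)) = \<phi>2 x \<otimes>\<^bsub>T2\<^esub> (?v (Suc m) \<ominus>\<^bsub>T2\<^esub> ?v m [^]\<^bsub>T2\<^esub> q \<alpha>))"
      by (auto simp: dv)
  next
    fix x r assume "x \<in> P \<alpha>" "r \<in> R0"
    then show "\<phi>2 (r \<otimes> x) \<otimes>\<^bsub>T2\<^esub> (?v (Suc m) \<ominus>\<^bsub>T2\<^esub> ?v m [^]\<^bsub>T2\<^esub> q \<alpha>) = h (\<phi> r) \<otimes>\<^bsub>T2\<^esub> (\<phi>2 x \<otimes>\<^bsub>T2\<^esub> (?v (Suc m) \<ominus>\<^bsub>T2\<^esub> ?v m [^]\<^bsub>T2\<^esub> q \<alpha>))" for m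
      using vc by (simp add: h_phi[symmetric] T.R0_carrier T.P_carrier ring_hom_mult[OF T2.phi] T2.phi_closed T2.T.m_assoc)
  qed (use vc h in \<open>auto simp: T2.T.is_cring ring_hom_add[OF T2.phi] T.P_carrier T2.phi_closed T2.T.l_distr\<close>)
  then obtain z where z: "\<And>i. z i \<in> carrier T" 
    "\<And>x. x \<in> P \<alpha> \<Longrightarrow> T.wit T \<phi> Q (Poly_Mapping.single \<alpha> k) (\<lambda>i. \<phi> x \<otimes>\<^bsub>T\<^esub> z i)"
    "\<And>x m. x \<in> P \<alpha> \<Longrightarrow> m \<le> k \<Longrightarrow> \<phi>2 x \<otimes>\<^bsub>T2\<^esub> h (z (Poly_Mapping.single \<alpha> m)) = \<phi>2 x \<otimes>\<^bsub>T2\<^esub> (?v (Suc m) \<ominus>\<^bsub>T2\<^esub> ?v m [^]\<^bsub>T2\<^esub> q \<alpha>)"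
    by (auto simp: h_phi T.P_carrier)
  have zm: "h (z (Poly_Mapping.single \<alpha> m)) = ?v (Suc m) \<ominus>\<^bsub>T2\<^esub> ?v m [^]\<^bsub>T2\<^esub> q \<alpha>" if "m \<le> k" for m
    by (rule T2.span_cancel[where \<alpha> = \<alpha>]) (use z that vc ring_hom_closed[OF h] in auto)
  have "v 0 \<in> h ` Q" using T.wit_zero[OF Suc(2)] h_Q by simp
  then obtain y where y: "y \<in> Q" "h y = v 0" by auto
  have tc: "T.tower z y \<alpha> m \<in> carrier T" for m using T.tower_closed z y T.Q_carrier by auto
  have t: "h (T.tower z y \<alpha> m) = ?v m" if "m \<le> Suc k" for m
    using that
  proof (induct m)
    case (Suc m)
    have "a \<oplus>\<^bsub>T2\<^esub> (b \<ominus>\<^bsub>T2\<^esub> a) = b" if "a \<in> carrier T2" "b \<in> carrier T2" for a b using that by algebra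
    then show ?case using Suc zm vc z tc 
      by (simp add: ring_hom_add[OF h] ring_hom_minus(3)[OF T.T.is_cring T2.T.is_cring h tc tc])
  qed (simp add: y)
  have "T.wit T \<phi> Q (Poly_Mapping.single \<alpha> (Suc k)) (\<lambda>i. T.tower z y \<alpha> (Poly_Mapping.lookup i \<alpha>))"
    by (rule T.tower_wit) (use z y in auto)
  then show ?case by (rule lift_adjust) (use t vc in \<open>auto simp: box_single\<close>)
qed

end

text \<open>One coordinate at a time. The earlier coordinates are absorbed into the base:
  surjectivity on the families that are integral up to \<open>n\<close> is the induction hypothesis,
  and \<open>lift_single\<close> is applied over these rings of families.\<close>

lemma (in wcover_surj) lift:
  "T.wit T2 \<phi>2 Q2 n v \<Longrightarrow> \<exists>s. T.wit T \<phi> Q n s \<and> (\<forall>i. h (s i) = v i)"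
proof (induct n arbitrary: v rule: exp_support_induct)
  case zero
  then show ?case using lift_single[of undefined 0 v] by simp
next
  case (plus n \<alpha> k)
  let ?F = "fun_ring T :: (('e \<Rightarrow>\<^sub>0 nat) \<Rightarrow> 't) ring" and ?\<phi> = "\<lambda>r (i :: 'e \<Rightarrow>\<^sub>0 nat). \<phi> r"
  let ?F2 = "fun_ring T2 :: (('e \<Rightarrow>\<^sub>0 nat) \<Rightarrow> 't2) ring" and ?\<phi>2 = "\<lambda>r (i :: 'e \<Rightarrow>\<^sub>0 nat). \<phi>2 r"
  let ?h = "\<lambda>f (i :: 'e \<Rightarrow>\<^sub>0 nat). h (f i)"
  interpret F: wcover_surj S R0 M P q ?F ?\<phi> "{s. T.wit T \<phi> Q n s}" ?F2 ?\<phi>2 "{s. T.wit T2 \<phi>2 Q2 n s}" ?h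
  proof (intro wcover_surj.intro wcover_surj_axioms.intro T.wcover_fun T2.wcover_fun)
    show "?h \<in> ring_hom ?F ?F2" by (rule ring_hom_compose_fun[OF h])
    show "?\<phi>2 k = ?h (?\<phi> k)" if "k \<in> carrier S" for k using h_phi[OF that] by simp
    show "\<exists>x\<in>carrier ?F. ?h x = y" if "y \<in> carrier ?F2" for y
    proof -
      have "\<forall>i. \<exists>x. x \<in> carrier T \<and> h x = y i" using that h_surj by auto
      then obtain x where "\<forall>i. x i \<in> carrier T \<and> h (x i) = y i" by metis
      then show ?thesis by (intro bexI[of _ x]) auto
    qed
    have "T.wit T2 \<phi>2 Q2 n (?h s)" if "T.wit T \<phi> Q n s" for s
      by (rule T.wit_hom[OF T.T.is_cring T2.T.is_cring h T.phi h_phi _ that]) (use h_Q in auto)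
    moreover have "\<exists>s. T.wit T \<phi> Q n s \<and> ?h s = v" if "T.wit T2 \<phi>2 Q2 n v" for v
      using plus(2)[OF that] by auto
    ultimately show "?h ` {s. T.wit T \<phi> Q n s} = {s. T.wit T2 \<phi>2 Q2 n s}" by blast
  qed
  from F.lift_single[OF T2.wit_hat[OF plus(3)]] obtain u where
    u: "T.wit ?F ?\<phi> {s. T.wit T \<phi> Q n s} (Poly_Mapping.single \<alpha> k) u" "\<And>i j. h (u i j) = v (j + i)" 
    by (auto simp: fun_eq_iff)
  have "Poly_Mapping.keys n \<inter> Poly_Mapping.keys (Poly_Mapping.single \<alpha> k) = {}" using plus(1) by simp
  from T.unhat_exists[OF u(1) this] obtain s where
    s: "T.wit T \<phi> Q (n + Poly_Mapping.single \<alpha> k) s" "\<And>i j. i \<in> box (Poly_Mapping.single \<alpha> k) \<Longrightarrow> j \<in> box n \<Longrightarrow> s (j + i) = u i j" by auto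
  show ?case
  proof (rule lift_adjust[OF s(1)])
    fix i assume i: "i \<in> box (n + Poly_Mapping.single \<alpha> k)"
    obtain i0 m where im: "i = i0 + Poly_Mapping.single \<alpha> m" "\<alpha> \<notin> Poly_Mapping.keys i0"
      using decompose_exp[of i \<alpha>] by metis
    have le: "Poly_Mapping.lookup i \<beta> \<le> Poly_Mapping.lookup (n + Poly_Mapping.single \<alpha> k) \<beta>" for \<beta> using i by (simp add: box_def)
    have "m \<le> k" using le[of \<alpha>] im plus(1) by (simp add: lookup_add in_keys_iff)
    moreover have "i0 \<in> box n"
      unfolding box_def
    proof (rule CollectI, rule allI)
      fix \<beta> show "Poly_Mapping.lookup i0 \<beta> \<le> Poly_Mapping.lookup n \<beta>"
        using le[of \<beta>] im(2) by (cases "\<beta> = \<alpha>") (auto simp: im(1) lookup_add lookup_single when_def in_keys_iff)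
    qed
    ultimately show "h (s i) = v i" using s(2)[of "Poly_Mapping.single \<alpha> m" i0] u(2) im by (simp add: single_in_box)
  qed (rule T.wit_closed[OF plus(3)])
qed


section \<open>The rings of operators\<close>

lemma (in mpoly) mpoly_hom_UNIV:
  assumes "cring T" "\<phi> \<in> ring_hom S T" "\<And>i. s i \<in> carrier T"
  shows "mpoly_hom S T \<phi> s UNIV"
  by (intro mpoly_hom.intro mpoly_hom_axioms.intro assms mpoly_axioms)

context mpoly
begin

lemma eval_facts:
  assumes "cring T" "\<phi> \<in> ring_hom S T" "\<And>i. s i \<in> carrier T"
  shows "mpoly_eval S T \<phi> s \<in> ring_hom (mpoly_alg S UNIV) T"
    and "k \<in> carrier S \<Longrightarrow> mpoly_eval S T \<phi> s (cst k) = \<phi> k"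
    and "mpoly_eval S T \<phi> s (vr i) = s i"
proof -
  interpret mpoly_hom S T \<phi> s UNIV by (rule mpoly_hom_UNIV[where s = s, OF assms])
  show "mpoly_eval S T \<phi> s \<in> ring_hom (mpoly_alg S UNIV) T"
    and "k \<in> carrier S \<Longrightarrow> mpoly_eval S T \<phi> s (cst k) = \<phi> k"
    and "mpoly_eval S T \<phi> s (vr i) = s i"
    using ev_hom ev_const ev_var by auto
qed

lemma eval_unique:
  assumes "cring T" "\<phi> \<in> ring_hom S T" "\<And>i. s i \<in> carrier T"
    and "g \<in> carrier (mpoly_alg S UNIV)" "h \<in> ring_hom (mpoly_alg S UNIV) T"
    and "\<And>k. k \<in> carrier S \<Longrightarrow> h (cst k) = \<phi> k" "\<And>i. h (vr i) = s i"
  shows "h g = mpoly_eval S T \<phi> s g"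
proof -
  interpret mpoly_hom S T \<phi> s UNIV by (rule mpoly_hom_UNIV[where s = s, OF assms(1-3)])
  show ?thesis
    by (rule ev_unique[OF carrier_is_subring _ subset_refl assms(5)]) (use assms in \<open>auto simp: mpoly_alg_simps\<close>)
qed

lemma eval_comp:
  assumes "cring T" "cring T2" "\<phi> \<in> ring_hom S T" "h \<in> ring_hom T T2" "\<And>k. k \<in> carrier S \<Longrightarrow> \<phi>2 k = h (\<phi> k)"
    and "\<And>i. s i \<in> carrier T" "g \<in> carrier (mpoly_alg S UNIV)"
  shows "h (mpoly_eval S T \<phi> s g) = mpoly_eval S T2 \<phi>2 (\<lambda>i. h (s i)) g"
proof -
  note e = eval_facts[where s = s, OF assms(1,3,6)]
  have p2: "\<phi>2 \<in> ring_hom S T2"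
    using ring_hom_trans[OF assms(3,4)] assms(5) unfolding ring_hom_def by auto
  have "(h \<circ> mpoly_eval S T \<phi> s) g = mpoly_eval S T2 \<phi>2 (\<lambda>i. h (s i)) g"
    by (rule eval_unique[OF assms(2) p2 _ assms(7) ring_hom_trans[OF e(1) assms(4)]])
       (use e assms ring_hom_closed[OF assms(4)] in auto)
  then show ?thesis by simp
qed

lemma eval_cong:
  assumes "cring T" "\<phi> \<in> ring_hom S T" "\<And>i. s i \<in> carrier T" "\<And>i. t i \<in> carrier T"
    and "g \<in> pset J (carrier S)" "\<And>i. i \<in> J \<Longrightarrow> s i = t i"
  shows "mpoly_eval S T \<phi> s g = mpoly_eval S T \<phi> t g"
  by (rule mpoly_hom_ext[OF carrier_is_subring assms(5) subset_UNIV eval_facts(1)[where s = s, OF assms(1-3)] eval_facts(1)[where s = t, OF assms(1,2,4)]])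
     (use assms eval_facts[where s = s, OF assms(1-3)] eval_facts[where s = t, OF assms(1,2,4)] in auto)

lemma eval_id:
  assumes "g \<in> carrier (mpoly_alg S UNIV)"
  shows "mpoly_eval S (mpoly_alg S UNIV) cst vr g = g"
proof -
  have "id g = mpoly_eval S (mpoly_alg S UNIV) cst vr g"
    by (rule eval_unique[OF cring_mpoly cst_hom _ assms id_ring_hom]) (auto simp: vr_closed)
  then show ?thesis by simp
qed

end

section \<open>The universal family and the least subrings\<close>

context witt_base
begin

text \<open>All exponents over the type serve as variables, so that the operator rings of all
  subfamilies are subrings of one ring.\<close>

abbreviation PP :: "('a, ('e \<Rightarrow>\<^sub>0 nat) multiset \<Rightarrow> 's) module" where
  "PP \<equiv> mpoly_alg S UNIV"

abbreviation ev :: "('t, 'm) ring_scheme \<Rightarrow> ('s \<Rightarrow> 't) \<Rightarrow> (('e \<Rightarrow>\<^sub>0 nat) \<Rightarrow> 't) \<Rightarrow> (('e \<Rightarrow>\<^sub>0 nat) multiset \<Rightarrow> 's) \<Rightarrow> 't" where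
  "ev \<equiv> mpoly_eval S"

definition psi :: "('e \<Rightarrow>\<^sub>0 nat) \<Rightarrow> (('e \<Rightarrow>\<^sub>0 nat) multiset \<Rightarrow> 's) \<Rightarrow> (('e \<Rightarrow>\<^sub>0 nat) multiset \<Rightarrow> 's)" where
  "psi i g = ev PP cst (\<lambda>j. vr (j + i)) g"

definition comp :: "(('e \<Rightarrow>\<^sub>0 nat) multiset \<Rightarrow> 's) \<Rightarrow> (('e \<Rightarrow>\<^sub>0 nat) multiset \<Rightarrow> 's) \<Rightarrow> (('e \<Rightarrow>\<^sub>0 nat) multiset \<Rightarrow> 's)" where
  "comp \<beta> \<gamma> = ev PP cst (\<lambda>i. psi i \<gamma>) \<beta>"

lemmas PP_cring = cring_mpoly[where I = "UNIV :: ('e \<Rightarrow>\<^sub>0 nat) set"]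
lemmas PP_cst = cst_hom[where I = "UNIV :: ('e \<Rightarrow>\<^sub>0 nat) set"]
lemma PP_vr: "vr i \<in> carrier PP" by (simp add: vr_closed)
lemma PP_cst_closed: "k \<in> carrier S \<Longrightarrow> cst k \<in> carrier PP" by (rule cst_closed)

lemma psi_hom: "psi i \<in> ring_hom PP PP"
  using eval_facts(1)[OF PP_cring PP_cst, of "\<lambda>j. vr (j + i)"] PP_vr
  by (simp add: psi_def[abs_def])

lemma psi_closed: "g \<in> carrier PP \<Longrightarrow> psi i g \<in> carrier PP"
  by (rule ring_hom_closed[OF psi_hom])

lemma psi_cst: "k \<in> carrier S \<Longrightarrow> psi i (cst k) = cst k"
  and psi_vr: "psi i (vr j) = vr (j + i)"
  using eval_facts(2,3)[OF PP_cring PP_cst, of "\<lambda>j. vr (j + i)"] PP_vr by (simp_all add: psi_def)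

lemma psi_zero: "g \<in> carrier PP \<Longrightarrow> psi 0 g = g"
  by (simp add: psi_def eval_id)

lemma psi_psi: "g \<in> carrier PP \<Longrightarrow> psi i (psi j g) = psi (i + j) g"
  using eval_comp[where s = "\<lambda>l. vr (l + j)" and h = "psi i" and g = g, OF PP_cring PP_cring PP_cst psi_hom, of cst] PP_vr
  unfolding psi_def[of j] psi_def[of "i + j"] by (simp add: psi_cst psi_vr ac_simps)

lemma wcover_PP:
  assumes "subring Q PP" "\<And>r. r \<in> R0 \<Longrightarrow> cst r \<in> Q"
  shows "wcover S R0 M P q PP cst Q"
  by (intro wcover.intro wcover_axioms.intro witt_base_axioms PP_cring PP_cst assms)

definition adm :: "('e \<Rightarrow>\<^sub>0 nat) \<Rightarrow> (('e \<Rightarrow>\<^sub>0 nat) multiset \<Rightarrow> 's) set set" where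
  "adm n = {Q. subring Q PP \<and> cst ` R0 \<subseteq> Q \<and> wit PP cst Q n vr}"

text \<open>Minimality turns each containment into a single integrality test for the universal
  family. That the unions and the truncations of the generated rings are given by these is shown in
  \<open>Lambda_eq\<close> and \<open>Lambda_tr_eq\<close>.\<close>

definition L :: "('e \<Rightarrow>\<^sub>0 nat) \<Rightarrow> (('e \<Rightarrow>\<^sub>0 nat) multiset \<Rightarrow> 's) set" where
  "L n = \<Inter> (adm n)"

lemma adm_nonempty: "carrier PP \<in> adm n"
proof -
  interpret PP: cring PP by (rule PP_cring)
  interpret wcover S R0 M P q PP cst "carrier PP"
    by (rule wcover_PP) (auto intro: PP.carrier_is_subring PP_cst_closed R0_carrier)
  have "wit PP cst (carrier PP) n vr"
    by (rule wit_full) (auto intro: PP_cst_closed PP_vr)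
  then show ?thesis
    unfolding adm_def using PP.carrier_is_subring PP_cst_closed R0_carrier by blast
qed

lemma L_subring: "subring (L n) PP"
proof -
  interpret PP: cring PP by (rule PP_cring)
  show ?thesis
    unfolding L_def by (rule PP.subring_Inter) (use adm_nonempty in \<open>auto simp: adm_def\<close>)
qed

lemma L_carrier: "g \<in> L n \<Longrightarrow> g \<in> carrier PP"
  using subringE(1)[OF L_subring] by blast

lemma L_cst: "r \<in> R0 \<Longrightarrow> cst r \<in> L n"
  by (auto simp: L_def adm_def)

lemma L_wit: "wit PP cst (L n) n vr"
  unfolding L_def by (rule wit_Int) (use adm_nonempty in \<open>auto simp: adm_def\<close>)

lemma L_least: "subring Q PP \<Longrightarrow> (\<And>r. r \<in> R0 \<Longrightarrow> cst r \<in> Q) \<Longrightarrow> wit PP cst Q n vr \<Longrightarrow> L n \<subseteq> Q"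
  unfolding L_def by (rule Inter_lower) (auto simp: adm_def)

lemma wcover_L: "wcover S R0 M P q PP cst (L n)"
  by (rule wcover_PP[OF L_subring L_cst])

lemma L_vr: "i \<in> box n \<Longrightarrow> vr i \<in> L n"
  by (rule wcover.wit_mem[OF wcover_L L_wit])

lemma L_mono: "k \<in> box n \<Longrightarrow> L k \<subseteq> L n"
  unfolding box_iff by (elim exE) (metis L_least L_subring L_cst wit_mono L_wit)

text \<open>With all of \<open>S\<close> as coefficients, integrality only restricts the variables,
  by \<open>wit_full\<close>.\<close>

lemma L_pset: "L n \<subseteq> pset (box n) (carrier S)"
proof -
  have sub: "subring (pset (box n) (carrier S)) PP" by (rule pset_subring[OF carrier_is_subring]) simp
  have c: "cst k \<in> pset (box n) (carrier S)" if "k \<in> carrier S" for k using that by (rule indexed_pset.intros)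
  interpret wcover S R0 M P q PP cst "pset (box n) (carrier S)"
    by (rule wcover_PP[OF sub c[OF R0_carrier]])
  have "vr i \<in> pset (box n) (carrier S)" if "i \<in> box n" for i
    unfolding indexed_var_def by (rule indexed_pset.intros(3)[OF c that]) simp
  then show ?thesis
    by (intro L_least sub c[OF R0_carrier] wit_full[OF c] PP_vr)
qed

end

section \<open>Evaluation of the operator rings at integral families\<close>

context wcover
begin

lemma ev_closed: "(\<And>i. s i \<in> carrier T) \<Longrightarrow> g \<in> carrier PP \<Longrightarrow> ev T \<phi> s g \<in> carrier T"
  by (rule ring_hom_closed[OF eval_facts(1)[OF T.is_cring phi]])

lemma ev_cst: "(\<And>i. s i \<in> carrier T) \<Longrightarrow> k \<in> carrier S \<Longrightarrow> ev T \<phi> s (cst k) = \<phi> k"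
  by (rule eval_facts(2)[OF T.is_cring phi])

lemma ev_vr: "(\<And>i. s i \<in> carrier T) \<Longrightarrow> ev T \<phi> s (vr i) = s i"
  by (rule eval_facts(3)[OF T.is_cring phi])

lemma ev_hom: "(\<And>i. s i \<in> carrier T) \<Longrightarrow> ev T \<phi> s \<in> ring_hom PP T"
  by (rule eval_facts(1)[OF T.is_cring phi])

lemma ev_preimage_subring:
  assumes "\<And>i. s i \<in> carrier T"
  shows "subring {g \<in> carrier PP. ev T \<phi> s g \<in> Q} PP"
proof -
  interpret PP: cring PP by (rule PP_cring)
  note e = ev_hom[of s, OF assms]
  show ?thesis
    by (rule PP.subringI) 
       (auto simp: ring_hom_one[OF e] ring_hom_add[OF e] ring_hom_mult[OF e] ring_hom_minus(2)[OF PP_cring T.is_cring e] subringE[OF Q])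
qed

text \<open>The preimage of \<open>Q\<close> under evaluation at an integral \<open>s\<close> is a
  subring for which the universal family is integral, so it contains \<open>L n\<close>. Conversely
  \<open>s\<close> is the image of the universal family under evaluation. Hence \<open>L n\<close>
  represents integral families.\<close>

lemma wit_iff:
  assumes s: "\<And>i. s i \<in> carrier T"
  shows "wit T \<phi> Q n s \<longleftrightarrow> (\<forall>g\<in>L n. ev T \<phi> s g \<in> Q)"
proof
  assume w: "wit T \<phi> Q n s"
  let ?Q = "{g \<in> carrier PP. ev T \<phi> s g \<in> Q}"
  have "wit PP cst ?Q n vr"
    by (rule wit_hom_reflect[where h = "ev T \<phi> s", OF PP_cring T.is_cring ev_hom[of s, OF s] PP_cst, of \<phi> Q])
       (use w s in \<open>auto simp: ev_cst ev_vr PP_vr\<close>)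
  then have "L n \<subseteq> ?Q"
    by (intro L_least ev_preimage_subring) (use s in \<open>auto simp: ev_cst R0_carrier PP_cst_closed phi_R0\<close>)
  then show "\<forall>g\<in>L n. ev T \<phi> s g \<in> Q" by auto
next
  assume *: "\<forall>g\<in>L n. ev T \<phi> s g \<in> Q"
  have "wit T \<phi> Q n (\<lambda>i. ev T \<phi> s (vr i))"
    by (rule wit_hom[OF PP_cring T.is_cring ev_hom[of s, OF s] PP_cst _ _ L_wit]) (use * s in \<open>auto simp: ev_cst\<close>)
  then show "wit T \<phi> Q n s" using s by (simp add: ev_vr)
qed

lemma ev_mem: "wit T \<phi> Q n s \<Longrightarrow> g \<in> L n \<Longrightarrow> ev T \<phi> s g \<in> Q"
  using wit_iff wit_closed by blast

lemma ev_cong_L: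
  assumes "\<And>i. s i \<in> carrier T" "\<And>i. t i \<in> carrier T" "g \<in> L n" "\<And>i. i \<in> box n \<Longrightarrow> s i = t i"
  shows "ev T \<phi> s g = ev T \<phi> t g"
  by (rule eval_cong[OF T.is_cring phi assms(1,2)]) (use L_pset assms in auto)

lemma ev_pointwise:
  assumes "\<And>i j. u i j \<in> carrier T" "g \<in> carrier PP"
  shows "ev (fun_ring T) (\<lambda>r i. \<phi> r) u g = (\<lambda>j. ev T \<phi> (\<lambda>i. u i j) g)"
proof
  fix j
  show "ev (fun_ring T) (\<lambda>r i. \<phi> r) u g j = ev T \<phi> (\<lambda>i. u i j) g"
    using eval_comp[OF cring_fun_ring[OF T.is_cring] T.is_cring const_hom ring_hom_apply[of j], of \<phi> u g] assms by simp
qed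

text \<open>The equaliser of \<open>u\<close> and the evaluation cannot be tested with
  \<open>del\<close> directly, since multiplication by \<open>x\<close> means nothing for
  \<open>u\<close>. But it is saturated, because \<open>T\<close> has no torsion for the ideals
  (\<open>span_cancel'\<close>), and so \<open>wit_saturated\<close> makes the universal family
  integral for it.\<close>

lemma hom_eq_ev:
  assumes u: "u \<in> ring_hom (PP\<lparr>carrier := L n\<rparr>) T" and uQ: "\<And>g. g \<in> L n \<Longrightarrow> u g \<in> Q"
    and u_cst: "\<And>r. r \<in> R0 \<Longrightarrow> u (cst r) = \<phi> r"
    and s: "\<And>i. s i \<in> carrier T" "\<And>i. i \<in> box n \<Longrightarrow> u (vr i) = s i" and g: "g \<in> L n"
  shows "u g = ev T \<phi> s g"
proof -
  interpret PP: cring PP by (rule PP_cring)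
  interpret C: wcover S R0 M P q PP cst "L n" by (rule wcover_L)
  let ?Q = "{g \<in> L n. u g = ev T \<phi> s g}"
  note e = ev_hom[of s, OF s(1)] and Ls = subringE[OF L_subring] 
  have um: "u (f \<otimes>\<^bsub>PP\<^esub> g) = u f \<otimes>\<^bsub>T\<^esub> u g" "u (f \<oplus>\<^bsub>PP\<^esub> g) = u f \<oplus>\<^bsub>T\<^esub> u g" if "f \<in> L n" "g \<in> L n" for f g
    using that ring_hom_mult[OF u, of f g] ring_hom_add[OF u, of f g] by simp_all
  have u1: "u \<one>\<^bsub>PP\<^esub> = \<one>\<^bsub>T\<^esub>" using ring_hom_one[OF u] by simp
  have uc: "u g \<in> carrier T" if "g \<in> L n" for g using uQ[OF that] Q_carrier by auto
  have cring_L: "cring (PP\<lparr>carrier := L n\<rparr>)"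
    using PP.subcring_iff[OF Ls(1)] PP.subcringI'[OF L_subring] by blast
  have sub: "subring ?Q PP"
  proof (rule PP.subringI)
    fix f assume f: "f \<in> ?Q"
    then have fc: "f \<in> L n" "f \<in> carrier PP" using L_carrier by auto
    have "u (\<ominus>\<^bsub>PP\<^esub> f) \<oplus>\<^bsub>T\<^esub> u f = u (\<ominus>\<^bsub>PP\<^esub> f \<oplus>\<^bsub>PP\<^esub> f)"
      using fc Ls(5) by (simp add: um)
    also have "\<dots> = \<zero>\<^bsub>T\<^esub>" using fc ring_hom_zero[OF u] cring_L T.ring_axioms 
      by (simp add: PP.l_neg cring.axioms(1))
    finally have "u (\<ominus>\<^bsub>PP\<^esub> f) = \<ominus>\<^bsub>T\<^esub> u f" using fc Ls(5) uc by (intro T.minus_equality[symmetric]) auto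
    then show "\<ominus>\<^bsub>PP\<^esub> f \<in> ?Q"
      using f fc Ls(5) ring_hom_minus(2)[OF PP_cring T.is_cring e fc(2) fc(2)] by simp
  qed (use Ls um u1 L_carrier in \<open>auto simp: ring_hom_one[OF e] ring_hom_add[OF e] ring_hom_mult[OF e]\<close>)
  have "wit PP cst ?Q n vr"
  proof (rule C.wit_saturated[OF sub _ _ _ L_wit])
    fix \<alpha> y assume y: "y \<in> L n" "\<And>a. a \<in> M \<alpha> \<Longrightarrow> cst a \<otimes>\<^bsub>PP\<^esub> y \<in> ?Q"
    have "u y = ev T \<phi> s y"
    proof (rule span_cancel'[where \<alpha> = \<alpha>])
      fix a assume a: "a \<in> M \<alpha>"
      then have aR: "a \<in> R0" using M_sub by auto
      have "\<phi> a \<otimes>\<^bsub>T\<^esub> u y = u (cst a \<otimes>\<^bsub>PP\<^esub> y)" using aR y(1) by (simp add: um L_cst u_cst)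
      also have "\<dots> = ev T \<phi> s (cst a \<otimes>\<^bsub>PP\<^esub> y)" using y(2)[OF a] by simp
      also have "\<dots> = \<phi> a \<otimes>\<^bsub>T\<^esub> ev T \<phi> s y" 
        using aR y(1) s(1) L_carrier by (simp add: ring_hom_mult[OF e] PP_cst_closed R0_carrier ev_cst)
      finally show "\<phi> a \<otimes>\<^bsub>T\<^esub> u y = \<phi> a \<otimes>\<^bsub>T\<^esub> ev T \<phi> s y" .
    qed (use y(1) uc ev_closed[of s, OF s(1)] L_carrier in auto)
    then show "y \<in> ?Q" using y(1) by simp
  qed (use L_cst u_cst s L_vr in \<open>auto simp: ev_cst ev_vr R0_carrier\<close>)
  then have "L n \<subseteq> ?Q"
    by (intro L_least sub) (use L_cst u_cst s in \<open>auto simp: ev_cst R0_carrier\<close>)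
  then show ?thesis using g by auto
qed

end

section \<open>Composition, generation and truncation of the operator rings\<close>

context witt_base
begin

lemma ev_hat_vr: "g \<in> carrier PP \<Longrightarrow> ev (fun_ring PP) (\<lambda>r i. cst r) (\<lambda>i j. vr (j + i)) g = (\<lambda>j. psi j g)"
  by (subst wcover.ev_pointwise[OF wcover_L[of 0]]) (auto simp: PP_vr psi_def ac_simps)

text \<open>By \<open>wit_hat\<close> the rows of the universal family are integral along
  \<open>n''\<close> over the ring of families that are integral up to \<open>n'\<close>. Evaluating
  \<open>\<gamma>\<close> at them gives the family of the \<open>psi i \<gamma>\<close>.\<close>

lemma L_comp_wit:
  assumes "\<gamma> \<in> L n''"
  shows "wit PP cst (L (n' + n'')) n' (\<lambda>i. psi i \<gamma>)"
proof -
  interpret C: wcover S R0 M P q PP cst "L (n' + n'')" by (rule wcover_L)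
  interpret F: wcover S R0 M P q "fun_ring PP :: (('e \<Rightarrow>\<^sub>0 nat) \<Rightarrow> _) ring" "\<lambda>r i. cst r" "{s. wit PP cst (L (n' + n'')) n' s}"
    by (rule C.wcover_fun)
  have "ev (fun_ring PP) (\<lambda>r i. cst r) (\<lambda>i j. vr (j + i)) \<gamma> \<in> {s. wit PP cst (L (n' + n'')) n' s}"
    by (rule F.ev_mem[OF C.wit_hat[OF L_wit] assms])
  then show ?thesis using L_carrier[OF assms] by (simp add: ev_hat_vr)
qed

lemma L_comp: "\<beta> \<in> L n' \<Longrightarrow> \<gamma> \<in> L n'' \<Longrightarrow> comp \<beta> \<gamma> \<in> L (n' + n'')"
  unfolding comp_def by (rule wcover.ev_mem[OF wcover_L L_comp_wit])

text \<open>The case \<open>n' = bexp \<alpha>\<close> of \<open>L_comp_wit\<close>. It keeps the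
  generators added by \<open>Lambda_step\<close> inside the rings \<open>L n\<close>.\<close>

lemma L_left_del:
  assumes "g \<in> L n" "x \<in> P \<alpha>"
  shows "cst x \<otimes>\<^bsub>PP\<^esub> (psi (bexp \<alpha>) g \<ominus>\<^bsub>PP\<^esub> g [^]\<^bsub>PP\<^esub> q \<alpha>) \<in> L (n + bexp \<alpha>)"
proof -
  have "wit PP cst (L (bexp \<alpha> + n)) 0 (del PP cst \<alpha> x (\<lambda>i. psi i g))"
    by (rule wit_del[OF _ assms(2)]) (use L_comp_wit[OF assms(1)] in simp)
  from wit_zero[OF this] show ?thesis
    using psi_zero[OF L_carrier[OF assms(1)]] by (simp add: del_def ac_simps)
qed

text \<open>If \<open>Q\<close> contains the compositions, then for \<open>\<gamma>\<close> in
  \<open>L n''\<close> the family of the \<open>psi j \<gamma>\<close> is integral up to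
  \<open>n'\<close>. By \<open>wit_iff\<close> this is the integrality of the family of rows along
  \<open>n''\<close>, and \<open>wit_unhat\<close> yields that of the universal family. Injectivity
  of the canonical map rests on this.\<close>

lemma comp_generates:
  assumes "Poly_Mapping.keys n' \<inter> Poly_Mapping.keys n'' = {}" "subring Q PP" "\<And>r. r \<in> R0 \<Longrightarrow> cst r \<in> Q"
    and comp: "\<And>\<beta> \<gamma>. \<beta> \<in> L n' \<Longrightarrow> \<gamma> \<in> L n'' \<Longrightarrow> comp \<beta> \<gamma> \<in> Q"
  shows "L (n' + n'') \<subseteq> Q"
proof -
  interpret C: wcover S R0 M P q PP cst Q by (rule wcover_PP[OF assms(2,3)])
  interpret F: wcover S R0 M P q "fun_ring PP :: (('e \<Rightarrow>\<^sub>0 nat) \<Rightarrow> _) ring" "\<lambda>r i. cst r" "{s. wit PP cst Q n' s}"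
    by (rule C.wcover_fun)
  have "wit (fun_ring PP) (\<lambda>r i. cst r) {s. wit PP cst Q n' s} n'' (\<lambda>i j. vr (j + i))"
  proof (subst F.wit_iff)
    show "\<forall>\<gamma>\<in>L n''. ev (fun_ring PP) (\<lambda>r i. cst r) (\<lambda>i j. vr (j + i)) \<gamma> \<in> {s. wit PP cst Q n' s}"
    proof
      fix \<gamma> assume \<gamma>: "\<gamma> \<in> L n''"
      have "wit PP cst Q n' (\<lambda>j. psi j \<gamma>)"
        using \<gamma> comp psi_closed L_carrier by (subst C.wit_iff) (auto simp: comp_def)
      then show "ev (fun_ring PP) (\<lambda>r i. cst r) (\<lambda>i j. vr (j + i)) \<gamma> \<in> {s. wit PP cst Q n' s}"
        using L_carrier[OF \<gamma>] by (simp add: ev_hat_vr)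
    qed
  qed (simp add: PP_vr)
  from C.wit_unhat[OF this assms(1)] show ?thesis by (intro L_least assms(2,3))
qed

text \<open>The universal family is extended by one step inside the smaller ring to an integral
  family \<open>t\<close>. Evaluation at \<open>t\<close> sends \<open>g\<close> into the smaller
  ring, yet it fixes \<open>g\<close>, whose variables lie in the box where \<open>t\<close> is
  still universal.\<close>

lemma L_int: "g \<in> L (n + m) \<Longrightarrow> g \<in> pset (box n) (carrier S) \<Longrightarrow> g \<in> L n"
proof (induct m arbitrary: g rule: exp_induct)
  case (step m)
  consider "m = 0" | k \<alpha> where "m = k + bexp \<alpha>" using exp_cases by blast
  then show ?case
  proof cases
    case (2 k \<alpha>)
    interpret C: wcover S R0 M P q PP cst "L (n + k)" by (rule wcover_L)
    obtain t where t: "wit PP cst (L (n + k)) (n + k + bexp \<alpha>) t" "\<And>i. i \<in> box (n + k) \<Longrightarrow> t i = vr i"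
      using C.extend[OF L_wit] by blast
    have "ev PP cst t g \<in> L (n + k)"
      by (rule C.ev_mem[OF t(1)]) (use step(2) 2 in \<open>simp add: ac_simps\<close>)
    moreover have "ev PP cst t g = ev PP cst vr g"
      by (rule eval_cong[OF PP_cring PP_cst _ _ step(3)]) (use t wit_closed PP_vr box_mono in \<open>blast+\<close>)
    ultimately have "g \<in> L (n + k)" by (simp add: eval_id[OF L_carrier[OF step(2)]])
    then show ?thesis using step(1)[OF 2] step(3) by blast
  qed (use step(2) in simp)
qed

text \<open>The universal family is the family of all \<open>psi i g\<close> for
  \<open>g = vr 0\<close>. Integrality is proved for every \<open>g\<close> in \<open>Q\<close>,
  because \<open>del\<close> turns the family of \<open>g\<close> into the family of another element
  of \<open>Q\<close>.\<close>

lemma L_subset_closed: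
  assumes Q: "subring Q PP" "\<And>r. r \<in> R0 \<Longrightarrow> cst r \<in> Q" "vr 0 \<in> Q"
    and del: "\<And>g \<alpha> x. g \<in> Q \<Longrightarrow> \<alpha> \<in> E \<Longrightarrow> x \<in> P \<alpha> \<Longrightarrow> cst x \<otimes>\<^bsub>PP\<^esub> (psi (bexp \<alpha>) g \<ominus>\<^bsub>PP\<^esub> g [^]\<^bsub>PP\<^esub> q \<alpha>) \<in> Q"
    and n: "n \<in> exponents E"
  shows "L n \<subseteq> Q"
proof -
  interpret PP: cring PP by (rule PP_cring)
  have Qc: "g \<in> carrier PP" if "g \<in> Q" for g using subringE(1)[OF Q(1)] that by auto
  have "wit PP cst Q n (\<lambda>i. psi i g)" if "g \<in> Q" for g
    using n that
  proof (induct n arbitrary: g rule: exp_induct)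
    case (step n)
    have gc: "g \<in> carrier PP" using step(3) Qc by simp
    show ?case
    proof (rule witI)
      show "psi 0 g \<in> Q" using step(3) gc by (simp add: psi_zero)
      fix \<alpha> k x assume k: "n = k + bexp \<alpha>" and x: "x \<in> P \<alpha>"
      let ?d = "cst x \<otimes>\<^bsub>PP\<^esub> (psi (bexp \<alpha>) g \<ominus>\<^bsub>PP\<^esub> g [^]\<^bsub>PP\<^esub> q \<alpha>)"
      have xc: "x \<in> carrier S" using x P_carrier by auto
      \<comment> \<open>\<open>psi i\<close> is a ring homomorphism that fixes the constants, so it
        commutes with the operation defining \<open>?d\<close>.\<close>
      have "psi i ?d = del PP cst \<alpha> x (\<lambda>i. psi i g) i" for i
      proof -
        have "psi i ?d = cst x \<otimes>\<^bsub>PP\<^esub> (psi i (psi (bexp \<alpha>) g) \<ominus>\<^bsub>PP\<^esub> psi i g [^]\<^bsub>PP\<^esub> q \<alpha>)"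
          using xc gc psi_closed by (simp add: ring_hom_mult[OF psi_hom] ring_hom_minus[OF PP_cring PP_cring psi_hom] PP_cst_closed psi_cst)
        then show ?thesis using gc by (simp add: del_def psi_psi)
      qed
      then have "del PP cst \<alpha> x (\<lambda>i. psi i g) = (\<lambda>i. psi i ?d)" by auto
      moreover have "\<alpha> \<in> E" "k \<in> exponents E" using step(2) by (auto simp: k exponents_def keys_plus_bexp)
      ultimately show "wit PP cst Q k (del PP cst \<alpha> x (\<lambda>i. psi i g))"
        using step(1)[OF k] del[OF step(3) _ x] by simp
    qed (rule psi_closed[OF gc])
  qed
  from this[OF Q(3)] have "wit PP cst Q n (\<lambda>i. psi i (vr 0))" .
  moreover have "(\<lambda>i. psi i (vr 0)) = vr"
    by (rule ext) (simp only: psi_vr add_0)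
  ultimately have "wit PP cst Q n vr" by (rule back_subst[where P = "wit PP cst Q n"])
  then show ?thesis by (intro L_least Q)
qed

end


section \<open>Lifting homomorphisms to ghost vectors\<close>

text \<open>One symbol for sum and product, so that each statement about both operations is proved
  once.\<close>

definition rop :: "bool \<Rightarrow> ('t, 'm) ring_scheme \<Rightarrow> 't \<Rightarrow> 't \<Rightarrow> 't" where
  "rop b T x y = (if b then x \<oplus>\<^bsub>T\<^esub> y else x \<otimes>\<^bsub>T\<^esub> y)"

lemma rop_hom: "h \<in> ring_hom T U \<Longrightarrow> x \<in> carrier T \<Longrightarrow> y \<in> carrier T \<Longrightarrow> h (rop b T x y) = rop b U (h x) (h y)"
  by (simp add: rop_def ring_hom_mult ring_hom_add)

lemma subring_rop: "subring Q T \<Longrightarrow> x \<in> Q \<Longrightarrow> y \<in> Q \<Longrightarrow> rop b T x y \<in> Q"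
  by (simp add: rop_def subringE)

lemma rop_closed: "cring T \<Longrightarrow> x \<in> carrier T \<Longrightarrow> y \<in> carrier T \<Longrightarrow> rop b T x y \<in> carrier T"
  by (auto simp: rop_def cring.cring_simprules)

lemma rop_update [simp]: "rop b (T\<lparr>carrier := Q\<rparr>) = rop b T"
  by (auto simp: rop_def fun_eq_iff)

lemma cring_subring:
  assumes "cring T" "subring Q T"
  shows "cring (T\<lparr>carrier := Q\<rparr>)"
proof -
  interpret T: cring T by fact
  show ?thesis using T.subcring_iff[OF subringE(1)[OF assms(2)]] T.subcringI'[OF assms(2)] by blast
qed

lemma subring_hom:
  assumes "cring T" "cring A" "subring Q T" "h \<in> ring_hom (T\<lparr>carrier := Q\<rparr>) A"
  shows "\<And>x. x \<in> Q \<Longrightarrow> h x \<in> carrier A"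
    and "\<And>x y. x \<in> Q \<Longrightarrow> y \<in> Q \<Longrightarrow> h (rop b T x y) = rop b A (h x) (h y)"
    and "h \<one>\<^bsub>T\<^esub> = \<one>\<^bsub>A\<^esub>"
    and "\<And>x. x \<in> Q \<Longrightarrow> h (\<ominus>\<^bsub>T\<^esub> x) = \<ominus>\<^bsub>A\<^esub> h x"
proof -
  interpret T: cring T by fact
  interpret A: cring A by fact
  note Q = subringE[OF assms(3)]
  show c: "h x \<in> carrier A" if "x \<in> Q" for x using ring_hom_closed[OF assms(4)] that by simp
  show o: "h (rop b T x y) = rop b A (h x) (h y)" if "x \<in> Q" "y \<in> Q" for x y b
    using rop_hom[OF assms(4), of x y b] that by simp
  show "h \<one>\<^bsub>T\<^esub> = \<one>\<^bsub>A\<^esub>" using ring_hom_one[OF assms(4)] by simp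
  show "h (\<ominus>\<^bsub>T\<^esub> x) = \<ominus>\<^bsub>A\<^esub> h x" if x: "x \<in> Q" for x
  proof (rule A.minus_equality[symmetric])
    have "h (\<ominus>\<^bsub>T\<^esub> x) \<oplus>\<^bsub>A\<^esub> h x = h (\<zero>\<^bsub>T\<^esub>)"
      using o[of "\<ominus>\<^bsub>T\<^esub> x" x True] Q x by (simp add: rop_def T.l_neg subset_iff)
    also have "\<dots> = \<zero>\<^bsub>A\<^esub>"
      using ring_hom_zero[OF assms(4)] cring_subring[OF assms(1,3)] A.ring_axioms by (simp add: cring.axioms(1))
    finally show "h (\<ominus>\<^bsub>T\<^esub> x) \<oplus>\<^bsub>A\<^esub> h x = \<zero>\<^bsub>A\<^esub>" .
  qed (use x Q c in auto)
qed

lemma algebra_facts: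
  assumes "algebra R B"
  shows "cring R" "cring B" "struct_map B \<in> ring_hom R B"
    and "\<And>r x. r \<in> carrier R \<Longrightarrow> x \<in> carrier B \<Longrightarrow> r \<odot>\<^bsub>B\<^esub> x = struct_map B r \<otimes>\<^bsub>B\<^esub> x"
proof -
  interpret algebra R B by fact
  show "cring R" by (rule R.is_cring)
  show "cring B" by unfold_locales
  show "struct_map B \<in> ring_hom R B"
    by (rule ring_hom_memI) (auto simp: struct_map_def smult_l_distr smult_assoc1 smult_assoc2)
  show "r \<odot>\<^bsub>B\<^esub> x = struct_map B r \<otimes>\<^bsub>B\<^esub> x" if "r \<in> carrier R" "x \<in> carrier B" for r x
    using that by (simp add: struct_map_def smult_assoc2)
qed

lemma alg_hom_iff:
  assumes "algebra R B" "algebra R C"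
  shows "h \<in> alg_hom R B C \<longleftrightarrow> h \<in> ring_hom B C \<and> (\<forall>r\<in>carrier R. h (struct_map B r) = struct_map C r)"
proof -
  note B = algebra_facts[OF assms(1)] and C = algebra_facts[OF assms(2)]
  interpret B: cring B by (rule B)
  interpret C: cring C by (rule C)
  show ?thesis
  proof (intro iffI conjI ballI)
    assume h: "h \<in> alg_hom R B C"
    then show "h \<in> ring_hom B C" by (simp add: alg_hom_def)
    fix r assume "r \<in> carrier R"
    then show "h (struct_map B r) = struct_map C r"
      using h by (auto simp: alg_hom_def struct_map_def ring_hom_one)
  next
    assume h: "h \<in> ring_hom B C \<and> (\<forall>r\<in>carrier R. h (struct_map B r) = struct_map C r)"
    then show "h \<in> alg_hom R B C"
      using ring_hom_closed[OF B(3)] by (auto simp: alg_hom_def B(4) C(4) ring_hom_mult ring_hom_closed)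
  qed
qed

section \<open>Polynomials over a subring of the coefficients\<close>

lemma (in mpoly) mpoly_sub_ops:
  assumes "subring K S"
  shows "ring.indexed_const (S\<lparr>carrier := K\<rparr>) k = cst k"
    and "ring.indexed_pmult (S\<lparr>carrier := K\<rparr>) f i = indexed_pmult f i"
    and "ring.indexed_padd (S\<lparr>carrier := K\<rparr>) f g = indexed_padd f g"
    and "ring.indexed_var (S\<lparr>carrier := K\<rparr>) i = vr i"
proof -
  let ?S = "S\<lparr>carrier := K\<rparr>"
  interpret K: mpoly ?S by (rule mpoly.intro) (rule cring_subring[OF is_cring assms])
  show "ring.indexed_const ?S k = cst k"
    by (simp add: fun_eq_iff K.indexed_const_def indexed_const_def)
  show "ring.indexed_pmult ?S f i = indexed_pmult f i"
    by (simp add: fun_eq_iff K.indexed_pmult_def indexed_pmult_def)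
  show "ring.indexed_padd ?S f g = indexed_padd f g"
    by (simp add: fun_eq_iff K.indexed_padd_def indexed_padd_def)
  show "ring.indexed_var ?S i = vr i"
    by (simp add: fun_eq_iff K.indexed_var_def indexed_var_def K.indexed_pmult_def indexed_pmult_def K.indexed_const_def indexed_const_def)
qed

lemma (in mpoly) mpoly_sub_pset:
  assumes "subring K S"
  shows "ring.indexed_pset (S\<lparr>carrier := K\<rparr>) J B = pset J B"
proof -
  interpret K: mpoly "S\<lparr>carrier := K\<rparr>" by (rule mpoly.intro) (rule cring_subring[OF is_cring assms])
  note e = mpoly_sub_ops[OF assms]
  show ?thesis
  proof (intro equalityI subsetI)
    fix f assume "f \<in> ring.indexed_pset (S\<lparr>carrier := K\<rparr>) J B"
    then show "f \<in> pset J B"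
      by (induct rule: K.indexed_pset.induct) (auto simp only: e intro: indexed_pset.intros)
  next
    fix f assume "f \<in> pset J B"
    then show "f \<in> ring.indexed_pset (S\<lparr>carrier := K\<rparr>) J B"
      by (induct rule: indexed_pset.induct) (auto simp only: e[symmetric] intro: K.indexed_pset.intros)
  qed
qed

text \<open>The two products are sums in different records, which agree because all terms lie in
  \<open>K\<close>.\<close>

lemma (in mpoly) mpoly_sub_mult:
  assumes "subring K S" "f \<in> pset J K" "g \<in> pset J K"
  shows "f \<otimes>\<^bsub>mpoly_alg (S\<lparr>carrier := K\<rparr>) I\<^esub> g = f \<otimes>\<^bsub>mpoly_alg S I'\<^esub> g"
proof -
  let ?S = "S\<lparr>carrier := K\<rparr>"
  interpret K: mpoly ?S by (rule mpoly.intro) (rule cring_subring[OF is_cring assms(1)])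
  have "f w \<in> K" "g w \<in> K" for w using supp_coeff[OF _ assms(1)] assms by auto
  then have "K.conv f g = conv f g"
    unfolding K.conv_def conv_def using subringE(6)[OF assms(1)]
    by (auto simp: fun_eq_iff intro!: finsum_subring[OF assms(1), simplified])
  then show ?thesis
    by (simp add: mpoly_mult K.mpoly_mult)
qed

section \<open>Covers of an algebra and lifts of homomorphisms\<close>

locale witt_alg = witt_base S R0 M P q
  for S :: "('a, 's) module" (structure) and R0 and M P :: "'e \<Rightarrow> 's set" and q +
  fixes R :: "'a ring"
  assumes S_alg: "algebra R S" and R0_eq: "R0 = struct_map S ` carrier R"
    and struct_inj: "inj_on (struct_map S) (carrier R)"
begin

abbreviation io :: "'a \<Rightarrow> 's" where "io \<equiv> struct_map S"

lemmas R_cring = algebra_facts(1)[OF S_alg]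
lemmas io_hom = algebra_facts(3)[OF S_alg]
lemma io_R0: "r \<in> carrier R \<Longrightarrow> io r \<in> R0" by (simp add: R0_eq)
lemma io_carrier: "r \<in> carrier R \<Longrightarrow> io r \<in> carrier S" using io_R0 R0_carrier by blast

lemma mpoly_smult:
  assumes "r \<in> carrier R" "f \<in> pset J (carrier S)"
  shows "r \<odot>\<^bsub>mpoly_alg S I\<^esub> f = cst (io r) \<otimes>\<^bsub>mpoly_alg S I\<^esub> f"
  using assms pset_coeff[OF assms(2)] 
  by (simp add: mpoly_alg_simps mpoly_mult conv_const io_carrier algebra_facts(4)[OF S_alg])

lemma struct_map_mpoly:
  assumes "r \<in> carrier R"
  shows "struct_map ((mpoly_alg S I)\<lparr>carrier := Q\<rparr>) r = cst (io r)"
proof -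
  have "cst \<one> \<in> pset I (carrier S)" by (simp add: indexed_pset.intros)
  then have "r \<odot>\<^bsub>mpoly_alg S I\<^esub> \<one>\<^bsub>mpoly_alg S I\<^esub> = cst (io r) \<otimes>\<^bsub>mpoly_alg S I\<^esub> \<one>\<^bsub>mpoly_alg S I\<^esub>"
    using mpoly_smult[OF assms] by (simp add: mpoly_alg_simps)
  also have "\<dots> = cst (io r)"
    using cring.cring_simprules(12)[OF cring_mpoly] cring.cring_simprules cst_closed[OF io_carrier[OF assms]]
    by (metis cring_mpoly)
  finally show ?thesis by (simp add: struct_map_def)
qed

lemma algebra_sub_mpoly:
  assumes "subring Q (mpoly_alg S I)" "\<And>r. r \<in> R0 \<Longrightarrow> cst r \<in> Q"
  shows "algebra R ((mpoly_alg S I)\<lparr>carrier := Q\<rparr>)"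
proof -
  let ?P = "mpoly_alg S I"
  interpret P: cring ?P by (rule cring_mpoly)
  note Q = subringE[OF assms(1)]
  have Qp: "f \<in> pset I (carrier S)" "f \<in> carrier ?P" if "f \<in> Q" for f using that Q(1) by (auto simp: mpoly_alg_simps)
  have sm: "r \<odot>\<^bsub>?P\<^esub> f = cst (io r) \<otimes>\<^bsub>?P\<^esub> f" if "r \<in> carrier R" "f \<in> Q" for r f
    using that Qp by (intro mpoly_smult) auto
  have io: "cst (io r) \<in> Q" "cst (io r) \<in> carrier ?P" if "r \<in> carrier R" for r 
    using that assms(2) io_R0 Qp by auto
  have ih: "cst (io (r \<oplus>\<^bsub>R\<^esub> r')) = cst (io r) \<oplus>\<^bsub>?P\<^esub> cst (io r')" "cst (io (r \<otimes>\<^bsub>R\<^esub> r')) = cst (io r) \<otimes>\<^bsub>?P\<^esub> cst (io r')"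
    if "r \<in> carrier R" "r' \<in> carrier R" for r r'
    using that by (simp_all add: ring_hom_add[OF io_hom] ring_hom_mult[OF io_hom] ring_hom_add[OF cst_hom[where I = I]] ring_hom_mult[OF cst_hom[where I = I]] io_carrier)
  have i1: "cst (io \<one>\<^bsub>R\<^esub>) = \<one>\<^bsub>?P\<^esub>" by (simp add: ring_hom_one[OF io_hom] mpoly_alg_simps)
  interpret R: cring R by (rule R_cring)
  show ?thesis
  proof (rule algebraI)
    show "cring (?P\<lparr>carrier := Q\<rparr>)" by (rule cring_subring[OF P.is_cring assms(1)])
  qed (use sm io Qp Q in \<open>simp_all add: R_cring ih i1 P.l_distr P.r_distr P.m_assoc\<close>)
qed

text \<open>Surjectivity of \<open>p\<close> is required separately: with \<open>L n\<close> inside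
  \<open>PP\<close> as the cover, the predicate says that \<open>a\<close> is an algebra
  homomorphism on \<open>L n\<close>, and this use is as frequent as that for the coverings of
  \<open>A\<close>.\<close>

definition pcov :: "('t, 'm) ring_scheme \<Rightarrow> ('s \<Rightarrow> 't) \<Rightarrow> 't set \<Rightarrow> ('a, 'c) module \<Rightarrow> ('t \<Rightarrow> 'c) \<Rightarrow> bool" where
  "pcov T \<phi> Q A p \<longleftrightarrow> wcover S R0 M P q T \<phi> Q \<and> algebra R A \<and> p \<in> ring_hom (T\<lparr>carrier := Q\<rparr>) A \<and>
     (\<forall>r\<in>carrier R. p (\<phi> (io r)) = struct_map A r)"

lemma pcov_facts:
  assumes "pcov T \<phi> Q A p"
  shows "cring T" "cring A" "\<phi> \<in> ring_hom S T" "subring Q T"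
    and "\<And>x. x \<in> Q \<Longrightarrow> p x \<in> carrier A"
    and "\<And>x y b. x \<in> Q \<Longrightarrow> y \<in> Q \<Longrightarrow> p (rop b T x y) = rop b A (p x) (p y)"
    and "p \<one>\<^bsub>T\<^esub> = \<one>\<^bsub>A\<^esub>" "\<And>x. x \<in> Q \<Longrightarrow> p (\<ominus>\<^bsub>T\<^esub> x) = \<ominus>\<^bsub>A\<^esub> p x"
    and "\<And>r. r \<in> carrier R \<Longrightarrow> p (\<phi> (io r)) = struct_map A r"
proof -
  interpret wcover S R0 M P q T \<phi> Q using assms by (simp add: pcov_def)
  have A: "cring A" using assms algebra_facts by (auto simp: pcov_def)
  have p: "p \<in> ring_hom (T\<lparr>carrier := Q\<rparr>) A" using assms by (simp add: pcov_def)
  show "cring T" "cring A" "\<phi> \<in> ring_hom S T" "subring Q T" by (fact T.is_cring A phi Q)+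
  note h = subring_hom[OF T.is_cring A Q p]
  show "\<And>x. x \<in> Q \<Longrightarrow> p x \<in> carrier A" "\<And>x y b. x \<in> Q \<Longrightarrow> y \<in> Q \<Longrightarrow> p (rop b T x y) = rop b A (p x) (p y)"
    "p \<one>\<^bsub>T\<^esub> = \<one>\<^bsub>A\<^esub>" "\<And>x. x \<in> Q \<Longrightarrow> p (\<ominus>\<^bsub>T\<^esub> x) = \<ominus>\<^bsub>A\<^esub> p x" using h by blast+
  show "\<And>r. r \<in> carrier R \<Longrightarrow> p (\<phi> (io r)) = struct_map A r" using assms by (simp add: pcov_def)
qed

definition fib :: "'t set \<Rightarrow> ('t \<Rightarrow> 'c) \<Rightarrow> 'u set \<Rightarrow> ('u \<Rightarrow> 'c) \<Rightarrow> ('t \<times> 'u) set" where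
  "fib Q p Q2 p2 = {(x, y). x \<in> Q \<and> y \<in> Q2 \<and> p x = p2 y}"

lemma fib_cover:
  assumes "pcov T \<phi> Q A p" "pcov T2 \<phi>2 Q2 A p2"
  shows "wcover S R0 M P q (RDirProd T T2) (\<lambda>k. (\<phi> k, \<phi>2 k)) (fib Q p Q2 p2)"
proof -
  note 1 = pcov_facts[OF assms(1)] and 2 = pcov_facts[OF assms(2)]
  interpret T: wcover S R0 M P q T \<phi> Q using assms by (simp add: pcov_def)
  interpret T2: wcover S R0 M P q T2 \<phi>2 Q2 using assms by (simp add: pcov_def)
  interpret D: cring "RDirProd T T2" by (rule cring_RDirProd[OF 1(1) 2(1)])
  note Q = subringE[OF 1(4)] and Q2 = subringE[OF 2(4)]
  show ?thesis
  proof (intro wcover.intro wcover_axioms.intro witt_base_axioms D.is_cring)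
    show "(\<lambda>k. (\<phi> k, \<phi>2 k)) \<in> ring_hom S (RDirProd T T2)"
      by (rule ring_hom_memI) (auto simp: T.phi_closed T2.phi_closed ring_hom_mult[OF 1(3)] ring_hom_mult[OF 2(3)]
        ring_hom_add[OF 1(3)] ring_hom_add[OF 2(3)] ring_hom_one[OF 1(3)] ring_hom_one[OF 2(3)])
    show "subring (fib Q p Q2 p2) (RDirProd T T2)"
    proof (rule D.subringI)
      show "fib Q p Q2 p2 \<subseteq> carrier (RDirProd T T2)" using Q(1) Q2(1) by (auto simp: fib_def)
      show "\<one>\<^bsub>RDirProd T T2\<^esub> \<in> fib Q p Q2 p2" using Q Q2 1 2 by (simp add: fib_def)
      fix z assume z: "z \<in> fib Q p Q2 p2"
      then obtain x y where xy: "z = (x, y)" "x \<in> Q" "y \<in> Q2" "p x = p2 y" by (auto simp: fib_def)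
      then have "\<ominus>\<^bsub>RDirProd T T2\<^esub> z = (\<ominus>\<^bsub>T\<^esub> x, \<ominus>\<^bsub>T2\<^esub> y)" 
        using Q(1) Q2(1) by (simp add: RDirProd_a_inv[OF 1(1) 2(1)] subset_iff)
      then show "\<ominus>\<^bsub>RDirProd T T2\<^esub> z \<in> fib Q p Q2 p2" using xy Q Q2 1(8) 2(8) by (simp add: fib_def)
      fix z' assume "z' \<in> fib Q p Q2 p2"
      then obtain x' y' where xy': "z' = (x', y')" "x' \<in> Q" "y' \<in> Q2" "p x' = p2 y'" by (auto simp: fib_def)
      show "z \<oplus>\<^bsub>RDirProd T T2\<^esub> z' \<in> fib Q p Q2 p2"
        using xy xy' Q Q2 1(6)[of x x' True] 2(6)[of y y' True] by (simp add: fib_def rop_def)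
      show "z \<otimes>\<^bsub>RDirProd T T2\<^esub> z' \<in> fib Q p Q2 p2"
        using xy xy' Q Q2 1(6)[of x x' False] 2(6)[of y y' False] by (simp add: fib_def rop_def)
    qed
    show "(\<phi> r, \<phi>2 r) \<in> fib Q p Q2 p2" if "r \<in> R0" for r
      using that T.phi_R0 T2.phi_R0 1(9) 2(9) by (auto simp: fib_def R0_eq)
  qed
qed

text \<open>\<open>s\<close> represents the homomorphism \<open>a\<close> on the cover. Nothing is
  required of \<open>a\<close> outside \<open>L n\<close>, so a homomorphism on a union of these
  rings can be represented level by level.\<close>

definition lift :: "('t, 'm) ring_scheme \<Rightarrow> ('s \<Rightarrow> 't) \<Rightarrow> 't set \<Rightarrow> ('t \<Rightarrow> 'c) \<Rightarrow> ('e \<Rightarrow>\<^sub>0 nat) \<Rightarrow> (('e \<Rightarrow>\<^sub>0 nat) \<Rightarrow> 't) \<Rightarrow>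
    ((('e \<Rightarrow>\<^sub>0 nat) multiset \<Rightarrow> 's) \<Rightarrow> 'c) \<Rightarrow> bool" where
  "lift T \<phi> Q p n s a \<longleftrightarrow> wit T \<phi> Q n s \<and> (\<forall>g\<in>L n. p (ev T \<phi> s g) = a g)"

lemma ev_pair:
  assumes "pcov T \<phi> Q A p" "pcov T2 \<phi>2 Q2 A p2" "\<And>i. s i \<in> carrier T" "\<And>i. s2 i \<in> carrier T2" "g \<in> carrier PP"
  shows "ev (RDirProd T T2) (\<lambda>k. (\<phi> k, \<phi>2 k)) (\<lambda>i. (s i, s2 i)) g = (ev T \<phi> s g, ev T2 \<phi>2 s2 g)"
proof -
  note 1 = pcov_facts[OF assms(1)] and 2 = pcov_facts[OF assms(2)]
  interpret D: wcover S R0 M P q "RDirProd T T2" "\<lambda>k. (\<phi> k, \<phi>2 k)" "fib Q p Q2 p2" by (rule fib_cover[OF assms(1,2)])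
  let ?s = "\<lambda>i. (s i, s2 i)"
  have c: "?s i \<in> carrier (RDirProd T T2)" for i using assms by simp
  show ?thesis
    using eval_comp[where s = ?s and \<phi> = "\<lambda>k. (\<phi> k, \<phi>2 k)" and ?\<phi>2.0 = \<phi> and g = g, OF D.T.is_cring 1(1) D.phi ring_hom_fst _ c assms(5)]
      eval_comp[where s = ?s and \<phi> = "\<lambda>k. (\<phi> k, \<phi>2 k)" and ?\<phi>2.0 = \<phi>2 and g = g, OF D.T.is_cring 2(1) D.phi ring_hom_snd _ c assms(5)]
    by (simp add: prod_eq_iff)
qed

text \<open>Evaluation at a family of pairs is the pair of evaluations, and lying in the fibre
  product means having the same image in \<open>A\<close>; \<open>wit_iff\<close> translates this
  back. So integral families of pairs are pairs of lifts of one homomorphism.\<close>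

lemma fib_wit_iff:
  assumes "pcov T \<phi> Q A p" "pcov T2 \<phi>2 Q2 A p2" "\<And>i. s i \<in> carrier T" "\<And>i. s2 i \<in> carrier T2"
  shows "wit (RDirProd T T2) (\<lambda>k. (\<phi> k, \<phi>2 k)) (fib Q p Q2 p2) n (\<lambda>i. (s i, s2 i)) \<longleftrightarrow>
    wit T \<phi> Q n s \<and> wit T2 \<phi>2 Q2 n s2 \<and> (\<forall>g\<in>L n. p (ev T \<phi> s g) = p2 (ev T2 \<phi>2 s2 g))"
proof -
  interpret T: wcover S R0 M P q T \<phi> Q using assms by (simp add: pcov_def)
  interpret T2: wcover S R0 M P q T2 \<phi>2 Q2 using assms by (simp add: pcov_def)
  interpret D: wcover S R0 M P q "RDirProd T T2" "\<lambda>k. (\<phi> k, \<phi>2 k)" "fib Q p Q2 p2" by (rule fib_cover[OF assms(1,2)])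
  have c: "(s i, s2 i) \<in> carrier (RDirProd T T2)" for i using assms by simp
  have e: "ev (RDirProd T T2) (\<lambda>k. (\<phi> k, \<phi>2 k)) (\<lambda>i. (s i, s2 i)) g = (ev T \<phi> s g, ev T2 \<phi>2 s2 g)" if "g \<in> L n" for g
    by (rule ev_pair[OF assms L_carrier[OF that]])
  show ?thesis
    unfolding D.wit_iff[of "\<lambda>i. (s i, s2 i)", OF c] T.wit_iff[of s, OF assms(3)] T2.wit_iff[of s2, OF assms(4)]
    using e by (auto simp: fib_def)
qed

text \<open>The lifts of \<open>a\<close>, and those of \<open>c\<close>, form integral families
  over the fibre product. Integral families form a ring, so the results are again two lifts of one
  homomorphism.\<close>

lemma lift_rop_eq:
  assumes "pcov T \<phi> Q A p" "pcov T2 \<phi>2 Q2 A p2"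
    and "lift T \<phi> Q p n s a" "lift T2 \<phi>2 Q2 p2 n s2 a" "lift T \<phi> Q p n t c" "lift T2 \<phi>2 Q2 p2 n t2 c"
    and "g \<in> L n"
  shows "p (ev T \<phi> (\<lambda>i. rop b T (s i) (t i)) g) = p2 (ev T2 \<phi>2 (\<lambda>i. rop b T2 (s2 i) (t2 i)) g)"
proof -
  note 1 = pcov_facts[OF assms(1)] and 2 = pcov_facts[OF assms(2)]
  interpret D: wcover S R0 M P q "RDirProd T T2" "\<lambda>k. (\<phi> k, \<phi>2 k)" "fib Q p Q2 p2" by (rule fib_cover[OF assms(1,2)])
  let ?W = "{s. wit (RDirProd T T2) (\<lambda>k. (\<phi> k, \<phi>2 k)) (fib Q p Q2 p2) n s}"
  have c: "s i \<in> carrier T" "t i \<in> carrier T" "s2 i \<in> carrier T2" "t2 i \<in> carrier T2" for i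
    using assms wit_closed by (auto simp: lift_def)
  have "(\<lambda>i. (s i, s2 i)) \<in> ?W" "(\<lambda>i. (t i, t2 i)) \<in> ?W"
    using assms(3-6) by (simp_all add: fib_wit_iff[OF assms(1,2)] c lift_def)
  then have "rop b (fun_ring (RDirProd T T2)) (\<lambda>i. (s i, s2 i)) (\<lambda>i. (t i, t2 i)) \<in> ?W"
    by (rule subring_rop[OF D.wit_subring])
  also have "rop b (fun_ring (RDirProd T T2)) (\<lambda>i. (s i, s2 i)) (\<lambda>i. (t i, t2 i)) = (\<lambda>i. (rop b T (s i) (t i), rop b T2 (s2 i) (t2 i)))"
    by (simp add: rop_def)
  finally show ?thesis
    using assms(7) by (simp add: fib_wit_iff[OF assms(1,2)] rop_closed[OF 1(1)] rop_closed[OF 2(1)] c)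
qed

lemma lift_const_eq:
  assumes "pcov T \<phi> Q A p" "pcov T2 \<phi>2 Q2 A p2" "k \<in> R0" "g \<in> L n"
  shows "p (ev T \<phi> (\<lambda>i. \<phi> k) g) = p2 (ev T2 \<phi>2 (\<lambda>i. \<phi>2 k) g)"
proof -
  interpret T: wcover S R0 M P q T \<phi> Q using assms by (simp add: pcov_def)
  interpret T2: wcover S R0 M P q T2 \<phi>2 Q2 using assms by (simp add: pcov_def)
  interpret D: wcover S R0 M P q "RDirProd T T2" "\<lambda>k. (\<phi> k, \<phi>2 k)" "fib Q p Q2 p2" by (rule fib_cover[OF assms(1,2)])
  show ?thesis
    using D.wit_const[OF assms(3), of n] assms(3,4)
    by (simp add: fib_wit_iff[OF assms(1,2)] T.phi_closed T2.phi_closed R0_carrier)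
qed

lemma lift_mono: "lift T \<phi> Q p l s a \<Longrightarrow> n \<in> box l \<Longrightarrow> lift T \<phi> Q p n s a"
  using L_mono[of n l] by (auto simp: lift_def box_iff intro: wit_mono)

lemma pcov_L:
  assumes "algebra R A" "a \<in> ring_hom (PP\<lparr>carrier := L n\<rparr>) A" "\<And>r. r \<in> carrier R \<Longrightarrow> a (cst (io r)) = struct_map A r"
  shows "pcov PP cst (L n) A a"
  using assms wcover_L by (simp add: pcov_def)

lemma lift_pcov:
  assumes p: "pcov T \<phi> Q A p" and s: "lift T \<phi> Q p n s a"
  shows "pcov PP cst (L n) A a"
proof (rule pcov_L)
  note 1 = pcov_facts[OF p]
  interpret T: wcover S R0 M P q T \<phi> Q using p by (simp add: pcov_def)
  have w: "wit T \<phi> Q n s" and a: "\<And>g. g \<in> L n \<Longrightarrow> a g = p (ev T \<phi> s g)" using s by (auto simp: lift_def)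
  have sc: "s i \<in> carrier T" for i using wit_closed[OF w] .
  have m: "ev T \<phi> s g \<in> Q" if "g \<in> L n" for g using T.ev_mem[OF w that] .
  note e = T.ev_hom[of s, OF sc] and LE = subringE[OF L_subring[of n]]
  show "algebra R A" using p by (simp add: pcov_def)
  show "a (cst (io r)) = struct_map A r" if "r \<in> carrier R" for r
    using that sc by (simp add: a L_cst io_R0 T.ev_cst io_carrier 1(9))
  show "a \<in> ring_hom (PP\<lparr>carrier := L n\<rparr>) A"
  proof (rule ring_hom_memI; simp)
    fix f g assume fg: "f \<in> L n" "g \<in> L n"
    then show "a f \<in> carrier A" using a m 1(5) by simp
    have c: "f \<in> carrier PP" "g \<in> carrier PP" using fg L_carrier by auto
    have "a (rop b PP f g) = rop b A (a f) (a g)" for b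
      using fg c m by (simp add: a subring_rop[OF L_subring] rop_hom[OF e] 1(6))
    from this[of True] this[of False]
    show "a (f \<otimes>\<^bsub>PP\<^esub> g) = a f \<otimes>\<^bsub>A\<^esub> a g" "a (f \<oplus>\<^bsub>PP\<^esub> g) = a f \<oplus>\<^bsub>A\<^esub> a g" by (simp_all add: rop_def)
  next
    show "a \<one>\<^bsub>PP\<^esub> = \<one>\<^bsub>A\<^esub>" using LE(3) by (simp add: a ring_hom_one[OF e] 1(7))
  qed
qed

text \<open>The projection of the fibre product of \<open>Q\<close> and \<open>L n\<close> to
  \<open>L n\<close> is surjective because \<open>p\<close> is. Lifting the universal family along
  it gives pairs whose first components represent \<open>a\<close>.\<close>

lemma lift_exists:
  assumes p: "pcov T \<phi> Q A p" and surj: "p ` Q = carrier A" and a: "pcov PP cst (L n) A a"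
  shows "\<exists>s. lift T \<phi> Q p n s a"
proof -
  note 1 = pcov_facts[OF p] and 2 = pcov_facts[OF a]
  interpret D: wcover S R0 M P q "RDirProd T PP" "\<lambda>k. (\<phi> k, cst k)" "fib Q p (L n) a" by (rule fib_cover[OF p a])
  interpret wcover_surj S R0 M P q "RDirProd T PP" "\<lambda>k. (\<phi> k, cst k)" "fib Q p (L n) a" PP cst "L n" snd
  proof (intro wcover_surj.intro wcover_surj_axioms.intro D.wcover_axioms wcover_L ring_hom_snd)
    show "\<exists>x\<in>carrier (RDirProd T PP). snd x = y" if "y \<in> carrier PP" for y
      using that ring.ring_simprules(2)[OF cring.axioms(1)[OF 1(1)]] by (intro bexI[of _ "(\<zero>\<^bsub>T\<^esub>, y)"]) auto
    show "snd ` fib Q p (L n) a = L n"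
    proof (intro equalityI subsetI)
      fix g assume g: "g \<in> L n"
      then have "a g \<in> p ` Q" using surj 2(5) by simp
      then obtain x where "x \<in> Q" "a g = p x" by auto
      then show "g \<in> snd ` fib Q p (L n) a" using g by (intro image_eqI[of _ _ "(x, g)"]) (auto simp: fib_def)
    qed (auto simp: fib_def)
  qed simp
  obtain u where u: "wit (RDirProd T PP) (\<lambda>k. (\<phi> k, cst k)) (fib Q p (L n) a) n u" "\<And>i. snd (u i) = vr i"
    using lift[OF L_wit] by blast
  let ?s = "\<lambda>i. fst (u i)"
  have uc: "u i \<in> carrier (RDirProd T PP)" for i using wit_closed[OF u(1)] .
  have sc: "?s i \<in> carrier T" for i using uc[of i] by auto
  have "u = (\<lambda>i. (?s i, vr i))" using u(2) by (auto simp: fun_eq_iff prod_eq_iff)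
  then have "wit (RDirProd T PP) (\<lambda>k. (\<phi> k, cst k)) (fib Q p (L n) a) n (\<lambda>i. (?s i, vr i))" using u(1) by simp
  then have "wit T \<phi> Q n ?s \<and> (\<forall>g\<in>L n. p (ev T \<phi> ?s g) = a (ev PP cst vr g))"
    by (subst (asm) fib_wit_iff[OF p a]) (auto simp: sc PP_vr)
  then have "lift T \<phi> Q p n ?s a" by (simp add: lift_def eval_id[OF L_carrier])
  then show ?thesis by blast
qed

end


section \<open>Sums and products of homomorphisms\<close>

lemma generate_ring_agree:
  assumes "cring T" "cring A" "subring Q T" "G \<subseteq> Q"
    and "h \<in> ring_hom (T\<lparr>carrier := Q\<rparr>) A" "h' \<in> ring_hom (T\<lparr>carrier := Q\<rparr>) A" "\<And>x. x \<in> G \<Longrightarrow> h x = h' x"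
    and "x \<in> generate_ring T G"
  shows "h x = h' x"
proof -
  interpret T: cring T by fact
  note h = subring_hom[OF assms(1-3,5)] and h' = subring_hom[OF assms(1-3,6)]
  have sub: "generate_ring T G \<subseteq> Q"
    using T.generate_ring_min_subring1[OF _ assms(3,4)] assms(4) subringE(1)[OF assms(3)] by auto
  show ?thesis
    using assms(8)
  proof (induct rule: generate_ring.induct)
    case (eng_add x y)
    then have "x \<in> Q" "y \<in> Q" using sub by auto
    then show ?case using eng_add h(2)[of x y True] h'(2)[of x y True] by (simp add: rop_def)
  next
    case (eng_mult x y)
    then have "x \<in> Q" "y \<in> Q" using sub by auto
    then show ?case using eng_mult h(2)[of x y False] h'(2)[of x y False] by (simp add: rop_def)
  next
    case (a_inv x)
    then have "x \<in> Q" using sub by auto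
    then show ?case using a_inv h(4)[of x] h'(4)[of x] by simp
  qed (use h(3) h'(3) assms(7) in auto)
qed

text \<open>The instances are \<open>box n\<close> and \<open>exponents E\<close>; they give the
  truncated and the full rings.\<close>

definition dirset :: "('e \<Rightarrow>\<^sub>0 nat) set \<Rightarrow> bool" where
  "dirset D \<longleftrightarrow> D \<noteq> {} \<and> (\<forall>n\<in>D. box n \<subseteq> D) \<and> (\<forall>n\<in>D. \<forall>m\<in>D. \<exists>l\<in>D. n \<in> box l \<and> m \<in> box l)"

lemma dirsetD: "dirset D \<Longrightarrow> n \<in> D \<Longrightarrow> m \<in> D \<Longrightarrow> \<exists>l\<in>D. n \<in> box l \<and> m \<in> box l"
  by (simp add: dirset_def)

lemma dirset_box: "dirset (box n)"
  unfolding dirset_def by (auto simp: box_def intro: order_trans)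

lemma dirset_exponents: "dirset (exponents (E :: 'e set))"
proof -
  have "\<exists>l\<in>exponents E. n \<in> box l \<and> m \<in> box l" if "n \<in> exponents E" "m \<in> exponents E" for n m :: "'e \<Rightarrow>\<^sub>0 nat"
    using that by (intro bexI[of _ "n + m"]) (auto simp: box_def exponents_def lookup_add keys_plus_nat)
  moreover have "0 \<in> exponents E" by (simp add: exponents_def)
  moreover have "box n \<subseteq> exponents E" if "n \<in> exponents E" for n :: "'e \<Rightarrow>\<^sub>0 nat"
    using that keys_box[of _ n] by (auto simp: exponents_def)
  ultimately show ?thesis
    unfolding dirset_def by blast
qed

section \<open>Operations on homomorphisms, defined through lifts\<close>

context witt_alg
begin

text \<open>The elements of the type of \<open>A\<close> are the variables. \<open>QA\<close> keeps
  those of the carrier, and \<open>pA\<close> sends each variable to the element it stands for, so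
  that \<open>A\<close> is covered without any choice of generators.\<close>

definition TA :: "('a, 'c) module \<Rightarrow> ('a, 'c multiset \<Rightarrow> 's) module" where
  "TA A = mpoly_alg S UNIV"

definition QA :: "('a, 'c) module \<Rightarrow> ('c multiset \<Rightarrow> 's) set" where
  "QA A = pset (carrier A) R0"

text \<open>Coefficients in \<open>R0\<close> are read back in \<open>R\<close> by
  \<open>inv_into\<close>, which is faithful because \<open>R\<close> embeds into
  \<open>S\<close>.\<close>

definition pA :: "('a, 'c) module \<Rightarrow> ('c multiset \<Rightarrow> 's) \<Rightarrow> 'c" where
  "pA A = mpoly_eval (S\<lparr>carrier := R0\<rparr>) A (\<lambda>k. struct_map A (inv_into (carrier R) io k)) (\<lambda>c. c)"

lemma std_cover:
  assumes A: "algebra R A"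
  shows "pcov (TA A) cst (QA A) A (pA A)" "pA A ` QA A = carrier A"
proof -
  note Af = algebra_facts[OF A]
  let ?S = "S\<lparr>carrier := R0\<rparr>" and ?s = "\<lambda>k. struct_map A (inv_into (carrier R) io k)"
  interpret A: cring A by (rule Af)
  interpret K: mpoly ?S by (rule mpoly.intro) (rule cring_subring[OF is_cring R0])
  have s: "?s (io r) = struct_map A r" if "r \<in> carrier R" for r
    using that struct_inj by simp
  interpret R: cring R by (rule R_cring)
  interpret K: mpoly_hom ?S A ?s "\<lambda>c. c" "carrier A"
  proof (intro mpoly_hom.intro mpoly_hom_axioms.intro K.mpoly_axioms A.is_cring)
    show "?s \<in> ring_hom ?S A"
    proof (rule ring_hom_memI; simp)
      fix x y assume "x \<in> R0" "y \<in> R0"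
      then obtain r t where rt: "r \<in> carrier R" "t \<in> carrier R" "x = io r" "y = io t" by (auto simp: R0_eq)
      then show "?s x \<in> carrier A" by (simp add: s ring_hom_closed[OF Af(3)])
      have "x \<otimes> y = io (r \<otimes>\<^bsub>R\<^esub> t)" "x \<oplus> y = io (r \<oplus>\<^bsub>R\<^esub> t)" using rt by (simp_all add: ring_hom_mult[OF io_hom] ring_hom_add[OF io_hom])
      then show "?s (x \<otimes> y) = ?s x \<otimes>\<^bsub>A\<^esub> ?s y" "?s (x \<oplus> y) = ?s x \<oplus>\<^bsub>A\<^esub> ?s y"
        using rt by (simp_all only: s R.m_closed R.a_closed ring_hom_mult[OF Af(3)] ring_hom_add[OF Af(3)])
    next
      have "?s (io \<one>\<^bsub>R\<^esub>) = \<one>\<^bsub>A\<^esub>" by (simp only: s R.one_closed ring_hom_one[OF Af(3)])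
      then show "?s \<one> = \<one>\<^bsub>A\<^esub>" by (simp only: ring_hom_one[OF io_hom])
    qed
  qed simp
  have p: "pA A = K.ev" by (simp add: pA_def)
  note ops = mpoly_sub_ops[OF R0] mpoly_sub_pset[OF R0]
  have Ke: "K.ev \<in> ring_hom (mpoly_alg ?S (carrier A)) A" by (rule K.ev_hom)
  have KQ: "carrier (mpoly_alg ?S (carrier A)) = QA A" by (simp add: mpoly_alg_simps ops QA_def)
  have sub: "subring (QA A) (TA A)" unfolding QA_def TA_def by (rule pset_subring[OF R0]) simp
  have c: "cst r \<in> QA A" if "r \<in> R0" for r unfolding QA_def using that by (rule indexed_pset.intros)
  have w: "wcover S R0 M P q (TA A) cst (QA A)"
    unfolding TA_def by (intro wcover.intro wcover_axioms.intro witt_base_axioms cring_mpoly cst_hom sub[unfolded TA_def] c)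
  have hom: "pA A \<in> ring_hom ((TA A)\<lparr>carrier := QA A\<rparr>) A"
  proof (rule ring_hom_memI; simp)
    fix f g assume fg: "f \<in> QA A" "g \<in> QA A"
    then have c: "f \<in> carrier (mpoly_alg ?S (carrier A))" "g \<in> carrier (mpoly_alg ?S (carrier A))" by (simp_all add: KQ)
    show "pA A f \<in> carrier A" using ring_hom_closed[OF Ke c(1)] by (simp add: p)
    have "f \<otimes>\<^bsub>TA A\<^esub> g = f \<otimes>\<^bsub>mpoly_alg ?S (carrier A)\<^esub> g"
      unfolding TA_def using fg by (intro mpoly_sub_mult[OF R0, symmetric]) (auto simp: QA_def)
    then show "pA A (f \<otimes>\<^bsub>TA A\<^esub> g) = pA A f \<otimes>\<^bsub>A\<^esub> pA A g"
      using ring_hom_mult[OF Ke c] by (simp add: p)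
    have "f \<oplus>\<^bsub>TA A\<^esub> g = f \<oplus>\<^bsub>mpoly_alg ?S (carrier A)\<^esub> g"
      unfolding TA_def by (simp add: mpoly_alg_simps ops)
    then show "pA A (f \<oplus>\<^bsub>TA A\<^esub> g) = pA A f \<oplus>\<^bsub>A\<^esub> pA A g"
      using ring_hom_add[OF Ke c] by (simp add: p)
  next
    have "\<one>\<^bsub>TA A\<^esub> = \<one>\<^bsub>mpoly_alg ?S (carrier A)\<^esub>" by (simp add: TA_def mpoly_alg_simps ops)
    then show "pA A \<one>\<^bsub>TA A\<^esub> = \<one>\<^bsub>A\<^esub>" using ring_hom_one[OF Ke] by (simp add: p)
  qed
  have "pA A (cst (io r)) = struct_map A r" if "r \<in> carrier R" for r
    using K.ev_const[of "io r"] io_R0[OF that] s[OF that] by (simp add: p ops)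
  then show cov: "pcov (TA A) cst (QA A) A (pA A)" using w hom A by (simp add: pcov_def)
  show "pA A ` QA A = carrier A"
  proof (intro equalityI subsetI)
    fix c assume c: "c \<in> carrier A"
    have "vr c \<in> QA A" unfolding QA_def indexed_var_def
      by (intro indexed_pset.intros) (use c R0_closed in auto)
    moreover have "pA A (vr c) = c" using K.ev_var[OF c] by (simp add: p ops)
    ultimately show "c \<in> pA A ` QA A" by force
  qed (use pcov_facts(5)[OF cov] in auto)
qed

definition LD :: "('e \<Rightarrow>\<^sub>0 nat) set \<Rightarrow> (('e \<Rightarrow>\<^sub>0 nat) multiset \<Rightarrow> 's) set" where
  "LD D = (\<Union>n\<in>D. L n)"

definition Lalg :: "('e \<Rightarrow>\<^sub>0 nat) set \<Rightarrow> ('a, ('e \<Rightarrow>\<^sub>0 nat) multiset \<Rightarrow> 's) module" where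
  "Lalg D = PP\<lparr>carrier := LD D\<rparr>"

lemma carrier_Lalg [simp]: "carrier (Lalg D) = LD D"
  by (simp add: Lalg_def)

lemma directed_subring:
  assumes D: "dirset D" and F: "\<And>n. n \<in> D \<Longrightarrow> subring (F n) PP" "\<And>n m. m \<in> D \<Longrightarrow> n \<in> box m \<Longrightarrow> F n \<subseteq> F m"
  shows "subring (\<Union>n\<in>D. F n) PP"
proof -
  interpret PP: cring PP by (rule PP_cring)
  have dir: "\<exists>l\<in>D. x \<in> F l \<and> y \<in> F l" if xy: "x \<in> (\<Union>n\<in>D. F n)" "y \<in> (\<Union>n\<in>D. F n)" for x y
  proof -
    obtain n m where nm: "n \<in> D" "x \<in> F n" "m \<in> D" "y \<in> F m" using xy by auto
    then obtain l where "l \<in> D" "n \<in> box l" "m \<in> box l" using dirsetD[OF D] by blast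
    then show ?thesis using F(2) nm by blast
  qed
  have ne: "D \<noteq> {}" using D by (simp add: dirset_def)
  show ?thesis
  proof (rule PP.subringI)
    show "(\<Union>n\<in>D. F n) \<subseteq> carrier PP" using subringE(1)[OF F(1)] by blast
    show "\<one>\<^bsub>PP\<^esub> \<in> (\<Union>n\<in>D. F n)" using ne subringE(3)[OF F(1)] by blast
    show "\<ominus>\<^bsub>PP\<^esub> x \<in> (\<Union>n\<in>D. F n)" if "x \<in> (\<Union>n\<in>D. F n)" for x using that subringE(5)[OF F(1)] by blast
    fix x y assume "x \<in> (\<Union>n\<in>D. F n)" "y \<in> (\<Union>n\<in>D. F n)"
    then obtain l where "l \<in> D" "x \<in> F l" "y \<in> F l" using dir by blast
    then show "x \<otimes>\<^bsub>PP\<^esub> y \<in> (\<Union>n\<in>D. F n)" "x \<oplus>\<^bsub>PP\<^esub> y \<in> (\<Union>n\<in>D. F n)"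
      using subringE(6,7)[OF F(1)[of l]] by blast+
  qed
qed

lemma LD_subring: "dirset D \<Longrightarrow> subring (LD D) PP"
  unfolding LD_def by (rule directed_subring) (use L_subring L_mono in auto)

lemma LD_cst: "dirset D \<Longrightarrow> r \<in> R0 \<Longrightarrow> cst r \<in> LD D"
  using L_cst by (auto simp: LD_def dirset_def)

lemma L_LD: "n \<in> D \<Longrightarrow> g \<in> L n \<Longrightarrow> g \<in> LD D"
  by (auto simp: LD_def)

lemma LD_dir: "dirset D \<Longrightarrow> f \<in> LD D \<Longrightarrow> g \<in> LD D \<Longrightarrow> \<exists>n\<in>D. f \<in> L n \<and> g \<in> L n"
proof -
  assume D: "dirset D" and "f \<in> LD D" "g \<in> LD D"
  then obtain n m where nm: "n \<in> D" "f \<in> L n" "m \<in> D" "g \<in> L m" by (auto simp: LD_def)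
  then obtain l where "l \<in> D" "n \<in> box l" "m \<in> box l" using dirsetD[OF D] by blast
  then show ?thesis using nm L_mono by blast
qed

lemma algebra_Lalg: "dirset D \<Longrightarrow> algebra R (Lalg D)"
  unfolding Lalg_def by (rule algebra_sub_mpoly[OF LD_subring LD_cst])

abbreviation Hm :: "('e \<Rightarrow>\<^sub>0 nat) set \<Rightarrow> ('a, 'c) module \<Rightarrow> ((('e \<Rightarrow>\<^sub>0 nat) multiset \<Rightarrow> 's) \<Rightarrow> 'c) set" where
  "Hm D A \<equiv> Hom_alg R (Lalg D) A"

lemma Hm_pcov:
  assumes D: "dirset D" and A: "algebra R A" and a: "a \<in> Hm D A" and n: "n \<in> D"
  shows "pcov PP cst (L n) A a"
proof (rule pcov_L[OF A])
  have "a \<in> alg_hom R (Lalg D) A" using a by (simp add: Hom_alg_def)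
  then have h: "a \<in> ring_hom (Lalg D) A" "\<And>r. r \<in> carrier R \<Longrightarrow> a (struct_map (Lalg D) r) = struct_map A r"
    using alg_hom_iff[OF algebra_Lalg[OF D] A] by auto
  show "a (cst (io r)) = struct_map A r" if "r \<in> carrier R" for r
    using h(2)[OF that] that by (simp add: Lalg_def struct_map_mpoly)
  show "a \<in> ring_hom (PP\<lparr>carrier := L n\<rparr>) A"
    using h(1) L_LD[OF n] by (auto simp: ring_hom_def Lalg_def)
qed

lemma HmI:
  assumes D: "dirset D" and A: "algebra R A" and a: "a \<in> extensional (LD D)" "\<And>n. n \<in> D \<Longrightarrow> pcov PP cst (L n) A a"
  shows "a \<in> Hm D A"
proof -
  have h: "a \<in> ring_hom (PP\<lparr>carrier := L n\<rparr>) A" "\<And>r. r \<in> carrier R \<Longrightarrow> a (cst (io r)) = struct_map A r" if "n \<in> D" for n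
    using a(2)[OF that] by (auto simp: pcov_def)
  have ne: "\<exists>n. n \<in> D" using D by (auto simp: dirset_def)
  have "a \<in> ring_hom (Lalg D) A"
  proof (rule ring_hom_memI; (simp only: carrier_Lalg)?)
    fix f g assume "f \<in> LD D" "g \<in> LD D"
    then obtain n where n: "n \<in> D" "f \<in> L n" "g \<in> L n" using LD_dir[OF D] by blast
    then show "a f \<in> carrier A" "a (f \<otimes>\<^bsub>Lalg D\<^esub> g) = a f \<otimes>\<^bsub>A\<^esub> a g" "a (f \<oplus>\<^bsub>Lalg D\<^esub> g) = a f \<oplus>\<^bsub>A\<^esub> a g"
      using h(1)[OF n(1)] by (auto simp: ring_hom_def Lalg_def)
  next
    show "a \<one>\<^bsub>Lalg D\<^esub> = \<one>\<^bsub>A\<^esub>" using ne h(1) by (auto simp: ring_hom_def Lalg_def)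
  qed
  moreover have "a (struct_map (Lalg D) r) = struct_map A r" if "r \<in> carrier R" for r
    using ne h(2) that by (auto simp: Lalg_def struct_map_mpoly)
  ultimately show ?thesis using a(1) by (simp add: Hom_alg_def alg_hom_iff[OF algebra_Lalg[OF D] A])
qed

lemma Hm_ext: "a \<in> Hm D A \<Longrightarrow> a \<in> extensional (LD D)"
  by (simp add: Hom_alg_def)

lemma Hm_eqI:
  assumes "a \<in> Hm D A" "c \<in> Hm D A" "\<And>n g. n \<in> D \<Longrightarrow> g \<in> L n \<Longrightarrow> a g = c g"
  shows "a = c"
  by (rule extensionalityI[OF Hm_ext Hm_ext]) (use assms in \<open>auto simp: LD_def\<close>)

abbreviation stdlift :: "('a, 'c) module \<Rightarrow> ('e \<Rightarrow>\<^sub>0 nat) \<Rightarrow> (('e \<Rightarrow>\<^sub>0 nat) \<Rightarrow> 'c multiset \<Rightarrow> 's) \<Rightarrow> 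
    ((('e \<Rightarrow>\<^sub>0 nat) multiset \<Rightarrow> 's) \<Rightarrow> 'c) \<Rightarrow> bool" where
  "stdlift A n s a \<equiv> lift (TA A) cst (QA A) (pA A) n s a"

lemma stdlift_exists: "dirset D \<Longrightarrow> algebra R A \<Longrightarrow> a \<in> Hm D A \<Longrightarrow> n \<in> D \<Longrightarrow> \<exists>s. stdlift A n s a"
  by (rule lift_exists[OF std_cover Hm_pcov])

text \<open>\<open>SOME\<close> picks a value that is unique: by \<open>lift_rop_eq\<close> it
  depends neither on the level \<open>n\<close> nor on the lifts. So no coherent system of lifts
  over all of \<open>D\<close> is required.\<close>

definition wop :: "('e \<Rightarrow>\<^sub>0 nat) set \<Rightarrow> ('a, 'c) module \<Rightarrow> bool \<Rightarrow> ((('e \<Rightarrow>\<^sub>0 nat) multiset \<Rightarrow> 's) \<Rightarrow> 'c) \<Rightarrow>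
    ((('e \<Rightarrow>\<^sub>0 nat) multiset \<Rightarrow> 's) \<Rightarrow> 'c) \<Rightarrow> ((('e \<Rightarrow>\<^sub>0 nat) multiset \<Rightarrow> 's) \<Rightarrow> 'c)" where
  "wop D A b a c = (\<lambda>g\<in>LD D. SOME y. \<exists>n\<in>D. \<exists>s t. g \<in> L n \<and> stdlift A n s a \<and> stdlift A n t c \<and>
     y = pA A (ev (TA A) cst (\<lambda>i. rop b (TA A) (s i) (t i)) g))"

definition wc :: "('e \<Rightarrow>\<^sub>0 nat) set \<Rightarrow> ('a, 'c) module \<Rightarrow> 's \<Rightarrow> ((('e \<Rightarrow>\<^sub>0 nat) multiset \<Rightarrow> 's) \<Rightarrow> 'c)" where
  "wc D A k = (\<lambda>g\<in>LD D. pA A (ev (TA A) cst (\<lambda>i. cst k) g))"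

lemma lift_rop_wit:
  assumes "pcov T \<phi> Q A p" "lift T \<phi> Q p n s a" "lift T \<phi> Q p n t c"
  shows "wit T \<phi> Q n (\<lambda>i. rop b T (s i) (t i))"
proof -
  interpret T: wcover S R0 M P q T \<phi> Q using assms by (simp add: pcov_def)
  have "rop b (fun_ring T) s t \<in> {s. wit T \<phi> Q n s}"
    by (rule subring_rop[OF T.wit_subring]) (use assms in \<open>auto simp: lift_def\<close>)
  then show ?thesis by (auto simp: rop_def split: if_splits)
qed

text \<open>Not just standard lifts but lifts on any cover compute the operation, by
  \<open>lift_rop_eq\<close>. This is what makes it functorial and lets it be followed through the
  canonical map.\<close>

lemma wop_lift:
  assumes D: "dirset D" and A: "algebra R A" and a: "a \<in> Hm D A" and c: "c \<in> Hm D A" and n: "n \<in> D"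
    and p: "pcov T \<phi> Q A p" and s: "lift T \<phi> Q p n s a" and t: "lift T \<phi> Q p n t c"
  shows "lift T \<phi> Q p n (\<lambda>i. rop b T (s i) (t i)) (wop D A b a c)"
  unfolding lift_def
proof (intro conjI ballI)
  show "wit T \<phi> Q n (\<lambda>i. rop b T (s i) (t i))" by (rule lift_rop_wit[OF p s t])
  fix g assume g: "g \<in> L n"
  note std = std_cover(1)[OF A]
  define PR where "PR y \<longleftrightarrow> (\<exists>n\<in>D. \<exists>s t. g \<in> L n \<and> stdlift A n s a \<and> stdlift A n t c \<and>
     y = pA A (ev (TA A) cst (\<lambda>i. rop b (TA A) (s i) (t i)) g))" for y
  obtain s' t' where st': "stdlift A n s' a" "stdlift A n t' c" using stdlift_exists[OF D A _ n] a c by blast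
  then have "PR (pA A (ev (TA A) cst (\<lambda>i. rop b (TA A) (s' i) (t' i)) g))" unfolding PR_def using n g by blast
  then have "PR (SOME y. PR y)" by (rule someI)
  then obtain m u v where m: "m \<in> D" "g \<in> L m" "stdlift A m u a" "stdlift A m v c"
     "(SOME y. PR y) = pA A (ev (TA A) cst (\<lambda>i. rop b (TA A) (u i) (v i)) g)" unfolding PR_def by blast
  \<comment> \<open>The level \<open>m\<close> hidden in the choice and the given level
    \<open>n\<close> are compared at a common upper bound.\<close>
  obtain l where l: "l \<in> D" "n \<in> box l" "m \<in> box l" using dirsetD[OF D n m(1)] by blast
  obtain s2 t2 where st2: "stdlift A l s2 a" "stdlift A l t2 c" using stdlift_exists[OF D A _ l(1)] a c by blast
  have "(SOME y. PR y) = pA A (ev (TA A) cst (\<lambda>i. rop b (TA A) (s2 i) (t2 i)) g)"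
    unfolding m(5) by (rule lift_rop_eq[OF std std m(3) lift_mono[OF st2(1) l(3)] m(4) lift_mono[OF st2(2) l(3)] m(2)])
  also have "\<dots> = p (ev T \<phi> (\<lambda>i. rop b T (s i) (t i)) g)"
    by (rule lift_rop_eq[OF std p lift_mono[OF st2(1) l(2)] s lift_mono[OF st2(2) l(2)] t g])
  finally show "p (ev T \<phi> (\<lambda>i. rop b T (s i) (t i)) g) = wop D A b a c g"
    using L_LD[OF n g] by (simp add: wop_def PR_def)
qed

lemma wc_lift:
  assumes A: "algebra R A" and n: "n \<in> D" and p: "pcov T \<phi> Q A p" and k: "k \<in> R0"
  shows "lift T \<phi> Q p n (\<lambda>i. \<phi> k) (wc D A k)"
  unfolding lift_def
proof (intro conjI ballI)
  interpret T: wcover S R0 M P q T \<phi> Q using p by (simp add: pcov_def)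
  show "wit T \<phi> Q n (\<lambda>i. \<phi> k)" by (rule T.wit_const[OF k])
  fix g assume g: "g \<in> L n"
  show "p (ev T \<phi> (\<lambda>i. \<phi> k) g) = wc D A k g"
    using lift_const_eq[OF p std_cover(1)[OF A] k g] L_LD[OF n g] by (simp add: wc_def)
qed

lemma wop_closed:
  assumes D: "dirset D" and A: "algebra R A" and a: "a \<in> Hm D A" and c: "c \<in> Hm D A"
  shows "wop D A b a c \<in> Hm D A"
proof (rule HmI[OF D A])
  show "wop D A b a c \<in> extensional (LD D)" by (simp add: wop_def)
  fix n assume n: "n \<in> D"
  obtain s t where "stdlift A n s a" "stdlift A n t c" using stdlift_exists[OF D A _ n] a c by blast
  from wop_lift[OF D A a c n std_cover(1)[OF A] this] show "pcov PP cst (L n) A (wop D A b a c)"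
    by (rule lift_pcov[OF std_cover(1)[OF A]])
qed

lemma wc_closed:
  assumes D: "dirset D" and A: "algebra R A" and k: "k \<in> R0"
  shows "wc D A k \<in> Hm D A"
proof (rule HmI[OF D A])
  show "wc D A k \<in> extensional (LD D)" by (simp add: wc_def)
  fix n assume n: "n \<in> D"
  show "pcov PP cst (L n) A (wc D A k)"
    by (rule lift_pcov[OF std_cover(1)[OF A] wc_lift[OF A n std_cover(1)[OF A] k]])
qed

text \<open>Identities between homomorphisms reduce to identities between families in the ring
  \<open>TA A\<close>; the axioms for \<open>WA\<close> are inherited in this way.\<close>

lemma stdlift_eqI:
  assumes "a \<in> Hm D A" "c \<in> Hm D A" "\<And>n. n \<in> D \<Longrightarrow> \<exists>s t. stdlift A n s a \<and> stdlift A n t c \<and> s = t"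
  shows "a = c"
  by (rule Hm_eqI[OF assms(1,2)]) (use assms(3) in \<open>fastforce simp: lift_def\<close>)

definition WA :: "('e \<Rightarrow>\<^sub>0 nat) set \<Rightarrow> ('a, 'c) module \<Rightarrow> ('a, (('e \<Rightarrow>\<^sub>0 nat) multiset \<Rightarrow> 's) \<Rightarrow> 'c) module" where
  "WA D A = \<lparr>carrier = Hm D A, monoid.mult = wop D A False, monoid.one = wc D A \<one>,
     ring.zero = wc D A \<zero>, ring.add = wop D A True, smult = (\<lambda>r. wop D A False (wc D A (io r)))\<rparr>"

lemma algebra_WA:
  fixes A :: "('a, 'c) module"
  assumes D: "dirset D" and A: "algebra R A"
  shows "algebra R (WA D A)"
proof -
  note std = std_cover(1)[OF A] and cl = wop_closed[OF D A] wc_closed[OF D A]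
  interpret R: cring R by (rule R_cring)
  interpret TA: cring "TA A" by (rule pcov_facts(1)[OF std])
  have TAc: "cring (TA A)" by (rule TA.is_cring)
  have ex: "\<exists>s. stdlift A n s a \<and> (\<forall>i. s i \<in> carrier (TA A))" if an: "a \<in> Hm D A" "n \<in> D" for a n
  proof -
    obtain s where "stdlift A n s a" using stdlift_exists[OF D A an] by blast
    then show ?thesis using wit_closed[of "TA A" cst "QA A" n s] by (auto simp: lift_def)
  qed
  have lo: "stdlift A n (\<lambda>i. rop b (TA A) (s i) (t i)) (wop D A b a c)" 
    if "stdlift A n s a" "stdlift A n t c" "a \<in> Hm D A" "c \<in> Hm D A" "n \<in> D" for n s t a c b
    by (rule wop_lift[OF D A that(3-5) std that(1,2)])
  have lc: "stdlift A n (\<lambda>i. cst k) (wc D A k)" if "k \<in> R0" "n \<in> D" for n k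
    by (rule wc_lift[OF A that(2) std that(1)])
  have TAcst: "(cst :: _ \<Rightarrow> 'c multiset \<Rightarrow> _) \<in> ring_hom S (TA A)" by (rule pcov_facts(3)[OF std])
  note cs = ring_hom_closed[OF TAcst] R0_carrier io_carrier ring_hom_one[OF TAcst] ring_hom_zero[OF TAcst ring_axioms TA.ring_axioms]
    ring_hom_add[OF TAcst] ring_hom_mult[OF TAcst] ring_hom_add[OF io_hom] ring_hom_mult[OF io_hom] ring_hom_one[OF io_hom]
  have m1: "\<ominus> \<one> \<in> R0" using R0_closed by auto
  have neg: "cst (\<ominus> \<one>) \<otimes>\<^bsub>TA A\<^esub> x \<oplus>\<^bsub>TA A\<^esub> x = \<zero>\<^bsub>TA A\<^esub>" if "x \<in> carrier (TA A)" for x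
  proof -
    have "cst (\<ominus> \<one>) = \<ominus>\<^bsub>TA A\<^esub> \<one>\<^bsub>TA A\<^esub>"
      using ring_hom_minus(2)[OF is_cring TAc TAcst one_closed one_closed] by (simp add: cs)
    then show ?thesis using that by (simp add: TA.l_minus TA.l_neg)
  qed
  have three: thesis if "\<And>s t u. \<lbrakk>stdlift A n s a; stdlift A n t c; stdlift A n u d; 
      \<And>i. s i \<in> carrier (TA A); \<And>i. t i \<in> carrier (TA A); \<And>i. u i \<in> carrier (TA A)\<rbrakk> \<Longrightarrow> thesis"
    "a \<in> Hm D A" "c \<in> Hm D A" "d \<in> Hm D A" "n \<in> D" for a c d n thesis
    using ex[OF that(2,5)] ex[OF that(3,5)] ex[OF that(4,5)] that(1) by blast
  have eqI: "a = c" if "a \<in> Hm D A" "c \<in> Hm D A" "\<And>n. n \<in> D \<Longrightarrow> \<exists>s t. stdlift A n s a \<and> stdlift A n t c \<and> s = t" for a c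
    using stdlift_eqI that by blast
  note cl0 = cl io_R0 R0_closed(1,2) m1
  have assoc: "wop D A b (wop D A b a c) d = wop D A b a (wop D A b c d)"
    if H: "a \<in> Hm D A" "c \<in> Hm D A" "d \<in> Hm D A" for b a c d
  proof (rule eqI)
    fix n assume n: "n \<in> D"
    show "\<exists>s t. stdlift A n s (wop D A b (wop D A b a c) d) \<and> stdlift A n t (wop D A b a (wop D A b c d)) \<and> s = t"
    proof (rule three[OF _ H n])
      fix s t u assume l: "stdlift A n s a" "stdlift A n t c" "stdlift A n u d"
        and car: "\<And>i. s i \<in> carrier (TA A)" "\<And>i. t i \<in> carrier (TA A)" "\<And>i. u i \<in> carrier (TA A)"
      \<comment> \<open>The lifts of both sides are built by \<open>lo\<close> along the two terms;
        what remains is a ring identity in \<open>TA A\<close>.\<close>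
      show ?thesis
        by (intro exI conjI) (rule lo lo l H n cl0 | (rule ext, use car in \<open>simp add: rop_def TA.a_assoc TA.m_assoc\<close>))+
    qed
  qed (intro cl0 H)+
  have comm: "wop D A b a c = wop D A b c a" if H: "a \<in> Hm D A" "c \<in> Hm D A" for b a c
  proof (rule eqI)
    fix n assume n: "n \<in> D"
    show "\<exists>s t. stdlift A n s (wop D A b a c) \<and> stdlift A n t (wop D A b c a) \<and> s = t"
    proof (rule three[OF _ H H(2) n])
      fix s t u assume l: "stdlift A n s a" "stdlift A n t c"
        and car: "\<And>i. s i \<in> carrier (TA A)" "\<And>i. t i \<in> carrier (TA A)"
      show ?thesis
        by (intro exI conjI) (rule lo l H n cl0 | (rule ext, use car in \<open>simp add: rop_def TA.a_comm TA.m_comm\<close>))+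
    qed
  qed (intro cl0 H)+
  have distr: "wop D A False (wop D A True a c) d = wop D A True (wop D A False a d) (wop D A False c d)"
    if H: "a \<in> Hm D A" "c \<in> Hm D A" "d \<in> Hm D A" for a c d
  proof (rule eqI)
    fix n assume n: "n \<in> D"
    show "\<exists>s t. stdlift A n s (wop D A False (wop D A True a c) d) \<and> stdlift A n t (wop D A True (wop D A False a d) (wop D A False c d)) \<and> s = t"
    proof (rule three[OF _ H n])
      fix s t u assume l: "stdlift A n s a" "stdlift A n t c" "stdlift A n u d"
        and car: "\<And>i. s i \<in> carrier (TA A)" "\<And>i. t i \<in> carrier (TA A)" "\<And>i. u i \<in> carrier (TA A)"
      show ?thesis
        by (intro exI conjI) (rule lo l H n cl0 | (rule ext, use car in \<open>simp add: rop_def TA.l_distr\<close>))+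
    qed
  qed (intro cl0 H)+
  have unit: "wop D A b (wc D A (if b then \<zero> else \<one>)) a = a" if H: "a \<in> Hm D A" for b a
  proof (rule eqI)
    fix n assume n: "n \<in> D"
    show "\<exists>s t. stdlift A n s (wop D A b (wc D A (if b then \<zero> else \<one>)) a) \<and> stdlift A n t a \<and> s = t"
    proof (rule three[OF _ H H H n])
      fix s t u assume l: "stdlift A n s a" and car: "\<And>i. s i \<in> carrier (TA A)"
      have z: "(if b then \<zero> else \<one>) \<in> R0" using R0_closed by auto
      show ?thesis
        by (intro exI conjI) (rule lo lc l H n z cl0 | (rule ext, use car in \<open>simp add: rop_def cs\<close>))+
    qed
  qed (use H cl0 in auto)
  have inv: "wop D A True (wop D A False (wc D A (\<ominus> \<one>)) a) a = wc D A \<zero>" if H: "a \<in> Hm D A" for a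
  proof (rule eqI)
    fix n assume n: "n \<in> D"
    show "\<exists>s t. stdlift A n s (wop D A True (wop D A False (wc D A (\<ominus> \<one>)) a) a) \<and> stdlift A n t (wc D A \<zero>) \<and> s = t"
    proof (rule three[OF _ H H H n])
      fix s t u assume l: "stdlift A n s a" and car: "\<And>i. s i \<in> carrier (TA A)"
      show ?thesis
        by (intro exI conjI) (rule lo lc l H n cl0 | (rule ext, use car in \<open>simp add: rop_def cs neg\<close>))+
    qed
  qed (use H cl0 in auto)
  have const: "wc D A (rop b S k k') = wop D A b (wc D A k) (wc D A k')" if H: "k \<in> R0" "k' \<in> R0" for b k k'
  proof (rule eqI)
    fix n assume n: "n \<in> D"
    have z: "rop b S k k' \<in> R0" using subring_rop[OF R0 H] .
    show "\<exists>s t. stdlift A n s (wc D A (rop b S k k')) \<and> stdlift A n t (wop D A b (wc D A k) (wc D A k')) \<and> s = t"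
      by (intro exI conjI) (rule lo lc H n z cl0 | (rule ext, use H in \<open>simp add: rop_def cs\<close>))+
  qed (use H cl0 subring_rop[OF R0 H] in auto)
  show ?thesis
  proof (rule algebraI)
    show "cring R" by (rule R_cring)
    show "cring (WA D A)"
    proof (rule cringI)
      show "abelian_group (WA D A)"
      proof (rule abelian_groupI)
        fix x y assume x: "x \<in> carrier (WA D A)" and y: "y \<in> carrier (WA D A)"
        then have xy: "x \<in> Hm D A" "y \<in> Hm D A" by (simp_all add: WA_def)
        show "x \<oplus>\<^bsub>WA D A\<^esub> y = y \<oplus>\<^bsub>WA D A\<^esub> x" using comm[OF xy] by (simp add: WA_def)
        show "x \<oplus>\<^bsub>WA D A\<^esub> y \<in> carrier (WA D A)" using xy by (simp add: WA_def cl0)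
        show "(x \<oplus>\<^bsub>WA D A\<^esub> y) \<oplus>\<^bsub>WA D A\<^esub> z = x \<oplus>\<^bsub>WA D A\<^esub> (y \<oplus>\<^bsub>WA D A\<^esub> z)" if "z \<in> carrier (WA D A)" for z
          using assoc[OF xy] that by (simp add: WA_def)
      next
        fix x assume "x \<in> carrier (WA D A)"
        then have x: "x \<in> Hm D A" by (simp add: WA_def)
        show "\<zero>\<^bsub>WA D A\<^esub> \<oplus>\<^bsub>WA D A\<^esub> x = x" using unit[OF x, of True] by (simp add: WA_def)
        show "\<exists>y\<in>carrier (WA D A). y \<oplus>\<^bsub>WA D A\<^esub> x = \<zero>\<^bsub>WA D A\<^esub>"
          by (rule bexI[of _ "wop D A False (wc D A (\<ominus> \<one>)) x"]) (simp_all add: WA_def inv[OF x] cl0 x)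
      qed (simp add: WA_def cl0)
      show "comm_monoid (WA D A)"
      proof (rule comm_monoidI)
        fix x y assume x: "x \<in> carrier (WA D A)" and y: "y \<in> carrier (WA D A)"
        then have xy: "x \<in> Hm D A" "y \<in> Hm D A" by (simp_all add: WA_def)
        show "x \<otimes>\<^bsub>WA D A\<^esub> y = y \<otimes>\<^bsub>WA D A\<^esub> x" using comm[OF xy] by (simp add: WA_def)
        show "x \<otimes>\<^bsub>WA D A\<^esub> y \<in> carrier (WA D A)" using xy by (simp add: WA_def cl0)
        show "(x \<otimes>\<^bsub>WA D A\<^esub> y) \<otimes>\<^bsub>WA D A\<^esub> z = x \<otimes>\<^bsub>WA D A\<^esub> (y \<otimes>\<^bsub>WA D A\<^esub> z)" if "z \<in> carrier (WA D A)" for z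
          using assoc[OF xy] that by (simp add: WA_def)
      next
        fix x assume "x \<in> carrier (WA D A)"
        then have x: "x \<in> Hm D A" by (simp add: WA_def)
        show "\<one>\<^bsub>WA D A\<^esub> \<otimes>\<^bsub>WA D A\<^esub> x = x" using unit[OF x, of False] by (simp add: WA_def)
      qed (simp add: WA_def cl0)
    qed (use distr in \<open>simp add: WA_def\<close>)
    fix r t x y assume r: "r \<in> carrier R" and x: "x \<in> carrier (WA D A)" 
    then have x': "x \<in> Hm D A" and w: "wc D A (io r) \<in> Hm D A" by (auto simp: WA_def cl0)
    show "r \<odot>\<^bsub>WA D A\<^esub> x \<in> carrier (WA D A)" using x' w by (simp add: WA_def cl0)
    show "(r \<odot>\<^bsub>WA D A\<^esub> x) \<otimes>\<^bsub>WA D A\<^esub> y = r \<odot>\<^bsub>WA D A\<^esub> (x \<otimes>\<^bsub>WA D A\<^esub> y)" if "y \<in> carrier (WA D A)"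
      using assoc[OF w x'] that by (simp add: WA_def)
    show "r \<odot>\<^bsub>WA D A\<^esub> (x \<oplus>\<^bsub>WA D A\<^esub> y) = r \<odot>\<^bsub>WA D A\<^esub> x \<oplus>\<^bsub>WA D A\<^esub> r \<odot>\<^bsub>WA D A\<^esub> y" if "y \<in> carrier (WA D A)"
      using that distr[OF x' _ w, of y] comm[OF w] x' w cl0(1)[OF x', of y True] by (simp add: WA_def)
    assume t: "t \<in> carrier R"
    then have w': "wc D A (io t) \<in> Hm D A" by (auto simp: cl0)
    show "(r \<oplus>\<^bsub>R\<^esub> t) \<odot>\<^bsub>WA D A\<^esub> x = r \<odot>\<^bsub>WA D A\<^esub> x \<oplus>\<^bsub>WA D A\<^esub> t \<odot>\<^bsub>WA D A\<^esub> x"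
      using r t distr[OF w w' x'] const[of "io r" "io t" True] by (simp add: WA_def rop_def ring_hom_add[OF io_hom] io_R0)
    show "(r \<otimes>\<^bsub>R\<^esub> t) \<odot>\<^bsub>WA D A\<^esub> x = r \<odot>\<^bsub>WA D A\<^esub> (t \<odot>\<^bsub>WA D A\<^esub> x)"
      using r t assoc[OF w w' x'] const[of "io r" "io t" False] by (simp add: WA_def rop_def ring_hom_mult[OF io_hom] io_R0)
  next
    fix x assume "x \<in> carrier (WA D A)"
    then show "\<one>\<^bsub>R\<^esub> \<odot>\<^bsub>WA D A\<^esub> x = x"
      using unit[of x False] by (simp add: WA_def ring_hom_one[OF io_hom])
  qed
qed

end


section \<open>Uniqueness of the functorial structure\<close>

lemma smult_closed': "algebra R B \<Longrightarrow> r \<in> carrier R \<Longrightarrow> x \<in> carrier B \<Longrightarrow> r \<odot>\<^bsub>B\<^esub> x \<in> carrier B"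
  by (rule module.smult_closed[OF algebra.axioms(1)])

context witt_alg
begin

lemma wop_var:
  assumes D: "dirset D" and A: "algebra R A" and a: "a \<in> Hm D A" and c: "c \<in> Hm D A" and i: "i \<in> D"
  shows "wop D A b a c (vr i) = rop b A (a (vr i)) (c (vr i))"
proof -
  note std = std_cover(1)[OF A]
  note 1 = pcov_facts[OF std]
  interpret T: wcover S R0 M P q "TA A" cst "QA A" using std by (simp add: pcov_def)
  obtain s t where st: "stdlift A i s a" "stdlift A i t c" using stdlift_exists[OF D A _ i] a c by blast
  have cl: "s j \<in> carrier (TA A)" "t j \<in> carrier (TA A)" for j using st wit_closed by (auto simp: lift_def)
  have v: "vr i \<in> L i" by (rule L_vr) simp
  have q: "s i \<in> QA A" "t i \<in> QA A" using st by (auto simp: lift_def intro: T.wit_mem)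
  have l: "pA A (ev (TA A) cst u (vr i)) = d (vr i)" if "stdlift A i u d" for u d
    using that v by (auto simp: lift_def)
  have "ev (TA A) cst (\<lambda>j. rop b (TA A) (s j) (t j)) (vr i) = rop b (TA A) (s i) (t i)"
    by (rule T.ev_vr) (rule rop_closed[OF 1(1) cl])
  then have "wop D A b a c (vr i) = pA A (rop b (TA A) (s i) (t i))"
    using l[OF wop_lift[OF D A a c i std st, where b = b]] by simp
  moreover have "a (vr i) = pA A (s i)" "c (vr i) = pA A (t i)"
    using l[OF st(1)] l[OF st(2)] T.ev_vr[of s, OF cl(1)] T.ev_vr[of t, OF cl(2)] by simp_all
  ultimately show ?thesis using q 1(6) by simp
qed

lemma wc_var:
  assumes A: "algebra R A" and i: "i \<in> D" and r: "r \<in> carrier R"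
  shows "wc D A (io r) (vr i) = struct_map A r"
proof -
  note std = std_cover(1)[OF A]
  interpret T: wcover S R0 M P q "TA A" cst "QA A" using std by (simp add: pcov_def)
  have v: "vr i \<in> L i" by (rule L_vr) simp
  have "ev (TA A) cst (\<lambda>j. cst (io r)) (vr i) = cst (io r)"
    by (rule T.ev_vr) (rule T.phi_closed[OF io_carrier[OF r]])
  moreover have "pA A (ev (TA A) cst (\<lambda>j. cst (io r)) (vr i)) = wc D A (io r) (vr i)"
    using wc_lift[OF A i std io_R0[OF r]] v by (auto simp: lift_def)
  ultimately show ?thesis using pcov_facts(9)[OF std r] by simp
qed

lemma wc_one_unit:
  assumes D: "dirset D" and A: "algebra R A" and a: "a \<in> Hm D A"
  shows "wop D A False a (wc D A \<one>) = a"
proof -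
  interpret W: cring "WA D A" by (rule algebra_facts(2)[OF algebra_WA[OF D A]])
  show ?thesis using W.r_one[of a] a by (simp add: WA_def)
qed

lemma struct_map_WA:
  assumes D: "dirset D" and A: "algebra R A" and r: "r \<in> carrier R"
  shows "struct_map (WA D A) r = wc D A (io r)"
  using wc_one_unit[OF D A wc_closed[OF D A io_R0[OF r]]] by (simp add: struct_map_def WA_def)

lemma ghost_WA:
  assumes D: "dirset D" and A: "algebra R A"
  shows "is_ghost_structure R (Lalg D) D vr A (WA D A)"
  unfolding is_ghost_structure_def
proof (intro conjI ballI)
  show "algebra R (WA D A)" by (rule algebra_WA[OF D A])
  show "carrier (WA D A) = Hm D A" by (simp add: WA_def)
  fix i assume i: "i \<in> D"
  show "(\<lambda>a. a (vr i)) \<in> alg_hom R (WA D A) A"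
    unfolding alg_hom_iff[OF algebra_WA[OF D A] A]
  proof (intro conjI ballI)
    show "struct_map (WA D A) r (vr i) = struct_map A r" if "r \<in> carrier R" for r
      by (simp add: struct_map_WA[OF D A that] wc_var[OF A i that])
    have one: "wc D A \<one> (vr i) = \<one>\<^bsub>A\<^esub>"
      using wc_var[OF A i, of "\<one>\<^bsub>R\<^esub>"] ring_hom_one[OF io_hom] ring_hom_one[OF algebra_facts(3)[OF A]] cring.cring_simprules(6)[OF R_cring]
      by simp
    have v: "vr i \<in> L i" by (rule L_vr) simp
    show "(\<lambda>a. a (vr i)) \<in> ring_hom (WA D A) A"
    proof (rule ring_hom_memI)
      fix a c assume a: "a \<in> carrier (WA D A)" and c: "c \<in> carrier (WA D A)"
      then have ac: "a \<in> Hm D A" "c \<in> Hm D A" by (simp_all add: WA_def)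
      show "a (vr i) \<in> carrier A" using pcov_facts(5)[OF Hm_pcov[OF D A ac(1) i] v] .
      show "(a \<otimes>\<^bsub>WA D A\<^esub> c) (vr i) = a (vr i) \<otimes>\<^bsub>A\<^esub> c (vr i)" "(a \<oplus>\<^bsub>WA D A\<^esub> c) (vr i) = a (vr i) \<oplus>\<^bsub>A\<^esub> c (vr i)"
        using wop_var[OF D A ac i, of False] wop_var[OF D A ac i, of True] by (simp_all add: WA_def rop_def)
    qed (use one in \<open>auto simp: WA_def\<close>)
  qed
qed

lemma pcov_trans:
  assumes p: "pcov T \<phi> Q B p" and h: "h \<in> alg_hom R B C" and C: "algebra R C"
  shows "pcov T \<phi> Q C (h \<circ> p)"
proof -
  have B: "algebra R B" "p \<in> ring_hom (T\<lparr>carrier := Q\<rparr>) B" using p by (auto simp: pcov_def)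
  have "h \<in> ring_hom B C" "\<And>r. r \<in> carrier R \<Longrightarrow> h (struct_map B r) = struct_map C r"
    using h alg_hom_iff[OF B(1) C] by auto
  then show ?thesis using p C ring_hom_trans[OF B(2)] by (simp add: pcov_def)
qed

lemma lift_trans:
  assumes "lift T \<phi> Q p n s a" "n \<in> D"
  shows "lift T \<phi> Q (h \<circ> p) n s (compose (LD D) h a)"
  using assms L_LD[OF assms(2)] by (simp add: lift_def compose_eq)

lemma compose_Hm:
  assumes D: "dirset D" and B: "algebra R B" and C: "algebra R C" and h: "h \<in> alg_hom R B C" and a: "a \<in> Hm D B"
  shows "compose (LD D) h a \<in> Hm D C"
proof (rule HmI[OF D C])
  show "compose (LD D) h a \<in> extensional (LD D)" by (simp add: compose_def)
  fix n assume n: "n \<in> D"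
  obtain s where s: "stdlift B n s a" using stdlift_exists[OF D B a n] by blast
  show "pcov PP cst (L n) C (compose (LD D) h a)"
    by (rule lift_pcov[OF pcov_trans[OF std_cover(1)[OF B] h C] lift_trans[OF s n]])
qed

text \<open>The same lifts serve before and after composition with \<open>h\<close>, on the covers
  \<open>pA B\<close> and \<open>h \<circ> pA B\<close>.\<close>

lemma compose_wop:
  assumes D: "dirset D" and B: "algebra R B" and C: "algebra R C" and h: "h \<in> alg_hom R B C" and a: "a \<in> Hm D B" "c \<in> Hm D B"
  shows "compose (LD D) h (wop D B b a c) = wop D C b (compose (LD D) h a) (compose (LD D) h c)"
proof (rule Hm_eqI)
  note cl = compose_Hm[OF D B C h] wop_closed[OF D]
  show "compose (LD D) h (wop D B b a c) \<in> Hm D C" "wop D C b (compose (LD D) h a) (compose (LD D) h c) \<in> Hm D C"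
    using a B C by (auto intro!: cl)
  fix n g assume n: "n \<in> D" and g: "g \<in> L n"
  note p = pcov_trans[OF std_cover(1)[OF B] h C]
  obtain s t where st: "stdlift B n s a" "stdlift B n t c" using stdlift_exists[OF D B _ n] a by blast
  have "lift (TA B) cst (QA B) (h \<circ> pA B) n (\<lambda>i. rop b (TA B) (s i) (t i)) (compose (LD D) h (wop D B b a c))"
    by (rule lift_trans[OF wop_lift[OF D B a n std_cover(1)[OF B] st] n])
  moreover have "lift (TA B) cst (QA B) (h \<circ> pA B) n (\<lambda>i. rop b (TA B) (s i) (t i)) (wop D C b (compose (LD D) h a) (compose (LD D) h c))"
    by (rule wop_lift[OF D C cl(1)[OF a(1)] cl(1)[OF a(2)] n p lift_trans[OF st(1) n] lift_trans[OF st(2) n]])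
  ultimately show "compose (LD D) h (wop D B b a c) g = wop D C b (compose (LD D) h a) (compose (LD D) h c) g"
    using g by (auto simp: lift_def)
qed

lemma compose_wc:
  assumes D: "dirset D" and B: "algebra R B" and C: "algebra R C" and h: "h \<in> alg_hom R B C" and k: "k \<in> R0"
  shows "compose (LD D) h (wc D B k) = wc D C k"
proof (rule Hm_eqI)
  show "compose (LD D) h (wc D B k) \<in> Hm D C" by (rule compose_Hm[OF D B C h wc_closed[OF D B k]])
  show "wc D C k \<in> Hm D C" by (rule wc_closed[OF D C k])
  fix n g assume n: "n \<in> D" and g: "g \<in> L n"
  have "lift (TA B) cst (QA B) (h \<circ> pA B) n (\<lambda>i. cst k) (compose (LD D) h (wc D B k))"
    by (rule lift_trans[OF wc_lift[OF B n std_cover(1)[OF B] k] n])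
  moreover have "lift (TA B) cst (QA B) (h \<circ> pA B) n (\<lambda>i. cst k) (wc D C k)"
    by (rule wc_lift[OF C n pcov_trans[OF std_cover(1)[OF B] h C] k])
  ultimately show "compose (LD D) h (wc D B k) g = wc D C k g" using g by (auto simp: lift_def)
qed

lemma WA_functorial:
  assumes D: "dirset D" and B: "algebra R B" and C: "algebra R C" and h: "h \<in> alg_hom R B C"
  shows "compose (LD D) h \<in> alg_hom R (WA D B) (WA D C)"
  unfolding alg_hom_iff[OF algebra_WA[OF D B] algebra_WA[OF D C]]
proof (intro conjI ballI)
  show "compose (LD D) h (struct_map (WA D B) r) = struct_map (WA D C) r" if "r \<in> carrier R" for r
    by (simp add: struct_map_WA[OF D B that] struct_map_WA[OF D C that] compose_wc[OF D B C h io_R0[OF that]])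
  show "compose (LD D) h \<in> ring_hom (WA D B) (WA D C)"
    by (rule ring_hom_memI) 
      (auto simp: WA_def compose_wop[OF D B C h] compose_wc[OF D B C h R0_closed(2)] compose_Hm[OF D B C h])
qed

text \<open>Two disjoint copies of the set of exponents inside itself: the polynomial ring on these
  contains a copy of \<open>L \<otimes> L\<close>.\<close>

definition e1 :: "('e \<Rightarrow>\<^sub>0 nat) \<Rightarrow> ('e \<Rightarrow>\<^sub>0 nat)" where "e1 i = i + i"
definition e2 :: "('e \<Rightarrow>\<^sub>0 nat) \<Rightarrow> ('e \<Rightarrow>\<^sub>0 nat)" where "e2 i = i + i + bexp undefined"

text \<open>The copies are told apart by the parity of the coordinate at \<open>undefined\<close>,
  an arbitrary but fixed index.\<close>

lemma e1_e2: "e1 i = e1 j \<longleftrightarrow> i = j" "e2 i = e2 j \<longleftrightarrow> i = j" "e1 i \<noteq> e2 j"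
proof -
  have inj: "i + i = j + j \<Longrightarrow> i = j" for i j :: "'e \<Rightarrow>\<^sub>0 nat"
  proof (rule poly_mapping_eqI)
    fix \<alpha> assume "i + i = j + j"
    then have "Poly_Mapping.lookup (i + i) \<alpha> = Poly_Mapping.lookup (j + j) \<alpha>" by simp
    then show "Poly_Mapping.lookup i \<alpha> = Poly_Mapping.lookup j \<alpha>" by (simp add: lookup_add)
  qed
  show "e1 i = e1 j \<longleftrightarrow> i = j" unfolding e1_def using inj[of i j] by metis
  show "e2 i = e2 j \<longleftrightarrow> i = j" unfolding e2_def add_right_cancel using inj[of i j] by metis
  have "Poly_Mapping.lookup (e1 i) undefined \<noteq> Poly_Mapping.lookup (e2 j) undefined"
    by (simp add: e1_def e2_def lookup_add) presburger
  then show "e1 i \<noteq> e2 j" by auto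
qed

definition copy :: "(('e \<Rightarrow>\<^sub>0 nat) \<Rightarrow> ('e \<Rightarrow>\<^sub>0 nat)) \<Rightarrow> (('e \<Rightarrow>\<^sub>0 nat) multiset \<Rightarrow> 's) \<Rightarrow> (('e \<Rightarrow>\<^sub>0 nat) multiset \<Rightarrow> 's)" where
  "copy e = ev PP cst (\<lambda>i. vr (e i))"

lemma copy_hom: "copy e \<in> ring_hom PP PP"
  unfolding copy_def by (rule eval_facts(1)[OF PP_cring PP_cst PP_vr])

lemma copy_cst: "k \<in> carrier S \<Longrightarrow> copy e (cst k) = cst k"
  and copy_vr: "copy e (vr i) = vr (e i)"
  unfolding copy_def by (rule eval_facts(2,3)[where s = "\<lambda>i. vr (e i)", OF PP_cring PP_cst PP_vr], assumption?)+

definition gens :: "('e \<Rightarrow>\<^sub>0 nat) \<Rightarrow> (('e \<Rightarrow>\<^sub>0 nat) multiset \<Rightarrow> 's) set" where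
  "gens n = copy e1 ` L n \<union> copy e2 ` L n \<union> cst ` R0"

text \<open>Stands in for the tensor product of two copies of \<open>L n\<close>. Its value lies in
  the mapping property \<open>universal_hom\<close> and in being a subring of \<open>PP\<close>,
  where ghost components are faithful.\<close>

definition M2 :: "('e \<Rightarrow>\<^sub>0 nat) \<Rightarrow> (('e \<Rightarrow>\<^sub>0 nat) multiset \<Rightarrow> 's) set" where
  "M2 n = generate_ring PP (gens n)"

lemma gens_carrier: "gens n \<subseteq> carrier PP"
  using ring_hom_closed[OF copy_hom] L_carrier R0_carrier PP_cst_closed by (auto simp: gens_def)

lemma M2_subring: "subring (M2 n) PP"
proof -
  interpret PP: cring PP by (rule PP_cring)
  show ?thesis unfolding M2_def by (rule PP.generate_ring_is_subring[OF gens_carrier])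
qed

lemma gens_M2: "gens n \<subseteq> M2 n"
  by (auto simp: M2_def intro: generate_ring.incl)

lemma M2_mono: "n \<in> box m \<Longrightarrow> M2 n \<subseteq> M2 m"
proof -
  interpret PP: cring PP by (rule PP_cring)
  assume "n \<in> box m"
  then have "gens n \<subseteq> M2 m" using L_mono[of n m] gens_M2[of m] by (auto simp: gens_def)
  then show ?thesis unfolding M2_def[of n] by (rule PP.generate_ring_min_subring1[OF gens_carrier M2_subring])
qed

definition B2 :: "('e \<Rightarrow>\<^sub>0 nat) set \<Rightarrow> (('e \<Rightarrow>\<^sub>0 nat) multiset \<Rightarrow> 's) set" where
  "B2 D = (\<Union>n\<in>D. M2 n)"

abbreviation Balg :: "('e \<Rightarrow>\<^sub>0 nat) set \<Rightarrow> ('a, ('e \<Rightarrow>\<^sub>0 nat) multiset \<Rightarrow> 's) module" where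
  "Balg D \<equiv> PP\<lparr>carrier := B2 D\<rparr>"

lemma B2_subring: "dirset D \<Longrightarrow> subring (B2 D) PP"
  unfolding B2_def by (rule directed_subring) (use M2_subring M2_mono in auto)

lemma B2_cst: "dirset D \<Longrightarrow> r \<in> R0 \<Longrightarrow> cst r \<in> B2 D"
  using gens_M2 by (force simp: B2_def dirset_def gens_def)

lemma B2_copy: "n \<in> D \<Longrightarrow> g \<in> L n \<Longrightarrow> e = e1 \<or> e = e2 \<Longrightarrow> copy e g \<in> B2 D"
  using gens_M2[of n] by (auto simp: B2_def gens_def)

lemma algebra_Balg: "dirset D \<Longrightarrow> algebra R (Balg D)"
  by (rule algebra_sub_mpoly[OF B2_subring B2_cst])

lemma wcover_B2: "dirset D \<Longrightarrow> wcover S R0 M P q PP cst (B2 D)"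
  by (rule wcover_PP[OF B2_subring B2_cst])

lemma copy_Hm:
  assumes D: "dirset D" and e: "e = e1 \<or> e = e2"
  shows "restrict (copy e) (LD D) \<in> Hm D (Balg D)"
proof (rule HmI[OF D algebra_Balg[OF D]])
  fix n assume n: "n \<in> D"
  note Ls = subringE[OF L_subring[of n]]
  show "pcov PP cst (L n) (Balg D) (restrict (copy e) (LD D))"
  proof (rule pcov_L[OF algebra_Balg[OF D]])
    show "restrict (copy e) (LD D) (cst (io r)) = struct_map (Balg D) r" if "r \<in> carrier R" for r
      using that D by (simp add: struct_map_mpoly LD_cst io_R0 copy_cst io_carrier)
    show "restrict (copy e) (LD D) \<in> ring_hom (PP\<lparr>carrier := L n\<rparr>) (Balg D)"
      by (rule ring_hom_memI)
         (use n B2_copy[OF n _ e] Ls L_LD[OF n] L_carrier in \<open>auto simp: ring_hom_mult[OF copy_hom] ring_hom_add[OF copy_hom] ring_hom_one[OF copy_hom]\<close>)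
  qed
qed simp

text \<open>At one level the lifts of \<open>a\<close> and \<open>c\<close> are merged into a single
  family \<open>w\<close> on the two copies of the exponents; evaluation at \<open>w\<close>
  followed by \<open>pA A\<close> induces both. Lifts of different levels are unrelated, but the
  maps \<open>hh n\<close> agree because they are prescribed on generators.\<close>

lemma universal_hom:
  fixes A :: "('a, 'c) module"
  assumes D: "dirset D" and A: "algebra R A" and a: "a \<in> Hm D A" and c: "c \<in> Hm D A"
  shows "\<exists>h\<in>alg_hom R (Balg D) A. \<forall>n\<in>D. \<forall>g\<in>L n. h (copy e1 g) = a g \<and> h (copy e2 g) = c g"
proof -
  note std = std_cover(1)[OF A]
  note 1 = pcov_facts[OF std]
  interpret T: wcover S R0 M P q "TA A" cst "QA A" using std by (simp add: pcov_def)
  interpret PP: cring PP by (rule PP_cring)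
  have "\<exists>h. h \<in> ring_hom (PP\<lparr>carrier := M2 n\<rparr>) A \<and> (\<forall>r\<in>carrier R. h (cst (io r)) = struct_map A r) \<and>
      (\<forall>g\<in>L n. h (copy e1 g) = a g \<and> h (copy e2 g) = c g)" if n: "n \<in> D" for n
  proof -
    obtain s t where st: "stdlift A n s a" "stdlift A n t c" using stdlift_exists[OF D A _ n] a c by blast
    have stc: "s j \<in> carrier (TA A)" "t j \<in> carrier (TA A)" for j using st wit_closed by (auto simp: lift_def)
    \<comment> \<open>Exponents in neither copy get the default zero; the generators of
      \<open>M2 n\<close> do not involve them.\<close>
    define w where "w k = (if \<exists>i. k = e1 i then s (THE i. k = e1 i) else if \<exists>i. k = e2 i then t (THE i. k = e2 i) else \<zero>\<^bsub>TA A\<^esub>)" for k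
    have w: "w (e1 i) = s i" "w (e2 i) = t i" for i
    proof -
      show "w (e1 i) = s i" by (auto simp: w_def e1_e2)
      have "\<nexists>j. e2 i = e1 j" using e1_e2(3) by metis
      then show "w (e2 i) = t i" by (auto simp: w_def e1_e2(2))
    qed
    have wc: "w k \<in> carrier (TA A)" for k by (simp add: w_def stc)
    let ?e = "ev (TA A) cst w"
    have eh: "?e \<in> ring_hom PP (TA A)" by (rule T.ev_hom[of w, OF wc])
    have ec: "?e (cst k) = cst k" if "k \<in> carrier S" for k by (rule T.ev_cst[of w, OF wc that])
    have ej: "?e (copy e g) = ev (TA A) cst (\<lambda>i. w (e i)) g" if "g \<in> L n" for e g
    proof -
      have "?e (copy e g) = ev (TA A) cst (\<lambda>i. ?e (vr (e i))) g"
        unfolding copy_def by (rule eval_comp[where s = "\<lambda>i. vr (e i)", OF PP_cring 1(1) PP_cst eh _ PP_vr L_carrier[OF that]]) (simp add: ec)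
      then show ?thesis by (simp add: T.ev_vr[of w, OF wc])
    qed
    have gQ: "gens n \<subseteq> {x \<in> carrier PP. ?e x \<in> QA A}"
    proof -
      have "?e (copy e1 g) \<in> QA A" "?e (copy e2 g) \<in> QA A" if g: "g \<in> L n" for g
        using T.ev_mem[OF _ g, of s] T.ev_mem[OF _ g, of t] st by (simp_all add: ej[OF g] w lift_def)
      then show ?thesis using gens_carrier[of n] by (auto simp: gens_def ec R0_carrier T.phi_R0)
    qed
    have MQ: "M2 n \<subseteq> {x \<in> carrier PP. ?e x \<in> QA A}"
      unfolding M2_def by (rule PP.generate_ring_min_subring1[OF gens_carrier T.ev_preimage_subring[of w, OF wc] gQ])
    have "(pA A \<circ> ?e) \<in> ring_hom (PP\<lparr>carrier := M2 n\<rparr>) A"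
    proof (rule ring_hom_memI)
      fix x y assume "x \<in> carrier (PP\<lparr>carrier := M2 n\<rparr>)" "y \<in> carrier (PP\<lparr>carrier := M2 n\<rparr>)"
      then have xy: "x \<in> carrier PP" "?e x \<in> QA A" "y \<in> carrier PP" "?e y \<in> QA A" using MQ by auto
      show "(pA A \<circ> ?e) x \<in> carrier A" using 1(5) xy by simp
      show "(pA A \<circ> ?e) (x \<otimes>\<^bsub>PP\<lparr>carrier := M2 n\<rparr>\<^esub> y) = (pA A \<circ> ?e) x \<otimes>\<^bsub>A\<^esub> (pA A \<circ> ?e) y"
        using 1(6)[OF xy(2,4), of False] xy by (simp add: ring_hom_mult[OF eh] rop_def)
      show "(pA A \<circ> ?e) (x \<oplus>\<^bsub>PP\<lparr>carrier := M2 n\<rparr>\<^esub> y) = (pA A \<circ> ?e) x \<oplus>\<^bsub>A\<^esub> (pA A \<circ> ?e) y"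
        using 1(6)[OF xy(2,4), of True] xy by (simp add: ring_hom_add[OF eh] rop_def)
    qed (simp add: ring_hom_one[OF eh] 1(7))
    moreover have "(pA A \<circ> ?e) (cst (io r)) = struct_map A r" if "r \<in> carrier R" for r
      using that by (simp add: ec io_carrier 1(9))
    moreover have "(pA A \<circ> ?e) (copy e1 g) = a g \<and> (pA A \<circ> ?e) (copy e2 g) = c g" if "g \<in> L n" for g
      using st that by (simp add: ej[OF that] w lift_def)
    ultimately show ?thesis by blast
  qed
  then have "\<forall>n\<in>D. \<exists>h. h \<in> ring_hom (PP\<lparr>carrier := M2 n\<rparr>) A \<and> (\<forall>r\<in>carrier R. h (cst (io r)) = struct_map A r) \<and>
      (\<forall>g\<in>L n. h (copy e1 g) = a g \<and> h (copy e2 g) = c g)" by blast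
  from bchoice[OF this] obtain hh where hh: "\<And>n. n \<in> D \<Longrightarrow> hh n \<in> ring_hom (PP\<lparr>carrier := M2 n\<rparr>) A"
    "\<And>n r. n \<in> D \<Longrightarrow> r \<in> carrier R \<Longrightarrow> hh n (cst (io r)) = struct_map A r"
    "\<And>n g. n \<in> D \<Longrightarrow> g \<in> L n \<Longrightarrow> hh n (copy e1 g) = a g \<and> hh n (copy e2 g) = c g" by blast
  have coh: "hh m x = hh n x" if nm: "n \<in> D" "m \<in> D" "n \<in> box m" and x: "x \<in> M2 n" for n m x
  proof (rule generate_ring_agree[OF PP_cring 1(2) M2_subring gens_M2 _ hh(1)[OF nm(1)] _ x[unfolded M2_def]])
    show "hh m \<in> ring_hom (PP\<lparr>carrier := M2 n\<rparr>) A"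
      using hh(1)[OF nm(2)] M2_mono[OF nm(3)] by (auto simp: ring_hom_def subset_iff)
    have "hh m (cst r) = hh n (cst r)" if "r \<in> R0" for r
    proof -
      obtain k where k: "k \<in> carrier R" "r = io k" using \<open>r \<in> R0\<close> unfolding R0_eq by blast
      show ?thesis unfolding k(2) hh(2)[OF nm(1) k(1)] hh(2)[OF nm(2) k(1)] ..
    qed
    then show "hh m y = hh n y" if "y \<in> gens n" for y
      using that hh(3)[OF nm(1)] hh(3)[OF nm(2)] L_mono[OF nm(3)] by (auto simp: gens_def)
  qed
  define h where "h x = hh (SOME n. n \<in> D \<and> x \<in> M2 n) x" for x
  have h: "h x = hh n x" if n: "n \<in> D" and x: "x \<in> M2 n" for n x
  proof -
    let ?m = "SOME n. n \<in> D \<and> x \<in> M2 n"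
    have m: "?m \<in> D \<and> x \<in> M2 ?m" by (rule someI[of _ n]) (use n x in blast)
    obtain l where l: "l \<in> D" "?m \<in> box l" "n \<in> box l" using dirsetD[OF D, of ?m n] m n by blast
    show ?thesis using coh[of ?m l x] coh[of n l x] l m n x by (simp add: h_def)
  qed
  have ne: "\<exists>n. n \<in> D" using D by (auto simp: dirset_def)
  have "h \<in> alg_hom R (Balg D) A"
    unfolding alg_hom_iff[OF algebra_Balg[OF D] A]
  proof (intro conjI ballI)
    show "h (struct_map (Balg D) r) = struct_map A r" if "r \<in> carrier R" for r
    proof -
      obtain n where n: "n \<in> D" using ne by blast
      have "cst (io r) \<in> M2 n" using gens_M2[of n] io_R0[OF that] by (auto simp: gens_def)
      then show ?thesis using h[OF n] hh(2)[OF n that] that by (simp add: struct_map_mpoly)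
    qed
    show "h \<in> ring_hom (Balg D) A"
    proof (rule ring_hom_memI)
      fix x y assume "x \<in> carrier (Balg D)" "y \<in> carrier (Balg D)"
      then obtain n m where nm: "n \<in> D" "x \<in> M2 n" "m \<in> D" "y \<in> M2 m" by (auto simp: B2_def)
      obtain l where l: "l \<in> D" "n \<in> box l" "m \<in> box l" using dirsetD[OF D nm(1,3)] by blast
      then have xy: "x \<in> M2 l" "y \<in> M2 l" using nm M2_mono by blast+
      note hl = subring_hom[OF PP_cring 1(2) M2_subring hh(1)[OF l(1)]] and c = subringE[OF M2_subring[of l]]
      show "h x \<in> carrier A" using h[OF l(1) xy(1)] hl(1)[OF xy(1)] by simp
      show "h (x \<otimes>\<^bsub>Balg D\<^esub> y) = h x \<otimes>\<^bsub>A\<^esub> h y" "h (x \<oplus>\<^bsub>Balg D\<^esub> y) = h x \<oplus>\<^bsub>A\<^esub> h y"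
        using h[OF l(1)] xy c hl(2)[OF xy, of False] hl(2)[OF xy, of True] by (simp_all add: rop_def)
    next
      obtain n where n: "n \<in> D" using ne by blast
      show "h \<one>\<^bsub>Balg D\<^esub> = \<one>\<^bsub>A\<^esub>"
        using h[OF n] subringE(3)[OF M2_subring[of n]] subring_hom(3)[OF PP_cring 1(2) M2_subring hh(1)[OF n]] by simp
    qed
  qed
  moreover have "h (copy e1 g) = a g \<and> h (copy e2 g) = c g" if "n \<in> D" "g \<in> L n" for n g
    using h[OF that(1)] hh(3)[OF that] gens_M2[of n] that(2) by (auto simp: gens_def)
  ultimately show ?thesis by blast
qed

definition ghost_prop :: "('e \<Rightarrow>\<^sub>0 nat) set \<Rightarrow> ('a, 'c) module \<Rightarrow> ('a, (('e \<Rightarrow>\<^sub>0 nat) multiset \<Rightarrow> 's) \<Rightarrow> 'c) module \<Rightarrow> bool" where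
  "ghost_prop D A N \<longleftrightarrow> is_ghost_structure R (Lalg D) D vr A N \<and>
        (\<exists>V. is_functorial_ghost_structure R (Lalg D) D vr V \<and>
           (\<forall>B. algebra R B \<longrightarrow> (\<forall>h \<in> alg_hom R B A.
              compose (carrier (Lalg D)) h \<in> alg_hom R (V B) N)))"

lemma ghost_prop_WA: "dirset D \<Longrightarrow> algebra R A \<Longrightarrow> ghost_prop D A (WA D A)"
  unfolding ghost_prop_def is_functorial_ghost_structure_def
  by (intro conjI exI[of _ "WA D"]) (auto intro: ghost_WA WA_functorial)

text \<open>The right-hand sides do not mention \<open>N\<close>, so the structure is forced. By
  functoriality along \<open>h\<close> the result is the image of the same operation on the
  universal pair over \<open>Balg D\<close>, and there, inside \<open>PP\<close>, it is determined
  by its ghost components, which are prescribed.\<close>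

lemma ghost_prop_universal:
  assumes D: "dirset D" and A: "algebra R A" and G: "ghost_prop D A N" and a: "a \<in> Hm D A" and c: "c \<in> Hm D A"
    and h: "h \<in> alg_hom R (Balg D) A" "\<forall>n\<in>D. \<forall>g\<in>L n. h (copy e1 g) = a g \<and> h (copy e2 g) = c g"
    and n: "n \<in> D" and g: "g \<in> L n"
  shows "rop b N a c g = h (ev PP cst (\<lambda>i. rop b PP (vr (e1 i)) (vr (e2 i))) g)"
    and "r \<in> carrier R \<Longrightarrow> (r \<odot>\<^bsub>N\<^esub> a) g = h (ev PP cst (\<lambda>i. cst (io r) \<otimes>\<^bsub>PP\<^esub> vr (e1 i)) g)"
proof -
  obtain V where V: "is_functorial_ghost_structure R (Lalg D) D vr V"
    and VN: "\<And>B h. algebra R B \<Longrightarrow> h \<in> alg_hom R B A \<Longrightarrow> compose (LD D) h \<in> alg_hom R (V B) N"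
    using G by (auto simp: ghost_prop_def)
  let ?B = "Balg D"
  have Ba: "algebra R ?B" by (rule algebra_Balg[OF D])
  interpret C: wcover S R0 M P q PP cst "B2 D" by (rule wcover_B2[OF D])
  interpret PP: cring PP by (rule PP_cring)
  have gs: "algebra R (V ?B)" "carrier (V ?B) = Hm D ?B" "\<And>i. i \<in> D \<Longrightarrow> (\<lambda>a. a (vr i)) \<in> alg_hom R (V ?B) ?B"
    using V Ba by (auto simp: is_functorial_ghost_structure_def is_ghost_structure_def)
  let ?u = "restrict (copy e1) (LD D)" and ?v = "restrict (copy e2) (LD D)"
  have uv: "?u \<in> carrier (V ?B)" "?v \<in> carrier (V ?B)" using copy_Hm[OF D] gs(2) by auto
  have cv: "cring (V ?B)" by (rule algebra_facts(2)[OF gs(1)])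
  have boxD: "i \<in> D" if "i \<in> box n" for i using D n that by (auto simp: dirset_def)
  have vl: "vr i \<in> LD D" if "i \<in> D" for i using that L_vr[of i i] by (auto simp: LD_def)
  have hN: "compose (LD D) h \<in> alg_hom R (V ?B) N" by (rule VN[OF Ba h(1)])
  have cu: "compose (LD D) h ?u = a" "compose (LD D) h ?v = c"
    using h(2) by (auto intro!: extensionalityI[OF _ Hm_ext[OF a]] extensionalityI[OF _ Hm_ext[OF c]] simp: compose_def LD_def)
  \<comment> \<open>A homomorphism into \<open>B2 D\<close> is evaluation at its ghost components,
    by \<open>hom_eq_ev\<close>. They exist only for indices in \<open>D\<close>; the family
    \<open>s\<close> continues them arbitrarily.\<close>
  have key: "w g = ev PP cst s g" if w: "w \<in> Hm D ?B" and s: "\<And>i. s i \<in> carrier PP" "\<And>i. i \<in> D \<Longrightarrow> w (vr i) = s i" for w s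
  proof (rule C.hom_eq_ev[OF _ _ _ s(1) _ g])
    note p = Hm_pcov[OF D Ba w n]
    have "w \<in> ring_hom (PP\<lparr>carrier := L n\<rparr>) ?B" using p by (simp add: pcov_def)
    then show "w \<in> ring_hom (PP\<lparr>carrier := L n\<rparr>) PP"
      using subringE(1)[OF B2_subring[OF D]] by (auto simp: ring_hom_def)
    show "w f \<in> B2 D" if "f \<in> L n" for f using pcov_facts(5)[OF p that] by simp
    show "w (cst r) = cst r" if "r \<in> R0" for r
    proof -
      obtain k where k: "k \<in> carrier R" "r = io k" using \<open>r \<in> R0\<close> unfolding R0_eq by blast
      show ?thesis using pcov_facts(9)[OF p k(1)] by (simp add: k struct_map_mpoly)
    qed
  qed (use s(2) boxD in auto)
  have hg: "compose (LD D) h w g = h (w g)" for w using L_LD[OF n g] by (simp add: compose_def)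
  {
    let ?w = "rop b (V ?B) ?u ?v"
    have w: "?w \<in> Hm D ?B" using rop_closed[OF cv uv] gs(2) by simp
    have "?w (vr i) = rop b PP (vr (e1 i)) (vr (e2 i))" if i: "i \<in> D" for i
    proof -
      have "?w (vr i) = rop b ?B (?u (vr i)) (?v (vr i))"
        using rop_hom[OF _ uv, of "\<lambda>a. a (vr i)" ?B b] gs(3)[OF i] by (simp add: alg_hom_def)
      then show ?thesis using vl[OF i] by (simp add: copy_vr)
    qed
    then have "?w g = ev PP cst (\<lambda>i. rop b PP (vr (e1 i)) (vr (e2 i))) g"
      by (intro key[OF w]) (auto simp: rop_closed[OF PP_cring] PP_vr)
    moreover have "rop b N a c = compose (LD D) h ?w"
      using rop_hom[OF _ uv, of "compose (LD D) h" N b] hN by (simp add: alg_hom_def cu)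
    ultimately show "rop b N a c g = h (ev PP cst (\<lambda>i. rop b PP (vr (e1 i)) (vr (e2 i))) g)" by (simp add: hg)
  }
  assume r: "r \<in> carrier R"
  let ?w = "r \<odot>\<^bsub>V ?B\<^esub> ?u"
  have w: "?w \<in> Hm D ?B" using smult_closed'[OF gs(1) r uv(1)] gs(2) by simp
  have "?w (vr i) = cst (io r) \<otimes>\<^bsub>PP\<^esub> vr (e1 i)" if i: "i \<in> D" for i
  proof -
    have "?w (vr i) = r \<odot>\<^bsub>?B\<^esub> ?u (vr i)" using gs(3)[OF i] r uv by (simp add: alg_hom_def)
    also have "\<dots> = r \<odot>\<^bsub>PP\<^esub> vr (e1 i)" using vl[OF i] by (simp add: copy_vr)
    also have "\<dots> = cst (io r) \<otimes>\<^bsub>PP\<^esub> vr (e1 i)"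
      using PP_vr[of "e1 i"] by (intro mpoly_smult[OF r]) (simp add: mpoly_alg_simps)
    finally show ?thesis .
  qed
  then have "?w g = ev PP cst (\<lambda>i. cst (io r) \<otimes>\<^bsub>PP\<^esub> vr (e1 i)) g"
    using r by (intro key[OF w]) (auto simp: PP_vr PP_cst_closed io_carrier)
  moreover have "r \<odot>\<^bsub>N\<^esub> a = compose (LD D) h ?w"
    using hN r uv by (simp add: alg_hom_def cu)
  ultimately show "(r \<odot>\<^bsub>N\<^esub> a) g = h (ev PP cst (\<lambda>i. cst (io r) \<otimes>\<^bsub>PP\<^esub> vr (e1 i)) g)" by (simp add: hg)
qed

definition Wt :: "('e \<Rightarrow>\<^sub>0 nat) set \<Rightarrow> ('a, 'c) module \<Rightarrow> ('a, (('e \<Rightarrow>\<^sub>0 nat) multiset \<Rightarrow> 's) \<Rightarrow> 'c) module" where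
  "Wt D A = ghost_algebra R (Lalg D) D vr A"

text \<open>The chosen structure and \<open>WA D A\<close> both satisfy \<open>ghost_prop\<close>,
  so \<open>ghost_prop_universal\<close> expresses their operations by the same formula. The units
  agree by uniqueness of neutral elements.\<close>

lemma Wt_facts:
  assumes D: "dirset D" and A: "algebra R A"
  shows algebra_Wt: "algebra R (Wt D A)" and carrier_Wt: "carrier (Wt D A) = Hm D A"
    and rop_Wt: "\<And>a c b. a \<in> Hm D A \<Longrightarrow> c \<in> Hm D A \<Longrightarrow> rop b (Wt D A) a c = wop D A b a c"
    and struct_map_Wt: "\<And>r. r \<in> carrier R \<Longrightarrow> struct_map (Wt D A) r = wc D A (io r)"
proof -
  have G: "ghost_prop D A (Wt D A)"
    unfolding Wt_def ghost_algebra_def ghost_prop_def[symmetric] by (rule someI[of _ "WA D A"]) (rule ghost_prop_WA[OF D A])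
  then show alg: "algebra R (Wt D A)" and car: "carrier (Wt D A) = Hm D A"
    by (auto simp: ghost_prop_def is_ghost_structure_def)
  interpret W: cring "Wt D A" by (rule algebra_facts(2)[OF alg])
  have Wc: "cring (Wt D A)" by (rule algebra_facts(2)[OF alg])
  show rop: "rop b (Wt D A) a c = wop D A b a c" if a: "a \<in> Hm D A" and c: "c \<in> Hm D A" for a c b
  proof (rule Hm_eqI)
    show "rop b (Wt D A) a c \<in> Hm D A" using rop_closed[OF Wc, of a c b] a c car by simp
    show "wop D A b a c \<in> Hm D A" by (rule wop_closed[OF D A a c])
    fix n g assume n: "n \<in> D" and g: "g \<in> L n"
    obtain h where h: "h \<in> alg_hom R (Balg D) A" "\<forall>n\<in>D. \<forall>g\<in>L n. h (copy e1 g) = a g \<and> h (copy e2 g) = c g"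
      using universal_hom[OF D A a c] by blast
    show "rop b (Wt D A) a c g = wop D A b a c g"
      using ghost_prop_universal(1)[OF D A G a c h n g, of b] ghost_prop_universal(1)[OF D A ghost_prop_WA[OF D A] a c h n g, of b]
      by (simp add: rop_def WA_def split: if_splits)
  qed
  have sm: "r \<odot>\<^bsub>Wt D A\<^esub> a = r \<odot>\<^bsub>WA D A\<^esub> a" if a: "a \<in> Hm D A" and r: "r \<in> carrier R" for r a
  proof (rule Hm_eqI)
    show "r \<odot>\<^bsub>Wt D A\<^esub> a \<in> Hm D A" using smult_closed'[OF alg r] a car by simp
    show "r \<odot>\<^bsub>WA D A\<^esub> a \<in> Hm D A" by (simp add: WA_def wop_closed[OF D A wc_closed[OF D A io_R0[OF r]] a])
    fix n g assume n: "n \<in> D" and g: "g \<in> L n"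
    obtain h where h: "h \<in> alg_hom R (Balg D) A" "\<forall>n\<in>D. \<forall>g\<in>L n. h (copy e1 g) = a g \<and> h (copy e2 g) = a g"
      using universal_hom[OF D A a a] by blast
    show "(r \<odot>\<^bsub>Wt D A\<^esub> a) g = (r \<odot>\<^bsub>WA D A\<^esub> a) g"
      using ghost_prop_universal(2)[OF D A G a a h n g r] ghost_prop_universal(2)[OF D A ghost_prop_WA[OF D A] a a h n g r] by simp
  qed
  have one: "\<one>\<^bsub>Wt D A\<^esub> = wc D A \<one>"
  proof -
    have o: "\<one>\<^bsub>Wt D A\<^esub> \<in> Hm D A" using car W.one_closed by simp
    have w: "wc D A \<one> \<in> Hm D A" by (rule wc_closed[OF D A R0_closed(2)])
    have "wop D A False \<one>\<^bsub>Wt D A\<^esub> (wc D A \<one>) = \<one>\<^bsub>Wt D A\<^esub>" by (rule wc_one_unit[OF D A o])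
    moreover have "rop False (Wt D A) \<one>\<^bsub>Wt D A\<^esub> (wc D A \<one>) = wc D A \<one>" using w car by (simp add: rop_def)
    ultimately show ?thesis using rop[OF o w, of False] by simp
  qed
  show "struct_map (Wt D A) r = wc D A (io r)" if r: "r \<in> carrier R" for r
    using sm[OF wc_closed[OF D A R0_closed(2)] r] struct_map_WA[OF D A r] by (simp add: struct_map_def one) (simp add: WA_def)
qed

end


section \<open>The canonical map\<close>

context witt_alg
begin

lemma LD_box: "LD (box n) = L n"
proof
  show "LD (box n) \<subseteq> L n" using L_mono by (auto simp: LD_def)
  show "L n \<subseteq> LD (box n)" using L_LD[OF box_refl] by blast
qed

lemma lift_restrict: "lift T \<phi> Q p n s (restrict a (L n)) \<longleftrightarrow> lift T \<phi> Q p n s a"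
  by (simp add: lift_def)

lemma lift_unique:
  assumes "lift T \<phi> Q p n s a" "lift T \<phi> Q p n s c" "g \<in> L n"
  shows "a g = c g"
  using assms unfolding lift_def by simp

lemma pcov_cong:
  assumes "pcov PP cst (L n) A a" "\<And>g. g \<in> L n \<Longrightarrow> c g = a g"
  shows "pcov PP cst (L n) A c"
proof (rule pcov_L)
  have h: "a \<in> ring_hom (PP\<lparr>carrier := L n\<rparr>) A" using assms(1) by (simp add: pcov_def)
  note L = subringE[OF L_subring[of n]]
  show "algebra R A" using assms(1) by (simp add: pcov_def)
  show "c \<in> ring_hom (PP\<lparr>carrier := L n\<rparr>) A"
    using ring_hom_closed[OF h] ring_hom_mult[OF h] ring_hom_add[OF h] ring_hom_one[OF h] L
    by (intro ring_hom_memI) (simp_all add: assms(2))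
  show "c (cst (io r)) = struct_map A r" if "r \<in> carrier R" for r
    using that pcov_facts(9)[OF assms(1)] by (simp add: assms(2) L_cst io_R0)
qed

lemma lift_Hm:
  assumes p: "pcov T \<phi> Q A p" and s: "lift T \<phi> Q p n s a"
  shows "restrict a (L n) \<in> Hm (box n) A"
proof (rule HmI[OF dirset_box])
  show "algebra R A" using p by (simp add: pcov_def)
  show "restrict a (L n) \<in> extensional (LD (box n))" by (simp add: LD_box)
  fix m assume "m \<in> box n"
  then show "pcov PP cst (L m) A (restrict a (L n))"
    using lift_pcov[OF p lift_mono] s lift_restrict by blast
qed

lemma restrict_Hm:
  assumes D: "dirset D" and A: "algebra R A" and a: "a \<in> Hm D A" and n: "n \<in> D"
  shows "restrict a (L n) \<in> Hm (box n) A"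
  using stdlift_exists[OF D A a n] lift_Hm[OF std_cover(1)[OF A]] by blast

text \<open>A lift of a homomorphism at level \<open>n\<close> is also a lift of its truncation, so
  truncation commutes with the operations.\<close>

lemma restrict_Wt:
  fixes A :: "('a, 'c) module"
  assumes D: "dirset D" and A: "algebra R A" and n: "n \<in> D"
  shows "(\<lambda>a. restrict a (L n)) \<in> alg_hom R (Wt D A) (Wt (box n) A)"
proof -
  note std = std_cover(1)[OF A] and B = dirset_box[of n]
  have eq: "restrict u (L n) = v" 
    if "lift (TA A) cst (QA A) (pA A) n s u" "lift (TA A) cst (QA A) (pA A) n s v" "v \<in> Hm (box n) A" for s u v
    by (rule extensionalityI[OF restrict_extensional Hm_ext[OF that(3), unfolded LD_box]])
       (use that(1,2) in \<open>simp add: lift_def\<close>)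
  have r: "restrict (wop D A b a c) (L n) = wop (box n) A b (restrict a (L n)) (restrict c (L n))"
    if ac: "a \<in> Hm D A" "c \<in> Hm D A" for a c b
  proof -
    obtain s t where st: "stdlift A n s a" "stdlift A n t c" using stdlift_exists[OF D A _ n] ac by blast
    note ac' = restrict_Hm[OF D A ac(1) n] restrict_Hm[OF D A ac(2) n]
    show ?thesis
      by (rule eq[OF wop_lift[OF D A ac n std st]
         wop_lift[OF B A ac' box_refl std lift_restrict[THEN iffD2, OF st(1)] lift_restrict[THEN iffD2, OF st(2)]]
         wop_closed[OF B A ac']])
  qed
  have c: "restrict (wc D A k) (L n) = wc (box n) A k" if "k \<in> R0" for k
    by (rule eq[OF wc_lift[OF A n std that] wc_lift[OF A box_refl std that] wc_closed[OF B A that]])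
  show ?thesis
    unfolding alg_hom_iff[OF algebra_Wt[OF D A] algebra_Wt[OF B A]]
  proof (intro conjI ballI)
    show "restrict (struct_map (Wt D A) k) (L n) = struct_map (Wt (box n) A) k" if "k \<in> carrier R" for k
      using that by (simp add: struct_map_Wt[OF D A] struct_map_Wt[OF B A] c io_R0)
    show "(\<lambda>a. restrict a (L n)) \<in> ring_hom (Wt D A) (Wt (box n) A)"
    proof (rule ring_hom_memI)
      fix a b assume "a \<in> carrier (Wt D A)" "b \<in> carrier (Wt D A)"
      then have ac: "a \<in> Hm D A" "b \<in> Hm D A" by (simp_all add: carrier_Wt[OF D A])
      show "restrict a (L n) \<in> carrier (Wt (box n) A)" using restrict_Hm[OF D A ac(1) n] by (simp add: carrier_Wt[OF B A])
      have "restrict (rop d (Wt D A) a b) (L n) = rop d (Wt (box n) A) (restrict a (L n)) (restrict b (L n))" for d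
        using ac restrict_Hm[OF D A _ n] by (simp add: rop_Wt[OF D A] rop_Wt[OF B A] r)
      from this[of True] this[of False]
      show "restrict (a \<otimes>\<^bsub>Wt D A\<^esub> b) (L n) = restrict a (L n) \<otimes>\<^bsub>Wt (box n) A\<^esub> restrict b (L n)"
        "restrict (a \<oplus>\<^bsub>Wt D A\<^esub> b) (L n) = restrict a (L n) \<oplus>\<^bsub>Wt (box n) A\<^esub> restrict b (L n)"
        by (simp_all add: rop_def)
    next
      have o: "\<one>\<^bsub>R\<^esub> \<in> carrier R" using cring.cring_simprules(6)[OF R_cring] .
      note h = ring_hom_one[OF algebra_facts(3)[OF algebra_Wt[OF D A]]] ring_hom_one[OF algebra_facts(3)[OF algebra_Wt[OF B A]]]
      show "restrict \<one>\<^bsub>Wt D A\<^esub> (L n) = \<one>\<^bsub>Wt (box n) A\<^esub>"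
        using o by (simp add: h[symmetric] struct_map_Wt[OF D A] struct_map_Wt[OF B A] c io_R0)
    qed
  qed
qed

text \<open>The homomorphism on \<open>L n\<close> that an integral family induces, as a function of
  the family. Through it the ring of integral families covers the truncated Witt vectors, and the
  lifting results apply to these in turn.\<close>

definition hatp :: "('t, 'm) ring_scheme \<Rightarrow> ('s \<Rightarrow> 't) \<Rightarrow> ('t \<Rightarrow> 'c) \<Rightarrow> ('e \<Rightarrow>\<^sub>0 nat) \<Rightarrow> (('e \<Rightarrow>\<^sub>0 nat) \<Rightarrow> 't) \<Rightarrow>
    ((('e \<Rightarrow>\<^sub>0 nat) multiset \<Rightarrow> 's) \<Rightarrow> 'c)" where
  "hatp T \<phi> p n u = (\<lambda>\<beta>\<in>L n. p (ev T \<phi> u \<beta>))"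

lemma lift_hatp: "wit T \<phi> Q n u \<Longrightarrow> lift T \<phi> Q p n u (hatp T \<phi> p n u)"
  by (simp add: lift_def hatp_def)

lemma hatp_eq: "lift T \<phi> Q p n u a \<Longrightarrow> hatp T \<phi> p n u = restrict a (L n)"
  by (auto simp: lift_def hatp_def)

lemma hatp_Hm: "pcov T \<phi> Q A p \<Longrightarrow> wit T \<phi> Q n u \<Longrightarrow> hatp T \<phi> p n u \<in> Hm (box n) A"
  using lift_Hm[OF _ lift_hatp, of T \<phi> Q A p n u] by (simp add: hatp_def)

lemma restrict_box_Hm: "a \<in> Hm (box n) A \<Longrightarrow> restrict a (L n) = a"
  using Hm_ext[of a "box n" A] by (simp add: LD_box extensional_restrict)

text \<open>By \<open>wop_lift\<close> and \<open>wc_lift\<close>, operations on integral families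
  induce the operations on the homomorphisms that belong to them.\<close>

lemma pcov_hat:
  assumes p: "pcov T \<phi> Q A p"
  shows "pcov (fun_ring T) (\<lambda>r (i :: 'e \<Rightarrow>\<^sub>0 nat). \<phi> r) {s. wit T \<phi> Q n s} (Wt (box n) A) (hatp T \<phi> p n)"
  unfolding pcov_def
proof (intro conjI ballI)
  interpret T: wcover S R0 M P q T \<phi> Q using p by (simp add: pcov_def)
  have A: "algebra R A" using p by (simp add: pcov_def)
  note B = dirset_box[of n]
  show "wcover S R0 M P q (fun_ring T) (\<lambda>r (i :: 'e \<Rightarrow>\<^sub>0 nat). \<phi> r) {s. wit T \<phi> Q n s}" by (rule T.wcover_fun)
  show "algebra R (Wt (box n) A)" by (rule algebra_Wt[OF B A])
  have c: "hatp T \<phi> p n (\<lambda>i. \<phi> k) = wc (box n) A k" if "k \<in> R0" for k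
    using hatp_eq[OF wc_lift[OF A box_refl p that]] restrict_box_Hm[OF wc_closed[OF B A that]] by simp
  show k: "hatp T \<phi> p n (\<lambda>i. \<phi> (io r)) = struct_map (Wt (box n) A) r" if "r \<in> carrier R" for r
    using that by (simp add: c io_R0 struct_map_Wt[OF B A])
  show "hatp T \<phi> p n \<in> ring_hom ((fun_ring T)\<lparr>carrier := {s. wit T \<phi> Q n s}\<rparr>) (Wt (box n) A)"
  proof (rule ring_hom_memI)
    fix s t assume "s \<in> carrier ((fun_ring T)\<lparr>carrier := {s. wit T \<phi> Q n s}\<rparr>)" "t \<in> carrier ((fun_ring T)\<lparr>carrier := {s. wit T \<phi> Q n s}\<rparr>)"
    then have st: "wit T \<phi> Q n s" "wit T \<phi> Q n t" by simp_all
    note l = st[THEN lift_hatp, where p = p] and h = st[THEN hatp_Hm[OF p]]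
    show "hatp T \<phi> p n s \<in> carrier (Wt (box n) A)" using h(1) by (simp add: carrier_Wt[OF B A])
    have "hatp T \<phi> p n (\<lambda>i. rop b T (s i) (t i)) = rop b (Wt (box n) A) (hatp T \<phi> p n s) (hatp T \<phi> p n t)" for b
      using hatp_eq[OF wop_lift[OF B A h box_refl p l, where b = b]] restrict_box_Hm[OF wop_closed[OF B A h, where b = b]]
      by (simp add: rop_Wt[OF B A h])
    from this[of True] this[of False]
    show "hatp T \<phi> p n (s \<otimes>\<^bsub>(fun_ring T)\<lparr>carrier := {s. wit T \<phi> Q n s}\<rparr>\<^esub> t) = hatp T \<phi> p n s \<otimes>\<^bsub>Wt (box n) A\<^esub> hatp T \<phi> p n t"
      "hatp T \<phi> p n (s \<oplus>\<^bsub>(fun_ring T)\<lparr>carrier := {s. wit T \<phi> Q n s}\<rparr>\<^esub> t) = hatp T \<phi> p n s \<oplus>\<^bsub>Wt (box n) A\<^esub> hatp T \<phi> p n t"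
      by (simp_all add: rop_def)
  next
    have o: "\<one>\<^bsub>R\<^esub> \<in> carrier R" using cring.cring_simprules(6)[OF R_cring] .
    have "\<phi> (io \<one>\<^bsub>R\<^esub>) = \<one>\<^bsub>T\<^esub>" by (simp add: ring_hom_one[OF io_hom] ring_hom_one[OF T.phi])
    then show "hatp T \<phi> p n \<one>\<^bsub>(fun_ring T)\<lparr>carrier := {s. wit T \<phi> Q n s}\<rparr>\<^esub> = \<one>\<^bsub>Wt (box n) A\<^esub>"
      using k[OF o] ring_hom_one[OF algebra_facts(3)[OF algebra_Wt[OF B A]]] by simp
  qed
qed

lemma ev_psi:
  assumes p: "wcover S R0 M P q T \<phi> Q" and s: "\<And>i. s i \<in> carrier T"
  shows "\<gamma> \<in> carrier PP \<Longrightarrow> ev T \<phi> s (psi j \<gamma>) = ev T \<phi> (\<lambda>i. s (j + i)) \<gamma>"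
    and "\<beta> \<in> carrier PP \<Longrightarrow> \<gamma> \<in> carrier PP \<Longrightarrow> ev T \<phi> s (comp \<beta> \<gamma>) = ev T \<phi> (\<lambda>j. ev T \<phi> s (psi j \<gamma>)) \<beta>"
proof -
  interpret T: wcover S R0 M P q T \<phi> Q by (rule p)
  note h = T.ev_hom[of s, OF s] T.ev_cst[of s, OF s] T.ev_vr[of s, OF s]
  show "ev T \<phi> s (psi j \<gamma>) = ev T \<phi> (\<lambda>i. s (j + i)) \<gamma>" if "\<gamma> \<in> carrier PP"
    using eval_comp[where s = "\<lambda>l. vr (l + j)", OF PP_cring T.T.is_cring PP_cst h(1) _ PP_vr that, of \<phi>]
    by (simp add: psi_def h(2,3) ac_simps)
  show "ev T \<phi> s (comp \<beta> \<gamma>) = ev T \<phi> (\<lambda>j. ev T \<phi> s (psi j \<gamma>)) \<beta>" if "\<beta> \<in> carrier PP" "\<gamma> \<in> carrier PP"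
    unfolding comp_def
    by (rule eval_comp[where s = "\<lambda>i. psi i \<gamma>", OF PP_cring T.T.is_cring PP_cst h(1) _ psi_closed[OF that(2)] that(1)])
       (simp add: h(2))
qed

text \<open>Evaluating \<open>\<gamma>\<close> at the rows of \<open>s\<close> gives the family of
  the values of \<open>psi j \<gamma>\<close> at \<open>s\<close>, and \<open>comp\<close> is the
  evaluation of \<open>\<beta>\<close> at the \<open>psi j \<gamma>\<close>.\<close>

lemma ev_hat_comp:
  assumes p: "wcover S R0 M P q T \<phi> Q" and s: "\<And>i. s i \<in> carrier T"
    and "\<beta> \<in> carrier PP" "\<gamma> \<in> carrier PP"
  shows "ev T \<phi> (ev (fun_ring T) (\<lambda>r i. \<phi> r) (\<lambda>i j. s (j + i)) \<gamma>) \<beta> = ev T \<phi> s (comp \<beta> \<gamma>)"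
proof -
  interpret T: wcover S R0 M P q T \<phi> Q by (rule p)
  have "ev (fun_ring T) (\<lambda>r i. \<phi> r) (\<lambda>i j. s (j + i)) \<gamma> = (\<lambda>j. ev T \<phi> s (psi j \<gamma>))"
    by (subst T.ev_pointwise[OF s assms(4)]) (simp add: ev_psi(1)[of T \<phi> Q s, OF p s assms(4)])
  then show ?thesis by (simp add: ev_psi(2)[of T \<phi> Q s, OF p s assms(3,4)])
qed

text \<open>The equaliser is a subring that contains the constants and all compositions, so
  \<open>comp_generates\<close> applies.\<close>

lemma comp_agree:
  assumes "pcov PP cst (L (n' + n'')) A a" "pcov PP cst (L (n' + n'')) A c" "Poly_Mapping.keys n' \<inter> Poly_Mapping.keys n'' = {}"
    and "\<And>\<beta> \<gamma>. \<beta> \<in> L n' \<Longrightarrow> \<gamma> \<in> L n'' \<Longrightarrow> a (comp \<beta> \<gamma>) = c (comp \<beta> \<gamma>)"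
    and "g \<in> L (n' + n'')"
  shows "a g = c g"
proof -
  interpret PP: cring PP by (rule PP_cring)
  let ?n = "n' + n''"
  note 1 = pcov_facts[OF assms(1)] and 2 = pcov_facts[OF assms(2)] and L = subringE[OF L_subring[of ?n]]
  have "L ?n \<subseteq> {g \<in> L ?n. a g = c g}"
  proof (rule comp_generates[OF assms(3)])
    show "subring {g \<in> L ?n. a g = c g} PP"
    proof (rule PP.subringI)
      fix x y assume xy: "x \<in> {g \<in> L ?n. a g = c g}" "y \<in> {g \<in> L ?n. a g = c g}"
      then have "rop b PP x y \<in> {g \<in> L ?n. a g = c g}" for b
        using 1(6) 2(6) subring_rop[OF L_subring[of ?n]] by simp
      from this[of True] this[of False]
      show "x \<otimes>\<^bsub>PP\<^esub> y \<in> {g \<in> L ?n. a g = c g}" "x \<oplus>\<^bsub>PP\<^esub> y \<in> {g \<in> L ?n. a g = c g}" by (simp_all add: rop_def)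
    qed (use L 1(7,8) 2(7,8) L_carrier in auto)
    show "cst r \<in> {g \<in> L ?n. a g = c g}" if "r \<in> R0" for r
    proof -
      obtain k where k: "k \<in> carrier R" "r = io k" using \<open>r \<in> R0\<close> unfolding R0_eq by blast
      show ?thesis using L_cst[OF that] 1(9)[OF k(1)] 2(9)[OF k(1)] by (simp add: k(2))
    qed
    show "comp \<beta> \<gamma> \<in> {g \<in> L ?n. a g = c g}" if "\<beta> \<in> L n'" "\<gamma> \<in> L n''" for \<beta> \<gamma>
      using L_comp[OF that] assms(4)[OF that] by simp
  qed
  then show ?thesis using assms(5) by blast
qed

end

section \<open>The canonical map for a splitting of the exponents\<close>

locale witt_split = witt_alg S R0 M P q R
  for S :: "('a, 's) module" (structure) and R0 and M P :: "'e \<Rightarrow> 's set" and q and R +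
  fixes D D' D'' :: "('e \<Rightarrow>\<^sub>0 nat) set"
  assumes D: "dirset D" and D': "dirset D'" and D'': "dirset D''"
    and D_add: "n' \<in> D' \<Longrightarrow> n'' \<in> D'' \<Longrightarrow> n' + n'' \<in> D"
    and D_disj: "n' \<in> D' \<Longrightarrow> n'' \<in> D'' \<Longrightarrow> Poly_Mapping.keys n' \<inter> Poly_Mapping.keys n'' = {}"
    and D_split: "n \<in> D \<Longrightarrow> \<exists>n'\<in>D'. \<exists>n''\<in>D''. n = n' + n''"
begin

text \<open>The form of \<open>canonical_map\<close> for directed sets of exponents. The full and
  the truncated map are its instances for all exponents and for boxes.\<close>

definition canon :: "((('e \<Rightarrow>\<^sub>0 nat) multiset \<Rightarrow> 's) \<Rightarrow> 'c) \<Rightarrow> (('e \<Rightarrow>\<^sub>0 nat) multiset \<Rightarrow> 's) \<Rightarrow> (('e \<Rightarrow>\<^sub>0 nat) multiset \<Rightarrow> 's) \<Rightarrow> 'c" where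
  "canon a = (\<lambda>\<gamma>\<in>LD D''. \<lambda>\<beta>\<in>LD D'. a (comp \<beta> \<gamma>))"

lemma hat_lift:
  assumes n: "n' \<in> D'" "n'' \<in> D''" and p: "pcov T \<phi> Q A p" and s: "lift T \<phi> Q p (n' + n'') s a"
    and \<gamma>: "\<gamma> \<in> L n''"
  shows "hatp T \<phi> p n' (ev (fun_ring T) (\<lambda>r i. \<phi> r) (\<lambda>i j. s (j + i)) \<gamma>) = restrict (canon a \<gamma>) (L n')"
proof -
  have w: "wcover S R0 M P q T \<phi> Q" using p by (simp add: pcov_def)
  have sc: "s i \<in> carrier T" for i using wit_closed s unfolding lift_def by blast
  have "p (ev T \<phi> (ev (fun_ring T) (\<lambda>r i. \<phi> r) (\<lambda>i j. s (j + i)) \<gamma>) \<beta>) = a (comp \<beta> \<gamma>)" if "\<beta> \<in> L n'" for \<beta>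
    using s L_comp[OF that \<gamma>] unfolding lift_def
    by (subst ev_hat_comp[of T \<phi> Q s, OF w sc L_carrier[OF that] L_carrier[OF \<gamma>]]) blast
  then show ?thesis
    using L_LD[OF n(2) \<gamma>] L_LD[OF n(1)] by (auto simp: hatp_def canon_def fun_eq_iff restrict_def)
qed

text \<open>The rows of a lift of \<open>a\<close> are a lift of the canonical image of
  \<open>a\<close>, truncated at \<open>n'\<close>, on the cover of the truncated Witt vectors by
  integral families. That \<open>canon\<close> is well defined and compatible with the operations is
  read off from this.\<close>

lemma hat_lift':
  assumes n: "n' \<in> D'" "n'' \<in> D''" and p: "pcov T \<phi> Q A p" and s: "lift T \<phi> Q p (n' + n'') s a"
  shows "lift (fun_ring T) (\<lambda>r i. \<phi> r) {s. wit T \<phi> Q n' s} (hatp T \<phi> p n') n'' (\<lambda>i j. s (j + i))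
    (compose (LD D'') (\<lambda>w. restrict w (L n')) (canon a))"
  unfolding lift_def
proof (intro conjI ballI)
  interpret T: wcover S R0 M P q T \<phi> Q using p by (simp add: pcov_def)
  show "wit (fun_ring T) (\<lambda>r i. \<phi> r) {s. wit T \<phi> Q n' s} n'' (\<lambda>i j. s (j + i))"
    using s by (intro T.wit_hat) (simp add: lift_def)
  fix \<gamma> assume \<gamma>: "\<gamma> \<in> L n''"
  show "hatp T \<phi> p n' (ev (fun_ring T) (\<lambda>r i. \<phi> r) (\<lambda>i j. s (j + i)) \<gamma>) =
      compose (LD D'') (\<lambda>w. restrict w (L n')) (canon a) \<gamma>"
    using hat_lift[OF assms \<gamma>] L_LD[OF n(2) \<gamma>] by (simp add: compose_eq)
qed

lemma canon_restrict_pcov: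
  assumes A: "algebra R A" and a: "a \<in> Hm D A" and n: "n' \<in> D'" "n'' \<in> D''"
  shows "pcov PP cst (L n'') (Wt (box n') A) (\<lambda>\<gamma>. restrict (canon a \<gamma>) (L n'))"
proof -
  obtain s where s: "stdlift A (n' + n'') s a" using stdlift_exists[OF D A a D_add[OF n]] by blast
  have "pcov PP cst (L n'') (Wt (box n') A) (compose (LD D'') (\<lambda>w. restrict w (L n')) (canon a))"
    by (rule lift_pcov[OF pcov_hat[OF std_cover(1)[OF A]] hat_lift'[OF n std_cover(1)[OF A] s]])
  then show ?thesis by (rule pcov_cong) (simp add: compose_eq L_LD[OF n(2)])
qed

lemma canon_inner:
  assumes A: "algebra R A" and a: "a \<in> Hm D A" and \<gamma>: "\<gamma> \<in> LD D''"
  shows "canon a \<gamma> \<in> Hm D' A"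
proof (rule HmI[OF D' A])
  show "canon a \<gamma> \<in> extensional (LD D')" using \<gamma> by (simp add: canon_def)
  fix n' assume n': "n' \<in> D'"
  obtain n'' where n'': "n'' \<in> D''" "\<gamma> \<in> L n''" using \<gamma> by (auto simp: LD_def)
  have "restrict (canon a \<gamma>) (L n') \<in> Hm (box n') A"
    using pcov_facts(5)[OF canon_restrict_pcov[OF A a n' n''(1)] n''(2)] by (simp add: carrier_Wt[OF dirset_box A])
  from Hm_pcov[OF dirset_box A this box_refl] show "pcov PP cst (L n') A (canon a \<gamma>)"
    by (rule pcov_cong) simp
qed

text \<open>Covers by integral families are at hand level by level, so equality of homomorphisms on
  the union is checked after truncation.\<close>

lemma Hm_restrict_eqI:
  assumes "a \<in> Hm D' A" "c \<in> Hm D' A" "\<And>n'. n' \<in> D' \<Longrightarrow> restrict a (L n') = restrict c (L n')"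
  shows "a = c"
  by (rule Hm_eqI[OF assms(1,2)]) (use assms(3) in \<open>metis restrict_apply'\<close>)

lemma canon_Hm:
  assumes A: "algebra R A" and a: "a \<in> Hm D A"
  shows "canon a \<in> Hm D'' (Wt D' A)"
proof (rule HmI[OF D'' algebra_Wt[OF D' A]])
  let ?W = "Wt D' A"
  have W: "algebra R ?W" and Wc: "cring ?W" using algebra_Wt[OF D' A] algebra_facts(2) by auto
  note car = carrier_Wt[OF D' A]
  show "canon a \<in> extensional (LD D'')" by (simp add: canon_def)
  fix n'' assume n'': "n'' \<in> D''"
  note in' = canon_inner[OF A a L_LD[OF n'']] and L = subringE[OF L_subring[of n'']]
  have rop: "canon a (rop b PP f g) = rop b ?W (canon a f) (canon a g)" if fg: "f \<in> L n''" "g \<in> L n''" for b f g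
  proof (rule Hm_restrict_eqI)
    show "canon a (rop b PP f g) \<in> Hm D' A" by (rule in'[OF subring_rop[OF L_subring fg]])
    show "rop b ?W (canon a f) (canon a g) \<in> Hm D' A"
      using rop_closed[OF Wc, of "canon a f" "canon a g" b] in'[OF fg(1)] in'[OF fg(2)] by (simp add: car)
    fix n' assume n': "n' \<in> D'"
    have h: "(\<lambda>a. restrict a (L n')) \<in> ring_hom ?W (Wt (box n') A)"
      using restrict_Wt[OF D' A n'] by (simp add: alg_hom_def)
    show "restrict (canon a (rop b PP f g)) (L n') = restrict (rop b ?W (canon a f) (canon a g)) (L n')"
      using rop_hom[OF h, of "canon a f" "canon a g" b] in'[OF fg(1)] in'[OF fg(2)] 
        pcov_facts(6)[OF canon_restrict_pcov[OF A a n' n''] fg, of b] by (simp add: car)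
  qed
  have cst: "canon a (cst (io r)) = struct_map ?W r" if r: "r \<in> carrier R" for r
  proof (rule Hm_restrict_eqI)
    show "canon a (cst (io r)) \<in> Hm D' A" by (rule in'[OF L_cst[OF io_R0[OF r]]])
    show "struct_map ?W r \<in> Hm D' A" using ring_hom_closed[OF algebra_facts(3)[OF W] r] by (simp add: car)
    fix n' assume n': "n' \<in> D'"
    have "restrict (struct_map ?W r) (L n') = struct_map (Wt (box n') A) r"
      using restrict_Wt[OF D' A n'] r unfolding alg_hom_iff[OF W algebra_Wt[OF dirset_box A]] by blast
    then show "restrict (canon a (cst (io r))) (L n') = restrict (struct_map ?W r) (L n')"
      using pcov_facts(9)[OF canon_restrict_pcov[OF A a n' n''] r] by simp
  qed
  show "pcov PP cst (L n'') ?W (canon a)"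
  proof (rule pcov_L[OF W _ cst])
    show "canon a \<in> ring_hom (PP\<lparr>carrier := L n''\<rparr>) ?W"
    proof (rule ring_hom_memI)
      fix f g assume "f \<in> carrier (PP\<lparr>carrier := L n''\<rparr>)" "g \<in> carrier (PP\<lparr>carrier := L n''\<rparr>)"
      then have fg: "f \<in> L n''" "g \<in> L n''" by simp_all
      show "canon a f \<in> carrier ?W" using in'[OF fg(1)] by (simp add: car)
      show "canon a (f \<otimes>\<^bsub>PP\<lparr>carrier := L n''\<rparr>\<^esub> g) = canon a f \<otimes>\<^bsub>?W\<^esub> canon a g"
        "canon a (f \<oplus>\<^bsub>PP\<lparr>carrier := L n''\<rparr>\<^esub> g) = canon a f \<oplus>\<^bsub>?W\<^esub> canon a g"
        using rop[OF fg, of True] rop[OF fg, of False] by (simp_all add: rop_def)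
    next
      have "\<one>\<^bsub>R\<^esub> \<in> carrier R" using cring.cring_simprules(6)[OF R_cring] .
      from cst[OF this] show "canon a \<one>\<^bsub>PP\<lparr>carrier := L n''\<rparr>\<^esub> = \<one>\<^bsub>?W\<^esub>"
        by (simp add: ring_hom_one[OF io_hom] ring_hom_one[OF algebra_facts(3)[OF W]] ring_hom_one[OF PP_cst])
    qed
  qed
qed

lemma canon_eqI:
  assumes A: "algebra R A" and "\<Phi> \<in> Hm D'' (Wt D' A)" "\<Psi> \<in> Hm D'' (Wt D' A)"
    and "\<And>n' n'' \<gamma>. n' \<in> D' \<Longrightarrow> n'' \<in> D'' \<Longrightarrow> \<gamma> \<in> L n'' \<Longrightarrow>
      compose (LD D'') (\<lambda>w. restrict w (L n')) \<Phi> \<gamma> = compose (LD D'') (\<lambda>w. restrict w (L n')) \<Psi> \<gamma>"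
  shows "\<Phi> = \<Psi>"
proof (rule Hm_eqI[OF assms(2,3)])
  fix n'' \<gamma> assume n'': "n'' \<in> D''" and \<gamma>: "\<gamma> \<in> L n''"
  note W = algebra_Wt[OF D' A]
  show "\<Phi> \<gamma> = \<Psi> \<gamma>"
  proof (rule Hm_restrict_eqI)
    show "\<Phi> \<gamma> \<in> Hm D' A" "\<Psi> \<gamma> \<in> Hm D' A"
      using pcov_facts(5)[OF Hm_pcov[OF D'' W _ n''] \<gamma>] assms(2,3) by (simp_all add: carrier_Wt[OF D' A])
    show "restrict (\<Phi> \<gamma>) (L n') = restrict (\<Psi> \<gamma>) (L n')" if "n' \<in> D'" for n'
      using assms(4)[OF that n'' \<gamma>] L_LD[OF n'' \<gamma>] by (simp add: compose_eq)
  qed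
qed

text \<open>After truncation at \<open>n'\<close> both sides have a common lift, the rows of the
  pointwise sum or product of lifts of \<open>a\<close> and \<open>c\<close>, and
  \<open>lift_unique\<close> concludes.\<close>

lemma canon_alg_hom:
  fixes A :: "('a, 'c) module"
  assumes A: "algebra R A"
  shows "canon \<in> alg_hom R (Wt D A) (Wt D'' (Wt D' A))"
proof -
  let ?W = "Wt D' A"
  note W = algebra_Wt[OF D' A] and std = std_cover(1)[OF A]
  have rop: "canon (rop b (Wt D A) a c) = rop b (Wt D'' ?W) (canon a) (canon c)"
    if ac: "a \<in> Hm D A" "c \<in> Hm D A" for a c b
  proof -
    note k = canon_Hm[OF A ac(1)] canon_Hm[OF A ac(2)]
    have "canon (wop D A b a c) = wop D'' ?W b (canon a) (canon c)"
    proof (rule canon_eqI[OF A canon_Hm[OF A wop_closed[OF D A ac]] wop_closed[OF D'' W k]])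
      fix n' n'' \<gamma> assume n: "n' \<in> D'" "n'' \<in> D''" and \<gamma>: "\<gamma> \<in> L n''"
      let ?\<rho> = "compose (LD D'') (\<lambda>w. restrict w (L n'))"
      let ?F = "fun_ring (TA A) :: (('e \<Rightarrow>\<^sub>0 nat) \<Rightarrow> _) ring"
      let ?Q = "{s. wit (TA A) cst (QA A) n' s}" and ?p = "hatp (TA A) cst (pA A) n'"
      note WB = algebra_Wt[OF dirset_box[of n'] A] and r = restrict_Wt[OF D' A n(1)]
      obtain s t where st: "stdlift A (n' + n'') s a" "stdlift A (n' + n'') t c" 
        using stdlift_exists[OF D A _ D_add[OF n]] ac by blast
      have l: "lift ?F (\<lambda>r i. cst r) ?Q ?p n'' (\<lambda>i j. rop b (TA A) (s (j + i)) (t (j + i))) (?\<rho> (canon (wop D A b a c)))"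
        by (rule hat_lift'[OF n std wop_lift[OF D A ac D_add[OF n] std st]])
      have "lift ?F (\<lambda>r i. cst r) ?Q ?p n'' (\<lambda>i. rop b ?F (\<lambda>j. s (j + i)) (\<lambda>j. t (j + i))) (wop D'' (Wt (box n') A) b (?\<rho> (canon a)) (?\<rho> (canon c)))"
        by (rule wop_lift[OF D'' WB compose_Hm[OF D'' W WB r k(1)] compose_Hm[OF D'' W WB r k(2)] n(2) pcov_hat[OF std]
              hat_lift'[OF n std st(1)] hat_lift'[OF n std st(2)]])
      moreover have "rop b ?F (\<lambda>j. s (j + i)) (\<lambda>j. t (j + i)) = (\<lambda>j. rop b (TA A) (s (j + i)) (t (j + i)))" for i
        by (simp add: rop_def)
      ultimately have l2: "lift ?F (\<lambda>r i. cst r) ?Q ?p n'' (\<lambda>i j. rop b (TA A) (s (j + i)) (t (j + i))) (?\<rho> (wop D'' ?W b (canon a) (canon c)))"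
        by (simp add: compose_wop[OF D'' W WB r k])
      show "?\<rho> (canon (wop D A b a c)) \<gamma> = ?\<rho> (wop D'' ?W b (canon a) (canon c)) \<gamma>"
        by (rule lift_unique[OF l l2 \<gamma>])
    qed
    then show ?thesis by (simp add: rop_Wt[OF D A ac] rop_Wt[OF D'' W k])
  qed
  have sm: "canon (struct_map (Wt D A) r) = struct_map (Wt D'' ?W) r" if r: "r \<in> carrier R" for r
  proof -
    note r0 = io_R0[OF r]
    have "canon (wc D A (io r)) = wc D'' ?W (io r)"
    proof (rule canon_eqI[OF A canon_Hm[OF A wc_closed[OF D A r0]] wc_closed[OF D'' W r0]])
      fix n' n'' \<gamma> assume n: "n' \<in> D'" "n'' \<in> D''" and \<gamma>: "\<gamma> \<in> L n''"
      let ?\<rho> = "compose (LD D'') (\<lambda>w. restrict w (L n'))"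
      let ?F = "fun_ring (TA A) :: (('e \<Rightarrow>\<^sub>0 nat) \<Rightarrow> _) ring"
      let ?Q = "{s. wit (TA A) cst (QA A) n' s}" and ?p = "hatp (TA A) cst (pA A) n'"
      note WB = algebra_Wt[OF dirset_box[of n'] A] and \<rho> = restrict_Wt[OF D' A n(1)]
      have l: "lift ?F (\<lambda>r i. cst r) ?Q ?p n'' (\<lambda>i j. cst (io r)) (?\<rho> (canon (wc D A (io r))))"
        by (rule hat_lift'[OF n std wc_lift[OF A D_add[OF n] std r0]])
      have "lift ?F (\<lambda>r i. cst r) ?Q ?p n'' (\<lambda>i j. cst (io r)) (wc D'' (Wt (box n') A) (io r))"
        by (rule wc_lift[OF WB n(2) pcov_hat[OF std] r0])
      then have l2: "lift ?F (\<lambda>r i. cst r) ?Q ?p n'' (\<lambda>i j. cst (io r)) (?\<rho> (wc D'' ?W (io r)))"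
        by (simp add: compose_wc[OF D'' W WB \<rho> r0])
      show "?\<rho> (canon (wc D A (io r))) \<gamma> = ?\<rho> (wc D'' ?W (io r)) \<gamma>"
        by (rule lift_unique[OF l l2 \<gamma>])
    qed
    then show ?thesis by (simp add: struct_map_Wt[OF D A r] struct_map_Wt[OF D'' W r])
  qed
  show ?thesis
    unfolding alg_hom_iff[OF algebra_Wt[OF D A] algebra_Wt[OF D'' W]]
  proof (intro conjI ballI sm)
    show "canon \<in> ring_hom (Wt D A) (Wt D'' ?W)"
    proof (rule ring_hom_memI)
      fix a c assume "a \<in> carrier (Wt D A)" "c \<in> carrier (Wt D A)"
      then have ac: "a \<in> Hm D A" "c \<in> Hm D A" by (simp_all add: carrier_Wt[OF D A])
      show "canon a \<in> carrier (Wt D'' ?W)" using canon_Hm[OF A ac(1)] by (simp add: carrier_Wt[OF D'' W])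
      show "canon (a \<otimes>\<^bsub>Wt D A\<^esub> c) = canon a \<otimes>\<^bsub>Wt D'' ?W\<^esub> canon c" "canon (a \<oplus>\<^bsub>Wt D A\<^esub> c) = canon a \<oplus>\<^bsub>Wt D'' ?W\<^esub> canon c"
        using rop[OF ac, of True] rop[OF ac, of False] by (simp_all add: rop_def)
    next
      have "\<one>\<^bsub>R\<^esub> \<in> carrier R" using cring.cring_simprules(6)[OF R_cring] .
      from sm[OF this] show "canon \<one>\<^bsub>Wt D A\<^esub> = \<one>\<^bsub>Wt D'' ?W\<^esub>"
        by (simp add: ring_hom_one[OF algebra_facts(3)[OF algebra_Wt[OF D A]]] ring_hom_one[OF algebra_facts(3)[OF algebra_Wt[OF D'' W]]])
    qed
  qed
qed

lemma canon_apply: "\<gamma> \<in> LD D'' \<Longrightarrow> \<beta> \<in> LD D' \<Longrightarrow> canon a \<gamma> \<beta> = a (comp \<beta> \<gamma>)"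
  by (simp add: canon_def)

text \<open>The canonical image records the values on compositions, and by \<open>comp_agree\<close>
  these determine a homomorphism.\<close>

lemma canon_inj:
  assumes A: "algebra R A" and ac: "a \<in> Hm D A" "c \<in> Hm D A" and eq: "canon a = canon c"
  shows "a = c"
proof (rule Hm_eqI[OF ac])
  fix n g assume n: "n \<in> D" and g: "g \<in> L n"
  obtain n' n'' where n': "n' \<in> D'" "n'' \<in> D''" "n = n' + n''" using D_split[OF n] by blast
  note p = Hm_pcov[OF D A _ n, unfolded n'(3)]
  show "a g = c g"
  proof (rule comp_agree[OF p[OF ac(1)] p[OF ac(2)] D_disj[OF n'(1,2)] _ g[unfolded n'(3)]])
    fix \<beta> \<gamma> assume "\<beta> \<in> L n'" "\<gamma> \<in> L n''"
    then have "\<beta> \<in> LD D'" "\<gamma> \<in> LD D''" using L_LD n' by blast+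
    then show "a (comp \<beta> \<gamma>) = c (comp \<beta> \<gamma>)" using canon_apply eq by metis
  qed
qed

text \<open>\<open>\<Phi>\<close>, truncated at \<open>n'\<close>, lifts by
  \<open>lift_exists\<close> to an integral family \<open>u\<close> of integral families;
  \<open>unhat_exists\<close> turns it into one family \<open>s\<close>, and \<open>s\<close>
  induces \<open>a\<close>.\<close>

lemma canon_local:
  fixes A :: "('a, 'c) module"
  assumes A: "algebra R A" and \<Phi>: "\<Phi> \<in> Hm D'' (Wt D' A)" and n: "n' \<in> D'" "n'' \<in> D''"
  shows "\<exists>a. pcov PP cst (L (n' + n'')) A a \<and> (\<forall>\<gamma>\<in>L n''. \<forall>\<beta>\<in>L n'. a (comp \<beta> \<gamma>) = \<Phi> \<gamma> \<beta>)"
proof -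
  note W = algebra_Wt[OF D' A] and std = std_cover(1)[OF A] and WB = algebra_Wt[OF dirset_box[of n'] A]
  note C = std[unfolded pcov_def, THEN conjunct1]
  interpret T: wcover S R0 M P q "TA A" cst "QA A" by (rule C)
  let ?\<rho> = "compose (LD D'') (\<lambda>w. restrict w (L n'))"
  let ?F = "fun_ring (TA A) :: (('e \<Rightarrow>\<^sub>0 nat) \<Rightarrow> _) ring"
  let ?Q = "{s. wit (TA A) cst (QA A) n' s}" and ?p = "hatp (TA A) cst (pA A) n'"
  have r: "?\<rho> \<Phi> \<in> Hm D'' (Wt (box n') A)" by (rule compose_Hm[OF D'' W WB restrict_Wt[OF D' A n(1)] \<Phi>])
  \<comment> \<open>Every truncated Witt vector has a standard lift, so the cover by integral
    families is surjective.\<close>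
  have "?p ` ?Q = carrier (Wt (box n') A)"
  proof (intro equalityI subsetI)
    show "w \<in> carrier (Wt (box n') A)" if "w \<in> ?p ` ?Q" for w
      using that pcov_facts(5)[OF pcov_hat[OF std]] by blast
    fix w assume "w \<in> carrier (Wt (box n') A)"
    then have w: "w \<in> Hm (box n') A" by (simp add: carrier_Wt[OF dirset_box A])
    obtain u where u: "stdlift A n' u w" using stdlift_exists[OF dirset_box A w box_refl] by blast
    have "w = ?p u" using hatp_eq[OF u] restrict_box_Hm[OF w] by simp
    moreover have "u \<in> ?Q" using u by (simp add: lift_def)
    ultimately show "w \<in> ?p ` ?Q" by blast
  qed
  from lift_exists[OF pcov_hat[OF std] this Hm_pcov[OF D'' WB r n(2)]] obtain u where
    u: "lift ?F (\<lambda>r i. cst r) ?Q ?p n'' u (?\<rho> \<Phi>)" by blast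
  then have uw: "wit ?F (\<lambda>r i. cst r) ?Q n'' u" by (simp add: lift_def)
  have uc: "u i j \<in> carrier (TA A)" for i j using wit_closed[OF uw] by simp
  obtain s where s: "wit (TA A) cst (QA A) (n' + n'') s" "\<And>i j. i \<in> box n'' \<Longrightarrow> j \<in> box n' \<Longrightarrow> s (j + i) = u i j"
    using T.unhat_exists[OF uw D_disj[OF n]] by blast
  have sc: "s i \<in> carrier (TA A)" for i by (rule wit_closed[OF s(1)])
  define a where "a g = pA A (ev (TA A) cst s g)" for g
  have la: "stdlift A (n' + n'') s a" using s(1) by (simp add: lift_def a_def)
  have "a (comp \<beta> \<gamma>) = \<Phi> \<gamma> \<beta>" if \<gamma>: "\<gamma> \<in> L n''" and \<beta>: "\<beta> \<in> L n'" for \<gamma> \<beta>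
  proof -
    let ?h = "ev ?F (\<lambda>r i. cst r) (\<lambda>i j. s (j + i)) \<gamma>" and ?u = "ev ?F (\<lambda>r i. cst r) u \<gamma>"
    note gc = L_carrier[OF \<gamma>]
    have hu: "?h j = ev (TA A) cst (\<lambda>i. s (j + i)) \<gamma>" "?u j = ev (TA A) cst (\<lambda>i. u i j) \<gamma>" for j
      using T.ev_pointwise[of "\<lambda>i j. s (j + i)" \<gamma>, OF sc gc] T.ev_pointwise[of u \<gamma>, OF uc gc] by simp_all
    have huc: "?h j \<in> carrier (TA A)" "?u j \<in> carrier (TA A)" for j
      unfolding hu by (rule T.ev_closed; use sc uc gc in simp)+
    \<comment> \<open>The rows of \<open>s\<close> agree with \<open>u\<close> only on the boxes.
      This suffices for the inner evaluation, as \<open>\<gamma>\<close> involves only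
      \<open>box n''\<close>, and then for the outer one, as \<open>\<beta>\<close> involves only
      \<open>box n'\<close>.\<close>
    have "?h j = ?u j" if "j \<in> box n'" for j
      unfolding hu by (rule T.ev_cong_L[OF _ _ \<gamma>]) (use s(2)[OF _ that] sc uc in auto)
    then have "ev (TA A) cst ?h \<beta> = ev (TA A) cst ?u \<beta>"
      by (intro T.ev_cong_L[OF _ _ \<beta>] huc)
    then have "a (comp \<beta> \<gamma>) = ?p ?u \<beta>"
      using ev_hat_comp[of "TA A" cst "QA A" s, OF C sc L_carrier[OF \<beta>] gc] \<beta> by (simp add: a_def hatp_def)
    also have "?p ?u = ?\<rho> \<Phi> \<gamma>" using u \<gamma> by (simp add: lift_def)
    finally show ?thesis using \<beta> L_LD[OF n(2) \<gamma>] by (simp add: compose_eq)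
  qed
  then show ?thesis using lift_pcov[OF std la] by blast
qed

text \<open>The solutions at the single pairs of levels are unique on their rings by
  \<open>comp_agree\<close>, so they agree where they meet and glue.\<close>

lemma canon_surj:
  fixes A :: "('a, 'c) module"
  assumes A: "algebra R A" and \<Phi>: "\<Phi> \<in> Hm D'' (Wt D' A)"
  shows "\<exists>a\<in>Hm D A. canon a = \<Phi>"
proof -
  note W = algebra_Wt[OF D' A]
  define G where "G n' n'' a \<longleftrightarrow> pcov PP cst (L (n' + n'')) A a \<and> (\<forall>\<gamma>\<in>L n''. \<forall>\<beta>\<in>L n'. a (comp \<beta> \<gamma>) = \<Phi> \<gamma> \<beta>)" for n' n'' a
  define aa where "aa n' n'' = (SOME a. G n' n'' a)" for n' n''
  have aa: "G n' n'' (aa n' n'')" if "n' \<in> D'" "n'' \<in> D''" for n' n''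
    using canon_local[OF A \<Phi> that] unfolding aa_def G_def[symmetric] by (rule someI_ex)
  have coh: "aa l' l'' g = aa n' n'' g" 
    if n: "n' \<in> D'" "n'' \<in> D''" and l: "l' \<in> D'" "l'' \<in> D''" and nl: "n' \<in> box l'" "n'' \<in> box l''" and g: "g \<in> L (n' + n'')"
    for n' n'' l' l'' g
  proof (rule comp_agree[OF _ _ D_disj[OF n] _ g])
    have L: "L (n' + n'') \<subseteq> L (l' + l'')" by (rule L_mono[OF box_plus[OF nl]])
    have pl: "pcov PP cst (L (l' + l'')) A (aa l' l'')" using aa[OF l] by (simp add: G_def)
    show "pcov PP cst (L (n' + n'')) A (aa n' n'')" using aa[OF n] by (simp add: G_def)
    show "pcov PP cst (L (n' + n'')) A (aa l' l'')"
    proof (rule pcov_L[OF A])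
      show "aa l' l'' \<in> ring_hom (PP\<lparr>carrier := L (n' + n'')\<rparr>) A"
        using pl L by (auto simp: pcov_def ring_hom_def subset_iff)
    qed (rule pcov_facts(9)[OF pl])
    show "aa l' l'' (comp \<beta> \<gamma>) = aa n' n'' (comp \<beta> \<gamma>)" if "\<beta> \<in> L n'" "\<gamma> \<in> L n''" for \<beta> \<gamma>
      using that aa[OF n] aa[OF l] L_mono[OF nl(1)] L_mono[OF nl(2)] unfolding G_def by (metis subsetD)
  qed
  \<comment> \<open>A pair of levels is picked for each \<open>g\<close> separately; by
    \<open>coh\<close> its choice does not influence the value.\<close>
  define a where "a = (\<lambda>g\<in>LD D. case SOME (n', n''). n' \<in> D' \<and> n'' \<in> D'' \<and> g \<in> L (n' + n'') of (n', n'') \<Rightarrow> aa n' n'' g)"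
  have a: "a g = aa n' n'' g" if n: "n' \<in> D'" "n'' \<in> D''" and g: "g \<in> L (n' + n'')" for n' n'' g
  proof -
    let ?PR = "\<lambda>x. case x of (n', n'') \<Rightarrow> n' \<in> D' \<and> n'' \<in> D'' \<and> g \<in> L (n' + n'')"
    obtain m' m'' where m: "(SOME x. ?PR x) = (m', m'')" by (cases "SOME x. ?PR x")
    have "?PR (SOME x. ?PR x)" by (rule someI[of _ "(n', n'')"]) (use n g in simp)
    then have m': "m' \<in> D'" "m'' \<in> D''" "g \<in> L (m' + m'')" unfolding m by simp_all
    obtain l' where l': "l' \<in> D'" "n' \<in> box l'" "m' \<in> box l'" using dirsetD[OF D' n(1) m'(1)] by blast
    obtain l'' where l'': "l'' \<in> D''" "n'' \<in> box l''" "m'' \<in> box l''" using dirsetD[OF D'' n(2) m'(2)] by blast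
    have "a g = aa m' m'' g" using m L_LD[OF D_add[OF n] g] by (simp add: a_def)
    also have "\<dots> = aa l' l'' g" by (rule coh[OF m'(1,2) l'(1) l''(1) l'(3) l''(3) m'(3), symmetric])
    also have "\<dots> = aa n' n'' g" by (rule coh[OF n l'(1) l''(1) l'(2) l''(2) g])
    finally show ?thesis .
  qed
  have aH: "a \<in> Hm D A"
  proof (rule HmI[OF D A])
    show "a \<in> extensional (LD D)" by (simp add: a_def)
    fix n assume "n \<in> D"
    then obtain n' n'' where n: "n' \<in> D'" "n'' \<in> D''" "n = n' + n''" using D_split by blast
    have "pcov PP cst (L (n' + n'')) A (aa n' n'')" using aa[OF n(1,2)] by (simp add: G_def)
    then show "pcov PP cst (L n) A a" unfolding n(3) by (rule pcov_cong) (rule a[OF n(1,2)])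
  qed
  have "canon a = \<Phi>"
  proof (rule Hm_eqI[OF canon_Hm[OF A aH] \<Phi>])
    fix n'' \<gamma> assume n'': "n'' \<in> D''" and \<gamma>: "\<gamma> \<in> L n''"
    show "canon a \<gamma> = \<Phi> \<gamma>"
    proof (rule Hm_eqI[OF canon_inner[OF A aH L_LD[OF n'' \<gamma>]]])
      show "\<Phi> \<gamma> \<in> Hm D' A"
        using pcov_facts(5)[OF Hm_pcov[OF D'' W \<Phi> n''] \<gamma>] by (simp add: carrier_Wt[OF D' A])
      fix n' \<beta> assume n': "n' \<in> D'" and \<beta>: "\<beta> \<in> L n'"
      show "canon a \<gamma> \<beta> = \<Phi> \<gamma> \<beta>"
        using aa[OF n' n''] \<beta> \<gamma> a[OF n' n'' L_comp[OF \<beta> \<gamma>]]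
        by (simp add: canon_apply[OF L_LD[OF n'' \<gamma>] L_LD[OF n' \<beta>]] G_def)
    qed
  qed
  then show ?thesis using aH by blast
qed

theorem canon_iso:
  fixes A :: "('a, 'c) module"
  assumes A: "algebra R A"
  shows "canon \<in> alg_iso R (Wt D A) (Wt D'' (Wt D' A))"
proof -
  have "canon ` Hm D A = Hm D'' (Wt D' A)"
    using canon_Hm[OF A] canon_surj[OF A] by blast
  then have "bij_betw canon (carrier (Wt D A)) (carrier (Wt D'' (Wt D' A)))"
    using canon_inj[OF A] by (auto simp: bij_betw_def inj_on_def carrier_Wt[OF D A] carrier_Wt[OF D'' algebra_Wt[OF D' A]])
  then show ?thesis using canon_alg_hom[OF A] by (simp add: alg_iso_def)
qed

end


section \<open>Supramaximal ideals\<close>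

lemma quot_facts:
  assumes "cring R" "ideal I R"
  shows quot_hom: "(+>\<^bsub>R\<^esub>) I \<in> ring_hom R (R Quot I)"
    and quot_surj: "carrier (R Quot I) = (+>\<^bsub>R\<^esub>) I ` carrier R"
    and quot_zero: "x \<in> carrier R \<Longrightarrow> I +>\<^bsub>R\<^esub> x = \<zero>\<^bsub>R Quot I\<^esub> \<longleftrightarrow> x \<in> I"
    and quot_eq: "x \<in> carrier R \<Longrightarrow> y \<in> carrier R \<Longrightarrow> I +>\<^bsub>R\<^esub> x = I +>\<^bsub>R\<^esub> y \<longleftrightarrow> x \<ominus>\<^bsub>R\<^esub> y \<in> I"
proof -
  interpret R: cring R by fact
  interpret I: ideal I R by fact
  interpret Q: cring "R Quot I" by (rule I.quotient_is_cring[OF assms(1)])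
  show h: "(+>\<^bsub>R\<^esub>) I \<in> ring_hom R (R Quot I)" by (rule I.rcos_ring_hom)
  show "carrier (R Quot I) = (+>\<^bsub>R\<^esub>) I ` carrier R" by (auto simp: FactRing_def A_RCOSETS_def')
  show z: "I +>\<^bsub>R\<^esub> x = \<zero>\<^bsub>R Quot I\<^esub> \<longleftrightarrow> x \<in> I" if "x \<in> carrier R" for x
    using R.a_coset_join1[OF _ that I.a_subgroup] R.a_coset_join2[OF that I.a_subgroup] by (auto simp: FactRing_def)
  show "I +>\<^bsub>R\<^esub> x = I +>\<^bsub>R\<^esub> y \<longleftrightarrow> x \<ominus>\<^bsub>R\<^esub> y \<in> I" if "x \<in> carrier R" "y \<in> carrier R"
  proof -
    have "I +>\<^bsub>R\<^esub> (x \<ominus>\<^bsub>R\<^esub> y) = (I +>\<^bsub>R\<^esub> x) \<ominus>\<^bsub>R Quot I\<^esub> (I +>\<^bsub>R\<^esub> y)"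
      by (rule ring_hom_minus(1)[OF R.is_cring Q.is_cring h that])
    then show ?thesis
      using z[of "x \<ominus>\<^bsub>R\<^esub> y"] that ring_hom_closed[OF h] by (simp add: Q.r_right_minus_eq)
  qed
qed

lemma ring_hom_add_pow:
  assumes "cring T" "cring U" "h \<in> ring_hom T U" "x \<in> carrier T"
  shows "h (add_pow T (k :: nat) x) = add_pow U k (h x)"
proof -
  interpret T: cring T by fact
  interpret U: cring U by fact
  have "add_pow T k x \<in> carrier T \<and> h (add_pow T k x) = add_pow U k (h x)"
    by (induct k) (use assms(4) ring_hom_zero[OF assms(3) T.ring_axioms U.ring_axioms] in
      \<open>auto simp: add_pow_def nat_pow_def ring_hom_add[OF assms(3)]\<close>)
  then show ?thesis ..
qed

text \<open>The elements other than zero form a group of order \<open>q - 1\<close>; for zero it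
  matters that the exponent is positive.\<close>

lemma finite_field_frobenius:
  assumes "field F" "finite (carrier F)" "x \<in> carrier F"
  shows "x [^]\<^bsub>F\<^esub> order F = x"
proof -
  interpret F: field F by fact
  have "order F > 0" using assms(2,3) by (auto simp: order_def card_gt_0_iff)
  then obtain k where k: "order F = Suc k" using gr0_implies_Suc by blast
  show ?thesis
  proof (cases "x = \<zero>\<^bsub>F\<^esub>")
    case True
    then show ?thesis using F.zero_closed by (simp add: k)
  next
    case False
    interpret G: group "Multiplicative_Group.mult_of F" by (rule F.field_mult_group)
    have "x [^]\<^bsub>Multiplicative_Group.mult_of F\<^esub> order (Multiplicative_Group.mult_of F) = \<one>\<^bsub>Multiplicative_Group.mult_of F\<^esub>"
      by (rule G.pow_order_eq_1) (use assms(3) False in simp)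
    then have "x [^]\<^bsub>F\<^esub> k = \<one>\<^bsub>F\<^esub>" using F.order_mult_of[OF assms(2)] by (simp add: Multiplicative_Group.nat_pow_mult_of k)
    then show ?thesis using assms(3) by (simp add: k)
  qed
qed

text \<open>Sylow's theorem with exponent 1 gives a subgroup of order \<open>l\<close> of the
  additive group, hence some \<open>x\<close> other than zero with \<open>l x = 0\<close>.
  Cancelling \<open>x\<close> leaves \<open>l 1 = 0\<close>.\<close>

lemma finite_field_prime:
  assumes "field F" "finite (carrier F)" "Factorial_Ring.prime l" "l dvd order F"
  shows "add_pow F l \<one>\<^bsub>F\<^esub> = \<zero>\<^bsub>F\<^esub>"
proof -
  interpret F: field F by fact
  obtain m where m: "order F = l ^ 1 * m" using assms(4) by (auto elim: dvdE)
  have "order (add_monoid F) = l ^ 1 * m" using m by (simp add: order_def)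
  from sylow_thm[OF assms(3) F.a_group this] assms(2) obtain H where H: "subgroup H (add_monoid F)" "card H = l" by auto
  interpret H: group "(add_monoid F)\<lparr>carrier := H\<rparr>" by (rule subgroup.subgroup_is_group[OF H(1) F.a_group])
  have "card H > 1" using H(2) prime_gt_1_nat[OF assms(3)] by simp
  moreover have fin: "finite H" using \<open>card H > 1\<close> card.infinite by fastforce
  ultimately obtain x where x: "x \<in> H" "x \<noteq> \<zero>\<^bsub>F\<^esub>"
    by (metis card_le_Suc0_iff_eq One_nat_def leD)
  have xF: "x \<in> carrier F" using x(1) subgroup.subset[OF H(1)] by auto
  have "x [^]\<^bsub>(add_monoid F)\<lparr>carrier := H\<rparr>\<^esub> order ((add_monoid F)\<lparr>carrier := H\<rparr>) = \<one>\<^bsub>(add_monoid F)\<lparr>carrier := H\<rparr>\<^esub>"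
    by (rule H.pow_order_eq_1) (use x in simp)
  then have "add_pow F l x = \<zero>\<^bsub>F\<^esub>" by (simp add: add_pow_def order_def H(2) nat_pow_def)
  then have "add_pow F l \<one>\<^bsub>F\<^esub> \<otimes>\<^bsub>F\<^esub> x = \<zero>\<^bsub>F\<^esub>" using xF by (simp add: F.add_pow_ldistr)
  then show ?thesis using x(2) xF F.integral[of "add_pow F l \<one>\<^bsub>F\<^esub>" x] by auto
qed

text \<open>A prime dividing both \<open>q\<close> and the binomial coefficient would make the latter vanish in the field;
  so if it does not vanish, \<open>q\<close> is coprime to it and divides \<open>j\<close>.\<close>

lemma finite_field_binomial:
  assumes "field F" "finite (carrier F)" "0 < j" "j < order F"
  shows "add_pow F (order F choose j) \<one>\<^bsub>F\<^esub> = \<zero>\<^bsub>F\<^esub>"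
proof (rule ccontr)
  interpret F: field F by fact
  let ?q = "order F" and ?C = "order F choose j"
  assume nz: "add_pow F ?C \<one>\<^bsub>F\<^esub> \<noteq> \<zero>\<^bsub>F\<^esub>"
  have "\<not> l dvd ?C" if "Factorial_Ring.prime l" "l dvd ?q" for l
  proof
    assume "l dvd ?C"
    then obtain k where k: "?C = l * k" by (auto elim: dvdE)
    have "add_pow F ?C \<one>\<^bsub>F\<^esub> = add_pow F k (add_pow F l \<one>\<^bsub>F\<^esub>)"
      unfolding k by (simp add: F.add.nat_pow_pow)
    then show False using nz finite_field_prime[OF assms(1,2) that] by simp
  qed
  then have "gcd ?q ?C = 1" using prime_factor_nat[of "gcd ?q ?C"] by auto
  then have "coprime ?q ?C" by (simp only: coprime_iff_gcd_eq_1)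
  moreover have "?q dvd j * ?C"
  proof -
    obtain i k where "j = Suc i" "?q = Suc k" using assms(3,4) by (metis gr0_implies_Suc less_trans)
    \<comment> \<open>The absorption identity \<open>j C(q, j) = q C(q-1, j-1)\<close>.\<close>
    then have "j * ?C = ?q * (k choose i)" using Suc_times_binomial[of i k] by (simp only:)
    then show ?thesis by simp
  qed
  ultimately have "?q dvd j" by (simp add: coprime_dvd_mult_left_iff)
  then show False using assms(3,4) by (simp add: nat_dvd_not_less)
qed

text \<open>\<open>localisation\<close> expects a ring record without further fields, so the type of
  \<open>R\<close> is fixed here.\<close>

locale unextended_cring = cring R for R :: "'a ring" (structure)
begin

section \<open>Localisation at a prime ideal and local generators\<close>

lemma loc_rel_iff:
  assumes "primeideal p R"
  shows "((a, s), (b, t)) \<in> loc_rel R p \<longleftrightarrow> a \<in> carrier R \<and> s \<in> carrier R - p \<and> b \<in> carrier R \<and> t \<in> carrier R - p \<and>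
    (\<exists>u\<in>carrier R - p. u \<otimes> (a \<otimes> t) = u \<otimes> (b \<otimes> s))"
proof -
  have "u \<otimes> (a \<otimes> t \<ominus> b \<otimes> s) = \<zero> \<longleftrightarrow> u \<otimes> (a \<otimes> t) = u \<otimes> (b \<otimes> s)"
    if "u \<in> carrier R" "a \<in> carrier R" "s \<in> carrier R" "b \<in> carrier R" "t \<in> carrier R" for u
  proof -
    have "u \<otimes> (a \<otimes> t \<ominus> b \<otimes> s) = u \<otimes> (a \<otimes> t) \<ominus> u \<otimes> (b \<otimes> s)"
      using that by (simp add: a_minus_def r_distr r_minus)
    then show ?thesis using that by (simp add: r_right_minus_eq)
  qed
  then show ?thesis unfolding loc_rel_def by blast
qed

lemma prime_complement_mult:
  assumes "primeideal p R" "u \<in> carrier R - p" "v \<in> carrier R - p"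
  shows "u \<otimes> v \<in> carrier R - p"
  using assms primeideal.I_prime[OF assms(1)] by auto

lemma loc_rel_equiv:
  assumes p: "primeideal p R"
  shows "equiv (carrier R \<times> (carrier R - p)) (loc_rel R p)"
proof (rule equivI)
  interpret p: primeideal p R by fact
  have one: "\<one> \<in> carrier R - p" using p.I_notcarr p.one_imp_carrier by auto
  show "loc_rel R p \<subseteq> (carrier R \<times> (carrier R - p)) \<times> (carrier R \<times> (carrier R - p))"
    using loc_rel_iff[OF p] by auto
  show "refl_on (carrier R \<times> (carrier R - p)) (loc_rel R p)"
    using one by (auto simp: refl_on_def loc_rel_iff[OF p])
  show "sym (loc_rel R p)"
  proof (rule symI)
    fix x y assume "(x, y) \<in> loc_rel R p"
    then obtain a s b t u where e: "x = (a, s)" "y = (b, t)" and A: "a \<in> carrier R" "b \<in> carrier R"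
      "s \<in> carrier R - p" "t \<in> carrier R - p" "u \<in> carrier R - p" and h: "u \<otimes> (a \<otimes> t) = u \<otimes> (b \<otimes> s)"
      by (cases x; cases y) (auto simp: loc_rel_iff[OF p])
    show "(y, x) \<in> loc_rel R p" unfolding e loc_rel_iff[OF p] using A h[symmetric] by blast
  qed
  show "trans (loc_rel R p)"
  proof (rule transI)
    fix x y z assume "(x, y) \<in> loc_rel R p" "(y, z) \<in> loc_rel R p"
    then obtain a s b t c r u v where e: "x = (a, s)" "y = (b, t)" "z = (c, r)"
      and A: "a \<in> carrier R" "b \<in> carrier R" "c \<in> carrier R"
      and B: "s \<in> carrier R - p" "t \<in> carrier R - p" "r \<in> carrier R - p" "u \<in> carrier R - p" "v \<in> carrier R - p"
      and h: "u \<otimes> (a \<otimes> t) = u \<otimes> (b \<otimes> s)" "v \<otimes> (b \<otimes> r) = v \<otimes> (c \<otimes> t)"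
      by (cases x; cases y; cases z) (auto simp: loc_rel_iff[OF p])
    \<comment> \<open>The multiplier is \<open>u v t\<close>: the middle denominator
      \<open>t\<close> cannot be cancelled, but it lies outside \<open>p\<close> and may be
      kept.\<close>
    have "(u \<otimes> (v \<otimes> t)) \<otimes> (a \<otimes> r) = (u \<otimes> (a \<otimes> t)) \<otimes> (v \<otimes> r)" using A B by (simp add: m_ac)
    also have "\<dots> = (v \<otimes> (b \<otimes> r)) \<otimes> (u \<otimes> s)" unfolding h(1) using A B by (simp add: m_ac)
    also have "\<dots> = (u \<otimes> (v \<otimes> t)) \<otimes> (c \<otimes> s)" unfolding h(2) using A B by (simp add: m_ac)
    finally have "(u \<otimes> (v \<otimes> t)) \<otimes> (a \<otimes> r) = (u \<otimes> (v \<otimes> t)) \<otimes> (c \<otimes> s)" .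
    moreover have "u \<otimes> (v \<otimes> t) \<in> carrier R - p" by (intro prime_complement_mult[OF p] B)
    ultimately show "(x, z) \<in> loc_rel R p"
      unfolding e loc_rel_iff[OF p] using A B(1,3) by blast
  qed
qed

lemma loc_ops:
  assumes p: "primeideal p R" and a: "a \<in> carrier R" "s \<in> carrier R - p" and b: "b \<in> carrier R" "t \<in> carrier R - p"
  shows "loc_rel R p `` {(a, s)} \<otimes>\<^bsub>localisation R p\<^esub> loc_rel R p `` {(b, t)} = loc_rel R p `` {(a \<otimes> b, s \<otimes> t)}"
    and "loc_rel R p `` {(a, s)} \<oplus>\<^bsub>localisation R p\<^esub> loc_rel R p `` {(b, t)} = loc_rel R p `` {(a \<otimes> t \<oplus> b \<otimes> s, s \<otimes> t)}"
proof -
  note eq = loc_rel_equiv[OF p] and cl = prime_complement_mult[OF p]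
  have two: "(\<Union>(a, s)\<in>loc_rel R p `` {(a, s)}. \<Union>(b, t)\<in>loc_rel R p `` {(b, t)}. loc_rel R p `` {f a s b t}) = loc_rel R p `` {f a s b t}"
    if f: "\<And>a s b t a' s' b' t'. ((a, s), (a', s')) \<in> loc_rel R p \<Longrightarrow> ((b, t), (b', t')) \<in> loc_rel R p \<Longrightarrow>
      (f a s b t, f a' s' b' t') \<in> loc_rel R p" for f
  proof -
    have "loc_rel R p `` {f a' s' b' t'} = loc_rel R p `` {f a s b t}"
      if "(a', s') \<in> loc_rel R p `` {(a, s)}" "(b', t') \<in> loc_rel R p `` {(b, t)}" for a' s' b' t'
      using f[of a s a' s' b t b' t'] that equiv_class_eq[OF eq] by auto
    moreover have "(a, s) \<in> loc_rel R p `` {(a, s)}" "(b, t) \<in> loc_rel R p `` {(b, t)}"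
      using equiv_class_self[OF eq] a b by auto
    ultimately show ?thesis by blast
  qed
  show "loc_rel R p `` {(a, s)} \<otimes>\<^bsub>localisation R p\<^esub> loc_rel R p `` {(b, t)} = loc_rel R p `` {(a \<otimes> b, s \<otimes> t)}"
    unfolding localisation_def monoid.simps
  proof (rule two)
    fix a s b t a' s' b' t' assume "((a, s), (a', s')) \<in> loc_rel R p" "((b, t), (b', t')) \<in> loc_rel R p"
    then obtain u v where A: "a \<in> carrier R" "b \<in> carrier R" "a' \<in> carrier R" "b' \<in> carrier R"
      and B: "s \<in> carrier R - p" "t \<in> carrier R - p" "s' \<in> carrier R - p" "t' \<in> carrier R - p" "u \<in> carrier R - p" "v \<in> carrier R - p"
      and h: "u \<otimes> (a \<otimes> s') = u \<otimes> (a' \<otimes> s)" "v \<otimes> (b \<otimes> t') = v \<otimes> (b' \<otimes> t)" by (auto simp: loc_rel_iff[OF p])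
    have "(u \<otimes> v) \<otimes> ((a \<otimes> b) \<otimes> (s' \<otimes> t')) = (u \<otimes> (a \<otimes> s')) \<otimes> (v \<otimes> (b \<otimes> t'))" using A B by (simp add: m_ac)
    also have "\<dots> = (u \<otimes> v) \<otimes> ((a' \<otimes> b') \<otimes> (s \<otimes> t))" unfolding h using A B by (simp add: m_ac)
    finally show "((a \<otimes> b, s \<otimes> t), (a' \<otimes> b', s' \<otimes> t')) \<in> loc_rel R p"
      unfolding loc_rel_iff[OF p] using A cl[OF B(1,2)] cl[OF B(3,4)] cl[OF B(5,6)] by blast
  qed
  show "loc_rel R p `` {(a, s)} \<oplus>\<^bsub>localisation R p\<^esub> loc_rel R p `` {(b, t)} = loc_rel R p `` {(a \<otimes> t \<oplus> b \<otimes> s, s \<otimes> t)}"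
    unfolding localisation_def ring.simps
  proof (rule two)
    fix a s b t a' s' b' t' assume "((a, s), (a', s')) \<in> loc_rel R p" "((b, t), (b', t')) \<in> loc_rel R p"
    then obtain u v where A: "a \<in> carrier R" "b \<in> carrier R" "a' \<in> carrier R" "b' \<in> carrier R"
      and B: "s \<in> carrier R - p" "t \<in> carrier R - p" "s' \<in> carrier R - p" "t' \<in> carrier R - p" "u \<in> carrier R - p" "v \<in> carrier R - p"
      and h: "u \<otimes> (a \<otimes> s') = u \<otimes> (a' \<otimes> s)" "v \<otimes> (b \<otimes> t') = v \<otimes> (b' \<otimes> t)" by (auto simp: loc_rel_iff[OF p])
    have C: "s \<in> carrier R" "t \<in> carrier R" "s' \<in> carrier R" "t' \<in> carrier R" "u \<in> carrier R" "v \<in> carrier R" using B by auto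
    have "(u \<otimes> v) \<otimes> ((a \<otimes> t \<oplus> b \<otimes> s) \<otimes> (s' \<otimes> t')) = 
      (u \<otimes> (a \<otimes> s')) \<otimes> (v \<otimes> (t \<otimes> t')) \<oplus> (v \<otimes> (b \<otimes> t')) \<otimes> (u \<otimes> (s \<otimes> s'))" using A C by (simp add: l_distr r_distr m_ac)
    also have "\<dots> = (u \<otimes> v) \<otimes> ((a' \<otimes> t' \<oplus> b' \<otimes> s') \<otimes> (s \<otimes> t))" unfolding h using A C by (simp add: l_distr r_distr m_ac)
    finally show "((a \<otimes> t \<oplus> b \<otimes> s, s \<otimes> t), (a' \<otimes> t' \<oplus> b' \<otimes> s', s' \<otimes> t')) \<in> loc_rel R p"
      unfolding loc_rel_iff[OF p] using A C cl[OF B(1,2)] cl[OF B(3,4)] cl[OF B(5,6)] by blast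
  qed
qed

text \<open>The fractions with numerator in \<open>p\<close> form an ideal of the localisation,
  hence a principal one. Clearing denominators in \<open>a / 1 = (r / s) (\<pi> / t)\<close> yields
  a factor outside \<open>p\<close>, which still depends on \<open>a\<close>.\<close>

lemma local_generator:
  assumes p: "primeideal p R" and V: "principal_domain (localisation R p)"
  shows "\<exists>\<pi>\<in>p. \<forall>a\<in>p. \<exists>f\<in>carrier R - p. \<exists>r\<in>carrier R. f \<otimes> a = r \<otimes> \<pi>"
proof -
  let ?V = "localisation R p" and ?c = "\<lambda>a s. loc_rel R p `` {(a, s)}"
  interpret V: principal_domain ?V by (rule V)
  interpret p: primeideal p R by (rule p)
  note cl = prime_complement_mult[OF p] and ops = loc_ops[OF p] and eq = loc_rel_equiv[OF p]
  have one: "\<one> \<in> carrier R - p" using p.I_notcarr p.one_imp_carrier by auto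
  have car: "carrier ?V = (\<lambda>(a, s). ?c a s) ` (carrier R \<times> (carrier R - p))"
    by (auto simp: localisation_def quotient_def)
  define J where "J = (\<lambda>(a, s). ?c a s) ` (p \<times> (carrier R - p))"
  note pz = additive_subgroup.zero_closed[OF p.additive_subgroup_axioms]
    and pa = additive_subgroup.a_closed[OF p.additive_subgroup_axioms]
  have pc: "a \<in> carrier R" if "a \<in> p" for a using that p.Icarr by blast
  have J: "J \<subseteq> carrier ?V" unfolding J_def car using pc by (intro image_mono) auto
  have mult: "x \<otimes>\<^bsub>?V\<^esub> y \<in> J" if V: "x \<in> carrier ?V" "y \<in> J" for x y
  proof -
    obtain a s b t where xy: "x = ?c a s" "a \<in> carrier R" "s \<in> carrier R - p" "y = ?c b t" "b \<in> p" "t \<in> carrier R - p"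
      using V by (auto simp: J_def car)
    show ?thesis
      unfolding xy(1,4) ops(1)[OF xy(2,3) pc[OF xy(5)] xy(6)] J_def
      using p.I_l_closed[OF xy(5,2)] cl[OF xy(3,6)] by (intro image_eqI[of _ _ "(a \<otimes> b, s \<otimes> t)"]) auto
  qed
  have "ideal J ?V"
  proof (rule idealI[OF V.ring_axioms])
    show "subgroup J (add_monoid ?V)"
    proof (rule V.add.subgroupI)
      show "J \<subseteq> carrier ?V" by (rule J)
      have "?c \<zero> \<one> \<in> J" unfolding J_def using one pz by (intro image_eqI[of _ _ "(\<zero>, \<one>)"]) auto
      then show "J \<noteq> {}" by blast
      fix x assume x: "x \<in> J"
      have "\<ominus>\<^bsub>?V\<^esub> x = (\<ominus>\<^bsub>?V\<^esub> \<one>\<^bsub>?V\<^esub>) \<otimes>\<^bsub>?V\<^esub> x" using x J by (simp add: V.l_minus subset_iff)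
      then show "\<ominus>\<^bsub>?V\<^esub> x \<in> J" using mult[OF _ x] by simp
      fix y assume y: "y \<in> J"
      obtain a s b t where xy: "x = ?c a s" "a \<in> p" "s \<in> carrier R - p" "y = ?c b t" "b \<in> p" "t \<in> carrier R - p"
        using x y by (auto simp: J_def)
      have m: "a \<otimes> t \<oplus> b \<otimes> s \<in> p" using xy p.I_r_closed pa by auto
      show "x \<oplus>\<^bsub>?V\<^esub> y \<in> J"
        unfolding xy(1,4) ops(2)[OF pc[OF xy(2)] xy(3) pc[OF xy(5)] xy(6)] J_def
        using m cl[OF xy(3,6)] by (intro image_eqI[of _ _ "(a \<otimes> t \<oplus> b \<otimes> s, s \<otimes> t)"]) auto
    qed
    fix a x assume a: "a \<in> J" and x: "x \<in> carrier ?V"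
    show "x \<otimes>\<^bsub>?V\<^esub> a \<in> J" by (rule mult[OF x a])
    then show "a \<otimes>\<^bsub>?V\<^esub> x \<in> J" using V.m_comm[OF x, of a] a J by auto
  qed
  then obtain P where P: "P \<in> carrier ?V" "J = PIdl\<^bsub>?V\<^esub> P" using V.exists_gen by blast
  have "P \<in> J" using P V.cgenideal_self by blast
  then obtain \<pi> t where \<pi>: "P = ?c \<pi> t" "\<pi> \<in> p" "t \<in> carrier R - p" by (auto simp: J_def)
  show ?thesis
  proof (rule bexI[OF _ \<pi>(2)], rule ballI)
    fix a assume a: "a \<in> p"
    have "?c a \<one> \<in> J" using a one by (auto simp: J_def)
    then obtain x where x: "x \<in> carrier ?V" "?c a \<one> = x \<otimes>\<^bsub>?V\<^esub> P" unfolding P(2) cgenideal_def by blast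
    then obtain r s where r: "x = ?c r s" "r \<in> carrier R" "s \<in> carrier R - p" by (auto simp: car)
    have "?c a \<one> = ?c (r \<otimes> \<pi>) (s \<otimes> t)" unfolding x(2) r(1) \<pi>(1) by (rule ops(1)[OF r(2,3) pc[OF \<pi>(2)] \<pi>(3)])
    then have "((a, \<one>), (r \<otimes> \<pi>, s \<otimes> t)) \<in> loc_rel R p"
      by (rule eq_equiv_class[OF _ eq]) (use r \<pi> pc cl in auto)
    then obtain u where u: "u \<in> carrier R - p" "u \<otimes> (a \<otimes> (s \<otimes> t)) = u \<otimes> ((r \<otimes> \<pi>) \<otimes> \<one>)" by (auto simp: loc_rel_iff[OF p])
    have "(u \<otimes> (s \<otimes> t)) \<otimes> a = (u \<otimes> r) \<otimes> \<pi>" using u r \<pi> pc a by (simp add: m_ac)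
    moreover have "u \<otimes> (s \<otimes> t) \<in> carrier R - p" using cl u(1) r(3) \<pi>(3) by blast
    moreover have "u \<otimes> r \<in> carrier R" using u(1) r(2) by auto
    ultimately show "\<exists>f\<in>carrier R - p. \<exists>r\<in>carrier R. f \<otimes> a = r \<otimes> \<pi>" by blast
  qed
qed

text \<open>The factors belonging to finitely many generators of \<open>p\<close> are multiplied,
  which removes the dependence on \<open>a\<close>.\<close>

lemma common_denominator:
  assumes p: "primeideal p R" and \<pi>: "\<pi> \<in> p" "\<forall>a\<in>p. \<exists>f\<in>carrier R - p. \<exists>r\<in>carrier R. f \<otimes> a = r \<otimes> \<pi>"
    and fp: "finitely_presented R (ideal_module R p)"
  shows "\<exists>f\<in>carrier R - p. \<forall>a\<in>p. \<exists>r\<in>carrier R. f \<otimes> a = r \<otimes> \<pi>"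
proof -
  interpret p: primeideal p R by (rule p)
  let ?M = "ideal_module R p"
  interpret M: module R ?M using fp by (simp add: finitely_presented_def)
  obtain k g where g: "g \<in> {..<k::nat} \<rightarrow> p"
    "\<And>x. x \<in> p \<Longrightarrow> \<exists>a \<in> {..<k} \<rightarrow> carrier R. x = (\<Oplus>\<^bsub>?M\<^esub> i\<in>{..<k}. a i \<odot>\<^bsub>?M\<^esub> g i)"
    using fp unfolding finitely_presented_def by (auto simp: ideal_module_def)
  note pz = additive_subgroup.zero_closed[OF p.additive_subgroup_axioms]
    and pa = additive_subgroup.a_closed[OF p.additive_subgroup_axioms]
  have pc: "a \<in> carrier R" if "a \<in> p" for a using that p.Icarr by blast
  have \<pi>c: "\<pi> \<in> carrier R" by (rule pc[OF \<pi>(1)])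
  have one: "\<one> \<in> carrier R - p" using p.I_notcarr p.one_imp_carrier by auto
  have "\<exists>f\<in>carrier R - p. \<forall>i<l. \<exists>r\<in>carrier R. f \<otimes> g i = r \<otimes> \<pi>" if "l \<le> k" for l
    using that
  proof (induct l)
    case 0
    then show ?case using one by blast
  next
    case (Suc l)
    then obtain f where f: "f \<in> carrier R - p" "\<forall>i<l. \<exists>r\<in>carrier R. f \<otimes> g i = r \<otimes> \<pi>" by auto
    have gl: "g i \<in> p" if "i < Suc l" for i using that Suc(2) g(1) by (auto simp: Pi_iff)
    obtain f' r' where f': "f' \<in> carrier R - p" "r' \<in> carrier R" "f' \<otimes> g l = r' \<otimes> \<pi>" using \<pi>(2) gl[of l] by blast
    have "\<exists>r\<in>carrier R. (f \<otimes> f') \<otimes> g i = r \<otimes> \<pi>" if i: "i < Suc l" for i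
    proof (cases "i = l")
      case True
      have "(f \<otimes> f') \<otimes> g i = f \<otimes> (f' \<otimes> g l)" using True f f' pc[OF gl[OF i]] by (simp add: m_assoc)
      also have "\<dots> = (f \<otimes> r') \<otimes> \<pi>" using f f' \<pi>c by (simp add: m_assoc)
      finally show ?thesis using f f' by blast
    next
      case False
      then have "i < l" using i by simp
      then obtain r where r: "r \<in> carrier R" "f \<otimes> g i = r \<otimes> \<pi>" using f(2) by blast
      have "(f \<otimes> f') \<otimes> g i = f' \<otimes> (f \<otimes> g i)" using f f' pc[OF gl[OF i]] by (simp add: m_ac)
      also have "\<dots> = (f' \<otimes> r) \<otimes> \<pi>" using f' r \<pi>c by (simp add: m_assoc)
      finally show ?thesis using r f' by blast
    qed
    then show ?case using prime_complement_mult[OF p f(1) f'(1)] by blast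
  qed
  then obtain f where f: "f \<in> carrier R - p" "\<And>i. i < k \<Longrightarrow> \<exists>r\<in>carrier R. f \<otimes> g i = r \<otimes> \<pi>" by blast
  have "\<exists>r\<in>carrier R. f \<otimes> x = r \<otimes> \<pi>" if x: "x \<in> p" for x
  proof -
    obtain a where a: "a \<in> {..<k} \<rightarrow> carrier R" "x = (\<Oplus>\<^bsub>?M\<^esub> i\<in>{..<k}. a i \<odot>\<^bsub>?M\<^esub> g i)" using g(2)[OF x] by blast
    have "(\<Oplus>\<^bsub>?M\<^esub> i\<in>{..<l}. a i \<odot>\<^bsub>?M\<^esub> g i) \<in> p \<and> (\<exists>r\<in>carrier R. f \<otimes> (\<Oplus>\<^bsub>?M\<^esub> i\<in>{..<l}. a i \<odot>\<^bsub>?M\<^esub> g i) = r \<otimes> \<pi>)" if "l \<le> k" for l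
      using that
    proof (induct l)
      case 0
      have "(\<Oplus>\<^bsub>?M\<^esub> i\<in>{..<0::nat}. a i \<odot>\<^bsub>?M\<^esub> g i) = \<zero>\<^bsub>?M\<^esub>" by simp
      also have "\<zero>\<^bsub>?M\<^esub> = \<zero>" by (simp add: ideal_module_def)
      finally have "(\<Oplus>\<^bsub>?M\<^esub> i\<in>{..<0::nat}. a i \<odot>\<^bsub>?M\<^esub> g i) = \<zero>" .
      moreover have "f \<otimes> \<zero> = \<zero> \<otimes> \<pi>" using f(1) \<pi>c by simp
      ultimately show ?case using pz zero_closed by metis
    next
      case (Suc l)
      let ?y = "\<Oplus>\<^bsub>?M\<^esub> i\<in>{..<l}. a i \<odot>\<^bsub>?M\<^esub> g i"
      have mem: "a i \<in> carrier R" "g i \<in> p" if "i < Suc l" for i using that Suc(2) a(1) g(1) by (auto simp: Pi_iff)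
      have mc: "a i \<odot>\<^bsub>?M\<^esub> g i \<in> carrier ?M" if "i < Suc l" for i
        using mem[OF that] p.I_l_closed by (simp add: ideal_module_def)
      have "(\<Oplus>\<^bsub>?M\<^esub> i\<in>{..<Suc l}. a i \<odot>\<^bsub>?M\<^esub> g i) = a l \<odot>\<^bsub>?M\<^esub> g l \<oplus>\<^bsub>?M\<^esub> ?y"
        unfolding lessThan_Suc by (rule M.finsum_insert) (use mc in auto)
      also have "\<dots> = a l \<otimes> g l \<oplus> ?y" by (simp add: ideal_module_def)
      finally have s: "(\<Oplus>\<^bsub>?M\<^esub> i\<in>{..<Suc l}. a i \<odot>\<^bsub>?M\<^esub> g i) = a l \<otimes> g l \<oplus> ?y" .
      have "?y \<in> p" "\<exists>r\<in>carrier R. f \<otimes> ?y = r \<otimes> \<pi>" using Suc by auto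
      then obtain r where r: "r \<in> carrier R" "f \<otimes> ?y = r \<otimes> \<pi>" by blast
      obtain r' where r': "r' \<in> carrier R" "f \<otimes> g l = r' \<otimes> \<pi>" using f(2)[of l] Suc(2) by auto
      have al: "a l \<in> carrier R" "g l \<in> p" "g l \<in> carrier R" using mem[of l] pc by auto
      have "f \<otimes> (a l \<otimes> g l \<oplus> ?y) = a l \<otimes> (f \<otimes> g l) \<oplus> f \<otimes> ?y"
        using f(1) al pc[OF \<open>?y \<in> p\<close>] by (simp add: r_distr m_lcomm)
      also have "\<dots> = (a l \<otimes> r' \<oplus> r) \<otimes> \<pi>" unfolding r r' using al r r' \<pi>c by (simp add: l_distr m_assoc)
      finally have "f \<otimes> (a l \<otimes> g l \<oplus> ?y) = (a l \<otimes> r' \<oplus> r) \<otimes> \<pi>" .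
      moreover have "a l \<otimes> g l \<oplus> ?y \<in> p" using al \<open>?y \<in> p\<close> p.I_l_closed pa by auto
      moreover have "a l \<otimes> r' \<oplus> r \<in> carrier R" using al r r' by simp
      ultimately show ?case unfolding s by blast
    qed
    from this[of k] show ?thesis unfolding a(2) by simp
  qed
  then show ?thesis using f(1) by blast
qed

end

lemma hom_image_subring:
  assumes "cring R" "cring S" "h \<in> ring_hom R S"
  shows "subring (h ` carrier R) S"
proof -
  interpret R: cring R by fact
  interpret S: cring S by fact
  interpret h: ring_hom_ring R S h by (rule ring_hom_ringI2[OF R.ring_axioms S.ring_axioms assms(3)])
  show ?thesis by (rule h.img_is_subring[OF R.carrier_is_subring])
qed

text \<open>If \<open>f a = r\<^sub>a \<pi>\<close> for all \<open>a\<close> in the ideal, then \<open>f = z \<pi>\<close> in \<open>S\<close>, where the ideal generates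
  the unit ideal, and \<open>z f\<close> is an element of the inverse ideal whose product with \<open>\<pi>\<close> is \<open>f\<^sup>2\<close>.\<close>

lemma supramaximal_invertible:
  assumes R: "cring R" and S: "algebra R S" and inj: "inj_on (struct_map S) (carrier R)"
    and m: "supramaximal R m" and unit: "becomes_unit m S"
  shows "\<one>\<^bsub>S\<^esub> \<in> prod_span S (struct_map S ` m) (ideal_inverse R S m)"
proof -
  interpret R: cring R by (rule R)
  interpret S: cring S by (rule algebra_facts(2)[OF S])
  let ?i = "struct_map S"
  note h = algebra_facts(3)[OF S]
  have id: "ideal m R" using m by (simp add: supramaximal_def)
  interpret m: ideal m R by (rule id)
  have mc: "a \<in> carrier R" if "a \<in> m" for a using that m.Icarr by blast
  have ic: "?i r \<in> carrier S" if "r \<in> carrier R" for r by (rule ring_hom_closed[OF h that])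
  note hom = ring_hom_mult[OF h] ring_hom_add[OF h] ring_hom_one[OF h]
  have inv: "?i r \<in> ideal_inverse R S m" if "r \<in> carrier R" for r
    using that mc by (auto simp: ideal_inverse_def ic hom(1)[symmetric])
  show ?thesis
  proof (cases "m = carrier R")
    case True
    have "?i \<one>\<^bsub>R\<^esub> \<otimes>\<^bsub>S\<^esub> ?i \<one>\<^bsub>R\<^esub> \<in> prod_span S (?i ` m) (ideal_inverse R S m)"
      by (rule prod_span.intros(1)) (use True inv in auto)
    then show ?thesis by (simp add: hom)
  next
    case False
    then have F: "field (R Quot m)" and V: "discrete_valuation_ring (localisation R m)"
      and fp: "finitely_presented R (ideal_module R m)" using m by (auto simp: supramaximal_def)
    interpret F: field "R Quot m" by (rule F)
    note qh = quot_hom[OF R id] and qz = quot_zero[OF R id] and qe = quot_eq[OF R id]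
    have p: "primeideal m R" by (rule R.quot_domain_imp_primeideal[OF id F.domain_axioms])
    interpret U: unextended_cring R by (rule unextended_cring.intro[OF R])
    obtain \<pi> where \<pi>: "\<pi> \<in> m" "\<forall>a\<in>m. \<exists>f\<in>carrier R - m. \<exists>r\<in>carrier R. f \<otimes>\<^bsub>R\<^esub> a = r \<otimes>\<^bsub>R\<^esub> \<pi>"
      using U.local_generator[OF p] V unfolding discrete_valuation_ring_def by blast
    obtain f where f: "f \<in> carrier R" "f \<notin> m" "\<And>a. a \<in> m \<Longrightarrow> \<exists>r\<in>carrier R. f \<otimes>\<^bsub>R\<^esub> a = r \<otimes>\<^bsub>R\<^esub> \<pi>"
      using U.common_denominator[OF p \<pi> fp] by blast
    note \<pi>c = mc[OF \<pi>(1)]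
    \<comment> \<open>An ideal of \<open>S\<close> that contains the image of \<open>m\<close> by
      the choice of \<open>f\<close>. As \<open>m\<close> generates the unit ideal of
      \<open>S\<close>, it contains \<open>\<one>\<close>, and this provides
      \<open>z\<close>.\<close>
    let ?J = "{s \<in> carrier S. \<exists>z\<in>carrier S. ?i f \<otimes>\<^bsub>S\<^esub> s = z \<otimes>\<^bsub>S\<^esub> ?i \<pi>}"
    note [simp] = ic[OF f(1)] ic[OF \<pi>c]
    have mult: "x \<otimes>\<^bsub>S\<^esub> a \<in> ?J" if ax: "a \<in> ?J" "x \<in> carrier S" for a x
    proof -
      obtain z where z: "z \<in> carrier S" "?i f \<otimes>\<^bsub>S\<^esub> a = z \<otimes>\<^bsub>S\<^esub> ?i \<pi>" using ax by blast
      have "?i f \<otimes>\<^bsub>S\<^esub> (x \<otimes>\<^bsub>S\<^esub> a) = x \<otimes>\<^bsub>S\<^esub> (?i f \<otimes>\<^bsub>S\<^esub> a)" using ax by (simp add: S.m_lcomm)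
      also have "\<dots> = (x \<otimes>\<^bsub>S\<^esub> z) \<otimes>\<^bsub>S\<^esub> ?i \<pi>" unfolding z using ax z by (simp add: S.m_assoc)
      finally show ?thesis using ax z by blast
    qed
    have "ideal ?J S"
    proof (rule idealI[OF S.ring_axioms])
      show "subgroup ?J (add_monoid S)"
      proof (rule S.add.subgroupI)
        have "?i f \<otimes>\<^bsub>S\<^esub> \<zero>\<^bsub>S\<^esub> = \<zero>\<^bsub>S\<^esub> \<otimes>\<^bsub>S\<^esub> ?i \<pi>" by simp
        then show "?J \<noteq> {}" using S.zero_closed by blast
        fix a assume a: "a \<in> ?J"
        then have "\<ominus>\<^bsub>S\<^esub> a = (\<ominus>\<^bsub>S\<^esub> \<one>\<^bsub>S\<^esub>) \<otimes>\<^bsub>S\<^esub> a" by (simp add: S.l_minus)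
        then show "\<ominus>\<^bsub>S\<^esub> a \<in> ?J" using mult[OF a, of "\<ominus>\<^bsub>S\<^esub> \<one>\<^bsub>S\<^esub>"] by simp
        fix b assume b: "b \<in> ?J"
        obtain z w where "z \<in> carrier S" "?i f \<otimes>\<^bsub>S\<^esub> a = z \<otimes>\<^bsub>S\<^esub> ?i \<pi>" "w \<in> carrier S" "?i f \<otimes>\<^bsub>S\<^esub> b = w \<otimes>\<^bsub>S\<^esub> ?i \<pi>"
          using a b by blast
        then have "?i f \<otimes>\<^bsub>S\<^esub> (a \<oplus>\<^bsub>S\<^esub> b) = (z \<oplus>\<^bsub>S\<^esub> w) \<otimes>\<^bsub>S\<^esub> ?i \<pi>" "z \<oplus>\<^bsub>S\<^esub> w \<in> carrier S"
          using a b by (simp_all add: S.r_distr S.l_distr)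
        then show "a \<oplus>\<^bsub>S\<^esub> b \<in> ?J" using a b by blast
      qed auto
      fix a x assume a: "a \<in> ?J" and x: "x \<in> carrier S"
      show "x \<otimes>\<^bsub>S\<^esub> a \<in> ?J" by (rule mult[OF a x])
      moreover have "a \<otimes>\<^bsub>S\<^esub> x = x \<otimes>\<^bsub>S\<^esub> a" using a x S.m_comm by blast
      ultimately show "a \<otimes>\<^bsub>S\<^esub> x \<in> ?J" by simp
    qed
    moreover have "?i ` m \<subseteq> ?J"
    proof (rule image_subsetI)
      fix a assume a: "a \<in> m"
      obtain r where r: "r \<in> carrier R" "f \<otimes>\<^bsub>R\<^esub> a = r \<otimes>\<^bsub>R\<^esub> \<pi>" using f(3)[OF a] by blast
      have "?i f \<otimes>\<^bsub>S\<^esub> ?i a = ?i (f \<otimes>\<^bsub>R\<^esub> a)" by (simp add: hom f(1) mc[OF a])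
      also have "\<dots> = ?i r \<otimes>\<^bsub>S\<^esub> ?i \<pi>" by (simp add: hom r \<pi>c)
      finally show "?i a \<in> ?J" using ic[OF mc[OF a]] ic[OF r(1)] by blast
    qed
    ultimately have "Idl\<^bsub>S\<^esub> (?i ` m) \<subseteq> ?J" by (rule S.genideal_minimal)
    then have "\<one>\<^bsub>S\<^esub> \<in> ?J" using unit S.one_closed unfolding becomes_unit_def by blast
    then obtain z where z0: "z \<in> carrier S" "?i f \<otimes>\<^bsub>S\<^esub> \<one>\<^bsub>S\<^esub> = z \<otimes>\<^bsub>S\<^esub> ?i \<pi>" by blast
    then have z: "z \<in> carrier S" "?i f = z \<otimes>\<^bsub>S\<^esub> ?i \<pi>" by simp_all
    \<comment> \<open>If \<open>f a = r \<pi>\<close>, then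
      \<open>z f a = z r \<pi> = f r\<close>.\<close>
    have zinv: "z \<otimes>\<^bsub>S\<^esub> ?i f \<otimes>\<^bsub>S\<^esub> ?i a \<in> ?i ` carrier R" if a: "a \<in> m" for a
    proof -
      obtain r where r: "r \<in> carrier R" "f \<otimes>\<^bsub>R\<^esub> a = r \<otimes>\<^bsub>R\<^esub> \<pi>" using f(3)[OF a] by blast
      have "z \<otimes>\<^bsub>S\<^esub> ?i f \<otimes>\<^bsub>S\<^esub> ?i a = z \<otimes>\<^bsub>S\<^esub> ?i (f \<otimes>\<^bsub>R\<^esub> a)" using z(1) a f(1) by (simp add: hom mc ic S.m_assoc)
      also have "\<dots> = (z \<otimes>\<^bsub>S\<^esub> ?i \<pi>) \<otimes>\<^bsub>S\<^esub> ?i r" unfolding r(2) using z(1) r(1) \<pi>c by (simp add: hom ic S.m_ac)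
      also have "\<dots> = ?i (f \<otimes>\<^bsub>R\<^esub> r)" using r(1) f(1) by (simp add: z(2)[symmetric] hom)
      finally show ?thesis using r(1) f(1) by blast
    qed
    have "m +>\<^bsub>R\<^esub> f \<noteq> \<zero>\<^bsub>R Quot m\<^esub>" using qz[OF f(1)] f(2) by simp
    then have "m +>\<^bsub>R\<^esub> (f \<otimes>\<^bsub>R\<^esub> f) \<noteq> \<zero>\<^bsub>R Quot m\<^esub>"
      using ring_hom_mult[OF qh f(1) f(1)] ring_hom_closed[OF qh f(1)] F.integral by auto
    then have "m +>\<^bsub>R\<^esub> (f \<otimes>\<^bsub>R\<^esub> f) \<in> Units (R Quot m)"
      using ring_hom_closed[OF qh, of "f \<otimes>\<^bsub>R\<^esub> f"] f(1) F.field_Units by simp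
    then obtain y where y: "y \<in> carrier (R Quot m)" "y \<otimes>\<^bsub>R Quot m\<^esub> (m +>\<^bsub>R\<^esub> (f \<otimes>\<^bsub>R\<^esub> f)) = \<one>\<^bsub>R Quot m\<^esub>"
      using F.Units_l_inv_ex by blast
    obtain b where b: "b \<in> carrier R" "y = m +>\<^bsub>R\<^esub> b" using y(1) quot_surj[OF R id] by auto
    \<comment> \<open>\<open>b\<close> inverts \<open>f^2\<close> modulo \<open>m\<close>. So with
      \<open>?w = b f^2\<close> one has \<open>1 = (1 - ?w) 1 + \<pi> (b z f)\<close>, a sum of two
      products of the required kind.\<close>
    let ?w = "b \<otimes>\<^bsub>R\<^esub> (f \<otimes>\<^bsub>R\<^esub> f)"
    have wc: "?w \<in> carrier R" using b f by simp
    have "m +>\<^bsub>R\<^esub> \<one>\<^bsub>R\<^esub> = m +>\<^bsub>R\<^esub> ?w"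
      using y(2) b f(1) ring_hom_mult[OF qh, of b "f \<otimes>\<^bsub>R\<^esub> f"] ring_hom_one[OF qh] by simp
    then have a: "\<one>\<^bsub>R\<^esub> \<ominus>\<^bsub>R\<^esub> ?w \<in> m" using qe[OF R.one_closed wc] by simp
    have "?i (\<one>\<^bsub>R\<^esub> \<ominus>\<^bsub>R\<^esub> ?w) \<otimes>\<^bsub>S\<^esub> ?i \<one>\<^bsub>R\<^esub> \<in> prod_span S (?i ` m) (ideal_inverse R S m)"
      by (rule prod_span.intros(1)) (use a inv in auto)
    moreover have "?i \<pi> \<otimes>\<^bsub>S\<^esub> (?i b \<otimes>\<^bsub>S\<^esub> (z \<otimes>\<^bsub>S\<^esub> ?i f)) \<in> prod_span S (?i ` m) (ideal_inverse R S m)"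
    proof (rule prod_span.intros(1))
      have "?i b \<otimes>\<^bsub>S\<^esub> (z \<otimes>\<^bsub>S\<^esub> ?i f) \<otimes>\<^bsub>S\<^esub> ?i a \<in> ?i ` carrier R" if "a \<in> m" for a
      proof -
        obtain r where r: "r \<in> carrier R" "z \<otimes>\<^bsub>S\<^esub> ?i f \<otimes>\<^bsub>S\<^esub> ?i a = ?i r" using zinv[OF \<open>a \<in> m\<close>] by blast
        have "?i b \<otimes>\<^bsub>S\<^esub> (z \<otimes>\<^bsub>S\<^esub> ?i f) \<otimes>\<^bsub>S\<^esub> ?i a = ?i b \<otimes>\<^bsub>S\<^esub> (z \<otimes>\<^bsub>S\<^esub> ?i f \<otimes>\<^bsub>S\<^esub> ?i a)"
          using z(1) ic[OF b(1)] ic[OF mc[OF \<open>a \<in> m\<close>]] by (simp add: S.m_assoc)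
        also have "\<dots> = ?i (b \<otimes>\<^bsub>R\<^esub> r)" unfolding r(2) using b r(1) by (simp add: hom)
        finally show ?thesis using b r(1) by blast
      qed
      then show "?i b \<otimes>\<^bsub>S\<^esub> (z \<otimes>\<^bsub>S\<^esub> ?i f) \<in> ideal_inverse R S m"
        using z(1) ic[OF b(1)] by (simp add: ideal_inverse_def)
    qed (use \<pi>(1) in simp)
    ultimately have "?i (\<one>\<^bsub>R\<^esub> \<ominus>\<^bsub>R\<^esub> ?w) \<otimes>\<^bsub>S\<^esub> ?i \<one>\<^bsub>R\<^esub> \<oplus>\<^bsub>S\<^esub> ?i \<pi> \<otimes>\<^bsub>S\<^esub> (?i b \<otimes>\<^bsub>S\<^esub> (z \<otimes>\<^bsub>S\<^esub> ?i f)) \<in> prod_span S (?i ` m) (ideal_inverse R S m)"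
      by (rule prod_span.intros(2))
    moreover have "?i \<pi> \<otimes>\<^bsub>S\<^esub> (?i b \<otimes>\<^bsub>S\<^esub> (z \<otimes>\<^bsub>S\<^esub> ?i f)) = ?i ?w"
    proof -
      have "?i \<pi> \<otimes>\<^bsub>S\<^esub> (?i b \<otimes>\<^bsub>S\<^esub> (z \<otimes>\<^bsub>S\<^esub> ?i f)) = ?i b \<otimes>\<^bsub>S\<^esub> ((z \<otimes>\<^bsub>S\<^esub> ?i \<pi>) \<otimes>\<^bsub>S\<^esub> ?i f)"
        using z(1) ic[OF b(1)] by (simp add: S.m_ac)
      then show ?thesis using b f(1) by (simp add: z(2)[symmetric] hom)
    qed
    moreover have "?i (\<one>\<^bsub>R\<^esub> \<ominus>\<^bsub>R\<^esub> ?w) \<otimes>\<^bsub>S\<^esub> ?i \<one>\<^bsub>R\<^esub> = ?i (\<one>\<^bsub>R\<^esub> \<ominus>\<^bsub>R\<^esub> ?w)"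
      using ic[OF R.minus_closed[OF R.one_closed wc]] by (simp add: hom(3))
    moreover have "?i (\<one>\<^bsub>R\<^esub> \<ominus>\<^bsub>R\<^esub> ?w) \<oplus>\<^bsub>S\<^esub> ?i ?w = \<one>\<^bsub>S\<^esub>"
    proof -
      have "(\<one>\<^bsub>R\<^esub> \<ominus>\<^bsub>R\<^esub> ?w) \<oplus>\<^bsub>R\<^esub> ?w = \<one>\<^bsub>R\<^esub>" using wc by (simp add: a_minus_def R.a_assoc R.l_neg)
      then show ?thesis using hom(2)[OF R.minus_closed[OF R.one_closed wc] wc] by (simp add: hom(3))
    qed
    ultimately show ?thesis by simp
  qed
qed

text \<open>For the unit ideal the quotient is the zero ring and \<open>q = 1\<close>, and the
  claims are immediate. Otherwise they are read off in the finite residue field: every element is a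
  root of \<open>X^q - X\<close>, and the middle binomial coefficients vanish. They become
  \<open>q_pos\<close>, \<open>frob\<close> and \<open>binom\<close>.\<close>

lemma supramaximal_order:
  assumes R: "cring R" and m: "supramaximal R m"
  shows "order (R Quot m) > 0"
    and "r \<in> carrier R \<Longrightarrow> r \<ominus>\<^bsub>R\<^esub> r [^]\<^bsub>R\<^esub> order (R Quot m) \<in> m"
    and "0 < j \<Longrightarrow> j < order (R Quot m) \<Longrightarrow> add_pow R (order (R Quot m) choose j) \<one>\<^bsub>R\<^esub> \<in> m"
proof -
  interpret R: cring R by (rule R)
  have id: "ideal m R" using m by (simp add: supramaximal_def)
  interpret m: ideal m R by (rule id)
  interpret Q: cring "R Quot m" by (rule m.quotient_is_cring[OF R])
  note qh = quot_hom[OF R id] and qz = quot_zero[OF R id] and qe = quot_eq[OF R id]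
  let ?q = "order (R Quot m)"
  consider "m = carrier R" | "field (R Quot m)" "finite (carrier (R Quot m))" using m by (auto simp: supramaximal_def)
  then have "?q > 0 \<and> (\<forall>r\<in>carrier R. r \<ominus>\<^bsub>R\<^esub> r [^]\<^bsub>R\<^esub> ?q \<in> m) \<and> (\<forall>j. 0 < j \<longrightarrow> j < ?q \<longrightarrow> add_pow R (?q choose j) \<one>\<^bsub>R\<^esub> \<in> m)"
  proof cases
    case 1
    have "carrier (R Quot m) = {\<zero>\<^bsub>R Quot m\<^esub>}"
      unfolding quot_surj[OF R id] using qz R.zero_closed 1 by auto
    then have "?q = 1" by (simp add: order_def)
    then show ?thesis using 1 by auto
  next
    case 2
    have "?q > 0" using 2(2) Q.zero_closed by (auto simp: order_def card_gt_0_iff)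
    moreover have "r \<ominus>\<^bsub>R\<^esub> r [^]\<^bsub>R\<^esub> ?q \<in> m" if r: "r \<in> carrier R" for r
    proof -
      have "m +>\<^bsub>R\<^esub> r [^]\<^bsub>R\<^esub> ?q = m +>\<^bsub>R\<^esub> r"
        using ring_hom_minus(3)[OF R Q.is_cring qh r r] finite_field_frobenius[OF 2 ring_hom_closed[OF qh r]] by simp
      then show ?thesis using qe[of r "r [^]\<^bsub>R\<^esub> ?q"] r by simp
    qed
    moreover have "add_pow R (?q choose j) \<one>\<^bsub>R\<^esub> \<in> m" if j: "0 < j" "j < ?q" for j
    proof -
      have "m +>\<^bsub>R\<^esub> add_pow R (?q choose j) \<one>\<^bsub>R\<^esub> = \<zero>\<^bsub>R Quot m\<^esub>"
        using ring_hom_add_pow[OF R Q.is_cring qh R.one_closed] finite_field_binomial[OF 2 j] ring_hom_one[OF qh] by simp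
      then show ?thesis using qz[of "add_pow R (?q choose j) \<one>\<^bsub>R\<^esub>"] by simp
    qed
    ultimately show ?thesis by blast
  qed
  then show "?q > 0" "r \<in> carrier R \<Longrightarrow> r \<ominus>\<^bsub>R\<^esub> r [^]\<^bsub>R\<^esub> ?q \<in> m"
    "0 < j \<Longrightarrow> j < ?q \<Longrightarrow> add_pow R (?q choose j) \<one>\<^bsub>R\<^esub> \<in> m" by blast+
qed

lemma witt_alg_supramaximal:
  assumes R: "cring R" and S: "algebra R S" and inj: "inj_on (struct_map S) (carrier R)"
    and m: "\<And>\<alpha>. supramaximal R (m \<alpha>)" and unit: "\<And>\<alpha>. becomes_unit (m \<alpha>) S"
    and cop: "\<And>\<alpha> \<beta>. \<alpha> \<noteq> \<beta> \<Longrightarrow> m \<alpha> <+>\<^bsub>R\<^esub> m \<beta> = carrier R"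
  shows "witt_alg S (struct_map S ` carrier R) (\<lambda>\<alpha>. struct_map S ` m \<alpha>) (\<lambda>\<alpha>. ideal_inverse R S (m \<alpha>))
    (\<lambda>\<alpha>. order (R Quot m \<alpha>)) R"
proof -
  interpret R: cring R by (rule R)
  interpret S: cring S by (rule algebra_facts(2)[OF S])
  let ?i = "struct_map S"
  note h = algebra_facts(3)[OF S]
  note hom = ring_hom_mult[OF h] ring_hom_add[OF h] ring_hom_one[OF h]
  have id: "ideal (m \<alpha>) R" for \<alpha> using m by (simp add: supramaximal_def)
  have mc: "a \<in> carrier R" if "a \<in> m \<alpha>" for a \<alpha> using that ideal.Icarr[OF id] by blast
  have ic: "?i r \<in> carrier S" if "r \<in> carrier R" for r by (rule ring_hom_closed[OF h that])
  note add_sub = ideal.axioms(1)[OF id]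
  show ?thesis
  proof (intro witt_alg.intro witt_alg_axioms.intro witt_base.intro witt_base_axioms.intro)
    show "mpoly S" by (rule mpoly.intro[OF S.is_cring])
    show "subring (?i ` carrier R) S" by (rule hom_image_subring[OF R S.is_cring h])
    fix \<alpha>
    show "?i ` m \<alpha> \<subseteq> ?i ` carrier R" using mc by blast
    show "ideal_inverse R S (m \<alpha>) \<subseteq> carrier S" by (auto simp: ideal_inverse_def)
    show "\<zero>\<^bsub>S\<^esub> \<in> ?i ` m \<alpha>"
      using additive_subgroup.zero_closed[OF add_sub] ring_hom_zero[OF h R.ring_axioms S.ring_axioms] by (metis image_eqI)
    show "a \<oplus>\<^bsub>S\<^esub> b \<in> ?i ` m \<alpha>" if "a \<in> ?i ` m \<alpha>" "b \<in> ?i ` m \<alpha>" for a b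
      using that additive_subgroup.a_closed[OF add_sub, of _ \<alpha>] mc by (auto simp: hom(2)[symmetric])
    show "r \<otimes>\<^bsub>S\<^esub> a \<in> ?i ` m \<alpha>" if "a \<in> ?i ` m \<alpha>" "r \<in> ?i ` carrier R" for a r
      using that ideal.I_l_closed[OF id, of _ \<alpha>] mc by (auto simp: hom(1)[symmetric])
    show "x \<oplus>\<^bsub>S\<^esub> y \<in> ideal_inverse R S (m \<alpha>)" if "x \<in> ideal_inverse R S (m \<alpha>)" "y \<in> ideal_inverse R S (m \<alpha>)" for x y
    proof -
      have "(x \<oplus>\<^bsub>S\<^esub> y) \<otimes>\<^bsub>S\<^esub> ?i a \<in> ?i ` carrier R" if a: "a \<in> m \<alpha>" for a
      proof -
        have "x \<otimes>\<^bsub>S\<^esub> ?i a \<in> ?i ` carrier R" "y \<otimes>\<^bsub>S\<^esub> ?i a \<in> ?i ` carrier R" "x \<in> carrier S" "y \<in> carrier S"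
          using \<open>x \<in> ideal_inverse R S (m \<alpha>)\<close> \<open>y \<in> ideal_inverse R S (m \<alpha>)\<close> a by (auto simp: ideal_inverse_def)
        then show ?thesis
          using ic[OF mc[OF a]] subringE(7)[OF hom_image_subring[OF R S.is_cring h]] by (simp add: S.l_distr)
      qed
      then show ?thesis using that by (simp add: ideal_inverse_def)
    qed
    show "r \<otimes>\<^bsub>S\<^esub> x \<in> ideal_inverse R S (m \<alpha>)" if "x \<in> ideal_inverse R S (m \<alpha>)" "r \<in> ?i ` carrier R" for x r
    proof -
      have xr: "x \<in> carrier S" "r \<in> carrier S" using that ic by (auto simp: ideal_inverse_def)
      have "(r \<otimes>\<^bsub>S\<^esub> x) \<otimes>\<^bsub>S\<^esub> ?i a \<in> ?i ` carrier R" if a: "a \<in> m \<alpha>" for a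
      proof -
        have "x \<otimes>\<^bsub>S\<^esub> ?i a \<in> ?i ` carrier R" using \<open>x \<in> ideal_inverse R S (m \<alpha>)\<close> a by (auto simp: ideal_inverse_def)
        then show ?thesis
          using xr ic[OF mc[OF a]] subringE(6)[OF hom_image_subring[OF R S.is_cring h] \<open>r \<in> ?i ` carrier R\<close>] by (simp add: S.m_assoc)
      qed
      then show ?thesis using xr by (simp add: ideal_inverse_def)
    qed
    show "x \<otimes>\<^bsub>S\<^esub> a \<in> ?i ` carrier R" if "x \<in> ideal_inverse R S (m \<alpha>)" "a \<in> ?i ` m \<alpha>" for x a
      using that by (auto simp: ideal_inverse_def)
    show "\<one>\<^bsub>S\<^esub> \<in> prod_span S (?i ` m \<alpha>) (ideal_inverse R S (m \<alpha>))"
      by (rule supramaximal_invertible[OF R S inj m unit])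
    show "order (R Quot m \<alpha>) > 0" by (rule supramaximal_order(1)[OF R m])
    show "r \<ominus>\<^bsub>S\<^esub> r [^]\<^bsub>S\<^esub> order (R Quot m \<alpha>) \<in> ?i ` m \<alpha>" if r: "r \<in> ?i ` carrier R" for r
    proof -
      obtain s where s: "s \<in> carrier R" "r = ?i s" using r by (rule imageE)
      have "r \<ominus>\<^bsub>S\<^esub> r [^]\<^bsub>S\<^esub> order (R Quot m \<alpha>) = ?i (s \<ominus>\<^bsub>R\<^esub> s [^]\<^bsub>R\<^esub> order (R Quot m \<alpha>))"
        using s by (simp add: ring_hom_minus[OF R S.is_cring h])
      then show ?thesis using supramaximal_order(2)[OF R m s(1)] by blast
    qed
    show "add_pow S (order (R Quot m \<alpha>) choose j) \<one>\<^bsub>S\<^esub> \<in> ?i ` m \<alpha>" if "0 < j" "j < order (R Quot m \<alpha>)" for j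
      using supramaximal_order(3)[OF R m that] ring_hom_add_pow[OF R S.is_cring h R.one_closed] by (metis hom(3) image_eqI)
    fix \<beta> assume "\<alpha> \<noteq> \<beta>"
    then have "\<one>\<^bsub>R\<^esub> \<in> m \<alpha> <+>\<^bsub>R\<^esub> m \<beta>" using cop by simp
    then obtain a b where ab: "a \<in> m \<alpha>" "b \<in> m \<beta>" "\<one>\<^bsub>R\<^esub> = a \<oplus>\<^bsub>R\<^esub> b" by (auto simp: set_add_def' )
    have "?i a \<oplus>\<^bsub>S\<^esub> ?i b = \<one>\<^bsub>S\<^esub>" using hom(2)[OF mc[OF ab(1)] mc[OF ab(2)]] hom(3) ab(3) by simp
    then show "\<exists>a\<in>?i ` m \<alpha>. \<exists>b\<in>?i ` m \<beta>. a \<oplus>\<^bsub>S\<^esub> b = \<one>\<^bsub>S\<^esub>" using ab by blast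
  qed (use S inj in auto)
qed


section \<open>Identification of the operator rings\<close>

lemma exp_restrict_exponents: "exp_restrict F n \<in> exponents F"
  by (auto simp: exponents_def in_keys_iff split: if_splits)

lemma exp_restrict_split:
  assumes "n \<in> exponents (E' \<union> E'')" "E' \<inter> E'' = {}"
  shows "n = exp_restrict E' n + exp_restrict E'' n"
proof (rule poly_mapping_eqI)
  fix \<alpha>
  have "\<alpha> \<notin> E' \<Longrightarrow> \<alpha> \<notin> E'' \<Longrightarrow> Poly_Mapping.lookup n \<alpha> = 0" using assms(1) by (auto simp: exponents_def in_keys_iff)
  then show "Poly_Mapping.lookup n \<alpha> = Poly_Mapping.lookup (exp_restrict E' n + exp_restrict E'' n) \<alpha>"
    using assms(2) by (auto simp: lookup_add)
qed

lemma exponents_zero: "0 \<in> exponents F"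
  by (simp add: exponents_def)

lemma exponents_add: "i \<in> exponents F \<Longrightarrow> j \<in> exponents F \<Longrightarrow> i + j \<in> exponents F"
  by (auto simp: exponents_def keys_plus_nat)

lemma exponents_mono: "F \<subseteq> F' \<Longrightarrow> exponents F \<subseteq> exponents F'"
  by (auto simp: exponents_def)

lemma alg_hom_cong:
  assumes "carrier L1 = carrier L2" "\<one>\<^bsub>L1\<^esub> = \<one>\<^bsub>L2\<^esub>"
    and "\<And>x y. x \<in> carrier L1 \<Longrightarrow> y \<in> carrier L1 \<Longrightarrow> x \<otimes>\<^bsub>L1\<^esub> y = x \<otimes>\<^bsub>L2\<^esub> y"
    and "\<And>x y. x \<in> carrier L1 \<Longrightarrow> y \<in> carrier L1 \<Longrightarrow> x \<oplus>\<^bsub>L1\<^esub> y = x \<oplus>\<^bsub>L2\<^esub> y"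
    and "\<And>r x. r \<in> carrier R \<Longrightarrow> x \<in> carrier L1 \<Longrightarrow> r \<odot>\<^bsub>L1\<^esub> x = r \<odot>\<^bsub>L2\<^esub> x"
  shows "alg_hom R L1 A = alg_hom R L2 A"
  using assms by (auto simp: alg_hom_def ring_hom_def)

text \<open>The polynomial algebras over \<open>K\<close> and over \<open>S\<close> are compared on
  the carrier only, since outside \<open>K\<close> the sums in the convolution products may differ.
  Homomorphisms see no more than the carrier.\<close>

lemma ghost_algebra_cong:
  fixes L1 L2 :: "('a, 'l) module" and A :: "('a, 'c) module"
  assumes "carrier L1 = carrier L2" "\<one>\<^bsub>L1\<^esub> = \<one>\<^bsub>L2\<^esub>"
    and "\<And>x y. x \<in> carrier L1 \<Longrightarrow> y \<in> carrier L1 \<Longrightarrow> x \<otimes>\<^bsub>L1\<^esub> y = x \<otimes>\<^bsub>L2\<^esub> y"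
    and "\<And>x y. x \<in> carrier L1 \<Longrightarrow> y \<in> carrier L1 \<Longrightarrow> x \<oplus>\<^bsub>L1\<^esub> y = x \<oplus>\<^bsub>L2\<^esub> y"
    and "\<And>r x. r \<in> carrier R \<Longrightarrow> x \<in> carrier L1 \<Longrightarrow> r \<odot>\<^bsub>L1\<^esub> x = r \<odot>\<^bsub>L2\<^esub> x"
  shows "ghost_algebra R L1 I v A = ghost_algebra R L2 I v A"
proof -
  have "Hom_alg R L1 A = Hom_alg R L2 A"
    using alg_hom_cong[OF assms, where A = A] assms(1) by (simp add: Hom_alg_def)
  moreover have "Hom_alg R L1 B = Hom_alg R L2 B" for B :: "('a, 'l) module"
    using alg_hom_cong[OF assms, where A = B] assms(1) by (simp add: Hom_alg_def)
  ultimately show ?thesis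
    unfolding ghost_algebra_def is_functorial_ghost_structure_def is_ghost_structure_def by (simp add: assms(1))
qed

text \<open>\<open>S\<close> is \<open>R[1/E]\<close>, and \<open>K\<close> is the copy of
  \<open>R[1/F]\<close> inside it, so that all operator rings consist of polynomials over one ring.
  The case of \<open>F = E\<close> with \<open>K = carrier S\<close> is included.\<close>

locale witt_sub = witt_alg S R0 M P q R
  for S :: "('a, 's) module" (structure) and R0 and M P :: "'e \<Rightarrow> 's set" and q and R +
  fixes K :: "'s set" and F :: "'e set" and m :: "'e \<Rightarrow> 'a set"
  assumes K: "subring K S" and R0_K: "R0 \<subseteq> K"
    and P_eq: "\<alpha> \<in> F \<Longrightarrow> ideal_inverse R (S\<lparr>carrier := K\<rparr>) (m \<alpha>) = P \<alpha>"
    and q_eq: "\<alpha> \<in> F \<Longrightarrow> order (R Quot m \<alpha>) = q \<alpha>"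
begin

abbreviation SK :: "('a, 's) module" where "SK \<equiv> S\<lparr>carrier := K\<rparr>"
abbreviation PK :: "('a, ('e \<Rightarrow>\<^sub>0 nat) multiset \<Rightarrow> 's) module" where "PK \<equiv> psi_ring SK F"
abbreviation H :: "(('e \<Rightarrow>\<^sub>0 nat) multiset \<Rightarrow> 's) set" where "H \<equiv> pset (exponents F) K"

sublocale SK: mpoly SK
  by (rule mpoly.intro) (rule cring_subring[OF is_cring K])

lemma K_carrier: "k \<in> K \<Longrightarrow> k \<in> carrier S"
  using subringE(1)[OF K] by blast

lemma struct_map_SK: "struct_map SK = io"
  by (simp add: struct_map_def fun_eq_iff)

lemma carrier_PK: "carrier PK = H"
  by (simp add: mpoly_alg_simps mpoly_sub_pset[OF K])

lemma H_subring: "subring H PP"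
  by (rule pset_subring[OF K]) simp

lemma H_carrier: "f \<in> H \<Longrightarrow> f \<in> carrier PP"
  using subringE(1)[OF H_subring] by blast

lemma PK_ops:
  shows PK_one: "\<one>\<^bsub>PK\<^esub> = \<one>\<^bsub>PP\<^esub>"
    and PK_add: "f \<oplus>\<^bsub>PK\<^esub> g = f \<oplus>\<^bsub>PP\<^esub> g"
    and PK_mult: "f \<in> H \<Longrightarrow> g \<in> H \<Longrightarrow> f \<otimes>\<^bsub>PK\<^esub> g = f \<otimes>\<^bsub>PP\<^esub> g"
    and PK_smult: "r \<odot>\<^bsub>PK\<^esub> f = r \<odot>\<^bsub>PP\<^esub> f"
  using mpoly_sub_mult[OF K] by (simp_all add: mpoly_alg_simps mpoly_sub_ops[OF K])

lemma PK_incl: "(\<lambda>f. f) \<in> ring_hom PK PP"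
  by (rule ring_hom_memI) (auto simp: carrier_PK H_carrier PK_ops)

lemma PK_hom_ops:
  assumes "f \<in> H" "g \<in> H"
  shows "f \<ominus>\<^bsub>PK\<^esub> g = f \<ominus>\<^bsub>PP\<^esub> g" "\<ominus>\<^bsub>PK\<^esub> g = \<ominus>\<^bsub>PP\<^esub> g" "f [^]\<^bsub>PK\<^esub> (k::nat) = f [^]\<^bsub>PP\<^esub> k"
  using ring_hom_minus[OF SK.cring_mpoly PP_cring PK_incl, of f g] assms by (simp_all add: carrier_PK)

text \<open>Both sides are homomorphisms to \<open>PP\<close> on the polynomials over
  \<open>K\<close>, and they agree on constants and variables.\<close>

lemma poly_subst_SK:
  assumes s: "\<And>i. s i \<in> carrier PP" and x: "\<And>i. i \<in> exponents F \<Longrightarrow> x i = s i \<and> s i \<in> H" and f: "f \<in> H"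
  shows "poly_subst SK (exponents F) x f = ev PP cst s f"
proof -
  interpret h: mpoly_hom SK PK "SK.cst" x "exponents F"
    by (intro mpoly_hom.intro mpoly_hom_axioms.intro SK.mpoly_axioms SK.cring_mpoly SK.cst_hom) (use x in \<open>simp add: carrier_PK\<close>)
  have cst: "SK.cst k = cst k" and vr: "SK.vr i = vr i" for k and i :: "'e \<Rightarrow>\<^sub>0 nat" by (rule mpoly_sub_ops[OF K])+
  note e = eval_facts[where s = s, OF PP_cring PP_cst s]
  have h1: "poly_subst SK (exponents F) x \<in> ring_hom PK PP"
    using ring_hom_trans[OF h.ev_hom PK_incl] by (simp add: poly_subst_eq_eval[abs_def] o_def)
  have h2: "ev PP cst s \<in> ring_hom PK PP"
    using ring_hom_trans[OF PK_incl e(1)] by (simp add: o_def)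
  have fK: "f \<in> SK.pset (exponents F) (carrier SK)" using f by (simp add: mpoly_sub_pset[OF K])
  show ?thesis
  proof (rule SK.mpoly_hom_ext[OF SK.carrier_is_subring fK subset_refl h1 h2])
    show "poly_subst SK (exponents F) x (SK.cst k) = ev PP cst s (SK.cst k)" if "k \<in> carrier SK" for k
      using h.ev_const[OF that] e(2) K_carrier that by (simp add: poly_subst_eq_eval cst)
    show "poly_subst SK (exponents F) x (SK.vr i) = ev PP cst s (SK.vr i)" if "i \<in> exponents F" for i
      using h.ev_var[OF that] e(3) x[OF that] by (simp add: poly_subst_eq_eval vr)
  qed
qed

lemma vr_H: "i \<in> exponents F \<Longrightarrow> vr i \<in> H"
  using SK.vr_closed[of i "exponents F"] by (simp add: carrier_PK mpoly_sub_ops[OF K])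

lemma cst_H: "k \<in> K \<Longrightarrow> cst k \<in> H"
  by (rule indexed_pset.intros)

lemma psi_act_SK: "k \<in> exponents F \<Longrightarrow> f \<in> H \<Longrightarrow> psi_act SK F k f = psi k f"
  unfolding psi_act_def psi_def
  by (rule poly_subst_SK) (auto simp: PP_vr mpoly_sub_ops[OF K] intro: vr_H exponents_add)

lemma psi_H:
  assumes "k \<in> exponents F" "f \<in> H"
  shows "psi k f \<in> H"
  unfolding psi_def
proof (rule mpoly_hom.ev_mem_subring[OF mpoly_hom_UNIV[where s = "\<lambda>j. vr (j + k)", OF PP_cring PP_cst PP_vr] K assms(2) _ H_subring])
  show "cst ` K \<subseteq> H" using cst_H by blast
  show "vr (i + k) \<in> H" if "i \<in> exponents F" for i using vr_H exponents_add[OF that assms(1)] by blast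
qed simp

lemma psi_comp_SK: "\<beta> \<in> H \<Longrightarrow> \<gamma> \<in> H \<Longrightarrow> psi_comp SK F \<beta> \<gamma> = comp \<beta> \<gamma>"
  unfolding psi_comp_def comp_def
  by (rule poly_subst_SK) (auto simp: psi_act_SK H_carrier psi_closed psi_H)

abbreviation Lk :: "nat \<Rightarrow> (('e \<Rightarrow>\<^sub>0 nat) multiset \<Rightarrow> 's) set" where
  "Lk \<equiv> Lambda_step R m SK F"

definition Gk :: "nat \<Rightarrow> (('e \<Rightarrow>\<^sub>0 nat) multiset \<Rightarrow> 's) set" where
  "Gk k = Lk k \<union> {SK.cst x \<otimes>\<^bsub>PK\<^esub> (psi_act SK F (Poly_Mapping.single \<alpha> 1) g \<ominus>\<^bsub>PK\<^esub> g [^]\<^bsub>PK\<^esub> order (R Quot m \<alpha>))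
         | \<alpha> x g. \<alpha> \<in> F \<and> x \<in> ideal_inverse R SK (m \<alpha>) \<and> g \<in> Lk k}"

lemma Lk_0: "Lk 0 = pset (exponents F) R0"
  by (simp add: struct_map_SK mpoly_sub_pset[OF K] R0_eq)

lemma Lk_Suc: "Lk (Suc k) = generate_ring PK (Gk k)"
  by (simp add: Gk_def)

lemma step_elem:
  assumes "g \<in> H" "\<alpha> \<in> F" "x \<in> P \<alpha>"
  shows "SK.cst x \<otimes>\<^bsub>PK\<^esub> (psi_act SK F (Poly_Mapping.single \<alpha> 1) g \<ominus>\<^bsub>PK\<^esub> g [^]\<^bsub>PK\<^esub> order (R Quot m \<alpha>)) =
    cst x \<otimes>\<^bsub>PP\<^esub> (psi (bexp \<alpha>) g \<ominus>\<^bsub>PP\<^esub> g [^]\<^bsub>PP\<^esub> q \<alpha>)"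
    and "cst x \<otimes>\<^bsub>PP\<^esub> (psi (bexp \<alpha>) g \<ominus>\<^bsub>PP\<^esub> g [^]\<^bsub>PP\<^esub> q \<alpha>) \<in> H"
proof -
  interpret PP: cring PP by (rule PP_cring)
  have b: "Poly_Mapping.single \<alpha> 1 \<in> exponents F" using assms(2) by (simp add: exponents_def)
  have xK: "x \<in> K" using P_eq[OF assms(2)] assms(3) by (auto simp: ideal_inverse_def)
  note H = subringE[OF H_subring]
  have p: "psi (bexp \<alpha>) g \<in> H" using psi_H[OF b assms(1)] by (simp add: bexp_def)
  have gp: "g [^]\<^bsub>PP\<^esub> q \<alpha> \<in> H" using subringE_more(2)[OF H_subring assms(1) PP_cring] .
  have d: "psi (bexp \<alpha>) g \<ominus>\<^bsub>PP\<^esub> g [^]\<^bsub>PP\<^esub> q \<alpha> \<in> H" using H(5,7) p gp by (simp add: a_minus_def)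
  show "cst x \<otimes>\<^bsub>PP\<^esub> (psi (bexp \<alpha>) g \<ominus>\<^bsub>PP\<^esub> g [^]\<^bsub>PP\<^esub> q \<alpha>) \<in> H" using H(6)[OF cst_H[OF xK] d] .
  show "SK.cst x \<otimes>\<^bsub>PK\<^esub> (psi_act SK F (Poly_Mapping.single \<alpha> 1) g \<ominus>\<^bsub>PK\<^esub> g [^]\<^bsub>PK\<^esub> order (R Quot m \<alpha>)) =
    cst x \<otimes>\<^bsub>PP\<^esub> (psi (bexp \<alpha>) g \<ominus>\<^bsub>PP\<^esub> g [^]\<^bsub>PP\<^esub> q \<alpha>)"
    using psi_act_SK[OF b assms(1)] p gp d xK assms(1) cst_H
    by (simp add: mpoly_sub_ops(1)[OF K] q_eq[OF assms(2)] PK_hom_ops PK_mult bexp_def)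
qed

text \<open>Products and negatives over \<open>K\<close> and over \<open>S\<close> are known to
  agree on \<open>H\<close> only, so both generated rings are first shown to lie in
  \<open>H\<close>.\<close>

lemma generate_PK:
  assumes "G \<subseteq> H"
  shows "generate_ring PK G = generate_ring PP G"
proof -
  interpret PP: cring PP by (rule PP_cring)
  interpret PK: cring PK by (rule SK.cring_mpoly)
  have sub: "generate_ring PK G \<subseteq> H" using PK.generate_ring_incl[of G] assms by (simp add: carrier_PK)
  have sub': "generate_ring PP G \<subseteq> H" by (rule PP.generate_ring_min_subring1[OF _ H_subring assms]) (use assms H_carrier in blast)
  show ?thesis
  proof (intro equalityI subsetI)
    fix f assume "f \<in> generate_ring PK G"
    then show "f \<in> generate_ring PP G"
    proof (induct rule: generate_ring.induct)
      case (a_inv x)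
      have "x \<in> H" using a_inv(1) sub by blast
      then show ?case using generate_ring.a_inv[OF a_inv(2)] by (simp add: PK_hom_ops(2))
    next
      case (eng_mult x y)
      have "x \<in> H" "y \<in> H" using eng_mult(1,3) sub by blast+
      then show ?case using generate_ring.eng_mult[OF eng_mult(2,4)] by (simp add: PK_mult)
    qed (auto simp: PK_one PK_add intro: generate_ring.intros)
  next
    fix f assume "f \<in> generate_ring PP G"
    then show "f \<in> generate_ring PK G"
    proof (induct rule: generate_ring.induct)
      case one
      then show ?case using generate_ring.one[of PK G] by (simp add: PK_one)
    next
      case (a_inv x)
      have "x \<in> H" using a_inv(1) sub' by blast
      then show ?case using generate_ring.a_inv[OF a_inv(2)] by (simp add: PK_hom_ops(2))
    next
      case (eng_mult x y)
      have "x \<in> H" "y \<in> H" using eng_mult(1,3) sub' by blast+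
      then show ?case using generate_ring.eng_mult[OF eng_mult(2,4)] by (simp add: PK_mult)
    next
      case (eng_add x y)
      then show ?case using generate_ring.eng_add[of x PK G y] by (simp add: PK_add)
    qed (rule generate_ring.incl)
  qed
qed

text \<open>Containment in \<open>H\<close> is carried through the induction because the operations
  over \<open>K\<close> and over \<open>S\<close> are identified there. Containment in the union of
  the \<open>L n\<close> comes from \<open>L_left_del\<close>.\<close>

lemma Lk_facts: "Lk k \<subseteq> H \<and> Lk k \<subseteq> LD (exponents F) \<and> subring (Lk k) PP \<and> Lk k \<subseteq> Lk (Suc k)"
proof -
  interpret PP: cring PP by (rule PP_cring)
  note LDs = LD_subring[OF dirset_exponents[of F]]
  have Gk_sub: "Gk k \<subseteq> H \<inter> LD (exponents F)" if "Lk k \<subseteq> H" "Lk k \<subseteq> LD (exponents F)" for k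
  proof
    fix f assume "f \<in> Gk k"
    then consider "f \<in> Lk k" | \<alpha> x g where "\<alpha> \<in> F" "x \<in> P \<alpha>" "g \<in> Lk k"
      "f = SK.cst x \<otimes>\<^bsub>PK\<^esub> (psi_act SK F (Poly_Mapping.single \<alpha> 1) g \<ominus>\<^bsub>PK\<^esub> g [^]\<^bsub>PK\<^esub> order (R Quot m \<alpha>))"
      using P_eq unfolding Gk_def by blast
    then show "f \<in> H \<inter> LD (exponents F)"
    proof cases
      case 2
      have gH: "g \<in> H" using 2(3) \<open>Lk k \<subseteq> H\<close> by blast
      obtain n where n: "n \<in> exponents F" "g \<in> L n" using 2(3) \<open>Lk k \<subseteq> LD (exponents F)\<close> by (auto simp: LD_def)
      have "n + bexp \<alpha> \<in> exponents F" using n(1) 2(1) by (auto simp: exponents_def keys_plus_bexp)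
      then show ?thesis
        unfolding 2(4) step_elem(1)[OF gH 2(1,2)] using step_elem(2)[OF gH 2(1,2)] L_LD[OF _ L_left_del[OF n(2) 2(2)]] by blast
    qed (use that in blast)
  qed
  have gen: "subring (Lk (Suc k)) PP \<and> Lk (Suc k) \<subseteq> H \<and> Lk (Suc k) \<subseteq> LD (exponents F) \<and> Lk k \<subseteq> Lk (Suc k)"
    if "Lk k \<subseteq> H" "Lk k \<subseteq> LD (exponents F)" for k
  proof -
    have G: "Gk k \<subseteq> H" "Gk k \<subseteq> LD (exponents F)" "Gk k \<subseteq> carrier PP" using Gk_sub[OF that] H_carrier by blast+
    have e: "Lk (Suc k) = generate_ring PP (Gk k)" unfolding Lk_Suc by (rule generate_PK[OF G(1)])
    have "Lk k \<subseteq> Gk k" by (auto simp: Gk_def)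
    then have "Lk k \<subseteq> Lk (Suc k)" unfolding e using generate_ring.incl[of _ "Gk k" PP] by blast
    then show ?thesis
      unfolding e using PP.generate_ring_is_subring[OF G(3)] PP.generate_ring_min_subring1[OF G(3) H_subring G(1)]
        PP.generate_ring_min_subring1[OF G(3) LDs G(2)] by blast
  qed
  have zero: "Lk 0 \<subseteq> H \<and> Lk 0 \<subseteq> LD (exponents F) \<and> subring (Lk 0) PP"
  proof (intro conjI)
    show "Lk 0 \<subseteq> H" unfolding Lk_0 using pset_mono[of _ "exponents F" R0 "exponents F" K] R0_K by blast
    show "subring (Lk 0) PP" unfolding Lk_0 by (rule pset_subring[OF R0]) simp
    show "Lk 0 \<subseteq> LD (exponents F)"
    proof
      fix f assume "f \<in> Lk 0"
      then have "f \<in> pset (exponents F) R0" unfolding Lk_0 .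
      with R0 show "f \<in> LD (exponents F)"
      proof (induct rule: mpoly_induct[where I = "UNIV :: ('e \<Rightarrow>\<^sub>0 nat) set"])
        case (const k) then show ?case by (rule LD_cst[OF dirset_exponents])
      next
        case (add f g) then show ?case using subringE(7)[OF LDs] by blast
      next
        case (var f i) then show ?case using subringE(6)[OF LDs L_LD[OF var(2) L_vr[OF box_refl]]] by blast
      qed
    qed
  qed
  have "Lk k \<subseteq> H \<and> Lk k \<subseteq> LD (exponents F) \<and> subring (Lk k) PP"
  proof (induct k)
    case (Suc k)
    then show ?case using gen[of k] by (simp del: Lambda_step.simps)
  qed (rule zero)
  then show ?thesis using gen by blast
qed

lemma Lambda_H: "Lambda R m SK F \<subseteq> H"
  using Lk_facts by (auto simp: Lambda_def)

lemma Lk_mono: "k \<le> l \<Longrightarrow> Lk k \<subseteq> Lk l"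
  by (rule lift_Suc_mono_le) (use Lk_facts in blast)+

text \<open>The generated ring is closed under the operations in \<open>L_subset_closed\<close>, as
  each step adjoins their values on all elements of the previous one; so it contains every
  \<open>L n\<close>. The other inclusion is part of \<open>Lk_facts\<close>.\<close>

lemma Lambda_eq: "Lambda R m SK F = LD (exponents F)"
proof
  show "Lambda R m SK F \<subseteq> LD (exponents F)" using Lk_facts by (auto simp: Lambda_def)
  interpret PP: cring PP by (rule PP_cring)
  have sub: "subring (Lambda R m SK F) PP"
  proof (rule PP.subringI)
    show "Lambda R m SK F \<subseteq> carrier PP" using Lambda_H H_carrier by blast
    have up: "f \<in> Lambda R m SK F" if "f \<in> Lk k" for f k using that unfolding Lambda_def by blast
    have s: "subring (Lk k) PP" for k using Lk_facts by blast
    show "\<one>\<^bsub>PP\<^esub> \<in> Lambda R m SK F" by (rule up[OF subringE(3)[OF s[of 0]]])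
    show "\<ominus>\<^bsub>PP\<^esub> f \<in> Lambda R m SK F" if f: "f \<in> Lambda R m SK F" for f
    proof -
      obtain k where "f \<in> Lk k" using f by (auto simp: Lambda_def)
      then show ?thesis by (rule up[OF subringE(5)[OF s]])
    qed
    fix f g assume "f \<in> Lambda R m SK F" "g \<in> Lambda R m SK F"
    then obtain k l where "f \<in> Lk k" "g \<in> Lk l" by (auto simp: Lambda_def)
    then have fg: "f \<in> Lk (max k l)" "g \<in> Lk (max k l)"
      using Lk_mono[of k "max k l"] Lk_mono[of l "max k l"] by auto
    show "f \<otimes>\<^bsub>PP\<^esub> g \<in> Lambda R m SK F" "f \<oplus>\<^bsub>PP\<^esub> g \<in> Lambda R m SK F"
      by (rule up[OF subringE(6)[OF s fg]], rule up[OF subringE(7)[OF s fg]])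
  qed
  have "L n \<subseteq> Lambda R m SK F" if n: "n \<in> exponents F" for n
  proof (rule L_subset_closed[OF sub _ _ _ n])
    show "cst r \<in> Lambda R m SK F" if "r \<in> R0" for r
    proof -
      have "cst r \<in> Lk 0" unfolding Lk_0 using that by (rule indexed_pset.intros)
      then show ?thesis unfolding Lambda_def by blast
    qed
    have "vr 0 \<in> Lk 0" unfolding Lk_0 indexed_var_def
      by (intro indexed_pset.intros R0_closed exponents_zero)
    then show "vr 0 \<in> Lambda R m SK F" unfolding Lambda_def by blast
    fix g \<alpha> x assume g: "g \<in> Lambda R m SK F" and \<alpha>: "\<alpha> \<in> F" and x: "x \<in> P \<alpha>"
    obtain k where k: "g \<in> Lk k" using g by (auto simp: Lambda_def)
    have gH: "g \<in> H" using k Lk_facts by blast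
    let ?t = "SK.cst x \<otimes>\<^bsub>PK\<^esub> (psi_act SK F (Poly_Mapping.single \<alpha> 1) g \<ominus>\<^bsub>PK\<^esub> g [^]\<^bsub>PK\<^esub> order (R Quot m \<alpha>))"
    have "?t \<in> Gk k" unfolding Gk_def using k \<alpha> x P_eq by blast
    then have "?t \<in> Lk (Suc k)" unfolding Lk_Suc by (rule generate_ring.incl)
    then have "?t \<in> Lambda R m SK F" unfolding Lambda_def by blast
    then show "cst x \<otimes>\<^bsub>PP\<^esub> (psi (bexp \<alpha>) g \<ominus>\<^bsub>PP\<^esub> g [^]\<^bsub>PP\<^esub> q \<alpha>) \<in> Lambda R m SK F"
      unfolding step_elem(1)[OF gH \<alpha> x] .
  qed
  then show "LD (exponents F) \<subseteq> Lambda R m SK F" by (auto simp: LD_def)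
qed

text \<open>An element of some \<open>L k\<close> with variables in \<open>box n\<close> lies in
  \<open>L n\<close> by \<open>L_int\<close>. Conversely \<open>L_pset\<close> bounds the variables,
  and the coefficients lie in \<open>K\<close> because \<open>Lambda\<close> is contained in
  \<open>H\<close>.\<close>

lemma Lambda_tr_eq:
  assumes n: "n \<in> exponents F"
  shows "Lambda_tr R m SK F n = L n"
proof (intro equalityI subsetI)
  fix f assume "f \<in> Lambda_tr R m SK F n"
  then have f: "f \<in> LD (exponents F)" "f \<in> pset (box n) K"
    by (simp_all add: Lambda_tr_def Lambda_eq mpoly_sub_pset[OF K])
  then obtain k where k: "f \<in> L k" by (auto simp: LD_def)
  have "f \<in> L (n + k)" using L_mono[of k "n + k"] k box_mono[OF box_refl, of k n] by (auto simp: add.commute)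
  then show "f \<in> L n" by (rule L_int) (use pset_mono[OF f(2) subset_refl subringE(1)[OF K]] in simp)
next
  fix f assume f: "f \<in> L n"
  then have l: "f \<in> LD (exponents F)" using L_LD[OF n] by blast
  then have fH: "f \<in> H" using Lambda_H Lambda_eq by blast
  have fb: "f \<in> pset (box n) (carrier S)" using L_pset f by blast
  have "f \<in> pset (box n) K"
    by (rule psetI[OF K finite_supp[OF fb] supp_coeff[OF fH K] supp_index[OF fb]])
  then show "f \<in> Lambda_tr R m SK F n" using l by (simp add: Lambda_tr_def Lambda_eq mpoly_sub_pset[OF K])
qed

lemma ghost_Wt:
  fixes A :: "('a, 'c) module"
  assumes "D \<subseteq> exponents F"
  shows "ghost_algebra R (PK\<lparr>carrier := LD D\<rparr>) D SK.vr A = Wt D A"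
proof -
  have "LD D \<subseteq> H" using Lambda_H assms unfolding Lambda_eq LD_def by blast
  then have "ghost_algebra R (PK\<lparr>carrier := LD D\<rparr>) D vr A = ghost_algebra R (Lalg D) D vr A"
    by (intro ghost_algebra_cong) (auto simp: Lalg_def PK_one PK_add PK_smult PK_mult subset_iff)
  moreover have "SK.vr = (vr :: ('e \<Rightarrow>\<^sub>0 nat) \<Rightarrow> _)" by (rule ext) (rule mpoly_sub_ops[OF K])
  ultimately show ?thesis by (simp add: Wt_def)
qed

lemma Witt_eq: "Witt R m SK F A = Wt (exponents F) A"
  unfolding Witt_def Lambda_alg_def Lambda_eq by (rule ghost_Wt) simp

lemma Witt_tr_eq:
  assumes "n \<in> exponents F"
  shows "Witt_tr R m SK F n A = Wt (box n) A"
proof -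
  have "box n \<subseteq> exponents F" using assms dirset_exponents[of F] by (simp add: dirset_def)
  then show ?thesis
    unfolding Witt_tr_def Lambda_tr_alg_def Lambda_tr_eq[OF assms] LD_box[symmetric] by (rule ghost_Wt)
qed

end

text \<open>For \<open>x\<close> in the inverse over \<open>S\<close>, the \<open>s\<close> in
  \<open>K\<close> with \<open>x s\<close> in \<open>K\<close> form an ideal of \<open>K\<close>
  that contains the image of \<open>I\<close>. So it is the unit ideal, and
  \<open>s = \<one>\<close> shows that \<open>x\<close> lies in \<open>K\<close>.\<close>

lemma ideal_inverse_sub:
  fixes S :: "('a, 's) module"
  assumes S: "algebra R S" and K: "subring K S" and SK: "algebra R (S\<lparr>carrier := K\<rparr>)"
    and unit: "becomes_unit I (S\<lparr>carrier := K\<rparr>)" and I: "I \<subseteq> carrier R"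
  shows "ideal_inverse R (S\<lparr>carrier := K\<rparr>) I = ideal_inverse R S I"
proof -
  let ?T = "S\<lparr>carrier := K\<rparr>"
  interpret S: cring S by (rule algebra_facts(2)[OF S])
  interpret T: cring ?T by (rule algebra_facts(2)[OF SK])
  have sm: "struct_map ?T = struct_map S" by (simp add: struct_map_def fun_eq_iff)
  note KE = subringE[OF K]
  have iK: "struct_map S r \<in> K" if "r \<in> carrier R" for r
    using ring_hom_closed[OF algebra_facts(3)[OF SK] that] by (simp add: sm)
  have "x \<in> K" if x: "x \<in> ideal_inverse R S I" for x
  proof -
    have xc: "x \<in> carrier S" using x by (simp add: ideal_inverse_def)
    let ?J = "{s \<in> K. x \<otimes>\<^bsub>S\<^esub> s \<in> K}"
    have mult: "y \<otimes>\<^bsub>S\<^esub> s \<in> ?J" if s: "s \<in> ?J" and y: "y \<in> K" for s y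
    proof -
      have "x \<otimes>\<^bsub>S\<^esub> (y \<otimes>\<^bsub>S\<^esub> s) = y \<otimes>\<^bsub>S\<^esub> (x \<otimes>\<^bsub>S\<^esub> s)" using xc y s KE(1) by (intro S.m_lcomm) auto
      then show ?thesis using s y KE(6) by simp
    qed
    have "ideal ?J ?T"
    proof (rule idealI[OF T.ring_axioms])
      show "subgroup ?J (add_monoid ?T)"
      proof (rule T.add.subgroupI)
        show "?J \<noteq> {}" using KE(2) xc by auto
        fix s assume s: "s \<in> ?J"
        have "\<ominus>\<^bsub>?T\<^esub> s = (\<ominus>\<^bsub>?T\<^esub> \<one>\<^bsub>?T\<^esub>) \<otimes>\<^bsub>?T\<^esub> s" using s T.l_minus[OF T.one_closed, of s] T.l_one[of s] by simp
        moreover have "\<ominus>\<^bsub>?T\<^esub> \<one>\<^bsub>?T\<^esub> \<in> K" using T.a_inv_closed[OF T.one_closed] by simp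
        ultimately show "\<ominus>\<^bsub>?T\<^esub> s \<in> ?J" using mult[OF s] by simp
        fix t assume "t \<in> ?J"
        then show "s \<oplus>\<^bsub>?T\<^esub> t \<in> ?J" using s KE(1,7) xc by (auto simp: S.r_distr subset_iff)
      qed auto
      fix s y assume s: "s \<in> ?J" and y: "y \<in> carrier ?T"
      show "y \<otimes>\<^bsub>?T\<^esub> s \<in> ?J" using mult[OF s] y by simp
      moreover have "s \<otimes>\<^bsub>?T\<^esub> y = y \<otimes>\<^bsub>?T\<^esub> s" using s y by (intro T.m_comm) auto
      ultimately show "s \<otimes>\<^bsub>?T\<^esub> y \<in> ?J" by simp
    qed
    moreover have "struct_map ?T ` I \<subseteq> ?J"
    proof (rule image_subsetI)
      fix a assume a: "a \<in> I"
      have "x \<otimes>\<^bsub>S\<^esub> struct_map S a \<in> struct_map S ` carrier R" using x a by (simp add: ideal_inverse_def)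
      then show "struct_map ?T a \<in> ?J" using iK a I by (auto simp: sm)
    qed
    ultimately have "Idl\<^bsub>?T\<^esub> (struct_map ?T ` I) \<subseteq> ?J" by (rule T.genideal_minimal)
    then have "\<one>\<^bsub>S\<^esub> \<in> ?J" using unit KE(3) unfolding becomes_unit_def by auto
    then show "x \<in> K" using xc by simp
  qed
  then show ?thesis using KE(1) by (auto simp: ideal_inverse_def sm)
qed

text \<open>The algebras for \<open>E'\<close> and \<open>E''\<close> are subrings of
  \<open>S\<close>, which makes the inclusions between the operator rings literal. Both isomorphisms
  are instances of \<open>canon_iso\<close>; the rest identifies the rings and maps of the
  definitions with those used there.\<close>

theorem corollary5p4:
  fixes R :: "'a ring"
    and E E' E'' :: "'e set" and \<mm> :: "'e \<Rightarrow> 'a set"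
    and S S' S'' :: "('a, 's) module" and K' K'' :: "'s set"
    and n n' n'' :: "'e \<Rightarrow>\<^sub>0 nat"
    and A :: "('a, 'c) module"
  assumes "cring R"
    and "coprime_supramaximal_family R E \<mm>"
    and "E = E' \<union> E''" and "E' \<inter> E'' = {}"
    and "is_inverting_algebra R E \<mm> S"
    and "K' \<subseteq> carrier S" and "S' = S\<lparr>carrier := K'\<rparr>" and "is_inverting_algebra R E' \<mm> S'"
    and "K'' \<subseteq> carrier S" and "S'' = S\<lparr>carrier := K''\<rparr>" and "is_inverting_algebra R E'' \<mm> S''"
    and "n \<in> exponents E" and "n' = exp_restrict E' n" and "n'' = exp_restrict E'' n"
    and "algebra R A"
  shows "canonical_map S E (Lambda R \<mm> S' E') (Lambda R \<mm> S'' E'')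
           \<in> alg_iso R (Witt R \<mm> S E A) (Witt R \<mm> S'' E'' (Witt R \<mm> S' E' A)) \<and>
         canonical_map S E (Lambda_tr R \<mm> S' E' n') (Lambda_tr R \<mm> S'' E'' n'')
           \<in> alg_iso R (Witt_tr R \<mm> S E n A) (Witt_tr R \<mm> S'' E'' n'' (Witt_tr R \<mm> S' E' n' A))"
proof -
  note R = assms(1)
  interpret R: cring R by (rule R)
  \<comment> \<open>Indices outside \<open>E\<close> get the unit ideal, with \<open>q = 1\<close>
    and \<open>R\<close> as its inverse, since \<open>witt_alg\<close> imposes its conditions on all
    indices of the type. For an exponent supported in \<open>E\<close> the recursion of
    \<open>wit\<close> never removes such a direction.\<close>
  define m where "m \<alpha> = (if \<alpha> \<in> E then \<mm> \<alpha> else carrier R)" for \<alpha>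
  have S: "algebra R S" and inj: "inj_on (struct_map S) (carrier R)" and unitS: "\<And>\<alpha>. \<alpha> \<in> E \<Longrightarrow> becomes_unit (\<mm> \<alpha>) S"
    using assms(5) by (auto simp: is_inverting_algebra_def)
  interpret S: cring S by (rule algebra_facts(2)[OF S])
  have super: "supramaximal R (m \<alpha>)" for \<alpha>
    using assms(2) R.oneideal by (auto simp: m_def coprime_supramaximal_family_def supramaximal_def)
  have mc: "m \<alpha> \<subseteq> carrier R" for \<alpha>
    using super[of \<alpha>] ideal.Icarr by (auto simp: supramaximal_def)
  have cop: "m \<alpha> <+>\<^bsub>R\<^esub> m \<beta> = carrier R" if "\<alpha> \<noteq> \<beta>" for \<alpha> \<beta>
  proof -
    have "carrier R <+>\<^bsub>R\<^esub> m \<gamma> = carrier R \<and> m \<gamma> <+>\<^bsub>R\<^esub> carrier R = carrier R" for \<gamma>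
    proof -
      have z: "\<zero>\<^bsub>R\<^esub> \<in> m \<gamma>" using super[of \<gamma>] additive_subgroup.zero_closed ideal.axioms(1) unfolding supramaximal_def by blast
      have "r \<in> carrier R <+>\<^bsub>R\<^esub> m \<gamma>" "r \<in> m \<gamma> <+>\<^bsub>R\<^esub> carrier R" if "r \<in> carrier R" for r
        unfolding set_add_def' using that z R.r_zero[OF that] R.l_zero[OF that] by force+
      moreover have "carrier R <+>\<^bsub>R\<^esub> m \<gamma> \<subseteq> carrier R" "m \<gamma> <+>\<^bsub>R\<^esub> carrier R \<subseteq> carrier R"
        using mc[of \<gamma>] unfolding set_add_def' by auto
      ultimately show ?thesis by blast
    qed
    then show ?thesis
      using assms(2) that unfolding coprime_supramaximal_family_def m_def by metis
  qed
  have unit: "becomes_unit (m \<alpha>) S" for \<alpha>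
  proof (cases "\<alpha> \<in> E")
    case False
    have "\<one>\<^bsub>S\<^esub> \<in> struct_map S ` carrier R"
      using ring_hom_one[OF algebra_facts(3)[OF S]] R.one_closed by (metis image_eqI)
    moreover have i: "struct_map S ` carrier R \<subseteq> carrier S" using ring_hom_closed[OF algebra_facts(3)[OF S]] by blast
    ultimately have "\<one>\<^bsub>S\<^esub> \<in> Idl\<^bsub>S\<^esub> (struct_map S ` carrier R)" using S.genideal_self by blast
    then have "Idl\<^bsub>S\<^esub> (struct_map S ` carrier R) = carrier S"
      using ideal.one_imp_carrier[OF S.genideal_ideal[OF i]] by blast
    then show ?thesis using False by (simp add: becomes_unit_def m_def)
  qed (simp add: m_def unitS)
  let ?i = "struct_map S"
  interpret W: witt_alg S "?i ` carrier R" "\<lambda>\<alpha>. ?i ` m \<alpha>" "\<lambda>\<alpha>. ideal_inverse R S (m \<alpha>)" "\<lambda>\<alpha>. order (R Quot m \<alpha>)" R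
    by (rule witt_alg_supramaximal[OF R S inj super unit cop])
  have sub: "witt_sub S (?i ` carrier R) (\<lambda>\<alpha>. ?i ` m \<alpha>) (\<lambda>\<alpha>. ideal_inverse R S (m \<alpha>)) (\<lambda>\<alpha>. order (R Quot m \<alpha>)) R K F \<mm>"
    if K: "K \<subseteq> carrier S" and F: "F \<subseteq> E" and inv: "is_inverting_algebra R F \<mm> (S\<lparr>carrier := K\<rparr>)" for K F
  proof (intro witt_sub.intro witt_sub_axioms.intro W.witt_alg_axioms)
    have SK: "algebra R (S\<lparr>carrier := K\<rparr>)" and uK: "\<And>\<alpha>. \<alpha> \<in> F \<Longrightarrow> becomes_unit (\<mm> \<alpha>) (S\<lparr>carrier := K\<rparr>)"
      using inv by (auto simp: is_inverting_algebra_def)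
    have "subcring K S" using S.subcring_iff[OF K] algebra_facts(2)[OF SK] by simp
    then show Ks: "subring K S" by (rule subcring.axioms)
    have "struct_map (S\<lparr>carrier := K\<rparr>) r = ?i r" for r by (simp add: struct_map_def)
    then show "?i ` carrier R \<subseteq> K" using ring_hom_closed[OF algebra_facts(3)[OF SK]] by auto
    fix \<alpha> assume "\<alpha> \<in> F"
    then have \<alpha>: "m \<alpha> = \<mm> \<alpha>" "becomes_unit (\<mm> \<alpha>) (S\<lparr>carrier := K\<rparr>)" using F uK by (auto simp: m_def)
    show "ideal_inverse R (S\<lparr>carrier := K\<rparr>) (\<mm> \<alpha>) = ideal_inverse R S (m \<alpha>)"
      unfolding \<alpha>(1) by (rule ideal_inverse_sub[OF S Ks SK \<alpha>(2)]) (use mc[of \<alpha>] \<alpha> in simp)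
    show "order (R Quot \<mm> \<alpha>) = order (R Quot m \<alpha>)" by (simp add: \<alpha>(1))
  qed
  interpret WE: witt_sub S "?i ` carrier R" "\<lambda>\<alpha>. ?i ` m \<alpha>" "\<lambda>\<alpha>. ideal_inverse R S (m \<alpha>)" "\<lambda>\<alpha>. order (R Quot m \<alpha>)" R "carrier S" E \<mm>
    by (rule sub) (use assms(5) in simp_all)
  interpret W': witt_sub S "?i ` carrier R" "\<lambda>\<alpha>. ?i ` m \<alpha>" "\<lambda>\<alpha>. ideal_inverse R S (m \<alpha>)" "\<lambda>\<alpha>. order (R Quot m \<alpha>)" R K' E' \<mm>
    by (rule sub) (use assms(3,6-8) in auto)
  interpret W'': witt_sub S "?i ` carrier R" "\<lambda>\<alpha>. ?i ` m \<alpha>" "\<lambda>\<alpha>. ideal_inverse R S (m \<alpha>)" "\<lambda>\<alpha>. order (R Quot m \<alpha>)" R K'' E'' \<mm>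
    by (rule sub) (use assms(3,9-11) in auto)
  have disj: "Poly_Mapping.keys k' \<inter> Poly_Mapping.keys k'' = {}" if "k' \<in> exponents E'" "k'' \<in> exponents E''" for k' k''
    using that assms(4) by (auto simp: exponents_def)
  have n': "n' \<in> exponents E'" "n'' \<in> exponents E''" by (simp_all add: assms(13,14) exp_restrict_exponents)
  have nsum: "n = n' + n''" unfolding assms(13,14) by (rule exp_restrict_split) (use assms(3,4,12) in auto)
  have boxE: "box k \<subseteq> exponents F" if "k \<in> exponents F" for k :: "'e \<Rightarrow>\<^sub>0 nat" and F
    using that dirset_exponents[of F] by (simp add: dirset_def)
  have sub_E: "exponents E' \<subseteq> exponents E" "exponents E'' \<subseteq> exponents E" by (rule exponents_mono; use assms(3) in blast)+
  interpret X: witt_split S "?i ` carrier R" "\<lambda>\<alpha>. ?i ` m \<alpha>" "\<lambda>\<alpha>. ideal_inverse R S (m \<alpha>)" "\<lambda>\<alpha>. order (R Quot m \<alpha>)" R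
    "exponents E" "exponents E'" "exponents E''"
  proof (intro witt_split.intro witt_split_axioms.intro W.witt_alg_axioms dirset_exponents disj)
    show "k' + k'' \<in> exponents E" if "k' \<in> exponents E'" "k'' \<in> exponents E''" for k' k''
      using that sub_E exponents_add by blast
    show "\<exists>k'\<in>exponents E'. \<exists>k''\<in>exponents E''. k = k' + k''" if "k \<in> exponents E" for k
      using exp_restrict_split[of k E' E''] that assms(3,4) exp_restrict_exponents by blast
  qed
  interpret Y: witt_split S "?i ` carrier R" "\<lambda>\<alpha>. ?i ` m \<alpha>" "\<lambda>\<alpha>. ideal_inverse R S (m \<alpha>)" "\<lambda>\<alpha>. order (R Quot m \<alpha>)" R
    "box n" "box n'" "box n''"
  proof (intro witt_split.intro witt_split_axioms.intro W.witt_alg_axioms dirset_box)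
    show "k' + k'' \<in> box n" if "k' \<in> box n'" "k'' \<in> box n''" for k' k''
      unfolding nsum by (rule box_plus[OF that])
    show "Poly_Mapping.keys k' \<inter> Poly_Mapping.keys k'' = {}" if "k' \<in> box n'" "k'' \<in> box n''" for k' k''
      using disj that boxE[OF n'(1)] boxE[OF n'(2)] by blast
    show "\<exists>k'\<in>box n'. \<exists>k''\<in>box n''. k = k' + k''" if k: "k \<in> box n" for k
    proof (intro bexI)
      have "k \<in> exponents (E' \<union> E'')" using k boxE[OF assms(12)] assms(3) by blast
      then show "k = exp_restrict E' k + exp_restrict E'' k" using assms(4) by (rule exp_restrict_split)
      show "exp_restrict E' k \<in> box n'" "exp_restrict E'' k \<in> box n''"
        using k by (simp_all add: box_def assms(13,14))
    qed
  qed
  \<comment> \<open>On the operator rings over \<open>S\<close> the composition of the definitions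
    is \<open>comp\<close>, whence \<open>canonical_map\<close> and \<open>canon\<close> agree as
    functions.\<close>
  have comp: "psi_comp S E \<beta> \<gamma> = W.comp \<beta> \<gamma>" if "\<beta> \<in> W.LD (exponents E)" "\<gamma> \<in> W.LD (exponents E)" for \<beta> \<gamma>
    using WE.psi_comp_SK[of \<beta> \<gamma>] that WE.Lambda_H unfolding WE.Lambda_eq by auto
  have LD_mono: "W.LD D \<subseteq> W.LD D'" if "D \<subseteq> D'" for D D' using that by (auto simp: W.LD_def)
  have can: "canonical_map S E (W.LD D') (W.LD D'') a = (\<lambda>\<gamma>\<in>W.LD D''. \<lambda>\<beta>\<in>W.LD D'. a (W.comp \<beta> \<gamma>))"
    if "D' \<subseteq> exponents E" "D'' \<subseteq> exponents E" for D' D'' and a :: "_ \<Rightarrow> 'c"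
    unfolding canonical_map_def
    by (intro restrict_ext) (simp add: comp subsetD[OF LD_mono[OF that(1)]] subsetD[OF LD_mono[OF that(2)]])
  have "canonical_map S E (W.LD (exponents E')) (W.LD (exponents E'')) = (X.canon :: _ \<Rightarrow> _ \<Rightarrow> _ \<Rightarrow> 'c)"
    by (rule ext) (simp only: can[OF sub_E] X.canon_def)
  moreover have "canonical_map S E (W.LD (box n')) (W.LD (box n'')) = (Y.canon :: _ \<Rightarrow> _ \<Rightarrow> _ \<Rightarrow> 'c)"
    by (rule ext) (simp only: can[OF order_trans[OF boxE[OF n'(1)] sub_E(1)] order_trans[OF boxE[OF n'(2)] sub_E(2)]] Y.canon_def)
  \<comment> \<open>The instance for \<open>E\<close> has \<open>K = carrier S\<close>, so its
    results speak of a record update that changes nothing.\<close>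
  moreover have SE: "S\<lparr>carrier := carrier S\<rparr> = S" by simp
  ultimately show ?thesis
    using X.canon_iso[OF assms(15)] Y.canon_iso[OF assms(15)]
      WE.Witt_eq[of A] WE.Witt_tr_eq[OF assms(12), of A]
    unfolding assms(7,10) W'.Witt_eq W''.Witt_eq W'.Witt_tr_eq[OF n'(1)] W''.Witt_tr_eq[OF n'(2)]
      W'.Lambda_eq W''.Lambda_eq W'.Lambda_tr_eq[OF n'(1)] W''.Lambda_tr_eq[OF n'(2)] W.LD_box SE
    by simp
qed

end
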